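(* If $\mathcal{P}$ and $\mathcal{P}'$ are finite presentations of quasi-isometric groups, then $$\mathrm{FL}_{\mathcal{P}}\simeq\mathrm{FL}_{\mathcal{P}'},\qquad \mathrm{FFL}_{\mathcal{P}}\simeq\mathrm{FFL}_{\mathcal{P}'},\qquad\text{and}\qquad \mathrm{FFFL}_{\mathcal{P}}\simeq\mathrm{FFFL}_{\mathcal{P}'} ,$$ where the subscript indicates the presentation with respect to which the filling length, free filling length and fragmenting free filling length functions $\mathbb{N}\to\mathbb{N}$ are taken.
   Context: Groups are quasi-isometric if they are quasi-isometric with respect to word metrics of finite generating sets. A word is null-homotopic if it represents $1$ in the group; $\ell(w)$ is the length of the word $w$. For functions $f,g:\mathbb{N}\to\mathbb{N}$, $f\preceq g$ means there is $C>0$ such that $f(l)\le C g(Cl+C)+Cl+C$ for all $l$ (functions on $\mathbb{N}$ being extended to be constant on each $[n,n+1)$); $f\simeq g$ means $f\preceq g$ and $g\preceq f$. A diagram is a finite, planar, contractible, combinatorial 2-complex $\Delta$; $\ell(\partial\Delta)$ is the length of its boundary circuit (edges in 1-dimensional portions are traversed twice). A van Kampen diagram for a word $w$ over a presentation $\langle\mathcal{A}\mid\mathcal{R}\rangle$ is a diagram with edges oriented and labelled by elements of $\mathcal{A}$ so that around each 2-cell one reads (from some vertex, in some direction) an element of $\mathcal{R}^{\pm1}$, and around the boundary circuit from a base vertex $\star\in\partial\Delta$ one reads $w$. A full shelling of $\Delta$ is a sequence of diagrams $\Delta=\Delta_0,\dots,\Delta_m$ with $\Delta_m$ a single vertex,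 each $\Delta_{i+1}$ being obtained from $\Delta_i$ by one of the moves: (1) 1-cell collapse: remove a pair $(e^1,e^0)$, where $e^1$ is a 1-cell, $e^0\in\partial e^1$, and $e^1$ is attached to the rest of $\Delta_i$ only by its end vertex $\neq e^0$; (2) 1-cell expansion: cut along a 1-cell $e^1$ of $\Delta_i$ that has a vertex $e^0$ in $\partial\Delta_i$, so that $e^0$ and $e^1$ are doubled; (3) 2-cell collapse: remove a pair $(e^2,e^1)$, where $e^2$ is a 2-cell and $e^1$ is an edge in $\partial e^2\cap\partial\Delta_i$ (on the boundary circuit $e^1$ is replaced by $\partial e^2\smallsetminus e^1$). A full shelling to a base vertex $\star\in\partial\Delta$ is a full shelling in which $\star$ is preserved throughout and $\Delta_m=\star$ (in every 1-cell collapse $e^0\ne\star$, and in a 1-cell expansion with $e^0=\star$ one of the two copies of $e^0$ is chosen to be $\star$ in $\Delta_{i+1}$). A full fragmenting shelling is defined like a full shelling except that each $\Delta_i$ may be a disjoint union of finitely many diagrams, $\Delta_m$ is a set of vertices, and one extra move is allowed: (4) fragmentation: $\Delta_{i+1}$ is the disjoint union of $\Delta_i'$ and $\Delta_i''$, where $\Delta_i=\Delta_i'\cup\Delta_i''$ and $\Delta_i'\cap\Delta_i''$ is a single vertex. For a shelling $\mathcal{S}=(\Delta_i)$ let $\ell(\mathcal{S})=\max_i\ell(\partial\Delta_i)$, where $\ell(\partial\Delta_i)$ is the sum of the lengths of the boundary circuits of the components of $\Delta_i$. Then $\mathrm{FL}(\Delta,\star)$, $\mathrm{FFL}(\Delta)$,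 $\mathrm{FFFL}(\Delta)$ are the minima of $\ell(\mathcal{S})$ over full shellings to $\star$, full shellings, and full fragmenting shellings of $\Delta$, respectively. For a null-homotopic word $w$, $\mathrm{FL}(w)$, $\mathrm{FFL}(w)$, $\mathrm{FFFL}(w)$ are the minima of $\mathrm{FL}(\Delta,\star)$, $\mathrm{FFL}(\Delta)$, $\mathrm{FFFL}(\Delta)$ over all van Kampen diagrams $\Delta$ for $w$. For $\mathrm{M}=\mathrm{FL},\mathrm{FFL},\mathrm{FFFL}$, the filling function is $\mathrm{M}(n):=\max\{\mathrm{M}(w)\mid w\text{ null-homotopic},\ \ell(w)\le n\}$. *)

theory Defs
  imports
    Complex_Main
    "HOL-Library.Multiset"
    "HOL-Combinatorics.Orbits"
    "HOL-Algebra.Generated_Groups"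
begin

text \<open>The letter \<open>(a, True)\<close> stands for the generator \<open>a\<close> and \<open>(a, False)\<close> for its inverse.\<close>

type_synonym 'a word = "('a \<times> bool) list"

record 'a presentation =
  gens :: "'a set"
  rels :: "'a word set"

definition words :: "'a presentation \<Rightarrow> 'a word set" where
  "words P = lists (gens P \<times> UNIV)"

definition inv_letter :: "'a \<times> bool \<Rightarrow> 'a \<times> bool" where
  "inv_letter x = (fst x, \<not> snd x)"

definition inv_word :: "'a word \<Rightarrow> 'a word" where
  "inv_word w = rev (map inv_letter w)"

definition finite_presentation :: "'a presentation \<Rightarrow> bool" where
  "finite_presentation P \<longleftrightarrow> finite (gens P) \<and> finite (rels P) \<and> rels P \<subseteq> words P"

inductive word_eq :: "'a presentation \<Rightarrow> 'a word \<Rightarrow> 'a word \<Rightarrow> bool" for P where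
  refl: "w \<in> words P \<Longrightarrow> word_eq P w w"
| sym: "word_eq P u v \<Longrightarrow> word_eq P v u"
| trans: "word_eq P u v \<Longrightarrow> word_eq P v w \<Longrightarrow> word_eq P u w"
| cancel: "u \<in> words P \<Longrightarrow> v \<in> words P \<Longrightarrow> x \<in> gens P \<times> UNIV
    \<Longrightarrow> word_eq P (u @ [x, inv_letter x] @ v) (u @ v)"
| relator: "u \<in> words P \<Longrightarrow> v \<in> words P \<Longrightarrow> r \<in> rels P \<Longrightarrow> word_eq P (u @ r @ v) (u @ v)"

definition word_class :: "'a presentation \<Rightarrow> 'a word \<Rightarrow> 'a word set" where
  "word_class P w = {v. word_eq P w v}"

definition presented_group :: "'a presentation \<Rightarrow> 'a word set monoid" where
  "presented_group P =
    \<lparr>carrier = word_class P ` words P,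
     mult = (\<lambda>X Y. \<Union>u\<in>X. \<Union>v\<in>Y. word_class P (u @ v)),
     one = word_class P []\<rparr>"

definition null_homotopic :: "'a presentation \<Rightarrow> 'a word \<Rightarrow> bool" where
  "null_homotopic P w \<longleftrightarrow> w \<in> words P \<and> word_class P w = \<one>\<^bsub>presented_group P\<^esub>"

definition word_norm :: "('g, 'm) monoid_scheme \<Rightarrow> 'g set \<Rightarrow> 'g \<Rightarrow> nat" where
  "word_norm G S g = (LEAST n. \<exists>xs. length xs = n \<and> set xs \<subseteq> S \<union> m_inv G ` S
     \<and> foldr (\<lambda>x y. x \<otimes>\<^bsub>G\<^esub> y) xs \<one>\<^bsub>G\<^esub> = g)"

definition word_dist :: "('g, 'm) monoid_scheme \<Rightarrow> 'g set \<Rightarrow> 'g \<Rightarrow> 'g \<Rightarrow> real" where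
  "word_dist G S g h = real (word_norm G S (inv\<^bsub>G\<^esub> g \<otimes>\<^bsub>G\<^esub> h))"

definition quasi_isometric ::
  "'x set \<Rightarrow> ('x \<Rightarrow> 'x \<Rightarrow> real) \<Rightarrow> 'y set \<Rightarrow> ('y \<Rightarrow> 'y \<Rightarrow> real) \<Rightarrow> bool" where
  "quasi_isometric X dX Y dY \<longleftrightarrow>
    (\<exists>f K C. f \<in> X \<rightarrow> Y \<and> K \<ge> 1 \<and> C \<ge> 0
       \<and> (\<forall>x\<in>X. \<forall>x'\<in>X. dX x x' / K - C \<le> dY (f x) (f x') \<and> dY (f x) (f x') \<le> K * dX x x' + C)
       \<and> (\<forall>y\<in>Y. \<exists>x\<in>X. dY (f x) y \<le> C))"

definition finite_generating_set :: "('g, 'm) monoid_scheme \<Rightarrow> 'g set \<Rightarrow> bool" where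
  "finite_generating_set G S \<longleftrightarrow> finite S \<and> S \<subseteq> carrier G \<and> generate G S = carrier G"

definition quasi_isometric_groups ::
  "('g, 'm) monoid_scheme \<Rightarrow> ('h, 'n) monoid_scheme \<Rightarrow> bool" where
  "quasi_isometric_groups G H \<longleftrightarrow>
    (\<exists>S T. finite_generating_set G S \<and> finite_generating_set H T
       \<and> quasi_isometric (carrier G) (word_dist G S) (carrier H) (word_dist H T))"

text \<open>A diagram is encoded by its vertices and its darts (oriented edges), together with a planar
  embedding. \<open>opp\<close> reverses a dart, \<open>org\<close> is its initial vertex, and \<open>nxt\<close> is its successor on the
  boundary of the complementary region of the 1-skeleton (in the sphere) lying on a fixed side of
  it. So the orbits of \<open>nxt\<close> are the boundary circuits of these regions. One of the regions is the
  complement of the diagram, and \<open>bnd\<close> is the set of its darts, that is, the boundary circuit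
  of the diagram; the other regions are its 2-cells. An edge in a 1-dimensional portion has both
  its darts in \<open>bnd\<close>. The values of the functions outside of \<open>darts\<close> are irrelevant.

  The single vertex is the case without darts, where \<open>bnd\<close> is empty.\<close>

record diag =
  verts :: "nat set"
  darts :: "nat set"
  opp :: "nat \<Rightarrow> nat"
  org :: "nat \<Rightarrow> nat"
  nxt :: "nat \<Rightarrow> nat"
  bnd :: "nat set"

text \<open>\<open>rot\<close> permutes the darts with a common initial vertex in their cyclic order around it.\<close>

definition rot :: "diag \<Rightarrow> nat \<Rightarrow> nat" where
  "rot \<Delta> d = nxt \<Delta> (opp \<Delta> d)"

definition regions :: "diag \<Rightarrow> nat set set" where
  "regions \<Delta> = orbit (nxt \<Delta>) ` darts \<Delta>"

definition cells :: "diag \<Rightarrow> nat set set" where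
  "cells \<Delta> = regions \<Delta> - {bnd \<Delta>}"

definition edges :: "diag \<Rightarrow> nat set set" where
  "edges \<Delta> = (\<lambda>d. {d, opp \<Delta> d}) ` darts \<Delta>"

definition adjacent :: "diag \<Rightarrow> (nat \<times> nat) set" where
  "adjacent \<Delta> = (\<lambda>d. (org \<Delta> d, org \<Delta> (opp \<Delta> d))) ` darts \<Delta>"

text \<open>The last conjunct is Euler's formula for the sphere, whose 2-cells are those of the diagram
  and the complementary one. It says that the connected map given by the darts is planar. A planar
  connected 2-complex is contractible if and only if its complement in the sphere is connected,
  which is what the single set \<open>bnd\<close> expresses.\<close>

definition diagram :: "diag \<Rightarrow> bool" where
  "diagram \<Delta> \<longleftrightarrow>
     finite (verts \<Delta>) \<and> finite (darts \<Delta>) \<and> verts \<Delta> \<noteq> {}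
   \<and> (\<forall>d\<in>darts \<Delta>. opp \<Delta> d \<in> darts \<Delta> \<and> opp \<Delta> d \<noteq> d \<and> opp \<Delta> (opp \<Delta> d) = d)
   \<and> bij_betw (nxt \<Delta>) (darts \<Delta>) (darts \<Delta>)
   \<and> org \<Delta> ` darts \<Delta> \<subseteq> verts \<Delta>
   \<and> (\<forall>d\<in>darts \<Delta>. \<forall>d'\<in>darts \<Delta>. org \<Delta> d = org \<Delta> d' \<longleftrightarrow> d' \<in> orbit (rot \<Delta>) d)
   \<and> (if darts \<Delta> = {} then bnd \<Delta> = {} else bnd \<Delta> \<in> regions \<Delta>)
   \<and> (\<forall>u\<in>verts \<Delta>. \<forall>v\<in>verts \<Delta>. (u, v) \<in> (adjacent \<Delta>)\<^sup>*)
   \<and> card (verts \<Delta>) + (card (cells \<Delta>) + 1) = card (edges \<Delta>) + 2"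

definition single_vertex :: "diag \<Rightarrow> bool" where
  "single_vertex \<Delta> \<longleftrightarrow> darts \<Delta> = {} \<and> (\<exists>v. verts \<Delta> = {v})"

definition perim :: "diag \<Rightarrow> nat" where
  "perim \<Delta> = card (bnd \<Delta>)"

definition read :: "diag \<Rightarrow> (nat \<Rightarrow> 'a \<times> bool) \<Rightarrow> nat \<Rightarrow> 'a word" where
  "read \<Delta> lab d = map (\<lambda>i. lab ((nxt \<Delta> ^^ i) d)) [0..<card (orbit (nxt \<Delta>) d)]"

text \<open>A label on an oriented edge is a labelling of its two darts by a letter and its inverse.\<close>

definition van_kampen ::
  "'a presentation \<Rightarrow> 'a word \<Rightarrow> diag \<Rightarrow> nat \<Rightarrow> bool" where
  "van_kampen P w \<Delta> s \<longleftrightarrow> diagram \<Delta> \<and> s \<in> verts \<Delta> \<and>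
    (\<exists>lab :: nat \<Rightarrow> 'a \<times> bool.
       (\<forall>d\<in>darts \<Delta>. lab d \<in> gens P \<times> UNIV \<and> lab (opp \<Delta> d) = inv_letter (lab d))
     \<and> (\<forall>c\<in>cells \<Delta>. \<exists>d\<in>c. read \<Delta> lab d \<in> rels P \<union> inv_word ` rels P)
     \<and> (if darts \<Delta> = {} then w = [] else \<exists>d\<in>bnd \<Delta>. org \<Delta> d = s \<and> read \<Delta> lab d = w))"

definition first_return :: "'c set \<Rightarrow> ('c \<Rightarrow> 'c) \<Rightarrow> 'c \<Rightarrow> 'c" where
  "first_return A f x = (f ^^ (LEAST n. n > 0 \<and> (f ^^ n) x \<in> A)) x"

text \<open>The subdiagram with vertices \<open>V\<close>, darts \<open>A\<close> and boundary circuit \<open>B\<close>; around each vertex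
  the remaining darts keep their cyclic order.\<close>

definition subdiag :: "diag \<Rightarrow> nat set \<Rightarrow> nat set \<Rightarrow> nat set \<Rightarrow> diag" where
  "subdiag \<Delta> V A B =
     \<Delta>\<lparr>verts := V, darts := A, nxt := (\<lambda>d. first_return A (rot \<Delta>) (opp \<Delta> d)), bnd := B\<rparr>"

text \<open>Here \<open>e\<^sup>0\<close> is the initial vertex of \<open>d\<close>, \<open>e\<^sup>1\<close> is the edge of \<open>d\<close>, and \<open>d\<close> is the only dart
  at \<open>e\<^sup>0\<close>. With \<open>d \<in> bnd \<Delta>\<close> it follows that \<open>opp \<Delta> d \<in> bnd \<Delta>\<close>, so no 2-cell is attached
  along \<open>e\<^sup>1\<close>.\<close>

definition collapse1 :: "diag \<Rightarrow> diag \<Rightarrow> bool" where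
  "collapse1 \<Delta> \<Delta>' \<longleftrightarrow>
    (\<exists>d\<in>bnd \<Delta>. {x\<in>darts \<Delta>. org \<Delta> x = org \<Delta> d} = {d}
       \<and> \<Delta>' = subdiag \<Delta> (verts \<Delta> - {org \<Delta> d}) (darts \<Delta> - {d, opp \<Delta> d}) (bnd \<Delta> - {d, opp \<Delta> d}))"

text \<open>The edge \<open>e\<^sup>1\<close> of \<open>d\<close> is cut from its initial vertex \<open>e\<^sup>0\<close>, at the occurrence of \<open>e\<^sup>0\<close> on
  the boundary circuit between \<open>p\<close> and \<open>nxt \<Delta> p\<close>. The two copies of \<open>e\<^sup>1\<close> have the darts
  \<open>d, h\<close> and \<open>g, opp \<Delta> d\<close>, where \<open>g, h\<close> are new, and \<open>g\<close> followed by \<open>h\<close> is inserted into the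
  boundary circuit after \<open>p\<close>. The darts at \<open>e\<^sup>0\<close> are separated into the rotation orbits of \<open>g\<close> and
  of \<open>nxt \<Delta> p\<close>; one of the two copies of \<open>e\<^sup>0\<close>, chosen by \<open>y\<close>, gets the new name \<open>v\<close>, and the
  other one keeps the name of \<open>e\<^sup>0\<close>.\<close>

definition expand1 :: "diag \<Rightarrow> diag \<Rightarrow> bool" where
  "expand1 \<Delta> \<Delta>' \<longleftrightarrow>
    (\<exists>d\<in>darts \<Delta>. \<exists>p\<in>bnd \<Delta>. \<exists>v g h. \<exists>y\<in>{g, nxt \<Delta> p}.
       org \<Delta> (nxt \<Delta> p) = org \<Delta> d
     \<and> v \<notin> verts \<Delta> \<and> g \<notin> darts \<Delta> \<and> h \<notin> darts \<Delta> \<and> g \<noteq> h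
     \<and> (let opp' = (opp \<Delta>)(d := h, h := d, opp \<Delta> d := g, g := opp \<Delta> d);
            nxt' = (nxt \<Delta>)(p := g, g := h, h := nxt \<Delta> p);
            org' = (org \<Delta>)(g := org \<Delta> d, h := org \<Delta> (opp \<Delta> d))
        in \<Delta>' = \<lparr>verts = insert v (verts \<Delta>),
                 darts = darts \<Delta> \<union> {g, h},
                 opp = opp',
                 org = (\<lambda>x. if x \<in> orbit (\<lambda>z. nxt' (opp' z)) y then v else org' x),
                 nxt = nxt',
                 bnd = bnd \<Delta> \<union> {g, h}\<rparr>))"

text \<open>The edge of \<open>d\<close> separates the 2-cell of \<open>opp \<Delta> d\<close> from the complement of the diagram.\<close>

definition collapse2 :: "diag \<Rightarrow> diag \<Rightarrow> bool" where
  "collapse2 \<Delta> \<Delta>' \<longleftrightarrow>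
    (\<exists>d\<in>bnd \<Delta>. opp \<Delta> d \<notin> bnd \<Delta>
       \<and> \<Delta>' = subdiag \<Delta> (verts \<Delta>) (darts \<Delta> - {d, opp \<Delta> d})
                 (bnd \<Delta> \<union> orbit (nxt \<Delta>) (opp \<Delta> d) - {d, opp \<Delta> d}))"

definition shelling_move :: "diag \<Rightarrow> diag \<Rightarrow> bool" where
  "shelling_move \<Delta> \<Delta>' \<longleftrightarrow> collapse1 \<Delta> \<Delta>' \<or> expand1 \<Delta> \<Delta>' \<or> collapse2 \<Delta> \<Delta>'"

definition fragment :: "diag \<Rightarrow> diag \<Rightarrow> diag \<Rightarrow> bool" where
  "fragment \<Delta> \<Delta>1 \<Delta>2 \<longleftrightarrow>
    (\<exists>v V1 V2 A1 A2.
       V1 \<union> V2 = verts \<Delta> \<and> V1 \<inter> V2 = {v} \<and> A1 \<union> A2 = darts \<Delta> \<and> A1 \<inter> A2 = {}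
     \<and> (\<forall>c\<in>cells \<Delta>. c \<subseteq> A1 \<or> c \<subseteq> A2)
     \<and> \<Delta>1 = subdiag \<Delta> V1 A1 (bnd \<Delta> \<inter> A1) \<and> \<Delta>2 = subdiag \<Delta> V2 A2 (bnd \<Delta> \<inter> A2)
     \<and> diagram \<Delta>1 \<and> diagram \<Delta>2)"

text \<open>A disjoint union of diagrams is represented by the multiset of its components.\<close>

definition fragmenting_move :: "diag multiset \<Rightarrow> diag multiset \<Rightarrow> bool" where
  "fragmenting_move X X' \<longleftrightarrow>
    (\<exists>Y \<Delta>. X = add_mset \<Delta> Y
       \<and> ((\<exists>\<Delta>'. shelling_move \<Delta> \<Delta>' \<and> X' = add_mset \<Delta>' Y)
          \<or> (\<exists>\<Delta>1 \<Delta>2. fragment \<Delta> \<Delta>1 \<Delta>2 \<and> X' = add_mset \<Delta>1 (add_mset \<Delta>2 Y))))"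

definition full_shelling :: "diag \<Rightarrow> diag list \<Rightarrow> bool" where
  "full_shelling \<Delta> S \<longleftrightarrow> S \<noteq> [] \<and> hd S = \<Delta> \<and> (\<forall>\<Delta>'\<in>set S. diagram \<Delta>')
     \<and> successively shelling_move S \<and> single_vertex (last S)"

text \<open>Vertices keep their names in all moves, and names given to new vertices are fresh, so the
  base vertex is preserved if and only if its name remains present.\<close>

definition full_shelling_to :: "diag \<Rightarrow> nat \<Rightarrow> diag list \<Rightarrow> bool" where
  "full_shelling_to \<Delta> s S \<longleftrightarrow> full_shelling \<Delta> S \<and> (\<forall>\<Delta>'\<in>set S. s \<in> verts \<Delta>')"

definition full_fragmenting_shelling :: "diag \<Rightarrow> diag multiset list \<Rightarrow> bool" where
  "full_fragmenting_shelling \<Delta> S \<longleftrightarrow> S \<noteq> [] \<and> hd S = {#\<Delta>#}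
     \<and> (\<forall>X\<in>set S. \<forall>\<Delta>'\<in>#X. diagram \<Delta>')
     \<and> successively fragmenting_move S \<and> (\<forall>\<Delta>'\<in>#last S. single_vertex \<Delta>')"

definition shelling_length :: "diag list \<Rightarrow> nat" where
  "shelling_length S = Max (perim ` set S)"

definition fragmenting_shelling_length :: "diag multiset list \<Rightarrow> nat" where
  "fragmenting_shelling_length S = Max ((\<lambda>X. \<Sum>\<Delta>\<in>#X. perim \<Delta>) ` set S)"

text \<open>Infima of sets of natural numbers are minima; each of the sets below is nonempty for the
  diagrams and words in question.\<close>

definition FL_diag :: "diag \<Rightarrow> nat \<Rightarrow> nat" where
  "FL_diag \<Delta> s = (INF S\<in>{S. full_shelling_to \<Delta> s S}. shelling_length S)"

definition FFL_diag :: "diag \<Rightarrow> nat" where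
  "FFL_diag \<Delta> = (INF S\<in>{S. full_shelling \<Delta> S}. shelling_length S)"

definition FFFL_diag :: "diag \<Rightarrow> nat" where
  "FFFL_diag \<Delta> = (INF S\<in>{S. full_fragmenting_shelling \<Delta> S}. fragmenting_shelling_length S)"

definition FL_word :: "'a presentation \<Rightarrow> 'a word \<Rightarrow> nat" where
  "FL_word P w = Inf {FL_diag \<Delta> s | \<Delta> s. van_kampen P w \<Delta> s}"

definition FFL_word :: "'a presentation \<Rightarrow> 'a word \<Rightarrow> nat" where
  "FFL_word P w = Inf {FFL_diag \<Delta> | \<Delta> s. van_kampen P w \<Delta> s}"

definition FFFL_word :: "'a presentation \<Rightarrow> 'a word \<Rightarrow> nat" where
  "FFFL_word P w = Inf {FFFL_diag \<Delta> | \<Delta> s. van_kampen P w \<Delta> s}"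

definition FL :: "'a presentation \<Rightarrow> nat \<Rightarrow> nat" where
  "FL P n = Max {FL_word P w | w. null_homotopic P w \<and> length w \<le> n}"

definition FFL :: "'a presentation \<Rightarrow> nat \<Rightarrow> nat" where
  "FFL P n = Max {FFL_word P w | w. null_homotopic P w \<and> length w \<le> n}"

definition FFFL :: "'a presentation \<Rightarrow> nat \<Rightarrow> nat" where
  "FFFL P n = Max {FFFL_word P w | w. null_homotopic P w \<and> length w \<le> n}"

definition step_ext :: "(nat \<Rightarrow> nat) \<Rightarrow> real \<Rightarrow> real" where
  "step_ext f x = real (f (nat \<lfloor>x\<rfloor>))"

definition fun_preceq :: "(nat \<Rightarrow> nat) \<Rightarrow> (nat \<Rightarrow> nat) \<Rightarrow> bool"  (infix "\<preceq>" 50) where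
  "f \<preceq> g \<longleftrightarrow>
    (\<exists>C>0. \<forall>l\<ge>0. step_ext f l \<le> C * step_ext g (C * l + C) + C * l + C)"

definition fun_simeq :: "(nat \<Rightarrow> nat) \<Rightarrow> (nat \<Rightarrow> nat) \<Rightarrow> bool"  (infix "\<simeq>" 50) where
  "f \<simeq> g \<longleftrightarrow> f \<preceq> g \<and> g \<preceq> f"

end

theory Submission
  imports Defs
begin

text \<open>A shelling of a diagram is recorded by the words along its boundary: a 1-cell collapse is a
  free reduction, a 1-cell expansion is a free expansion, and a 2-cell collapse replaces one letter
  of a relator by the inverse of the rest. So a van Kampen diagram for \<open>w\<close> with a full shelling of
  length at most \<open>L\<close> yields a null sequence, which reduces \<open>w\<close> to the empty word by such steps through
  words of length at most \<open>L\<close>. Without a base vertex one may also pass to cyclic conjugates, and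
  fragmentation splits a word into two factors. Some moves do not change the boundary word as
  expected, since the edge of an expansion may lie in the boundary circuit, and a whole subdiagram
  may be cut off; these are handled by restricting the boundary word to the darts of enclosed
  subdiagrams. Conversely, a diagram with a shelling is rebuilt from a null sequence from its end
  backwards, by attaching spikes, gluing cells, folding edges and wedging components; a fold
  that would close up a sphere is avoided by shortening the sequence instead. Hence the filling
  lengths of \<open>w\<close> are the least \<open>L\<close> for which null sequences of the corresponding kind exist.

  Up to an additive constant in \<open>L\<close>, the steps may be replaced by all substitutions \<open>s \<rightarrow> s'\<close> of
  bounded length between words that represent the same element. Quasi-isometries \<open>F\<close>, \<open>F'\<close> turn an
  edge of one Cayley graph into a path of bounded length in the other, so null sequences of bounded
  substitutions are carried over with \<open>L\<close> multiplied by a constant. A word \<open>w\<close> and its image under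
  \<open>F' \<circ> F\<close> are joined by a ladder of bounded substitutions of length linear in that of \<open>w\<close>.\<close>

section \<open>Cycles of a function as lists\<close>

text \<open>The two translations are not independent. The backward step for the insertion of a
  cancelling pair is a fold, and it is impossible when the two edges already form a loop. Then the
  rest of the boundary encloses a closed set of darts that carries the desired word, and the
  shelling built so far, restricted to this set, gives a null sequence for that word with no more
  moves than the shelling has. At least one move is saved, so induction on the number of moves
  applies; for this reason \<open>shellable\<close> and \<open>null_seq\<close> carry a counter, and
  the passage from shellings to sequences has to control it. The other obstacle is the base vertex.
  An expansion there distributes its darts over two copies, and the dart at which reading starts may
  go to the copy that loses the name. Reading then restarts at another occurrence of the base, which
  exchanges two factors of the boundary word. Both factors enclose subdiagrams, so closed sets can
  be cut along them, and concatenating the resulting words restores the old order. Thus a list of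
  words on disjoint closed sets is followed, and not a single boundary word.\<close>

definition cyc :: "('c \<Rightarrow> 'c) \<Rightarrow> 'c list \<Rightarrow> bool" where
  "cyc f l \<longleftrightarrow> distinct l \<and> successively (\<lambda>a b. f a = b) l \<and> (l \<noteq> [] \<longrightarrow> f (last l) = hd l)"

lemma cyc_Nil [simp]: "cyc f []"
  by (simp add: cyc_def)

lemma cyc_rotate: "cyc f (u @ v) \<Longrightarrow> cyc f (v @ u)"
  by (cases "u = []"; cases "v = []") (auto simp: cyc_def successively_append_iff)

lemma cyc_next: "cyc f (u @ x # v) \<Longrightarrow> f x = hd (v @ u @ [x])"
  by (cases v; cases u) (auto simp: cyc_def successively_append_iff successively_Cons)

lemma cyc_in: assumes "cyc f l" "x \<in> set l" shows "f x \<in> set l"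
proof -
  obtain u v where l: "l = u @ x # v" using assms(2) by (meson split_list)
  have "f x = hd (v @ u @ [x])" using assms(1) l cyc_next by fast
  then show ?thesis using l by (cases v; cases u) auto
qed

lemma cyc_cong: assumes "cyc f l" "\<And>x. x \<in> set l \<Longrightarrow> f x = g x" shows "cyc g l"
proof -
  have "successively (\<lambda>a b. g a = b) l"
    using assms unfolding cyc_def by (auto intro!: successively_mono[of "\<lambda>a b. f a = b" l])
  then show ?thesis using assms by (auto simp: cyc_def)
qed

lemma cyc_nth: assumes "cyc f l" "i < length l"
  shows "f (l ! i) = (if Suc i < length l then l ! Suc i else l ! 0)"
proof (cases "Suc i < length l")
  case True
  then show ?thesis using assms by (simp add: cyc_def successively_conv_nth)
next
  case False
  then have "l ! i = last l" "l \<noteq> []"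
    using assms(2) by (cases l rule: rev_cases; auto simp: nth_append)+
  then show ?thesis using assms False by (auto simp: cyc_def hd_conv_nth)
qed

lemma cyc_funpow: assumes "cyc f (x # l)" "i \<le> length l" shows "(f ^^ i) x = (x # l) ! i"
  using assms(2)
proof (induction i)
  case (Suc i)
  then show ?case using cyc_nth[OF assms(1), of i] by simp
qed simp

lemma cyc_orbit: assumes "cyc f l" "x \<in> set l" shows "orbit f x = set l"
proof -
  obtain u v where l: "l = u @ x # v" using assms(2) by (meson split_list)
  define m where "m = v @ u"
  have c: "cyc f (x # m)" using cyc_rotate[of f u "x # v"] assms(1) by (simp add: l m_def)
  have s: "set (x # m) = set l" by (auto simp: l m_def)
  have "y \<in> set (x # m)" if "y \<in> orbit f x" for y
    using that by induction (use cyc_in[OF c] in auto)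
  moreover have "y \<in> orbit f x" if y: "y \<in> set (x # m)" for y
  proof (cases "y = x")
    case True
    have "f (last (x # m)) = x" using c by (auto simp: cyc_def)
    moreover have "last (x # m) = (f ^^ length m) x"
      using cyc_funpow[OF c, of "length m"] by (simp add: last_conv_nth del: last.simps)
    ultimately have "(f ^^ Suc (length m)) x = x" by simp
    then show ?thesis unfolding orbit_altdef True
      by (metis (mono_tags, lifting) mem_Collect_eq zero_less_Suc)
  next
    case False
    then obtain i where i: "i < length (x # m)" "y = (x # m) ! i" using y by (metis in_set_conv_nth)
    then have "i > 0" using False by (cases i) auto
    moreover have "(f ^^ i) x = y" using cyc_funpow[OF c, of i] i by simp
    ultimately show ?thesis unfolding orbit_altdef by blast
  qed
  ultimately show ?thesis using s by blast
qed

text \<open>Both lists enumerate the iterates of \<open>f\<close> at \<open>x\<close> and have the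
  orbit as their set, hence the same length. Decompositions of one boundary circuit that were
  obtained in different ways are equated by this.\<close>

lemma cyc_unique: assumes "cyc f (x # l)" "cyc f (x # m)" shows "l = m"
proof -
  have "set (x # l) = set (x # m)"
    using cyc_orbit[OF assms(1), of x] cyc_orbit[OF assms(2), of x] by simp
  then have "length (x # l) = length (x # m)"
    using assms unfolding cyc_def by (metis distinct_card)
  moreover have "(x # l) ! i = (x # m) ! i" if "i < length (x # l)" for i
    using that cyc_funpow[OF assms(1), of i] cyc_funpow[OF assms(2), of i] calculation by simp
  ultimately have "x # l = x # m" using nth_equalityI by blast
  then show ?thesis by simp
qed

lemma cyc_same_set: assumes "cyc f l" "cyc f m" "x \<in> set l" "x \<in> set m" shows "set l = set m"
  using assms by (metis cyc_orbit)

lemma cyc_at: assumes "cyc f l" "x \<in> set l"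
  obtains u v where "l = u @ x # v" "cyc f (x # v @ u)" "set (x # v @ u) = set l"
proof -
  obtain u v where l: "l = u @ x # v" using assms(2) by (meson split_list)
  then show ?thesis using that[of u v] cyc_rotate[of f u "x # v"] assms by auto
qed

text \<open>Two iterates of \<open>x\<close> coincide by finiteness, and injectivity cancels their
  common initial part, so \<open>x\<close> itself recurs. The iterates before the least positive
  return time are distinct and close up.\<close>

lemma cyc_exists: assumes "finite S" "inj_on f S" "f ` S \<subseteq> S" "x \<in> S"
  obtains l where "cyc f (x # l)" "set (x # l) \<subseteq> S"
proof -
  have inS: "(f ^^ i) x \<in> S" for i using assms by (induction i) auto
  have cancel: "(f ^^ (j - i)) x = x" if "(f ^^ i) x = (f ^^ j) x" "i < j" for i j
    using that
  proof (induction i arbitrary: j)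
    case (Suc i)
    then obtain j' where j: "j = Suc j'" "i < j'" by (cases j) auto
    then have "(f ^^ i) x = (f ^^ j') x" using Suc.prems inS assms(2) by (auto dest: inj_onD)
    then show ?case using Suc.IH[of j'] j by simp
  qed simp
  have "\<not> inj (\<lambda>i. (f ^^ i) x)"
    using inS assms(1) by (metis finite_imageD finite_subset image_subsetI infinite_UNIV_nat)
  then have "\<exists>n>0. (f ^^ n) x = x"
    using cancel unfolding inj_def by (metis linorder_neqE_nat zero_less_diff)
  then obtain n where n: "n > 0 \<and> (f ^^ n) x = x" "\<forall>m<n. \<not> (m > 0 \<and> (f ^^ m) x = x)"
    using exists_least_iff[of "\<lambda>n. n > 0 \<and> (f ^^ n) x = x"] by blast
  define l where "l = map (\<lambda>i. (f ^^ i) x) [0..<n]"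
  have d: "distinct l" unfolding l_def distinct_map
  proof (safe, simp, rule inj_onI)
    fix i j assume ij: "i \<in> set [0..<n]" "j \<in> set [0..<n]" "(f ^^ i) x = (f ^^ j) x"
    show "i = j"
    proof (rule ccontr)
      assume "i \<noteq> j"
      then consider "i < j" | "j < i" by linarith
      then show False
      proof cases
        case 1
        then show False using cancel[of i j] n(2)[rule_format, of "j - i"] ij by (auto simp: less_imp_diff_less)
      next
        case 2
        then show False using cancel[of j i] n(2)[rule_format, of "i - j"] ij by (auto simp: less_imp_diff_less)
      qed
    qed
  qed
  have "successively (\<lambda>a b. f a = b) l" by (simp add: l_def successively_conv_nth)
  moreover have "f (last l) = hd l"
  proof -
    obtain k where k: "n = Suc k" using n(1) by (cases n) auto
    then have "(f ^^ Suc k) x = x" using n(1) by simp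
    then show ?thesis by (simp add: l_def k hd_map last_map del: upt_Suc)
  qed
  ultimately have c: "cyc f l" using d by (simp add: cyc_def)
  have "hd l = x" "l \<noteq> []" using n(1) by (auto simp: l_def hd_map)
  then have "l = x # tl l" by (metis list.collapse)
  moreover have "set l \<subseteq> S" using inS by (auto simp: l_def)
  ultimately show ?thesis using that[of "tl l"] c by metis
qed

section \<open>First return maps\<close>

lemma first_return_step: "f x \<in> A \<Longrightarrow> first_return A f x = f x"
proof -
  assume a: "f x \<in> A"
  have "(LEAST n. n > 0 \<and> (f ^^ n) x \<in> A) = 1"
    by (rule Least_equality) (use a in auto)
  then show ?thesis by (simp add: first_return_def)
qed

text \<open>The witness \<open>m\<close> makes the least return time of \<open>f x\<close> exist;
  that of \<open>x\<close> is larger by one. Without any return, \<open>LEAST\<close> would be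
  unspecified.\<close>

lemma first_return_skip: assumes "f x \<notin> A" "m > 0" "(f ^^ m) (f x) \<in> A"
  shows "first_return A f x = first_return A f (f x)"
proof -
  let ?P = "\<lambda>n. n > 0 \<and> (f ^^ n) x \<in> A" and ?Q = "\<lambda>n. n > 0 \<and> (f ^^ n) (f x) \<in> A"
  have q: "?Q (Least ?Q)" by (rule LeastI[of ?Q m]) (use assms in auto)
  have "Least ?P = Suc (Least ?Q)"
  proof (rule Least_equality)
    show "?P (Suc (Least ?Q))" using q by (simp add: funpow_swap1)
    fix n assume n: "?P n"
    then have "n \<noteq> 1" using assms(1) by auto
    then obtain k where k: "n = Suc k" "k > 0" using n by (cases n) auto
    then have "?Q k" using n by (simp add: funpow_swap1)
    then show "Suc (Least ?Q) \<le> n" using k Least_le[of ?Q k] by simp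
  qed
  then show ?thesis unfolding first_return_def by (simp add: funpow_swap1)
qed

lemma first_return_chain:
  assumes "successively (\<lambda>a b. f a = b) (x # l)" "filter (\<lambda>a. a \<in> A) l = z # zs"
  shows "first_return A f x = z \<and> (\<exists>m>0. (f ^^ m) x \<in> A)"
  using assms
proof (induction l arbitrary: x)
  case (Cons y l)
  then have fx: "f x = y" and s: "successively (\<lambda>a b. f a = b) (y # l)" by auto
  show ?case
  proof (cases "y \<in> A")
    case True
    then have "first_return A f x = y" using first_return_step[of f x A] fx by simp
    moreover have "\<exists>m>0. (f ^^ m) x \<in> A" using True fx by (intro exI[of _ 1]) auto
    ultimately show ?thesis using Cons.prems True by simp
  next
    case False
    then have ih: "first_return A f y = z" "\<exists>m>0. (f ^^ m) y \<in> A"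
      using Cons.IH[OF s] Cons.prems by auto
    then obtain m where m: "m > 0" "(f ^^ m) y \<in> A" by blast
    then have "first_return A f x = first_return A f y"
      using first_return_skip[of f x A m] fx False by simp
    moreover have "(f ^^ Suc m) x \<in> A" using m fx by (simp add: funpow_swap1)
    ultimately show ?thesis using ih by (metis zero_less_Suc)
  qed
qed simp

text \<open>Every survivor is sent to the next survivor along the cycle, the last one by passing
  over the seam of the list. In this form the rotation about a vertex is inherited when edges or
  whole subdiagrams are deleted.\<close>

lemma cyc_first_return: assumes "cyc f l"
  shows "cyc (first_return A f) (filter (\<lambda>x. x \<in> A) l)"
proof -
  let ?F = "filter (\<lambda>x. x \<in> A)" and ?g = "first_return A f"
  have suc: "successively (\<lambda>a b. ?g a = b) (?F m)" if "successively (\<lambda>a b. f a = b) m" for m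
    using that
  proof (induction m)
    case (Cons x m)
    then have ih: "successively (\<lambda>a b. ?g a = b) (?F m)" by (auto simp: successively_Cons)
    show ?case
    proof (cases "?F m")
      case (Cons z zs)
      then have "?g x = z" using first_return_chain[OF Cons.prems, of A z zs] by simp
      then show ?thesis using ih Cons by auto
    qed (auto)
  qed simp
  have "?g (last (?F l)) = hd (?F l)" if ne: "?F l \<noteq> []"
  proof -
    define x where "x = last (?F l)"
    have "last (?F l) \<in> set (?F l)" using ne last_in_set by blast
    then have xl: "x \<in> set l" "x \<in> A" by (auto simp: x_def)
    then obtain u v where l: "l = u @ x # v" by (meson split_list)
    have v: "?F v = []"
    proof (rule ccontr)
      assume "?F v \<noteq> []"
      then have "x \<in> set (?F v)" using l xl x_def by (metis filter_append filter.simps(2) last_ConsR last_appendR last_in_set list.discI)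
      then show False using assms l by (auto simp: cyc_def)
    qed
    have "cyc f ((x # v) @ u)" using assms l cyc_rotate[of f u "x # v"] by simp
    then have c: "cyc f (x # v @ u)" by simp
    have "successively (\<lambda>a b. f a = b) ((x # v @ u) @ [x])"
      unfolding successively_append_iff[of _ "x # v @ u"] using c by (simp add: cyc_def)
    then have s: "successively (\<lambda>a b. f a = b) (x # (v @ u @ [x]))" by simp
    have "?F (v @ u @ [x]) = ?F l" using v l xl by simp
    then have "?F (v @ u @ [x]) = hd (?F l) # tl (?F l)" using ne by simp
    from first_return_chain[OF s this] show ?thesis by (simp add: x_def)
  qed
  then show ?thesis using assms suc[of l] by (simp add: cyc_def)
qed

lemma cyc_image: assumes "cyc f l" shows "f ` set l = set l"
proof
  show "f ` set l \<subseteq> set l" using cyc_in[OF assms] by blast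
  show "set l \<subseteq> f ` set l"
  proof
    fix y assume "y \<in> set l"
    then obtain u v where c: "cyc f (y # v @ u)" "set (y # v @ u) = set l"
      using cyc_at[OF assms] by metis
    then have "f (last (y # v @ u)) = y" by (auto simp: cyc_def)
    moreover have "last (y # v @ u) \<in> set l" using c(2) last_in_set by (metis list.discI)
    ultimately show "y \<in> f ` set l" by (metis image_eqI)
  qed
qed

text \<open>A cycle is mapped onto itself, a surjection of a finite set onto itself is injective,
  and two elements with the same image lie on the same cycle. Bijectivity of \<open>nxt\<close> is
  verified in this way for the diagrams that are built explicitly.\<close>

lemma cyc_cover_bij: assumes "\<And>x. x \<in> S \<Longrightarrow> \<exists>l. cyc f l \<and> x \<in> set l \<and> set l \<subseteq> S"
  shows "bij_betw f S S"
proof -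
  have "inj_on f S"
  proof (rule inj_onI)
    fix x y assume xy: "x \<in> S" "y \<in> S" "f x = f y"
    obtain l where l: "cyc f l" "x \<in> set l" using assms[OF xy(1)] by blast
    obtain m where m: "cyc f m" "y \<in> set m" using assms[OF xy(2)] by blast
    have "set l = set m"
      using cyc_same_set[OF l(1) m(1), of "f x"] cyc_in[OF l] cyc_in[OF m] xy(3) by simp
    moreover have "inj_on f (set l)"
      using cyc_image[OF l(1)] by (simp add: eq_card_imp_inj_on)
    ultimately show "x = y" using l m xy(3) by (auto dest: inj_onD)
  qed
  moreover have "f ` S = S"
  proof
    show "f ` S \<subseteq> S"
    proof
      fix y assume "y \<in> f ` S"
      then obtain x where x: "x \<in> S" "y = f x" by blast
      obtain l where l: "cyc f l" "x \<in> set l" "set l \<subseteq> S" using assms[OF x(1)] by blast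
      show "y \<in> S" using cyc_in[OF l(1,2)] l(3) x(2) by blast
    qed
    show "S \<subseteq> f ` S"
    proof
      fix x assume "x \<in> S"
      then obtain l where l: "cyc f l" "x \<in> set l" "set l \<subseteq> S" using assms by blast
      then have "x \<in> f ` set l" using cyc_image[OF l(1)] by simp
      then show "x \<in> f ` S" using l(3) by blast
    qed
  qed
  ultimately show ?thesis by (simp add: bij_betw_def)
qed

section \<open>Combinatorial maps\<close>

text \<open>The clauses of \<open>diagram\<close> are separated because a surgery preserves them for
  different reasons: \<open>pmap\<close> by construction, \<open>orgcond\<close> through the
  rotation cycles, \<open>conn\<close> by rerouting paths and \<open>euler\<close> by
  counting.\<close>

definition pmap :: "diag \<Rightarrow> bool" where
  "pmap D \<longleftrightarrow> finite (verts D) \<and> finite (darts D)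
   \<and> (\<forall>d\<in>darts D. opp D d \<in> darts D \<and> opp D d \<noteq> d \<and> opp D (opp D d) = d)
   \<and> bij_betw (nxt D) (darts D) (darts D) \<and> org D ` darts D \<subseteq> verts D"

definition orgcond :: "diag \<Rightarrow> bool" where
  "orgcond D \<longleftrightarrow> (\<forall>d\<in>darts D. \<forall>d'\<in>darts D. org D d = org D d' \<longleftrightarrow> d' \<in> orbit (rot D) d)"

definition conn :: "diag \<Rightarrow> bool" where
  "conn D \<longleftrightarrow> (\<forall>u\<in>verts D. \<forall>v\<in>verts D. (u, v) \<in> (adjacent D)\<^sup>*)"

definition euler :: "diag \<Rightarrow> bool" where
  "euler D \<longleftrightarrow> card (verts D) + (card (cells D) + 1) = card (edges D) + 2"

definition bcyc :: "diag \<Rightarrow> nat list \<Rightarrow> bool" where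
  "bcyc D l \<longleftrightarrow> cyc (nxt D) l \<and> set l = bnd D"

lemma pmapD: assumes "pmap D"
  shows "finite (verts D)" "finite (darts D)"
    "d \<in> darts D \<Longrightarrow> opp D d \<in> darts D" "d \<in> darts D \<Longrightarrow> opp D d \<noteq> d"
    "d \<in> darts D \<Longrightarrow> opp D (opp D d) = d"
    "d \<in> darts D \<Longrightarrow> nxt D d \<in> darts D"
    "inj_on (nxt D) (darts D)" "d \<in> darts D \<Longrightarrow> org D d \<in> verts D"
    "d \<in> darts D \<Longrightarrow> rot D d \<in> darts D" "nxt D ` darts D = darts D"
  using assms by (auto simp: pmap_def bij_betw_def rot_def)

lemma rot_opp: "pmap D \<Longrightarrow> d \<in> darts D \<Longrightarrow> rot D (opp D d) = nxt D d"
  by (simp add: rot_def pmapD)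

lemma rot_inj: assumes "pmap D" shows "inj_on (rot D) (darts D)"
proof (rule inj_onI)
  fix x y assume xy: "x \<in> darts D" "y \<in> darts D" "rot D x = rot D y"
  then have "opp D x = opp D y"
    using inj_onD[OF pmapD(7)[OF assms], of "opp D x" "opp D y"] pmapD(3)[OF assms]
    by (simp add: rot_def)
  then show "x = y" using pmapD(5)[OF assms] xy by metis
qed

lemma nxt_cycle: assumes "pmap D" "d \<in> darts D"
  obtains t where "cyc (nxt D) (d # t)" "set (d # t) \<subseteq> darts D" "orbit (nxt D) d = set (d # t)"
proof -
  obtain t where t: "cyc (nxt D) (d # t)" "set (d # t) \<subseteq> darts D"
    using cyc_exists[of "darts D" "nxt D" d] pmapD[OF assms(1)] assms(2) by blast
  then show ?thesis using that cyc_orbit[OF t(1), of d] by simp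
qed

lemma rot_cycle: assumes "pmap D" "d \<in> darts D"
  obtains t where "cyc (rot D) (d # t)" "set (d # t) \<subseteq> darts D" "orbit (rot D) d = set (d # t)"
proof -
  obtain t where t: "cyc (rot D) (d # t)" "set (d # t) \<subseteq> darts D"
    using cyc_exists[of "darts D" "rot D" d] pmapD[OF assms(1)] rot_inj[OF assms(1)] assms(2)
    by blast
  then show ?thesis using that cyc_orbit[OF t(1), of d] by simp
qed

lemma cyc_region: assumes "cyc (nxt D) l" "l \<noteq> []" "set l \<subseteq> darts D"
  shows "set l \<in> regions D"
proof -
  have "hd l \<in> darts D" "orbit (nxt D) (hd l) = set l"
    using assms cyc_orbit[OF assms(1), of "hd l"] by auto
  then show ?thesis unfolding regions_def by (metis image_eqI)
qed

text \<open>The boundary region becomes a list that traverses it, with the empty list for the single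
  vertex. Lists can be split at a dart and spliced, which is all that the moves do to a
  circuit.\<close>

lemma diagram_iff: "diagram D \<longleftrightarrow> pmap D \<and> verts D \<noteq> {} \<and> orgcond D \<and> conn D \<and> euler D
   \<and> (\<exists>l. bcyc D l) \<and> bnd D \<subseteq> darts D \<and> (bnd D = {} \<longrightarrow> darts D = {})"
proof -
  have "(if darts D = {} then bnd D = {} else bnd D \<in> regions D) \<longleftrightarrow>
     (\<exists>l. bcyc D l) \<and> bnd D \<subseteq> darts D \<and> (bnd D = {} \<longrightarrow> darts D = {})" (is "?L = ?R") if p: "pmap D"
  proof (cases "darts D = {}")
    case True
    then show ?thesis by (auto simp: bcyc_def intro: exI[of _ "[]"])
  next
    case False
    show ?thesis
    proof
      assume ?L
      then obtain d where d: "d \<in> darts D" "bnd D = orbit (nxt D) d"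
        using False by (auto simp: regions_def)
      obtain t where t: "cyc (nxt D) (d # t)" "set (d # t) \<subseteq> darts D" "orbit (nxt D) d = set (d # t)"
        using nxt_cycle[OF p d(1)] .
      have "bcyc D (d # t)" "bnd D \<subseteq> darts D" "bnd D \<noteq> {}"
        using t d(2) by (auto simp: bcyc_def simp del: list.set)
      then show ?R by blast
    next
      assume r: ?R
      then obtain l where l: "cyc (nxt D) l" "set l = bnd D" by (auto simp: bcyc_def)
      moreover have "l \<noteq> []" using r False l(2) by auto
      ultimately show ?L using cyc_region[of D l] False r by simp
    qed
  qed
  then show ?thesis unfolding diagram_def orgcond_def conn_def euler_def pmap_def by blast
qed

lemma diagramD: assumes "diagram D"
  shows "pmap D" "verts D \<noteq> {}" "orgcond D" "conn D" "euler D" "\<exists>l. bcyc D l" "bnd D \<subseteq> darts D"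
    "bnd D = {} \<Longrightarrow> darts D = {}"
  using assms by (auto simp: diagram_iff)

lemma bcyc_rotate: "bcyc D (u @ v) \<Longrightarrow> bcyc D (v @ u)"
  by (auto simp: bcyc_def cyc_rotate)

lemma bcyc_at: assumes "bcyc D l" "d \<in> bnd D"
  obtains v where "bcyc D (d # v)"
  using assms cyc_at[of "nxt D" l d] by (metis bcyc_def)

lemma bnd_cycle: assumes "diagram D" "d \<in> bnd D" obtains v where "bcyc D (d # v)"
  using diagramD(6)[OF assms(1)] bcyc_at assms(2) by metis

lemma nonbnd_cycle: assumes p: "pmap D" and b: "bcyc D l" and d: "d \<in> darts D" "d \<notin> bnd D"
  obtains t where "cyc (nxt D) (d # t)" "set (d # t) \<subseteq> darts D - bnd D"
    "orbit (nxt D) d = set (d # t)"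
proof -
  obtain t where t: "cyc (nxt D) (d # t)" "set (d # t) \<subseteq> darts D" "orbit (nxt D) d = set (d # t)"
    using nxt_cycle[OF p d(1)] .
  have "set (d # t) \<inter> bnd D = {}"
  proof (rule ccontr)
    assume "set (d # t) \<inter> bnd D \<noteq> {}"
    then obtain x where "x \<in> set (d # t)" "x \<in> set l" using b by (auto simp: bcyc_def)
    then have "set (d # t) = set l" using cyc_same_set[OF t(1)] b unfolding bcyc_def by blast
    then show False using d(2) b by (auto simp: bcyc_def)
  qed
  then show ?thesis using t that by blast
qed

lemma cells_eq: assumes p: "pmap D" and b: "bcyc D l" and s: "bnd D \<subseteq> darts D"
  shows "cells D = orbit (nxt D) ` (darts D - bnd D)"
proof -
  have "orbit (nxt D) x = bnd D" if "x \<in> bnd D" for x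
    using cyc_orbit[of "nxt D" l x] that b by (auto simp: bcyc_def)
  moreover have "orbit (nxt D) x \<noteq> bnd D" if "x \<in> darts D" "x \<notin> bnd D" for x
    using nonbnd_cycle[OF p b that] that(2) by (metis list.set_intros(1))
  ultimately show ?thesis using s by (auto simp: cells_def regions_def)
qed

lemma org_rot: "diagram D \<Longrightarrow> d \<in> darts D \<Longrightarrow> org D (rot D d) = org D d"
  using diagramD(3)[of D] pmapD(9)[OF diagramD(1), of D d] orbit.base[of "rot D" d]
  unfolding orgcond_def by metis

lemma org_nxt: "diagram D \<Longrightarrow> d \<in> darts D \<Longrightarrow> org D (nxt D d) = org D (opp D d)"
  using org_rot[of D "opp D d"] by (simp add: diagramD pmapD rot_opp)

lemma nxt_bnd: assumes "diagram D" "d \<in> darts D" shows "nxt D d \<in> bnd D \<longleftrightarrow> d \<in> bnd D"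
proof
  obtain l where l: "bcyc D l" using diagramD(6)[OF assms(1)] by blast
  show "d \<in> bnd D \<Longrightarrow> nxt D d \<in> bnd D" using l cyc_in[of "nxt D" l d] unfolding bcyc_def by simp
  assume n: "nxt D d \<in> bnd D"
  show "d \<in> bnd D"
  proof (rule ccontr)
    assume "d \<notin> bnd D"
    then obtain t where t: "cyc (nxt D) (d # t)" "set (d # t) \<subseteq> darts D - bnd D"
      using nonbnd_cycle[OF diagramD(1)[OF assms(1)] l assms(2)] by metis
    then have "nxt D d \<in> set (d # t)" using cyc_in[OF t(1), of d] by simp
    then show False using t n by blast
  qed
qed

subsection \<open>Removing an edge\<close>

text \<open>\<open>E\<close> is \<open>D\<close> without the edge of \<open>d\<close> and
  \<open>e\<close>, regardless of which of the two was built from the other: collapses produce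
  \<open>E\<close> from \<open>D\<close>, the reverse constructions produce \<open>D\<close> on top
  of \<open>E\<close>. The value of \<open>nxt E\<close> is a first return because deletion keeps
  the cyclic order of darts around a vertex. Vertices are left open, since only the removal of a
  spike loses one.\<close>

definition ext :: "diag \<Rightarrow> diag \<Rightarrow> nat \<Rightarrow> nat \<Rightarrow> bool" where
  "ext D E d e \<longleftrightarrow> darts D = insert d (insert e (darts E)) \<and> d \<noteq> e \<and> d \<notin> darts E \<and> e \<notin> darts E
    \<and> opp D d = e \<and> opp D e = d
    \<and> (\<forall>x\<in>darts E. opp D x = opp E x \<and> org D x = org E x
        \<and> nxt E x = first_return (darts E) (rot D) (opp D x))"

lemma extD: assumes "ext D E d e"
  shows "darts D = insert d (insert e (darts E))" "d \<noteq> e" "d \<notin> darts E" "e \<notin> darts E"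
    "opp D d = e" "opp D e = d" "x \<in> darts E \<Longrightarrow> opp E x = opp D x"
    "x \<in> darts E \<Longrightarrow> org E x = org D x"
    "x \<in> darts E \<Longrightarrow> nxt E x = first_return (darts E) (rot D) (opp D x)"
    "x \<in> darts E \<Longrightarrow> x \<in> darts D"
  using assms unfolding ext_def by (blast | simp)+

lemma ext_opp: assumes "pmap D" "ext D E d e" "x \<in> darts E"
  shows "opp D x \<in> darts E" "opp D (opp D x) = x" "opp D x \<noteq> x" "opp E x = opp D x" "org E x = org D x"
proof -
  note E = extD[OF assms(2)]
  have x: "x \<in> darts D" using E(10)[OF assms(3)] .
  show inv: "opp D (opp D x) = x" "opp D x \<noteq> x" using pmapD[OF assms(1)] x by auto
  show "opp E x = opp D x" "org E x = org D x" using E(7,8)[OF assms(3)] .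
  have "opp D x \<in> darts D" using pmapD(3)[OF assms(1) x] .
  moreover have "opp D x \<noteq> d" "opp D x \<noteq> e"
    using inv(1) E(3-6) assms(3) by metis+
  ultimately show "opp D x \<in> darts E" using E(1) by auto
qed

lemma first_return_2: "f x \<notin> A \<Longrightarrow> f (f x) \<in> A \<Longrightarrow> first_return A f x = f (f x)"
  using first_return_skip[of f x A 1] first_return_step[of f "f x" A] by simp

lemma first_return_3: "f x \<notin> A \<Longrightarrow> f (f x) \<notin> A \<Longrightarrow> f (f (f x)) \<in> A
    \<Longrightarrow> first_return A f x = f (f (f x))"
  using first_return_skip[of f x A 2] first_return_2[of f "f x" A]
  by (simp add: numeral_2_eq_2)

text \<open>Rotation passes over a deleted dart: past \<open>d\<close> it continues to
  \<open>nxt D e\<close>, past \<open>e\<close> to \<open>nxt D d\<close>. In the third and the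
  fifth case both darts of the edge are passed in succession, which happens where a region is
  bounded by a single loop.\<close>

lemma ext_nxt: assumes "pmap D" "ext D E d e" "x \<in> darts E"
  shows "nxt D x \<in> darts E \<Longrightarrow> nxt E x = nxt D x"
    and "nxt D x = d \<Longrightarrow> nxt D e \<in> darts E \<Longrightarrow> nxt E x = nxt D e"
    and "nxt D x = d \<Longrightarrow> nxt D e = e \<Longrightarrow> nxt D d \<in> darts E \<Longrightarrow> nxt E x = nxt D d"
    and "nxt D x = e \<Longrightarrow> nxt D d \<in> darts E \<Longrightarrow> nxt E x = nxt D d"
    and "nxt D x = e \<Longrightarrow> nxt D d = d \<Longrightarrow> nxt D e \<in> darts E \<Longrightarrow> nxt E x = nxt D e"
proof -
  have x: "x \<in> darts D" using extD(10)[OF assms(2,3)] .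
  have n: "nxt E x = first_return (darts E) (rot D) (opp D x)" using extD(9)[OF assms(2,3)] .
  have r: "rot D (opp D x) = nxt D x" using rot_opp[OF assms(1) x] .
  have r': "rot D d = nxt D e" "rot D e = nxt D d" "d \<notin> darts E" "e \<notin> darts E"
    using extD[OF assms(2)] by (auto simp: rot_def)
  show "nxt D x \<in> darts E \<Longrightarrow> nxt E x = nxt D x"
    using n r first_return_step[of "rot D" "opp D x"] by simp
  show "nxt D x = d \<Longrightarrow> nxt D e \<in> darts E \<Longrightarrow> nxt E x = nxt D e"
    "nxt D x = e \<Longrightarrow> nxt D d \<in> darts E \<Longrightarrow> nxt E x = nxt D d"
    using n r r' first_return_2[of "rot D" "opp D x"] by auto
  show "nxt D x = d \<Longrightarrow> nxt D e = e \<Longrightarrow> nxt D d \<in> darts E \<Longrightarrow> nxt E x = nxt D d"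
    "nxt D x = e \<Longrightarrow> nxt D d = d \<Longrightarrow> nxt D e \<in> darts E \<Longrightarrow> nxt E x = nxt D e"
    using n r r' first_return_3[of "rot D" "opp D x"] by auto
qed

lemma ext_rot_orbit: assumes "pmap D" "ext D E d e" "x \<in> darts E"
  shows "orbit (rot E) x = orbit (rot D) x \<inter> darts E"
proof -
  have x: "x \<in> darts D" using extD(10)[OF assms(2,3)] .
  obtain t where t: "cyc (rot D) (x # t)" "set (x # t) \<subseteq> darts D" "orbit (rot D) x = set (x # t)"
    using rot_cycle[OF assms(1) x] .
  let ?l = "filter (\<lambda>y. y \<in> darts E) (x # t)"
  have "cyc (first_return (darts E) (rot D)) ?l" using cyc_first_return[OF t(1)] .
  moreover have "first_return (darts E) (rot D) y = rot E y" if "y \<in> set ?l" for y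
  proof -
    have y: "y \<in> darts E" using that unfolding set_filter by simp
    then have "opp D y \<in> darts E" "opp E y = opp D y" "opp D (opp D y) = y" using ext_opp[OF assms(1,2)] by auto
    then show ?thesis using extD(9)[OF assms(2), of "opp D y"] by (simp add: rot_def[of E])
  qed
  ultimately have "cyc (rot E) ?l" by (rule cyc_cong)
  then have "orbit (rot E) x = set ?l" by (rule cyc_orbit) (use assms(3) in auto)
  then show ?thesis using t(3) by auto
qed

lemma ext_edges: assumes "pmap D" "ext D E d e"
  shows "card (edges D) = Suc (card (edges E))"
proof -
  have f: "finite (darts E)" using extD(1)[OF assms(2)] pmapD(2)[OF assms(1)] by simp
  have "edges D = insert {d, e} (edges E)"
  proof -
    have "(\<lambda>x. {x, opp D x}) ` darts E = (\<lambda>x. {x, opp E x}) ` darts E"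
      using ext_opp(4)[OF assms] by simp
    then show ?thesis using extD(1,5,6)[OF assms(2)] by (auto simp: edges_def insert_commute)
  qed
  moreover have "{d, e} \<notin> edges E"
    using extD(3,4)[OF assms(2)] by (auto simp: edges_def doubleton_eq_iff)
  ultimately show ?thesis using f by (simp add: edges_def)
qed

lemma ext_orgcond_small: assumes "pmap D" "ext D E d e" "orgcond D" shows "orgcond E"
proof -
  have "darts E \<subseteq> darts D" using extD(10)[OF assms(2)] by blast
  then show ?thesis
    using assms(3) ext_rot_orbit[OF assms(1,2)] ext_opp(5)[OF assms(1,2)]
    unfolding orgcond_def by (simp add: subset_iff)
qed

lemma orbit_sym: assumes "pmap D" "x \<in> darts D" "y \<in> orbit (rot D) x"
  shows "y \<in> darts D" "orbit (rot D) y = orbit (rot D) x" "x \<in> orbit (rot D) x"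
proof -
  obtain t where t: "cyc (rot D) (x # t)" "set (x # t) \<subseteq> darts D" "orbit (rot D) x = set (x # t)"
    using rot_cycle[OF assms(1,2)] .
  then show "y \<in> darts D" "orbit (rot D) y = orbit (rot D) x" "x \<in> orbit (rot D) x"
    using assms(3) cyc_orbit[OF t(1)] by auto
qed

lemma org_orbit_const: assumes "pmap D" "x \<in> darts D" "y \<in> orbit (rot D) x"
  "\<And>z. z \<in> darts D \<Longrightarrow> org D (rot D z) = org D z"
  shows "org D y = org D x"
  using assms(3)
proof induction
  case base
  then show ?case using assms by simp
next
  case (step z)
  then show ?case using assms orbit_sym(1)[OF assms(1,2)] by simp
qed

text \<open>The condition transfers from \<open>E\<close> for every dart whose rotation orbit
  contains an old dart. The second alternative in \<open>alt\<close> is for a new dart whose orbit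
  exhausts its vertex, such as the dart at the tip of a spike.\<close>

lemma ext_orgcond_big: assumes p: "pmap D" and e: "ext D E d e" and o: "orgcond E"
  and c: "\<And>z. z \<in> darts D \<Longrightarrow> org D (rot D z) = org D z"
  and alt: "\<And>z. z \<in> {d, e} \<Longrightarrow> (\<exists>x\<in>darts E. x \<in> orbit (rot D) z)
     \<or> (\<forall>x\<in>darts D. org D x = org D z \<longrightarrow> x \<in> orbit (rot D) z)"
  shows "orgcond D"
  unfolding orgcond_def
proof (intro ballI iffI)
  fix x y assume xy: "x \<in> darts D" "y \<in> darts D"
  show "y \<in> orbit (rot D) x \<Longrightarrow> org D x = org D y" using org_orbit_const[OF p xy(1) _ c] by simp
  assume o': "org D x = org D y"
  have alt': "(\<exists>x\<in>darts E. x \<in> orbit (rot D) z)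
     \<or> (\<forall>x\<in>darts D. org D x = org D z \<longrightarrow> x \<in> orbit (rot D) z)" if zd: "z \<in> darts D" for z
  proof (cases "z \<in> {d, e}")
    case False
    then have "z \<in> darts E" using zd extD(1)[OF e] by simp
    moreover obtain t where "orbit (rot D) z = set (z # t)" using rot_cycle[OF p zd] by metis
    ultimately show ?thesis by auto
  qed (use alt in blast)
  consider "y \<in> orbit (rot D) x" | "x \<in> orbit (rot D) y"
    | a b where "a \<in> darts E" "a \<in> orbit (rot D) x" "b \<in> darts E" "b \<in> orbit (rot D) y"
    using alt'[OF xy(1)] alt'[OF xy(2)] xy o' by metis
  then show "y \<in> orbit (rot D) x"
  proof cases
    case 1 then show ?thesis .
  next
    case 2 then show ?thesis using orbit_sym[OF p xy(2) 2] by simp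
  next
    case 3
    have "org D a = org D b"
      using org_orbit_const[OF p xy(1) 3(2) c] org_orbit_const[OF p xy(2) 3(4) c] o' by simp
    then have "org E a = org E b" using ext_opp(5)[OF p e] 3 by simp
    then have "b \<in> orbit (rot E) a" using o 3 by (auto simp: orgcond_def)
    then have "b \<in> orbit (rot D) a" using ext_rot_orbit[OF p e 3(1)] by simp
    then show ?thesis
      using orbit_sym(2)[OF p xy(1) 3(2)] orbit_sym(2,3)[OF p xy(2) 3(4)]
        orbit_sym(2)[OF p orbit_sym(1)[OF p xy(1) 3(2)]] by metis
  qed
qed

lemma subdiag_ext: assumes p: "pmap D" and d: "d \<in> darts D"
  shows "ext D (subdiag D V (darts D - {d, opp D d}) B) d (opp D d)"
  using pmapD(3-5)[OF p d] d pmapD(4)[OF p d, symmetric] by (auto simp: ext_def subdiag_def)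

text \<open>Since \<open>nxt\<close> is reversal followed by rotation, it suffices that both permute
  the remaining darts. Rotation does so because its cycles are the old ones with the removed darts
  deleted.\<close>

lemma ext_pmap_small: assumes p: "pmap D" and e: "ext D E d e"
  and v: "finite (verts E)" "\<And>x. x \<in> darts E \<Longrightarrow> org D x \<in> verts E"
  shows "pmap E"
proof -
  note x = extD[OF e] ext_opp[OF p e]
  have "bij_betw (rot E) (darts E) (darts E)"
  proof (rule cyc_cover_bij)
    fix y assume y: "y \<in> darts E"
    obtain t where t: "cyc (rot D) (y # t)" "set (y # t) \<subseteq> darts D"
      using rot_cycle[OF p extD(10)[OF e y]] by metis
    let ?l = "filter (\<lambda>z. z \<in> darts E) (y # t)"
    have "cyc (first_return (darts E) (rot D)) ?l" using cyc_first_return[OF t(1)] .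
    moreover have "first_return (darts E) (rot D) z = rot E z" if "z \<in> set ?l" for z
    proof -
      have z: "z \<in> darts E" using that unfolding set_filter by simp
      then show ?thesis
        using ext_opp[OF p e z] extD(9)[OF e, of "opp D z"] by (simp add: rot_def[of E])
    qed
    ultimately have "cyc (rot E) ?l" by (rule cyc_cong)
    then show "\<exists>l. cyc (rot E) l \<and> y \<in> set l \<and> set l \<subseteq> darts E"
      using y by (intro exI[of _ ?l]) auto
  qed
  moreover have "bij_betw (opp E) (darts E) (darts E)"
  proof -
    have "inj_on (opp E) (darts E)" using x(14,12) by (metis inj_onI)
    moreover have "opp E ` darts E \<subseteq> darts E" using x(11,14) by fastforce
    moreover have "finite (darts E)" using x(1) pmapD(2)[OF p] by simp
    ultimately show ?thesis by (simp add: bij_betw_def endo_inj_surj)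
  qed
  ultimately have "bij_betw (rot E \<circ> opp E) (darts E) (darts E)"
    using bij_betw_trans by blast
  moreover have "(rot E \<circ> opp E) z = nxt E z" if "z \<in> darts E" for z
    using x(11-14) that by (simp add: rot_def)
  ultimately have "bij_betw (nxt E) (darts E) (darts E)"
    using bij_betw_cong[of "darts E"] by blast
  moreover have "finite (darts E)" using x(1) pmapD(2)[OF p] by simp
  ultimately show ?thesis using v x unfolding pmap_def by auto
qed

locale edge_removal =
  fixes D E d e
  assumes pD: "pmap D" and pE: "pmap E" and ex: "ext D E d e"
begin

lemma chain_conn:
  assumes "successively (\<lambda>a b. nxt D a = b) t" "t \<noteq> []" "set t \<subseteq> darts E"
    and "\<And>x. x \<in> darts D \<Longrightarrow> org D (nxt D x) = org D (opp D x)"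
  shows "(org D (hd t), org D (opp D (last t))) \<in> (adjacent E)\<^sup>*"
  using assms(1-3)
proof (induction t)
  case (Cons x t)
  have xE: "x \<in> darts E" using Cons.prems by simp
  have a: "(org D x, org D (opp D x)) \<in> adjacent E"
    unfolding adjacent_def
    using ext_opp[OF pD ex xE] ext_opp(5)[OF pD ex ext_opp(1)[OF pD ex xE]] xE
    by (metis (mono_tags, lifting) image_eqI)
  show ?case
  proof (cases "t = []")
    case True then show ?thesis using a by simp
  next
    case False
    then have "nxt D x = hd t" "successively (\<lambda>a b. nxt D a = b) t"
      using Cons.prems by (auto simp: successively_Cons)
    moreover have "org D (nxt D x) = org D (opp D x)" using assms(4) extD(10)[OF ex xE] .
    ultimately have "(org D (opp D x), org D (opp D (last t))) \<in> (adjacent E)\<^sup>*"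
      using Cons.IH Cons.prems False by simp
    then show ?thesis using a False by simp
  qed
qed simp

lemma adjacent_E: "adjacent E \<subseteq> adjacent D"
proof
  fix z assume "z \<in> adjacent E"
  then obtain x where x: "x \<in> darts E" "z = (org E x, org E (opp E x))" by (auto simp: adjacent_def)
  then have "z = (org D x, org D (opp D x))" 
    using ext_opp[OF pD ex x(1)] ext_opp(5)[OF pD ex ext_opp(1)[OF pD ex x(1)]] by simp
  then show "z \<in> adjacent D" using extD(10)[OF ex x(1)] by (auto simp: adjacent_def)
qed

lemma adjacent_D: "adjacent D \<subseteq> insert (org D d, org D e) (insert (org D e, org D d) (adjacent E))"
proof
  fix z assume "z \<in> adjacent D"
  then obtain x where x: "x \<in> darts D" "z = (org D x, org D (opp D x))" by (auto simp: adjacent_def)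
  consider "x = d" | "x = e" | "x \<in> darts E" using x(1) extD(1)[OF ex] by blast
  then show "z \<in> insert (org D d, org D e) (insert (org D e, org D d) (adjacent E))"
  proof cases
    case 3
    then have "z = (org E x, org E (opp E x))" using x(2)
      ext_opp[OF pD ex 3] ext_opp(5)[OF pD ex ext_opp(1)[OF pD ex 3]] by simp
    then show ?thesis using 3 by (auto simp: adjacent_def)
  qed (use x(2) extD(5,6)[OF ex] in simp_all)
qed

lemma cyc_transfer: assumes "cyc (nxt D) l" "set l \<subseteq> darts E" shows "cyc (nxt E) l"
proof (rule cyc_cong[OF assms(1)])
  fix x assume "x \<in> set l"
  then show "nxt D x = nxt E x"
    using ext_nxt(1)[OF pD ex, of x] cyc_in[OF assms(1)] assms(2) by (metis subsetD)
qed

end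

text \<open>\<open>d\<close> lies on the boundary circuit \<open>d # v\<close> and its reverse
  \<open>e\<close> on the cell \<open>e # t\<close>; without the edge the two circuits merge into
  \<open>t @ v\<close>. Neither side is assumed to be a diagram, so that the removal of a cell and
  its attachment are both instances.\<close>

locale removal2 = edge_removal +
  fixes t v
  assumes cd: "cyc (nxt D) (d # v)" and ce: "cyc (nxt D) (e # t)" and ed: "e \<notin> set v"
    and bD: "bnd D = set (d # v)" and bE: "bnd E = set (t @ v)" and vE: "verts E = verts D"
    and sD: "set (d # v) \<subseteq> darts D" "set (e # t) \<subseteq> darts D"
begin

lemma disj: "set (d # v) \<inter> set (e # t) = {}"
proof (rule ccontr)
  assume "set (d # v) \<inter> set (e # t) \<noteq> {}"
  then obtain x where "x \<in> set (d # v)" "x \<in> set (e # t)" by blast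
  then have "set (d # v) = set (e # t)" using cyc_same_set[OF cd ce] by blast
  then show False using ed extD(2)[OF ex] by auto
qed

lemma in_E: "set v \<subseteq> darts E" "set t \<subseteq> darts E"
proof -
  have "d \<notin> set v" "e \<notin> set t" using cd ce by (auto simp: cyc_def)
  then show "set v \<subseteq> darts E" "set t \<subseteq> darts E" using disj sD extD(1)[OF ex] by auto
qed

text \<open>The junctions from \<open>t\<close> to \<open>v\<close> and from \<open>v\<close> to
  \<open>t\<close> are the places where a removed dart is skipped. If one of the lists is empty, a
  single junction remains and both removed darts are skipped there.\<close>

lemma cyc_E: "cyc (nxt E) (t @ v)"
proof -
  have suc: "successively (\<lambda>a b. nxt E a = b) l" if "successively (\<lambda>a b. nxt D a = b) l" "set l \<subseteq> darts E" for l
    using that(1)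
  proof (rule successively_mono)
    fix x y assume "x \<in> set l" "y \<in> set l" "nxt D x = y"
    then show "nxt E x = y" using that(2) ext_nxt(1)[OF pD ex, of x] by auto
  qed
  have st: "successively (\<lambda>a b. nxt E a = b) t" "successively (\<lambda>a b. nxt E a = b) v"
    using cd ce in_E by (auto simp: cyc_def successively_Cons intro!: suc)
  have dt: "distinct (t @ v)" using cd ce disj by (auto simp: cyc_def)
  have nd: "nxt D d = hd (v @ [d])" "nxt D e = hd (t @ [e])"
    using cyc_next[of "nxt D" "[]" d v] cyc_next[of "nxt D" "[]" e t] cd ce by auto
  have lt: "nxt D (last t) = e" "last t \<in> darts E" if "t \<noteq> []"
    using ce that in_E(2) last_in_set[OF that] by (auto simp: cyc_def)
  have lv: "nxt D (last v) = d" "last v \<in> darts E" if "v \<noteq> []"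
    using cd that in_E(1) last_in_set[OF that] by (auto simp: cyc_def)
  have h: "hd t \<in> darts E" if "t \<noteq> []" using that in_E(2) hd_in_set by blast
  have h': "hd v \<in> darts E" if "v \<noteq> []" using that in_E(1) hd_in_set by blast
  have a: "nxt E (last t) = hd v" if "t \<noteq> []" "v \<noteq> []"
    using ext_nxt(4)[OF pD ex lt(2)] lt nd h' that by simp
  have b: "nxt E (last v) = hd t" if "t \<noteq> []" "v \<noteq> []"
    using ext_nxt(2)[OF pD ex lv(2)] lv nd h that by simp
  have c: "nxt E (last v) = hd v" if "t = []" "v \<noteq> []"
    using ext_nxt(3)[OF pD ex lv(2)] lv nd h' that by simp
  have c': "nxt E (last t) = hd t" if "t \<noteq> []" "v = []"
    using ext_nxt(5)[OF pD ex lt(2)] lt nd h that by simp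
  show ?thesis
    using st dt a b c c' by (cases "t = []"; cases "v = []") (auto simp: cyc_def successively_append_iff)
qed

lemma bcycs: "bcyc D (d # v)" "bcyc E (t @ v)"
  using cd cyc_E bD bE by (auto simp: bcyc_def)

lemma nonbnd_D: "darts D - bnd D = set (e # t) \<union> (darts E - bnd E)"
  using disj sD extD(1,2)[OF ex] in_E extD(3,4)[OF ex] cd ce unfolding bD bE cyc_def by auto

lemma other: assumes "x \<in> darts E - bnd E"
  obtains l where "cyc (nxt D) (x # l)" "cyc (nxt E) (x # l)" "set (x # l) \<subseteq> darts E - bnd E"
    "orbit (nxt D) x = set (x # l)" "orbit (nxt E) x = set (x # l)"
proof -
  have x: "x \<in> darts D" "x \<notin> bnd D" "x \<notin> set (e # t)" using assms nonbnd_D bE extD(4)[OF ex] by auto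
  obtain l where l: "cyc (nxt D) (x # l)" "set (x # l) \<subseteq> darts D - bnd D" "orbit (nxt D) x = set (x # l)"
    using nonbnd_cycle[OF pD bcycs(1) x(1,2)] .
  have "set (x # l) \<inter> set (e # t) = {}"
  proof (rule ccontr)
    assume "set (x # l) \<inter> set (e # t) \<noteq> {}"
    then obtain y where "y \<in> set (x # l)" "y \<in> set (e # t)" by blast
    then have "set (x # l) = set (e # t)" using cyc_same_set[OF l(1) ce] by blast
    then show False using x(3) by auto
  qed
  then have s: "set (x # l) \<subseteq> darts E - bnd E" using l(2) nonbnd_D by blast
  then have "cyc (nxt E) (x # l)" using cyc_transfer[OF l(1)] by blast
  then show ?thesis using that l s cyc_orbit[of "nxt E" "x # l" x] by simp
qed

lemma cells_D: "cells D = insert (set (e # t)) (cells E)" "set (e # t) \<notin> cells E"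
proof -
  have i: "orbit (nxt D) x = orbit (nxt E) x" if "x \<in> darts E - bnd E" for x
    using other[OF that] by metis
  have j: "orbit (nxt D) x = set (e # t)" if "x \<in> set (e # t)" for x
    using cyc_orbit[OF ce that] .
  have cD: "cells D = orbit (nxt D) ` (darts D - bnd D)"
    by (rule cells_eq[OF pD bcycs(1)]) (use sD bD in simp)
  have cE: "cells E = orbit (nxt E) ` (darts E - bnd E)"
    by (rule cells_eq[OF pE bcycs(2)]) (use in_E bE in simp)
  have "orbit (nxt D) ` set (e # t) = (\<lambda>x. set (e # t)) ` set (e # t)"
    using j by (rule image_cong[OF HOL.refl])
  also have "\<dots> = {set (e # t)}" by (simp add: image_constant_conv del: list.set)
  finally have "orbit (nxt D) ` set (e # t) = {set (e # t)}" .
  then show "cells D = insert (set (e # t)) (cells E)"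
    unfolding cD cE nonbnd_D image_Un using i by auto
  show "set (e # t) \<notin> cells E"
  proof
    assume "set (e # t) \<in> cells E"
    then obtain x where x: "x \<in> darts E - bnd E" "orbit (nxt E) x = set (e # t)" unfolding cE by auto
    then have "e \<in> darts E" using other[OF x(1)] by (metis DiffD1 list.set_intros(1) subsetD)
    then show False using extD(4)[OF ex] by simp
  qed
qed

lemma card_cells: "card (cells D) = Suc (card (cells E))"
proof -
  have "finite (cells E)" using pmapD(2)[OF pE] by (simp add: cells_def regions_def)
  then show ?thesis using cells_D by simp
qed

lemma euler_iff: "euler D \<longleftrightarrow> euler E"
  using card_cells ext_edges[OF pD ex] vE by (simp add: euler_def)

text \<open>The rest \<open>t\<close> of the cell boundary is a path between the ends of the removed
  edge; for empty \<open>t\<close> the edge is a loop.\<close>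

lemma conn_small: assumes "conn D" "\<And>x. x \<in> darts D \<Longrightarrow> org D (nxt D x) = org D (opp D x)"
  shows "conn E"
proof -
  have nd: "nxt D e = hd (t @ [e])"
    using cyc_next[of "nxt D" "[]" e t] ce by auto
  have dD: "d \<in> darts D" "e \<in> darts D" using sD by auto
  have "(org D d, org D e) \<in> (adjacent E)\<^sup>*"
  proof (cases "t = []")
    case True
    then have "org D e = org D d" using nd assms(2)[OF dD(2)] extD(6)[OF ex] by simp
    then show ?thesis by simp
  next
    case False
    have "successively (\<lambda>a b. nxt D a = b) t" using ce False by (auto simp: cyc_def successively_Cons)
    then have "(org D (hd t), org D (opp D (last t))) \<in> (adjacent E)\<^sup>*"
      using chain_conn[of t] False in_E(2) assms(2) by blast
    moreover have "org D (hd t) = org D d" using nd assms(2)[OF dD(2)] extD(6)[OF ex] False by simp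
    moreover have "nxt D (last t) = e" using ce False by (auto simp: cyc_def)
    moreover have "last t \<in> darts D" using in_E(2) False last_in_set extD(10)[OF ex] by blast
    ultimately show ?thesis using assms(2)[of "last t"] by simp
  qed
  moreover have "(a, b) \<in> (adjacent E)\<^sup>* \<Longrightarrow> (b, a) \<in> (adjacent E)\<^sup>*" for a b
  proof -
    have "sym (adjacent E)"
    proof (rule symI)
      fix a b assume "(a, b) \<in> adjacent E"
      then obtain x where "x \<in> darts E" "a = org E x" "b = org E (opp E x)" by (auto simp: adjacent_def)
      then show "(b, a) \<in> adjacent E" using pmapD(3,5)[OF pE]
        unfolding adjacent_def by (metis (mono_tags, lifting) image_eqI)
    qed
    then show "(a, b) \<in> (adjacent E)\<^sup>* \<Longrightarrow> (b, a) \<in> (adjacent E)\<^sup>*" by (meson sym_rtrancl symD)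
  qed
  ultimately have "adjacent D \<subseteq> (adjacent E)\<^sup>*" using adjacent_D by blast
  then have "(adjacent D)\<^sup>* \<subseteq> (adjacent E)\<^sup>*" by (rule rtrancl_subset_rtrancl)
  then show ?thesis using assms(1) vE by (auto simp: conn_def)
qed

lemma conn_big: "conn E \<Longrightarrow> conn D"
  using rtrancl_mono[OF adjacent_E] vE by (auto simp: conn_def)

text \<open>If both circuits are single loops, \<open>d\<close> and \<open>e\<close> form a whole
  rotation orbit. No other edge meets their vertex, and connectedness leaves none elsewhere. This
  gives the clause that an empty boundary occurs only without darts.\<close>

lemma darts_E_empty: assumes "diagram D" "t @ v = []" shows "darts E = {}"
proof (rule ccontr)
  assume "darts E \<noteq> {}"
  then obtain x where x: "x \<in> darts E" by blast
  have tv: "t = []" "v = []" using assms(2) by auto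
  have nd: "nxt D d = d" "nxt D e = e" using cd ce tv by (auto simp: cyc_def)
  have dD: "d \<in> darts D" "e \<in> darts D" using sD by auto
  have l: "org D e = org D d"
    using org_nxt[OF assms(1) dD(1)] nd extD(5)[OF ex] by simp
  have "cyc (rot D) [d, e]" using nd extD(2,5,6)[OF ex] by (auto simp: cyc_def rot_def)
  then have orb: "orbit (rot D) d = {d, e}" using cyc_orbit[of "rot D" "[d, e]" d] by simp
  have key: "org D y = org D d \<longrightarrow> y \<in> {d, e}" if "y \<in> darts D" for y
    using diagramD(3)[OF assms(1)] that dD orb unfolding orgcond_def by metis
  have a: "u = org D d" if "(org D d, u) \<in> (adjacent D)\<^sup>*" for u
    using that
  proof induction
    case (step y z)
    then obtain w where w: "w \<in> darts D" "y = org D w" "z = org D (opp D w)" by (auto simp: adjacent_def)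
    then have "w \<in> {d, e}" using key[OF w(1)] step by simp
    then show ?case using w l extD(5,6)[OF ex] by auto
  qed simp
  have xD: "x \<in> darts D" using extD(10)[OF ex x] .
  then have "org D x = org D d"
    using a diagramD(4)[OF assms(1)] pmapD(8)[OF pD] dD unfolding conn_def by blast
  then show False using key[OF xD] x extD(3,4)[OF ex] by auto
qed

lemma diagram_small: assumes "diagram D" shows "diagram E"
  unfolding diagram_iff
proof (intro conjI)
  note D = diagramD[OF assms]
  show "pmap E" by (rule pE)
  show "verts E \<noteq> {}" using D(2) vE by simp
  show "orgcond E" using ext_orgcond_small[OF pD ex D(3)] .
  show "conn E" using conn_small[OF D(4)] org_nxt[OF assms] by blast
  show "euler E" using euler_iff D(5) by simp
  show "\<exists>l. bcyc E l" using bcycs by blast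
  show "bnd E \<subseteq> darts E" using in_E bE by simp
  show "bnd E = {} \<longrightarrow> darts E = {}" using darts_E_empty[OF assms] bE by auto
qed

text \<open>That rotation preserves initial vertices is a hypothesis, as it depends on the choice of
  \<open>org\<close> for the new darts. The rotation of a new dart reaches an old one within two
  steps unless \<open>E\<close> has no darts at all.\<close>

lemma diagram_big: assumes "diagram E" and c: "\<And>z. z \<in> darts D \<Longrightarrow> org D (rot D z) = org D z"
  shows "diagram D"
  unfolding diagram_iff
proof (intro conjI)
  note EE = diagramD[OF assms(1)]
  have nd: "rot D e = hd (v @ [d])" "rot D d = hd (t @ [e])"
    using cyc_next[of "nxt D" "[]" d v] cyc_next[of "nxt D" "[]" e t] cd ce extD(5,6)[OF ex]
    by (auto simp: rot_def)
  have st: "rot D z \<in> orbit (rot D) z" "rot D (rot D z) \<in> orbit (rot D) z" for z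
    by (auto intro: orbit.intros)
  show "pmap D" by (rule pD)
  show "verts D \<noteq> {}" using EE(2) vE by simp
  show "conn D" using conn_big[OF EE(4)] .
  show "euler D" using euler_iff EE(5) by simp
  show "\<exists>l. bcyc D l" using bcycs by blast
  show "bnd D \<subseteq> darts D" using sD bD by simp
  show "bnd D = {} \<longrightarrow> darts D = {}" using bD by simp
  show "orgcond D"
  proof (rule ext_orgcond_big[OF pD ex EE(3) c])
    fix z assume z: "z \<in> {d, e}"
    show "(\<exists>x\<in>darts E. x \<in> orbit (rot D) z)
      \<or> (\<forall>x\<in>darts D. org D x = org D z \<longrightarrow> x \<in> orbit (rot D) z)"
    proof (cases "t = [] \<and> v = []")
      case True
      then have "darts E = {}" using EE(8) bE by simp
      moreover have "rot D e = d" "rot D d = e" using nd True by auto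
      ultimately show ?thesis using z st[of d] st[of e] extD(1)[OF ex] by auto
    next
      case False
      have "hd t \<in> darts E" if "t \<noteq> []" using that in_E(2) hd_in_set by blast
      moreover have "hd v \<in> darts E" if "v \<noteq> []" using that in_E(1) hd_in_set by blast
      ultimately have "rot D z \<in> darts E \<or> rot D (rot D z) \<in> darts E"
        using False z nd by (cases "t = []"; cases "v = []") auto
      then show ?thesis using st by blast
    qed
  qed
qed

end

text \<open>\<open>p\<close> is the tip of a spike: \<open>e\<close> runs into it and
  \<open>d\<close> leaves it, so that they are consecutive on the boundary circuit.\<close>

locale removal1 = edge_removal +
  fixes v p
  assumes cd: "cyc (nxt D) (e # d # v)"
    and bD: "bnd D = set (e # d # v)" and bE: "bnd E = set v" and vD: "verts D = insert p (verts E)"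
    and pv: "p \<notin> verts E" and od: "org D d = p" and oe: "org D e \<in> verts E"
    and sD: "set (e # d # v) \<subseteq> darts D"
begin

lemma in_E: "set v \<subseteq> darts E"
  using cd sD extD(1)[OF ex] by (auto simp: cyc_def)

lemma cyc_E: "cyc (nxt E) v"
proof (cases "v = []")
  case False
  have suc: "successively (\<lambda>a b. nxt D a = b) v" using cd False by (auto simp: cyc_def successively_Cons)
  have "successively (\<lambda>a b. nxt E a = b) v"
    using suc
  proof (rule successively_mono)
    fix x y assume "x \<in> set v" "y \<in> set v" "nxt D x = y"
    then show "nxt E x = y" using in_E ext_nxt(1)[OF pD ex, of x] by auto
  qed
  moreover have "nxt E (last v) = hd v"
  proof -
    have "nxt D (last v) = e" "nxt D d = hd v" using cd False by (auto simp: cyc_def successively_Cons)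
    moreover have "last v \<in> darts E" "hd v \<in> darts E" using False in_E by auto
    ultimately show ?thesis using ext_nxt(4)[OF pD ex] by simp
  qed
  ultimately show ?thesis using cd by (auto simp: cyc_def)
qed simp

lemma bcycs: "bcyc D (e # d # v)" "bcyc E v"
  using cd cyc_E bD bE by (auto simp: bcyc_def)

lemma nonbnd_D: "darts D - bnd D = darts E - bnd E"
  using extD(1,3,4)[OF ex] bD bE by auto

lemma cells_D: "cells D = cells E"
proof -
  have i: "orbit (nxt D) x = orbit (nxt E) x" if x: "x \<in> darts E - bnd E" for x
  proof -
    have x': "x \<in> darts D" "x \<notin> bnd D" using x nonbnd_D by auto
    obtain l where l: "cyc (nxt D) (x # l)" "set (x # l) \<subseteq> darts D - bnd D" "orbit (nxt D) x = set (x # l)"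
      using nonbnd_cycle[OF pD bcycs(1) x'] .
    then have "cyc (nxt E) (x # l)" using cyc_transfer[OF l(1)] nonbnd_D by blast
    then show ?thesis using l(3) cyc_orbit[of "nxt E" "x # l" x] by simp
  qed
  have "cells D = orbit (nxt D) ` (darts D - bnd D)"
    by (rule cells_eq[OF pD bcycs(1)]) (use sD bD in simp)
  moreover have "cells E = orbit (nxt E) ` (darts E - bnd E)"
    by (rule cells_eq[OF pE bcycs(2)]) (use in_E bE in simp)
  ultimately show ?thesis using i nonbnd_D by simp
qed

lemma euler_iff: "euler D \<longleftrightarrow> euler E"
  using cells_D ext_edges[OF pD ex] vD pv pmapD(1)[OF pE] by (simp add: euler_def)

text \<open>Paths are pushed off the tip by the map that sends \<open>p\<close> to the other end of
  the spike.\<close>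

lemma conn_small: assumes "conn D" shows "conn E"
proof -
  define r where "r u = (if u = p then org D e else u)" for u
  have "(r a, r b) \<in> (adjacent E)\<^sup>*" if "(a, b) \<in> (adjacent D)\<^sup>*" for a b
    using that
  proof induction
    case (step y z)
    have "(r y, r z) \<in> (adjacent E)\<^sup>*"
    proof (cases "(y, z) \<in> adjacent E")
      case True
      then have "y \<noteq> p" "z \<noteq> p" using pv pmapD(3,8)[OF pE] by (auto simp: adjacent_def)
      then show ?thesis using True by (simp add: r_def)
    next
      case False
      then have "y = p \<and> z = org D e \<or> y = org D e \<and> z = p" using step(2) adjacent_D od by blast
      then show ?thesis by (auto simp: r_def)
    qed
    then show ?case using step by simp
  qed simp
  moreover have "r u = u" if "u \<in> verts E" for u using that pv by (auto simp: r_def)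
  ultimately show ?thesis using assms vD unfolding conn_def by (metis insertCI)
qed

lemma conn_big: assumes "conn E" shows "conn D"
proof -
  have E: "(a, b) \<in> (adjacent D)\<^sup>*" if "a \<in> verts E" "b \<in> verts E" for a b
    using assms that rtrancl_mono[OF adjacent_E] by (auto simp: conn_def)
  have "(p, org D e) \<in> adjacent D" "(org D e, p) \<in> adjacent D"
    using sD od extD(5,6)[OF ex] unfolding adjacent_def by force+
  then have "(p, a) \<in> (adjacent D)\<^sup>*" "(a, p) \<in> (adjacent D)\<^sup>*" if "a \<in> verts E" for a
    using E[OF that oe] E[OF oe that] by (auto intro: rtrancl_into_rtrancl converse_rtrancl_into_rtrancl)
  then show ?thesis using E vD by (auto simp: conn_def)
qed

lemma darts_E_empty: assumes "diagram D" "v = []" shows "darts E = {}"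
proof (rule ccontr)
  assume "darts E \<noteq> {}"
  then obtain x where x: "x \<in> darts E" by blast
  have dD: "d \<in> darts D" "e \<in> darts D" using sD by auto
  have "rot D e = e" "rot D d = d" using cd assms(2) extD(5,6)[OF ex] by (auto simp: cyc_def rot_def)
  then have "orbit (rot D) e = {e}" "orbit (rot D) d = {d}" by (simp_all add: orbit_eq_singleton_iff)
  then have key: "org D y = org D d \<longrightarrow> y = d" "org D y = org D e \<longrightarrow> y = e" if "y \<in> darts D" for y
    using diagramD(3)[OF assms(1)] that dD unfolding orgcond_def by (metis singletonD)+
  have a: "u \<in> {org D d, org D e}" if "(org D d, u) \<in> (adjacent D)\<^sup>*" for u
    using that
  proof induction
    case (step y z)
    then obtain w where w: "w \<in> darts D" "y = org D w" "z = org D (opp D w)" by (auto simp: adjacent_def)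
    then have "w \<in> {d, e}" using key[OF w(1)] step by auto
    then show ?case using w extD(5,6)[OF ex] by auto
  qed simp
  have xD: "x \<in> darts D" using extD(10)[OF ex x] .
  then have "org D x \<in> {org D d, org D e}"
    using a diagramD(4)[OF assms(1)] pmapD(8)[OF pD] dD unfolding conn_def by blast
  then show False using key[OF xD] x extD(3,4)[OF ex] by auto
qed

lemma diagram_small: assumes "diagram D" shows "diagram E"
  unfolding diagram_iff
proof (intro conjI)
  note D = diagramD[OF assms]
  show "pmap E" by (rule pE)
  show "verts E \<noteq> {}" using oe by auto
  show "orgcond E" using ext_orgcond_small[OF pD ex D(3)] .
  show "conn E" using conn_small[OF D(4)] .
  show "euler E" using euler_iff D(5) by simp
  show "\<exists>l. bcyc E l" using bcycs by blast
  show "bnd E \<subseteq> darts E" using in_E bE by simp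
  show "bnd E = {} \<longrightarrow> darts E = {}" using darts_E_empty[OF assms] bE by auto
qed

lemma diagram_big: assumes "diagram E" and c: "\<And>z. z \<in> darts D \<Longrightarrow> org D (rot D z) = org D z"
  shows "diagram D"
  unfolding diagram_iff
proof (intro conjI)
  note EE = diagramD[OF assms(1)]
  have nd: "rot D e = hd (v @ [e])" "rot D d = d"
    using cyc_next[of "nxt D" "[e]" d v] cyc_next[of "nxt D" "[]" e "d # v"] cd extD(5,6)[OF ex]
    by (cases v; simp add: rot_def)+
  have st: "rot D z \<in> orbit (rot D) z" for z
    by (auto intro: orbit.intros)
  show "pmap D" by (rule pD)
  show "verts D \<noteq> {}" using vD by simp
  show "conn D" using conn_big[OF EE(4)] .
  show "euler D" using euler_iff EE(5) by simp
  show "\<exists>l. bcyc D l" using bcycs by blast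
  show "bnd D \<subseteq> darts D" using sD bD by simp
  show "bnd D = {} \<longrightarrow> darts D = {}" using bD by simp
  show "orgcond D"
  proof (rule ext_orgcond_big[OF pD ex EE(3) c])
    fix z assume z: "z \<in> {d, e}"
    have nE: "org D x \<noteq> p" if "x \<in> darts E" for x
      using that pv pmapD(8)[OF pE] ext_opp(5)[OF pD ex that] by metis
    show "(\<exists>x\<in>darts E. x \<in> orbit (rot D) z)
      \<or> (\<forall>x\<in>darts D. org D x = org D z \<longrightarrow> x \<in> orbit (rot D) z)"
    proof (cases "z = d")
      case True
      then show ?thesis using st[of d] nd nE od oe pv extD(1)[OF ex] by auto
    next
      case False
      then have [simp]: "z = e" using z by simp
      show ?thesis
      proof (cases "v = []")
        case True
        then have "darts E = {}" using EE(8) bE by simp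
        then show ?thesis using st[of e] nd od oe pv extD(1)[OF ex] True by auto
      next
        case False
        then have "hd v \<in> darts E" using in_E by auto
        then show ?thesis using st[of e] nd False by auto
      qed
    qed
  qed
qed

end

section \<open>Collapses as removals of an edge\<close>

lemma collapse2E: assumes D: "diagram D" and c: "collapse2 D E"
  obtains d e t v where "removal2 D E d e t v" "diagram E"
proof -
  note DD = diagramD[OF D]
  obtain d where d: "d \<in> bnd D" "opp D d \<notin> bnd D"
    "E = subdiag D (verts D) (darts D - {d, opp D d}) (bnd D \<union> orbit (nxt D) (opp D d) - {d, opp D d})"
    using c by (auto simp: collapse2_def)
  let ?e = "opp D d"
  have dD: "d \<in> darts D" "?e \<in> darts D" using d DD(7) pmapD(3)[OF DD(1)] by auto
  have ex: "ext D E d ?e" unfolding d(3) by (rule subdiag_ext[OF DD(1) dD(1)])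
  have pE: "pmap E"
    by (rule ext_pmap_small[OF DD(1) ex]) (use pmapD(1,8)[OF DD(1)] in \<open>auto simp: d(3) subdiag_def\<close>)
  obtain v where v: "bcyc D (d # v)" using bnd_cycle[OF D d(1)] .
  obtain t where t: "cyc (nxt D) (?e # t)" "set (?e # t) \<subseteq> darts D - bnd D" "orbit (nxt D) ?e = set (?e # t)"
    using nonbnd_cycle[OF DD(1) v dD(2) d(2)] .
  have di: "d \<notin> set v" "?e \<notin> set t" "d \<notin> set t" "?e \<notin> set v" 
    using v t d by (auto simp: bcyc_def cyc_def)
  have r: "removal2 D E d ?e t v"
  proof
    show "pmap D" "pmap E" "ext D E d ?e" by (rule DD(1) pE ex)+
    show "cyc (nxt D) (d # v)" "bnd D = set (d # v)" using v by (auto simp: bcyc_def)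
    show "cyc (nxt D) (?e # t)" by fact
    show "?e \<notin> set v" by fact
    show "bnd E = set (t @ v)" using t(3) v di unfolding d(3) subdiag_def bcyc_def by auto
    show "verts E = verts D" by (simp add: d(3) subdiag_def)
    show "set (d # v) \<subseteq> darts D" using v DD(7) by (auto simp: bcyc_def)
    show "set (?e # t) \<subseteq> darts D" using t(2) by blast
  qed
  then show ?thesis using that removal2.diagram_small[OF r D] by blast
qed

lemma collapse1E: assumes D: "diagram D" and c: "collapse1 D E"
  obtains d e v p where "removal1 D E d e v p" "diagram E"
proof -
  note DD = diagramD[OF D]
  obtain d where d: "d \<in> bnd D" "{x\<in>darts D. org D x = org D d} = {d}"
    "E = subdiag D (verts D - {org D d}) (darts D - {d, opp D d}) (bnd D - {d, opp D d})"
    using c by (auto simp: collapse1_def)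
  let ?e = "opp D d"
  have dD: "d \<in> darts D" "?e \<in> darts D" using d DD(7) pmapD(3)[OF DD(1)] by auto
  have un: "x = d" if "x \<in> darts D" "org D x = org D d" for x using d(2) that by blast
  have ne: "?e \<noteq> d" using pmapD(4)[OF DD(1) dD(1)] .
  \<comment> \<open>The tip carries no other dart, so the rotation fixes \<open>d\<close>. Hence
    \<open>d\<close> directly follows its reverse, and both lie on the boundary circuit.\<close>
  have n: "nxt D ?e = d" using un org_rot[OF D dD(1)] pmapD(9)[OF DD(1) dD(1)] by (simp add: rot_def)
  then have eb: "?e \<in> bnd D" using nxt_bnd[OF D dD(2)] d(1) by simp
  obtain w where w: "bcyc D (?e # w)" using bnd_cycle[OF D eb] .
  have "hd (w @ [?e]) = d" using cyc_next[of "nxt D" "[]" ?e w] w n by (auto simp: bcyc_def)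
  then obtain v where v: "w = d # v" using ne by (cases w) auto
  have ex: "ext D E d ?e" unfolding d(3) by (rule subdiag_ext[OF DD(1) dD(1)])
  have oe: "org D ?e \<noteq> org D d" using un[OF dD(2)] ne by blast
  have pE: "pmap E"
  proof (rule ext_pmap_small[OF DD(1) ex])
    show "finite (verts E)" using pmapD(1)[OF DD(1)] by (simp add: d(3) subdiag_def)
    fix x assume "x \<in> darts E"
    then have "x \<in> darts D" "x \<noteq> d" by (auto simp: d(3) subdiag_def)
    then show "org D x \<in> verts E" using un pmapD(8)[OF DD(1)] by (auto simp: d(3) subdiag_def)
  qed
  have r: "removal1 D E d ?e v (org D d)"
  proof
    show "pmap D" "pmap E" "ext D E d ?e" by (rule DD(1) pE ex)+
    show "cyc (nxt D) (?e # d # v)" "bnd D = set (?e # d # v)" using w v by (auto simp: bcyc_def)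
    have "d \<notin> set v" "?e \<notin> set v" using w v by (auto simp: bcyc_def cyc_def)
    then show "bnd E = set v" using w v unfolding d(3) subdiag_def bcyc_def by auto
    show "verts D = insert (org D d) (verts E)" "org D d \<notin> verts E"
      using pmapD(8)[OF DD(1) dD(1)] by (auto simp: d(3) subdiag_def)
    show "org D d = org D d" ..
    show "org D ?e \<in> verts E" using oe pmapD(8)[OF DD(1) dD(2)] by (simp add: d(3) subdiag_def)
    show "set (?e # d # v) \<subseteq> darts D" using w v DD(7) by (auto simp: bcyc_def)
  qed
  then show ?thesis using that removal1.diagram_small[OF r D] by blast
qed

text \<open>If no 2-cell can be collapsed, the diagram is a tree, and a tree with an edge has a leaf
  different from \<open>s\<close> since its degrees sum to twice the number of edges.\<close>

lemma collapse_exists: assumes D: "diagram D" and ne: "darts D \<noteq> {}" and s: "s \<in> verts D"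
  obtains E where "collapse1 D E \<or> collapse2 D E" "s \<in> verts E"
proof (cases "\<exists>d\<in>bnd D. opp D d \<notin> bnd D")
  case True
  then obtain d where "d \<in> bnd D" "opp D d \<notin> bnd D" by blast
  then have "collapse2 D (subdiag D (verts D) (darts D - {d, opp D d})
                 (bnd D \<union> orbit (nxt D) (opp D d) - {d, opp D d}))"
    unfolding collapse2_def by blast
  then show ?thesis by (rule that[OF disjI2]) (use s in \<open>simp add: subdiag_def\<close>)
next
  case False
  note DD = diagramD[OF D]
  have oc: "opp D d \<in> bnd D" if "d \<in> bnd D" for d using False that by blast
  have rc: "rot D d \<in> bnd D" if "d \<in> bnd D" for d
    using oc[OF that] nxt_bnd[OF D, of "opp D d"] DD(7) by (auto simp: rot_def)
  have orb: "y \<in> bnd D" if "y \<in> orbit (rot D) x" "x \<in> bnd D" for x y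
    using that by induction (auto intro: rc)
  have bn: "bnd D \<noteq> {}" using DD(8) ne by blast
  then obtain b where b: "b \<in> bnd D" by blast
  have step: "x \<in> bnd D" if "x \<in> darts D" "y \<in> bnd D" "org D x = org D y" for x y
  proof -
    have "x \<in> orbit (rot D) y" using DD(3,7) that unfolding orgcond_def by (metis subsetD)
    then show ?thesis using orb that(2) by blast
  qed
  have reach: "u \<in> org D ` bnd D" if "(org D b, u) \<in> (adjacent D)\<^sup>*" for u
    using that
  proof induction
    case base then show ?case using b by blast
  next
    case (step y z)
    then obtain w where w: "w \<in> darts D" "y = org D w" "z = org D (opp D w)" by (auto simp: adjacent_def)
    then have "w \<in> bnd D" using step(3) \<open>\<And>x y. x \<in> darts D \<Longrightarrow> y \<in> bnd D \<Longrightarrow> org D x = org D y \<Longrightarrow> x \<in> bnd D\<close> by blast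
    then show ?case using w oc by blast
  qed
  have vb: "verts D \<subseteq> org D ` bnd D"
    using reach DD(4) b DD(7) pmapD(8)[OF DD(1)] unfolding conn_def by blast
  \<comment> \<open>When no 2-cell can be collapsed, boundary darts are closed under reversal and
    rotation, and connectedness spreads them over all vertices. No cell remains, and Euler's formula
    leaves one more vertex than edges.\<close>
  have all: "darts D = bnd D"
  proof
    show "bnd D \<subseteq> darts D" by (rule DD)
    show "darts D \<subseteq> bnd D"
    proof
      fix x assume x: "x \<in> darts D"
      then have "org D x \<in> org D ` bnd D" using vb pmapD(8)[OF DD(1)] by blast
      then show "x \<in> bnd D" using step[OF x] by auto
    qed
  qed
  obtain l where l: "bcyc D l" using DD(6) by blast
  have "cells D = {}" using cells_eq[OF DD(1) l] all by simp
  then have ve: "card (verts D) = card (edges D) + 1" using DD(5) by (simp add: euler_def)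
  have fin: "finite (darts D)" "finite (verts D)" using pmapD[OF DD(1)] by auto
  have c2: "card (darts D) = 2 * card (edges D)"
  proof -
    have "card (\<Union>(edges D)) = 2 * card (edges D)"
    proof (rule card_partition[symmetric])
      show "finite (edges D)" "finite (\<Union> (edges D))" using fin pmapD(3)[OF DD(1)] by (auto simp: edges_def)
      show "card c = 2" if "c \<in> edges D" for c
        using that pmapD(4)[OF DD(1)] by (auto simp: edges_def card_2_iff)
      show "c1 \<inter> c2 = {}" if cc: "c1 \<in> edges D" "c2 \<in> edges D" "c1 \<noteq> c2" for c1 c2
      proof -
        obtain a b where ab: "a \<in> darts D" "b \<in> darts D" "c1 = {a, opp D a}" "c2 = {b, opp D b}"
          using cc(1,2) by (auto simp: edges_def)
        moreover have "opp D a = opp D b \<longleftrightarrow> a = b"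
          using pmapD(5)[OF DD(1) ab(1)] pmapD(5)[OF DD(1) ab(2)] by metis
        ultimately show ?thesis using cc(3) pmapD(5)[OF DD(1) ab(1)] pmapD(5)[OF DD(1) ab(2)] by auto
      qed
    qed
    moreover have "\<Union>(edges D) = darts D" using pmapD(3)[OF DD(1)] by (auto simp: edges_def)
    ultimately show ?thesis by simp
  qed
  let ?deg = "\<lambda>u. card {x\<in>darts D. org D x = u}"
  have sum: "(\<Sum>u\<in>verts D. ?deg u) = card (darts D)"
    using sum.group[of "darts D" "verts D" "org D" "\<lambda>_. 1::nat"] fin pmapD(8)[OF DD(1)] by auto
  have pos: "?deg u \<ge> 1" if "u \<in> verts D" for u
  proof -
    have "{x\<in>darts D. org D x = u} \<noteq> {}" using vb that all by auto
    then show ?thesis using fin by (simp add: Suc_leI card_gt_0_iff)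
  qed
  \<comment> \<open>Otherwise the degrees, at least one at \<open>s\<close> and at least two
    elsewhere, would sum to at least twice the number of vertices minus one, which exceeds twice the
    number of edges.\<close>
  have "\<exists>u\<in>verts D - {s}. ?deg u \<le> 1"
  proof (rule ccontr)
    assume "\<not> ?thesis"
    then have "?deg u \<ge> 2" if "u \<in> verts D - {s}" for u using that by force
    then have "(\<Sum>u\<in>verts D - {s}. ?deg u) \<ge> (\<Sum>u\<in>verts D - {s}. 2)" by (rule sum_mono)
    then have "(\<Sum>u\<in>verts D. ?deg u) \<ge> 1 + 2 * (card (verts D) - 1)"
      using pos[OF s] s fin by (simp add: sum.remove[of "verts D" s])
    then show False using sum c2 ve by simp
  qed
  then obtain u where u: "u \<in> verts D" "u \<noteq> s" "?deg u = 1" using pos by force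
  then obtain d where d: "{x\<in>darts D. org D x = u} = {d}" using card_1_singletonE by blast
  then have dd: "d \<in> bnd D" "org D d = u" using all by auto
  then have "collapse1 D (subdiag D (verts D - {org D d}) (darts D - {d, opp D d}) (bnd D - {d, opp D d}))"
    using d unfolding collapse1_def by blast
  then show ?thesis by (rule that[OF disjI1]) (use s u dd in \<open>simp add: subdiag_def\<close>)
qed

lemma collapse_diagram: assumes "diagram D" "collapse1 D E \<or> collapse2 D E"
  shows "diagram E" "card (darts E) < card (darts D)"
proof -
  have "diagram E \<and> (\<exists>d e. ext D E d e)"
    using assms collapse1E[OF assms(1)] collapse2E[OF assms(1)] edge_removal.ex
    by (metis removal1_def removal2_def)
  then obtain d e where e: "diagram E" "ext D E d e" by blast
  then show "diagram E" by simp
  have "finite (darts E)" using pmapD(2)[OF diagramD(1)[OF e(1)]] .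
  then show "card (darts E) < card (darts D)" using extD[OF e(2)] by simp
qed

section \<open>Closed boundary walks enclose subdiagrams\<close>

text \<open>Closure under crossing an edge and under walking around a 2-cell, but not under walking
  along the boundary. Such sets are unions of the pieces into which the diagram falls when it is
  taken apart at its cut vertices.\<close>

definition closed_darts :: "diag \<Rightarrow> nat set \<Rightarrow> bool" where
  "closed_darts D K \<longleftrightarrow> (\<forall>d\<in>darts D. (opp D d \<in> K \<longleftrightarrow> d \<in> K) \<and> (d \<notin> bnd D \<longrightarrow> (nxt D d \<in> K \<longleftrightarrow> d \<in> K)))"

lemma closed_opp: "closed_darts D K \<Longrightarrow> d \<in> darts D \<Longrightarrow> opp D d \<in> K \<longleftrightarrow> d \<in> K"
  by (simp add: closed_darts_def)

lemma closed_nxt: "closed_darts D K \<Longrightarrow> d \<in> darts D \<Longrightarrow> d \<notin> bnd D \<Longrightarrow> nxt D d \<in> K \<longleftrightarrow> d \<in> K"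
  by (simp add: closed_darts_def)

lemma closed_darts_compl: "closed_darts D K \<Longrightarrow> closed_darts D (- K)"
  by (auto simp: closed_darts_def)

lemma closed_darts_Int: "closed_darts D K \<Longrightarrow> closed_darts D L \<Longrightarrow> closed_darts D (K \<inter> L)"
  by (auto simp: closed_darts_def)

lemma bcyc_unique: "bcyc D (x # l) \<Longrightarrow> bcyc D (x # m) \<Longrightarrow> l = m"
  using cyc_unique unfolding bcyc_def by metis

context removal2
begin

text \<open>The added cell has to lie in the set as a whole, so its other edges \<open>t\<close>
  must already belong to \<open>K\<close>.\<close>

lemma closed_big: assumes K: "closed_darts E K" "set t \<subseteq> K"
  shows "closed_darts D (insert d (insert e (K \<inter> darts E)))" (is "closed_darts D ?K")
  unfolding closed_darts_def
proof (intro ballI)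
  fix x assume xD: "x \<in> darts D"
  have dE: "d \<notin> darts E" "e \<notin> darts E" using extD[OF ex] by auto
  consider "x = d" | "x = e" | "x \<in> darts E" "x \<notin> set t" | "x \<in> set t" using xD extD(1)[OF ex] by blast
  then show "(opp D x \<in> ?K \<longleftrightarrow> x \<in> ?K) \<and> (x \<notin> bnd D \<longrightarrow> (nxt D x \<in> ?K \<longleftrightarrow> x \<in> ?K))"
  proof cases
    case 1 then show ?thesis using extD(5)[OF ex] bD by simp
  next
    case 2
    have "nxt D e \<in> set (e # t)" using cyc_in[OF ce] by simp
    then show ?thesis using 2 extD(6)[OF ex] K(2) in_E by auto
  next
    case 3
    have o: "opp D x \<in> ?K \<longleftrightarrow> x \<in> ?K"
      using ext_opp(1,4)[OF pD ex 3(1)] closed_opp[OF K(1) 3(1)] 3(1) dE by auto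
    have "nxt D x \<in> ?K \<longleftrightarrow> x \<in> ?K" if "x \<notin> bnd D"
    proof -
      have x: "x \<in> darts E - bnd E" using 3 that bD bE by auto
      obtain l where l: "cyc (nxt D) (x # l)" "cyc (nxt E) (x # l)" "set (x # l) \<subseteq> darts E - bnd E"
        using other[OF x] by metis
      have "nxt D x \<in> set (x # l)" "nxt E x \<in> set (x # l)" using cyc_in[OF l(1)] cyc_in[OF l(2)] by auto
      then have "nxt D x \<in> darts E" using l(3) by blast
      moreover from this have "nxt E x = nxt D x" using ext_nxt(1)[OF pD ex 3(1)] by simp
      moreover have "x \<in> darts E" "x \<notin> bnd E" using x by auto
      ultimately show ?thesis using closed_nxt[OF K(1), of x] dE by auto
    qed
    then show ?thesis using o by simp
  next
    case 4
    then have xE: "x \<in> darts E" using in_E by blast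
    have "nxt D x \<in> set (e # t)" using cyc_in[OF ce] 4 by simp
    then have "nxt D x \<in> ?K" using K(2) in_E by auto
    moreover have "opp D x \<in> ?K \<longleftrightarrow> x \<in> ?K"
      using ext_opp(1,4)[OF pD ex xE] closed_opp[OF K(1) xE] xE dE by auto
    ultimately show ?thesis using 4 K(2) xE by auto
  qed
qed

end

context removal1
begin

lemma closed_big: assumes K: "closed_darts E K"
  shows "closed_darts D (insert d (insert e (K \<inter> darts E)))" (is "closed_darts D ?K")
  unfolding closed_darts_def
proof (intro ballI)
  fix x assume xD: "x \<in> darts D"
  have dE: "d \<notin> darts E" "e \<notin> darts E" using extD[OF ex] by auto
  consider "x = d" | "x = e" | "x \<in> darts E" using xD extD(1)[OF ex] by blast
  then show "(opp D x \<in> ?K \<longleftrightarrow> x \<in> ?K) \<and> (x \<notin> bnd D \<longrightarrow> (nxt D x \<in> ?K \<longleftrightarrow> x \<in> ?K))"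
  proof cases
    case 3
    have o: "opp D x \<in> ?K \<longleftrightarrow> x \<in> ?K"
      using ext_opp(1,4)[OF pD ex 3(1)] closed_opp[OF K(1) 3(1)] 3(1) dE by auto
    have "nxt D x \<in> ?K \<longleftrightarrow> x \<in> ?K" if "x \<notin> bnd D"
    proof -
      have x: "x \<in> darts D" "x \<notin> bnd D" using xD that by auto
      obtain l where l: "cyc (nxt D) (x # l)" "set (x # l) \<subseteq> darts D - bnd D"
        using nonbnd_cycle[OF pD bcycs(1) x] by metis
      then have "nxt D x \<in> darts E" using cyc_in[OF l(1), of x] nonbnd_D by auto
      moreover from this have "nxt E x = nxt D x" using ext_nxt(1)[OF pD ex 3(1)] by simp
      moreover have "x \<notin> bnd E" using that bD bE by auto
      ultimately show ?thesis using closed_nxt[OF K(1), of x] dE 3(1) by auto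
    qed
    then show ?thesis using o by simp
  qed (use extD(5,6)[OF ex] bD in simp_all)
qed

end

definition encloses :: "diag \<Rightarrow> nat list \<Rightarrow> bool" where
  "encloses D s \<longleftrightarrow> (\<exists>K. closed_darts D K \<and> K \<inter> bnd D = set s)"

lemma encloses_compl: assumes "bcyc D (s @ u)" "encloses D u" shows "encloses D s"
proof -
  obtain K where K: "closed_darts D K" "K \<inter> bnd D = set u" using assms(2) by (auto simp: encloses_def)
  have "- K \<inter> bnd D = set s" using K(2) assms(1) by (auto simp: bcyc_def cyc_def)
  then show ?thesis using closed_darts_compl[OF K(1)] unfolding encloses_def by blast
qed

text \<open>A combinatorial substitute for the Jordan curve theorem: the stretch of the boundary
  walk between two visits to the same vertex is exactly what some union of pieces of the diagram
  sees of the boundary.\<close>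

definition enclosing :: "diag \<Rightarrow> bool" where
  "enclosing D \<longleftrightarrow> (\<forall>s u. bcyc D (s @ u) \<longrightarrow> s \<noteq> [] \<longrightarrow> u \<noteq> [] \<longrightarrow> org D (hd s) = org D (hd u) \<longrightarrow> encloses D s)"

text \<open>The two loops into which the circuit is cut have complementary enclosures, so only the
  one through a chosen dart \<open>d\<close> needs treatment.\<close>

lemma enclosingI:
  assumes "d \<in> bnd D" and main: "\<And>s u. bcyc D (s @ u) \<Longrightarrow> s \<noteq> [] \<Longrightarrow> u \<noteq> []
    \<Longrightarrow> org D (hd s) = org D (hd u) \<Longrightarrow> d \<in> set s \<Longrightarrow> encloses D s"
  shows "enclosing D"
  unfolding enclosing_def
proof (intro allI impI)
  fix s u assume a: "bcyc D (s @ u)" "s \<noteq> []" "u \<noteq> []" "org D (hd s) = org D (hd u)"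
  have "d \<in> set s \<or> d \<in> set u" using a(1) assms(1) by (auto simp: bcyc_def)
  then show "encloses D s"
  proof
    assume "d \<in> set u"
    then have "encloses D u" using main[of u s] bcyc_rotate[OF a(1)] a by simp
    then show ?thesis using encloses_compl a(1) by blast
  qed (use main a in blast)
qed

lemma (in removal2) hd_org: assumes "diagram D" "v = s2 @ r" "t @ s2 \<noteq> []" shows "org D (hd (t @ s2)) = org D d"
proof -
  have nd: "nxt D e = hd (t @ [e])" "nxt D d = hd (v @ [d])"
    using cyc_next[of "nxt D" "[]" e t] cyc_next[of "nxt D" "[]" d v] ce cd by auto
  have dD: "d \<in> darts D" "e \<in> darts D" using sD by auto
  have ot: "org D (hd (t @ [e])) = org D d"
    using org_nxt[OF assms(1) dD(2)] nd extD(6)[OF ex] by simp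
  have ov: "org D (hd (v @ [d])) = org D e"
    using org_nxt[OF assms(1) dD(1)] nd extD(5)[OF ex] by simp
  show ?thesis
  proof (cases "t = []")
    case t: True
    then have "hd (t @ s2) = hd (v @ [d])" using assms by simp
    moreover have "org D e = org D d" using ot t by simp
    ultimately show ?thesis using ov by simp
  next
    case t: False
    then show ?thesis using ot by simp
  qed
qed

text \<open>Replacing \<open>d\<close> by \<open>t\<close> turns a loop of \<open>D\<close> into a
  loop of \<open>E\<close> with the same base point. The set it encloses contains \<open>t\<close>,
  so the cell and the edge of \<open>d\<close> can be added to it.\<close>

lemma (in removal2) enclosing_big: assumes D: "diagram D" and E: "enclosing E" shows "enclosing D"
proof -
  have main: "encloses D s"
    if b: "bcyc D (s @ u)" and ne: "s \<noteq> []" "u \<noteq> []" and o: "org D (hd s) = org D (hd u)" and ds: "d \<in> set s" for s u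
  proof -
    obtain s1 s2 where s: "s = s1 @ d # s2" using ds by (meson split_list)
    have "bcyc D (d # s2 @ u @ s1)" using bcyc_rotate[of D s1 "d # s2 @ u"] b s by simp
    then have v: "v = s2 @ u @ s1" using bcyc_unique bcycs(1) by blast
    have bE': "bcyc E ((s1 @ t @ s2) @ u)"
      using bcyc_rotate[of E "t @ s2 @ u" s1] bcycs(2) v by simp
    have "\<exists>K. closed_darts E K \<and> K \<inter> bnd E = set (s1 @ t @ s2)"
    proof (cases "s1 @ t @ s2 = []")
      case True
      then show ?thesis by (intro exI[of _ "{}"]) (auto simp: closed_darts_def)
    next
      case False
      have "org D (hd (s1 @ t @ s2)) = org D (hd s)"
      proof (cases "s1 = []")
        case True
        then show ?thesis using hd_org[OF D v] False s by simp
      qed (use s in simp)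
      moreover have "hd (s1 @ t @ s2) \<in> darts E" "hd u \<in> darts E"
      proof -
        have "set (s1 @ t @ s2) \<subseteq> darts E" "set u \<subseteq> darts E" using in_E v by auto
        then show "hd (s1 @ t @ s2) \<in> darts E" "hd u \<in> darts E"
          using hd_in_set[OF False] hd_in_set[OF ne(2)] by (simp_all only: subset_iff)
      qed
      ultimately have "org E (hd (s1 @ t @ s2)) = org E (hd u)"
        using o ext_opp(5)[OF pD ex] by simp
      then show ?thesis using E bE' False ne unfolding enclosing_def encloses_def by blast
    qed
    then obtain K where K: "closed_darts E K" "K \<inter> bnd E = set (s1 @ t @ s2)" by blast
    have tK: "set t \<subseteq> K" using K(2) by auto
    have "insert d (insert e (K \<inter> darts E)) \<inter> bnd D = set s"
    proof -
      have "e \<notin> bnd D" using bD ed extD(2)[OF ex] by auto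
      moreover have "set t \<inter> bnd D = {}" using disj bD by auto
      ultimately show ?thesis using K(2) in_E unfolding bD bE v s by auto
    qed
    then show ?thesis using closed_big[OF K(1) tK] unfolding encloses_def by blast
  qed
  show ?thesis by (rule enclosingI[OF _ main, of d]) (simp_all add: bD)
qed

lemma (in removal1) enclosing_big: assumes D: "diagram D" and E: "enclosing E" shows "enclosing D"
proof -
  have oE: "org D x \<noteq> p" if "x \<in> darts E" for x
    using that pv pmapD(8)[OF pE] ext_opp(5)[OF pD ex that] by metis
  have oD: "x = d" if "x \<in> darts D" "org D x = p" for x
    using that oE oe pv extD(1)[OF ex] by auto
  have main: "encloses D s"
    if b: "bcyc D (s @ u)" and ne: "s \<noteq> []" "u \<noteq> []" and o: "org D (hd s) = org D (hd u)" and ds: "d \<in> set s" for s u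
  proof -
    have su: "set (s @ u) \<subseteq> darts D" "distinct (s @ u)" using b bD sD by (auto simp: bcyc_def cyc_def)
    obtain s1 s2 where s: "s = s1 @ d # s2" using ds by (meson split_list)
    \<comment> \<open>A loop starting at the tip would need a second dart that leaves it, but
      \<open>d\<close> is the only one. So the loop contains both darts of the spike, and deleting
      them leaves a loop of \<open>E\<close>.\<close>
    have "s1 \<noteq> []"
    proof
      assume "s1 = []"
      then have "org D (hd u) = p" using o s od by simp
      moreover have "hd u \<in> set u" using ne by simp
      ultimately have "hd u = d" using oD su by auto
      then show False using su ds \<open>hd u \<in> set u\<close> by auto
    qed
    then obtain s0 e' where s1: "s1 = s0 @ [e']" by (cases s1 rule: rev_cases) auto
    have b': "bcyc D (e' # d # s2 @ u @ s0)" using bcyc_rotate[of D s0 "e' # d # s2 @ u"] b s s1 by simp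
    have "nxt D e' = d" "nxt D e = d"
      using b' cd cyc_next[of "nxt D" "[]" e' "d # s2 @ u @ s0"] cyc_next[of "nxt D" "[]" e "d # v"]
      by (auto simp: bcyc_def)
    moreover have "e' \<in> darts D" "e \<in> darts D" using su s s1 sD by auto
    ultimately have [simp]: "e' = e" using pmapD(7)[OF pD] by (auto dest: inj_onD)
    have v: "v = s2 @ u @ s0" using bcyc_unique[OF bcycs(1)] b' by auto
    have bE': "bcyc E ((s0 @ s2) @ u)"
      using bcyc_rotate[of E "s2 @ u" s0] bcycs(2) v by simp
    have "\<exists>K. closed_darts E K \<and> K \<inter> bnd E = set (s0 @ s2)"
    proof (cases "s0 @ s2 = []")
      case True
      then show ?thesis by (intro exI[of _ "{}"]) (auto simp: closed_darts_def)
    next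
      case False
      have "org D (hd (s0 @ s2)) = org D (hd s)"
      proof (cases "s0 = []")
        case True
        have "nxt D d = hd (v @ [e])" using cyc_next[of "nxt D" "[e]" d v] cd by (cases v) auto
        then have "org D (hd (v @ [e])) = org D e"
          using org_nxt[OF D, of d] sD extD(5)[OF ex] by simp
        then show ?thesis using False True s s1 v by auto
      qed (use s s1 in simp)
      moreover have "hd (s0 @ s2) \<in> darts E" "hd u \<in> darts E"
      proof -
        have "set (s0 @ s2) \<subseteq> darts E" "set u \<subseteq> darts E" using in_E v by auto
        then show "hd (s0 @ s2) \<in> darts E" "hd u \<in> darts E"
          using hd_in_set[OF False] hd_in_set[OF ne(2)] by (simp_all only: subset_iff)
      qed
      ultimately have "org E (hd (s0 @ s2)) = org E (hd u)"
        using o ext_opp(5)[OF pD ex] by simp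
      then show ?thesis using E bE' False ne unfolding enclosing_def encloses_def by blast
    qed
    then obtain K where K: "closed_darts E K" "K \<inter> bnd E = set (s0 @ s2)" by blast
    have "insert d (insert e (K \<inter> darts E)) \<inter> bnd D = set s"
      using K(2) in_E unfolding bD bE v s s1 by auto
    then show ?thesis using closed_big[OF K(1)] unfolding encloses_def by blast
  qed
  show ?thesis by (rule enclosingI[OF _ main, of d]) (simp_all add: bD)
qed

text \<open>Every diagram with an edge collapses to a smaller diagram, and the property passes back
  to the larger one; in the single vertex there is no loop to consider.\<close>

lemma diagram_enclosing: "diagram D \<Longrightarrow> enclosing D"
proof (induction "card (darts D)" arbitrary: D rule: less_induct)
  case less
  note DD = diagramD[OF less.prems]
  show ?case
  proof (cases "darts D = {}")
    case True
    then have "s = []" if "bcyc D (s @ u)" for s u using that DD(7) by (auto simp: bcyc_def)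
    then show ?thesis unfolding enclosing_def by blast
  next
    case False
    obtain s where "s \<in> verts D" using DD(2) by blast
    then obtain E where E: "collapse1 D E \<or> collapse2 D E"
      using collapse_exists[OF less.prems False] by metis
    have e: "enclosing E" using less.hyps collapse_diagram[OF less.prems E] by blast
    from E show ?thesis
    proof
      assume "collapse1 D E"
      then obtain d e v p where "removal1 D E d e v p" using collapse1E[OF less.prems] by metis
      then show ?thesis using removal1.enclosing_big less.prems e by blast
    next
      assume "collapse2 D E"
      then obtain d e t v where "removal2 D E d e t v" using collapse2E[OF less.prems] by metis
      then show ?thesis using removal2.enclosing_big less.prems e by blast
    qed
  qed
qed

section \<open>Shellings of disjoint unions of diagrams\<close>

definition total_perim :: "diag multiset \<Rightarrow> nat" where
  "total_perim X = (\<Sum>D\<in>#X. perim D)"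

definition admissible :: "nat set \<Rightarrow> nat \<Rightarrow> diag multiset \<Rightarrow> bool" where
  "admissible b L X \<longleftrightarrow> (\<forall>D\<in>#X. diagram D \<and> b \<subseteq> verts D) \<and> total_perim X \<le> L"

text \<open>All three kinds of shelling at once: \<open>b\<close> is \<open>{s}\<close> for a base
  vertex \<open>s\<close> and empty otherwise, and \<open>fr\<close> permits fragmentation. Only
  shelling moves are counted by \<open>n\<close>, as they correspond to applications of elementary
  steps to words.\<close>

inductive shellable :: "bool \<Rightarrow> nat set \<Rightarrow> nat \<Rightarrow> nat \<Rightarrow> diag multiset \<Rightarrow> bool" for fr b L where
  vertices: "admissible b L X \<Longrightarrow> \<forall>D\<in>#X. single_vertex D \<Longrightarrow> shellable fr b L 0 X"
| shell: "admissible b L (add_mset D X) \<Longrightarrow> shelling_move D D' \<Longrightarrow> shellable fr b L n (add_mset D' X)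
    \<Longrightarrow> shellable fr b L (Suc n) (add_mset D X)"
| frag: "fr \<Longrightarrow> admissible b L (add_mset D X) \<Longrightarrow> fragment D D1 D2
    \<Longrightarrow> shellable fr b L n (add_mset D1 (add_mset D2 X)) \<Longrightarrow> shellable fr b L n (add_mset D X)"

lemma shellable_admissible: "shellable fr b L n X \<Longrightarrow> admissible b L X"
  by (induction rule: shellable.induct) auto

section \<open>Diagrams up to vertex names and irrelevant values\<close>

lemma orbit_agree: assumes "\<And>x. x \<in> S \<Longrightarrow> f x = g x" "\<And>x. x \<in> S \<Longrightarrow> f x \<in> S" "y \<in> S"
  shows "orbit f y = orbit g y"
proof -
  have "(f ^^ n) y \<in> S \<and> (g ^^ n) y = (f ^^ n) y" for n
    using assms by (induction n) auto
  then have "(g ^^ n) y = (f ^^ n) y" for n by blast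
  then show ?thesis unfolding orbit_altdef by presburger
qed

lemma first_return_agree: assumes "\<And>x. x \<in> S \<Longrightarrow> f x = g x" "\<And>x. x \<in> S \<Longrightarrow> f x \<in> S" "y \<in> S"
  shows "first_return A f y = first_return A g y"
proof -
  have "(f ^^ n) y \<in> S \<and> (g ^^ n) y = (f ^^ n) y" for n
    using assms by (induction n) auto
  then have "(g ^^ n) y = (f ^^ n) y" for n by blast
  then show ?thesis unfolding first_return_def by presburger
qed

definition veq_via :: "nat set \<Rightarrow> (nat \<Rightarrow> nat) \<Rightarrow> diag \<Rightarrow> diag \<Rightarrow> bool" where
  "veq_via b \<phi> D E \<longleftrightarrow> darts E = darts D \<and> bnd E = bnd D \<and> inj_on \<phi> (verts D) \<and> verts E = \<phi> ` verts D
    \<and> (\<forall>s\<in>b. \<phi> s = s)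
    \<and> (\<forall>x\<in>darts D. opp E x = opp D x \<and> nxt E x = nxt D x \<and> org E x = \<phi> (org D x))"

text \<open>The functions of a diagram matter only on its darts, and vertex names outside of \<open>b\<close> do
  not matter at all.\<close>

definition veq :: "nat set \<Rightarrow> diag \<Rightarrow> diag \<Rightarrow> bool" where
  "veq b D E \<longleftrightarrow> (\<exists>\<phi>. veq_via b \<phi> D E)"

lemma veq_refl: "veq b D D"
  unfolding veq_def veq_via_def by (rule exI[of _ id]) simp

lemma veq_viaD: assumes "veq_via b \<phi> D E"
  shows "darts E = darts D" "bnd E = bnd D" "inj_on \<phi> (verts D)" "verts E = \<phi> ` verts D"
    "s \<in> b \<Longrightarrow> \<phi> s = s" "x \<in> darts D \<Longrightarrow> opp E x = opp D x" "x \<in> darts D \<Longrightarrow> nxt E x = nxt D x"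
    "x \<in> darts D \<Longrightarrow> org E x = \<phi> (org D x)"
  using assms unfolding veq_via_def by blast+

lemma veq_nxt_orbit: assumes "pmap D" "veq_via b \<phi> D E" "x \<in> darts D"
  shows "orbit (nxt E) x = orbit (nxt D) x"
  by (rule orbit_agree[of "darts D", symmetric]) (use assms veq_viaD(7) pmapD(6) in auto)

lemma veq_rot: assumes "pmap D" "veq_via b \<phi> D E" "x \<in> darts D"
  shows "rot E x = rot D x"
  using veq_viaD(6,7)[OF assms(2)] pmapD(3)[OF assms(1)] assms(3) by (simp add: rot_def)

lemma veq_rot_orbit: assumes "pmap D" "veq_via b \<phi> D E" "x \<in> darts D"
  shows "orbit (rot E) x = orbit (rot D) x"
  by (rule orbit_agree[of "darts D", symmetric]) (use assms veq_rot[OF assms(1,2)] pmapD(9)[OF assms(1)] in auto)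

lemma veq_diagram: assumes D: "diagram D" and v: "veq_via b \<phi> D E" shows "diagram E"
proof -
  note DD = diagramD[OF D] and v' = veq_viaD[OF v]
  note p = pmapD[OF DD(1)]
  have "pmap E"
    using p v' bij_betw_cong[of "darts D" "nxt E" "nxt D" "darts D"] DD(1)
    unfolding pmap_def by auto
  moreover have "orgcond E"
    unfolding orgcond_def v'(1)
  proof (intro ballI)
    fix x y assume xy: "x \<in> darts D" "y \<in> darts D"
    have "org E x = org E y \<longleftrightarrow> org D x = org D y"
      using v'(3,8) xy p(8) by (auto simp: inj_on_eq_iff)
    then show "org E x = org E y \<longleftrightarrow> y \<in> orbit (rot E) x"
      using DD(3) xy veq_rot_orbit[OF DD(1) v xy(1)] by (simp add: orgcond_def)
  qed
  moreover have "conn E"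
  proof -
    have adj: "adjacent E = (\<lambda>(u, w). (\<phi> u, \<phi> w)) ` adjacent D"
      using v' p(3) by (auto simp: adjacent_def image_image)
    have "(\<phi> a, \<phi> c) \<in> (adjacent E)\<^sup>*" if "(a, c) \<in> (adjacent D)\<^sup>*" for a c
      using that
    proof induction
      case (step y z)
      have "(\<phi> y, \<phi> z) \<in> adjacent E" using step(2) unfolding adj by force
      then show ?case using step by simp
    qed simp
    then show ?thesis using DD(4) v'(4) by (auto simp: conn_def)
  qed
  moreover have reg: "regions E = regions D"
    using veq_nxt_orbit[OF DD(1) v] v'(1) by (simp add: regions_def)
  moreover have "edges E = edges D" using v'(1,6) by (simp add: edges_def)
  moreover have "card (verts E) = card (verts D)" using v'(3,4) by (simp add: card_image)
  moreover have "\<exists>l. bcyc E l"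
  proof -
    obtain l where l: "bcyc D l" using DD(6) by blast
    then have "cyc (nxt E) l"
      using cyc_cong[of "nxt D" l "nxt E"] v'(7) DD(7) by (metis bcyc_def subsetD)
    then show ?thesis using l v'(2) by (auto simp: bcyc_def)
  qed
  ultimately show ?thesis using DD v'(1,2,4) unfolding diagram_iff
    by (auto simp: euler_def cells_def)
qed

lemma veq_subdiag: assumes "pmap D" "veq_via b \<phi> D E" "A \<subseteq> darts D" "V \<subseteq> verts D"
  shows "veq_via b \<phi> (subdiag D V A B) (subdiag E (\<phi> ` V) A B)"
proof -
  note v' = veq_viaD[OF assms(2)]
  have "first_return A (rot E) (opp E x) = first_return A (rot D) (opp D x)" if "x \<in> A" for x
  proof -
    have x: "x \<in> darts D" using that assms(3) by blast
    have "first_return A (rot E) (opp D x) = first_return A (rot D) (opp D x)"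
      by (rule first_return_agree[of "darts D", symmetric])
        (use veq_rot[OF assms(1,2)] pmapD(3,9)[OF assms(1)] x in auto)
    then show ?thesis using v'(6)[OF x] by simp
  qed
  moreover have "inj_on \<phi> V" using v'(3) assms(4) by (rule inj_on_subset)
  moreover have "x \<in> darts D" if "x \<in> A" for x using that assms(3) by blast
  ultimately show ?thesis using v'(5,6,8) unfolding veq_via_def subdiag_def by simp
qed

lemma collapse1_veq: assumes D: "diagram D" and v: "veq_via b \<phi> D E" and c: "collapse1 D D'"
  shows "\<exists>E'. collapse1 E E' \<and> veq b D' E'"
proof -
  note DD = diagramD[OF D] and v' = veq_viaD[OF v] note p = pmapD[OF DD(1)]
  obtain d where d: "d \<in> bnd D" "{x\<in>darts D. org D x = org D d} = {d}"
    "D' = subdiag D (verts D - {org D d}) (darts D - {d, opp D d}) (bnd D - {d, opp D d})"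
    using c by (auto simp: collapse1_def)
  have dD: "d \<in> darts D" using d(1) DD(7) by blast
  let ?E = "subdiag E (verts E - {org E d}) (darts E - {d, opp E d}) (bnd E - {d, opp E d})"
  have "org E x = org E d \<longleftrightarrow> org D x = org D d" if "x \<in> darts D" for x
    using v'(3,8) that dD p(8) by (auto simp: inj_on_eq_iff)
  then have "{x\<in>darts E. org E x = org E d} = {d}" using d(2) v'(1) by auto
  then have "collapse1 E ?E" using d(1) v'(2) unfolding collapse1_def by blast
  moreover have "verts E - {org E d} = \<phi> ` (verts D - {org D d})"
    using v'(3,4,8) dD p(8) by (auto simp: inj_on_eq_iff)
  then have "veq_via b \<phi> D' ?E"
    using veq_subdiag[OF DD(1) v, of "darts D - {d, opp D d}" "verts D - {org D d}" "bnd D - {d, opp D d}"]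
      v'(1,2) v'(6)[OF dD] d(3) by simp
  ultimately show ?thesis unfolding veq_def by blast
qed

lemma collapse2_veq: assumes D: "diagram D" and v: "veq_via b \<phi> D E" and c: "collapse2 D D'"
  shows "\<exists>E'. collapse2 E E' \<and> veq b D' E'"
proof -
  note DD = diagramD[OF D] and v' = veq_viaD[OF v] note p = pmapD[OF DD(1)]
  obtain d where d: "d \<in> bnd D" "opp D d \<notin> bnd D"
    "D' = subdiag D (verts D) (darts D - {d, opp D d}) (bnd D \<union> orbit (nxt D) (opp D d) - {d, opp D d})"
    using c by (auto simp: collapse2_def)
  have dD: "d \<in> darts D" using d(1) DD(7) by blast
  let ?E = "subdiag E (verts E) (darts E - {d, opp E d}) (bnd E \<union> orbit (nxt E) (opp E d) - {d, opp E d})"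
  have "collapse2 E ?E" using d(1,2) v'(2) v'(6)[OF dD] unfolding collapse2_def by metis
  moreover have "veq_via b \<phi> D' ?E"
    using veq_subdiag[OF DD(1) v, of "darts D - {d, opp D d}" "verts D" 
        "bnd D \<union> orbit (nxt D) (opp D d) - {d, opp D d}"]
      v'(1,2,4) v'(6)[OF dD] veq_nxt_orbit[OF DD(1) v p(3)[OF dD]] d(3) by simp
  ultimately show ?thesis unfolding veq_def by blast
qed

lemma expand1_veq: assumes D: "diagram D" and v: "veq_via b \<phi> D E" and b: "b \<subseteq> verts D" and c: "expand1 D D'"
  shows "\<exists>E'. expand1 E E' \<and> veq b D' E'"
proof -
  note DD = diagramD[OF D] and v' = veq_viaD[OF v] note p' = pmapD[OF DD(1)]
  obtain d p w g h y where d: "d \<in> darts D" "p \<in> bnd D" "y \<in> {g, nxt D p}" "org D (nxt D p) = org D d"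
    "w \<notin> verts D" "g \<notin> darts D" "h \<notin> darts D" "g \<noteq> h"
    and D': "D' = (let opp' = (opp D)(d := h, h := d, opp D d := g, g := opp D d);
            nxt' = (nxt D)(p := g, g := h, h := nxt D p);
            org' = (org D)(g := org D d, h := org D (opp D d))
        in \<lparr>verts = insert w (verts D), darts = darts D \<union> {g, h}, opp = opp',
                 org = (\<lambda>x. if x \<in> orbit (\<lambda>z. nxt' (opp' z)) y then w else org' x),
                 nxt = nxt', bnd = bnd D \<union> {g, h}\<rparr>)"
    using c unfolding expand1_def Let_def by blast
  \<comment> \<open>The name of the new vertex in the given expansion may be taken in
    \<open>E\<close>. Another one is picked, and the renaming is extended to match them.\<close>
  obtain w' where w': "w' \<notin> verts E"
    using ex_new_if_finite[of "verts E"] v'(4) p'(1) by auto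
  let ?S = "darts D \<union> {g, h}"
  define oD where "oD = (opp D)(d := h, h := d, opp D d := g, g := opp D d)"
  define oE where "oE = (opp E)(d := h, h := d, opp E d := g, g := opp E d)"
  define nD where "nD = (nxt D)(p := g, g := h, h := nxt D p)"
  define nE where "nE = (nxt E)(p := g, g := h, h := nxt E p)"
  define gD where "gD = (org D)(g := org D d, h := org D (opp D d))"
  define gE where "gE = (org E)(g := org E d, h := org E (opp E d))"
  define E' where "E' = \<lparr>verts = insert w' (verts E), darts = darts E \<union> {g, h}, opp = oE,
                 org = (\<lambda>x. if x \<in> orbit (\<lambda>z. nE (oE z)) y then w' else gE x),
                 nxt = nE, bnd = bnd E \<union> {g, h}\<rparr>"
  have pD: "p \<in> darts D" "nxt D p \<in> darts D" using d(2) DD(7) p'(6) by auto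
  have "expand1 E E'"
    unfolding expand1_def
  proof (intro bexI exI conjI)
    show "org E (nxt E p) = org E d" using v'(7)[OF pD(1)] v'(8) pD d(1,4) by simp
    show "w' \<notin> verts E" by fact
    show "g \<notin> darts E" "h \<notin> darts E" "g \<noteq> h" "d \<in> darts E" "p \<in> bnd E" "y \<in> {g, nxt E p}"
      using d v'(1,2) v'(7)[OF pD(1)] by auto
    show "let opp' = (opp E)(d := h, h := d, opp E d := g, g := opp E d);
            nxt' = (nxt E)(p := g, g := h, h := nxt E p);
            org' = (org E)(g := org E d, h := org E (opp E d))
        in E' = \<lparr>verts = insert w' (verts E), darts = darts E \<union> {g, h}, opp = opp',
                 org = (\<lambda>x. if x \<in> orbit (\<lambda>z. nxt' (opp' z)) y then w' else org' x),
                 nxt = nxt', bnd = bnd E \<union> {g, h}\<rparr>"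
      unfolding Let_def E'_def oE_def nE_def gE_def by (rule HOL.refl)
  qed
  moreover have "veq_via b (\<phi>(w := w')) D' E'"
  proof -
    have D'eq: "D' = \<lparr>verts = insert w (verts D), darts = ?S, opp = oD,
                 org = (\<lambda>x. if x \<in> orbit (\<lambda>z. nD (oD z)) y then w else gD x),
                 nxt = nD, bnd = bnd D \<union> {g, h}\<rparr>"
      unfolding D' Let_def oD_def nD_def gD_def by (rule HOL.refl)
    have o: "oE x = oD x" if "x \<in> ?S" for x using that v'(6) d(1) by (auto simp: oE_def oD_def)
    have n: "nE x = nD x" if "x \<in> ?S" for x using that v'(7) pD(1) by (auto simp: nE_def nD_def)
    have oS: "oD x \<in> ?S" if "x \<in> ?S" for x using that p'(3) d(1) by (auto simp: oD_def)
    have nS: "nD x \<in> ?S" if "x \<in> ?S" for x using that p'(6) pD(2) by (auto simp: nD_def)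
    have orb: "orbit (\<lambda>z. nE (oE z)) y = orbit (\<lambda>z. nD (oD z)) y"
      by (rule orbit_agree[of ?S, symmetric]) (use o n oS nS d(3) pD in auto)
    have gm: "gD x \<in> verts D" if "x \<in> ?S" for x using that p'(3,8) d(1) by (auto simp: gD_def)
    have g: "gE x = \<phi> (gD x)" if "x \<in> ?S" for x
      using that v'(6)[OF d(1)] v'(8) d(1) p'(3)[OF d(1)] by (auto simp: gE_def gD_def)
    have "inj_on (\<phi>(w := w')) (insert w (verts D))"
      using v'(3,4) w' d(5) by (auto simp: inj_on_def)
    moreover have "insert w' (verts E) = (\<phi>(w := w')) ` insert w (verts D)"
      using v'(4) d(5) by auto
    moreover have "(\<phi>(w := w')) s = s" if "s \<in> b" for s using v'(5) that b d(5) by auto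
    moreover have "gD x \<noteq> w" if "x \<in> ?S" for x using gm[OF that] d(5) by blast
    ultimately show ?thesis
      using o n g v'(1,2) orb unfolding veq_via_def D'eq E'_def by simp
  qed
  ultimately show ?thesis unfolding veq_def by blast
qed

lemma shelling_move_veq:
  assumes "diagram D" "veq b D E" "b \<subseteq> verts D" "shelling_move D D'"
  shows "\<exists>E'. shelling_move E E' \<and> veq b D' E'"
  using assms collapse1_veq collapse2_veq expand1_veq unfolding veq_def[of b D E] shelling_move_def by metis

lemma fragment_veq: assumes D: "diagram D" and v: "veq b D E" and f: "fragment D D1 D2"
  shows "\<exists>E1 E2. fragment E E1 E2 \<and> veq b D1 E1 \<and> veq b D2 E2"
proof -
  obtain \<phi> where v: "veq_via b \<phi> D E" using v by (auto simp: veq_def)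
  note DD = diagramD[OF D] and v' = veq_viaD[OF v] note p' = pmapD[OF DD(1)]
  obtain w V1 V2 A1 A2 where f: "V1 \<union> V2 = verts D" "V1 \<inter> V2 = {w}" "A1 \<union> A2 = darts D" "A1 \<inter> A2 = {}"
     "\<forall>c\<in>cells D. c \<subseteq> A1 \<or> c \<subseteq> A2"
     "D1 = subdiag D V1 A1 (bnd D \<inter> A1)" "D2 = subdiag D V2 A2 (bnd D \<inter> A2)" "diagram D1" "diagram D2"
    using f unfolding fragment_def by blast
  let ?E1 = "subdiag E (\<phi> ` V1) A1 (bnd E \<inter> A1)" and ?E2 = "subdiag E (\<phi> ` V2) A2 (bnd E \<inter> A2)"
  have V: "V1 \<subseteq> verts D" "V2 \<subseteq> verts D" "A1 \<subseteq> darts D" "A2 \<subseteq> darts D" using f by auto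
  have v1: "veq_via b \<phi> D1 ?E1" and v2: "veq_via b \<phi> D2 ?E2"
    using veq_subdiag[OF DD(1) v V(3,1)] veq_subdiag[OF DD(1) v V(4,2)] f(6,7) v'(2) by simp_all
  have "cells E = cells D"
    using veq_nxt_orbit[OF DD(1) v] v'(1,2) by (simp add: cells_def regions_def)
  moreover have "\<phi> ` V1 \<union> \<phi> ` V2 = verts E" using f(1) v'(4) by blast
  moreover have "\<phi> ` V1 \<inter> \<phi> ` V2 = {\<phi> w}"
    using f(2) inj_on_image_Int[OF v'(3) V(1,2)] by simp
  ultimately have "fragment E ?E1 ?E2"
    unfolding fragment_def using f(3-5) v'(1,2) veq_diagram[OF f(8) v1] veq_diagram[OF f(9) v2] by metis
  then show ?thesis using v1 v2 unfolding veq_def by blast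
qed

lemma total_perim_add [simp]: "total_perim (add_mset D X) = perim D + total_perim X" "total_perim {#} = 0"
  by (simp_all add: total_perim_def)

lemma admissible_veq: assumes "rel_mset (veq b) X Y" "admissible b L X" shows "admissible b L Y"
proof -
  have "total_perim Y = total_perim X \<and> (\<forall>E\<in>#Y. \<exists>D\<in>#X. veq b D E)"
    using assms(1)
  proof (induction "veq b" X Y rule: rel_mset_induct)
    case (add D E X Y)
    then have "perim E = perim D" by (auto simp: veq_def veq_via_def perim_def)
    then show ?case using add by auto
  qed simp
  then have t: "total_perim Y = total_perim X" "\<And>E. E \<in># Y \<Longrightarrow> \<exists>D\<in>#X. veq b D E" by auto
  have "diagram E \<and> b \<subseteq> verts E" if E: "E \<in># Y" for E
  proof -
    obtain D \<phi> where D: "D \<in># X" "veq_via b \<phi> D E" using t(2)[OF E] by (auto simp: veq_def)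
    then have d: "diagram D" "b \<subseteq> verts D" using assms(2) by (auto simp: admissible_def)
    moreover have "s \<in> verts E" if s: "s \<in> b" for s
    proof -
      have "\<phi> s \<in> \<phi> ` verts D" using d(2) s by blast
      then show ?thesis using veq_viaD(4,5)[OF D(2)] s by simp
    qed
    ultimately show ?thesis using veq_diagram[OF d(1) D(2)] by blast
  qed
  then show ?thesis using assms(2) t(1) by (simp add: admissible_def)
qed

lemma shellable_veq_mset: "shellable fr b L n X \<Longrightarrow> rel_mset (veq b) X Y \<Longrightarrow> shellable fr b L n Y"
proof (induction arbitrary: Y rule: shellable.induct)
  case (vertices X)
  have "\<forall>E\<in>#Y. \<exists>D\<in>#X. veq b D E"
    using vertices(3) by (induction rule: rel_mset_induct) auto
  then have "single_vertex E" if "E \<in># Y" for E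
    using that vertices(2) by (fastforce simp: veq_def veq_via_def single_vertex_def)
  then show ?case using admissible_veq[OF vertices(3,1)] by (auto intro: shellable.vertices)
next
  case (shell D X D' n)
  obtain E Y' where Y: "Y = add_mset E Y'" "veq b D E" "rel_mset (veq b) X Y'"
    using msed_rel_invL[OF shell.prems] by blast
  have "diagram D" "b \<subseteq> verts D" using shell(1) by (auto simp: admissible_def)
  then obtain E' where E': "shelling_move E E'" "veq b D' E'"
    using shelling_move_veq Y(2) shell(2) by blast
  have "shellable fr b L n (add_mset E' Y')"
    using shell.IH rel_mset_Plus[of "veq b", OF E'(2) Y(3)] by blast
  moreover have "admissible b L (add_mset E Y')" using admissible_veq[OF shell.prems shell(1)] Y(1) by simp
  ultimately show ?case using E'(1) Y(1) by (auto intro: shellable.shell)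
next
  case (frag D X D1 D2 n)
  obtain E Y' where Y: "Y = add_mset E Y'" "veq b D E" "rel_mset (veq b) X Y'"
    using msed_rel_invL[OF frag.prems] by blast
  have "diagram D" using frag(2) by (auto simp: admissible_def)
  then obtain E1 E2 where E': "fragment E E1 E2" "veq b D1 E1" "veq b D2 E2"
    using fragment_veq Y(2) frag(3) by blast
  have "shellable fr b L n (add_mset E1 (add_mset E2 Y'))"
    using frag.IH rel_mset_Plus[of "veq b", OF E'(2) rel_mset_Plus[of "veq b", OF E'(3) Y(3)]] by blast
  moreover have "admissible b L (add_mset E Y')" using admissible_veq[OF frag.prems frag(2)] Y(1) by simp
  ultimately show ?case using E'(1) Y(1) frag(1) by (auto intro: shellable.frag)
qed

lemma rel_mset_veq_refl: "rel_mset (veq b) X X"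
  by (induction X) (auto intro: rel_mset_Plus veq_refl simp: rel_mset_Zero)

lemma shellable_veq: assumes "shellable fr b L n (add_mset D X)" "veq b D E"
  shows "shellable fr b L n (add_mset E X)"
  using shellable_veq_mset[OF assms(1)] rel_mset_Plus[of "veq b", OF assms(2) rel_mset_veq_refl] by blast

subsection \<open>Comparison with sequences\<close>

lemma shelling_seq_shellable:
  assumes "S \<noteq> []" "\<forall>D\<in>set S. diagram D \<and> b \<subseteq> verts D \<and> perim D \<le> L"
    "successively shelling_move S" "single_vertex (last S)"
  shows "shellable False b L (length S - 1) {#hd S#}"
  using assms
proof (induction S)
  case (Cons D S)
  have a: "admissible b L {#D#}" using Cons.prems by (simp add: admissible_def)
  show ?case
  proof (cases "S = []")
    case True
    then show ?thesis using Cons.prems a by (auto intro: shellable.vertices)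
  next
    case False
    then have "shelling_move D (hd S)" "shellable False b L (length S - 1) {#hd S#}"
      using Cons.prems Cons.IH by (auto simp: successively_Cons)
    then have "shellable False b L (Suc (length S - 1)) {#D#}" using shellable.shell[OF a] by blast
    then show ?thesis using False by (cases S) auto
  qed
qed simp

lemma shellable_shelling_seq:
  assumes "shellable fr b L n X" "\<not> fr" "X = {#D#}"
  shows "\<exists>S. S \<noteq> [] \<and> hd S = D \<and> (\<forall>D\<in>set S. diagram D \<and> b \<subseteq> verts D \<and> perim D \<le> L)
    \<and> successively shelling_move S \<and> single_vertex (last S)"
  using assms
proof (induction arbitrary: D rule: shellable.induct)
  case (vertices X)
  then show ?case by (intro exI[of _ "[D]"]) (auto simp: admissible_def)
next
  case (shell D0 X D' n)
  have [simp]: "D0 = D" "X = {#}" using shell.prems by auto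
  obtain S where S: "S \<noteq> []" "hd S = D'" "\<forall>D\<in>set S. diagram D \<and> b \<subseteq> verts D \<and> perim D \<le> L"
    "successively shelling_move S" "single_vertex (last S)"
    using shell.IH shell.prems by auto
  then show ?case using shell(1,2)
    by (intro exI[of _ "D # S"]) (auto simp: successively_Cons admissible_def)
qed simp

lemma fragmenting_seq_shellable:
  assumes "S \<noteq> []" "\<forall>X\<in>set S. admissible {} L X"
    "successively fragmenting_move S" "\<forall>D\<in>#last S. single_vertex D"
  shows "\<exists>n. shellable True {} L n (hd S)"
  using assms
proof (induction S)
  case (Cons X S)
  have a: "admissible {} L X" using Cons.prems by simp
  show ?case
  proof (cases "S = []")
    case True
    then show ?thesis using Cons.prems a by (auto intro: shellable.vertices)
  next
    case False
    then obtain n where m: "fragmenting_move X (hd S)" "shellable True {} L n (hd S)"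
      using Cons.prems Cons.IH by (auto simp: successively_Cons)
    obtain Y D where X: "X = add_mset D Y" "(\<exists>D'. shelling_move D D' \<and> hd S = add_mset D' Y)
          \<or> (\<exists>D1 D2. fragment D D1 D2 \<and> hd S = add_mset D1 (add_mset D2 Y))"
      using m(1) unfolding fragmenting_move_def by blast
    from X(2) have "\<exists>n. shellable True {} L n X"
      using shellable.shell[of "{}" L D Y] shellable.frag[of True "{}" L D Y] a m(2) X(1) by (metis (full_types))
    then show ?thesis by simp
  qed
qed simp

lemma shellable_fragmenting_seq:
  assumes "shellable True {} L n X"
  shows "\<exists>S. S \<noteq> [] \<and> hd S = X \<and> (\<forall>X\<in>set S. admissible {} L X)
    \<and> successively fragmenting_move S \<and> (\<forall>D\<in>#last S. single_vertex D)"
  using assms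
proof (induction rule: shellable.induct)
  case (vertices X)
  then show ?case by (intro exI[of _ "[X]"]) auto
next
  case (shell D X D' n)
  then obtain S where S: "S \<noteq> []" "hd S = add_mset D' X" "\<forall>X\<in>set S. admissible {} L X"
    "successively fragmenting_move S" "\<forall>D\<in>#last S. single_vertex D" by blast
  have "fragmenting_move (add_mset D X) (hd S)" unfolding fragmenting_move_def using shell(2) S(2) by blast
  then show ?case using S shell(1)
    by (intro exI[of _ "add_mset D X # S"]) (auto simp: successively_Cons)
next
  case (frag D X D1 D2 n)
  then obtain S where S: "S \<noteq> []" "hd S = add_mset D1 (add_mset D2 X)" "\<forall>X\<in>set S. admissible {} L X"
    "successively fragmenting_move S" "\<forall>D\<in>#last S. single_vertex D" by blast
  have "fragmenting_move (add_mset D X) (hd S)" unfolding fragmenting_move_def using frag(3) S(2) by blast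
  then show ?case using S frag(2)
    by (intro exI[of _ "add_mset D X # S"]) (auto simp: successively_Cons)
qed

text \<open>Collapses alone shell every diagram to any of its vertices. Hence the infima that define
  the filling lengths of diagrams are taken over nonempty sets and are attained.\<close>

lemma full_shelling_exists: "diagram D \<Longrightarrow> s \<in> verts D \<Longrightarrow> \<exists>S. full_shelling_to D s S"
proof (induction "card (darts D)" arbitrary: D rule: less_induct)
  case less
  note DD = diagramD[OF less.prems(1)]
  show ?case
  proof (cases "darts D = {}")
    case True
    then have "adjacent D = {}" by (simp add: adjacent_def)
    then have "u = s" if "u \<in> verts D" for u using DD(4) that less.prems(2) unfolding conn_def by auto
    then have "verts D = {s}" using less.prems(2) by blast
    then have "single_vertex D" using True by (simp add: single_vertex_def)
    then show ?thesis using less.prems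
      by (intro exI[of _ "[D]"]) (simp add: full_shelling_to_def full_shelling_def)
  next
    case False
    then obtain E where E: "collapse1 D E \<or> collapse2 D E" "s \<in> verts E"
      using collapse_exists[OF less.prems(1) _ less.prems(2)] by metis
    then obtain S where S: "full_shelling_to E s S"
      using less.hyps collapse_diagram[OF less.prems(1) E(1)] by blast
    have "shelling_move D E" using E(1) by (auto simp: shelling_move_def)
    then have "full_shelling_to D s (D # S)" using S less.prems
      unfolding full_shelling_to_def full_shelling_def by (auto simp: successively_Cons)
    then show ?thesis ..
  qed
qed

lemma FL_diag_le: assumes "shellable False {s} L n {#D#}" shows "FL_diag D s \<le> L"
proof -
  obtain S where S: "S \<noteq> []" "hd S = D" "\<forall>D\<in>set S. diagram D \<and> {s} \<subseteq> verts D \<and> perim D \<le> L"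
    "successively shelling_move S" "single_vertex (last S)"
    using shellable_shelling_seq[OF assms] by auto
  then have "full_shelling_to D s S" by (auto simp: full_shelling_to_def full_shelling_def)
  moreover have "shelling_length S \<le> L" using S(1,3) by (simp add: shelling_length_def)
  ultimately show ?thesis unfolding FL_diag_def by (auto intro: cINF_lower2)
qed

lemma FL_diag_shellable: assumes "diagram D" "s \<in> verts D"
  shows "\<exists>n. shellable False {s} (FL_diag D s) n {#D#}"
proof -
  have "FL_diag D s \<in> shelling_length ` {S. full_shelling_to D s S}"
    unfolding FL_diag_def by (rule Inf_nat_def1) (use full_shelling_exists[OF assms] in auto)
  then obtain S where S: "full_shelling_to D s S" "shelling_length S = FL_diag D s" by auto
  have "\<forall>D'\<in>set S. diagram D' \<and> {s} \<subseteq> verts D' \<and> perim D' \<le> FL_diag D s"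
    using S(1) by (auto simp: full_shelling_to_def full_shelling_def S(2)[symmetric] shelling_length_def)
  then show ?thesis using shelling_seq_shellable[of S "{s}" "FL_diag D s"] S(1)
    by (auto simp: full_shelling_to_def full_shelling_def)
qed

lemma FFL_diag_le: assumes "shellable False {} L n {#D#}" shows "FFL_diag D \<le> L"
proof -
  obtain S where S: "S \<noteq> []" "hd S = D" "\<forall>D\<in>set S. diagram D \<and> {} \<subseteq> verts D \<and> perim D \<le> L"
    "successively shelling_move S" "single_vertex (last S)"
    using shellable_shelling_seq[OF assms] by auto
  then have "full_shelling D S" by (auto simp: full_shelling_def)
  moreover have "shelling_length S \<le> L" using S(1,3) by (simp add: shelling_length_def)
  ultimately show ?thesis unfolding FFL_diag_def by (auto intro: cINF_lower2)
qed

lemma FFL_diag_shellable: assumes "diagram D"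
  shows "\<exists>n. shellable False {} (FFL_diag D) n {#D#}"
proof -
  obtain s where "s \<in> verts D" using diagramD(2)[OF assms] by blast
  then have "\<exists>S. full_shelling D S" using full_shelling_exists[OF assms] full_shelling_to_def by blast
  then have "FFL_diag D \<in> shelling_length ` {S. full_shelling D S}"
    unfolding FFL_diag_def by (intro Inf_nat_def1) auto
  then obtain S where S: "full_shelling D S" "shelling_length S = FFL_diag D" by auto
  have "\<forall>D'\<in>set S. diagram D' \<and> {} \<subseteq> verts D' \<and> perim D' \<le> FFL_diag D"
    using S(1) by (auto simp: full_shelling_def S(2)[symmetric] shelling_length_def)
  then show ?thesis using shelling_seq_shellable[of S "{}" "FFL_diag D"] S(1)
    by (auto simp: full_shelling_def)
qed

lemma FFFL_diag_le: assumes "shellable True {} L n {#D#}" shows "FFFL_diag D \<le> L"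
proof -
  obtain S where S: "S \<noteq> []" "hd S = {#D#}" "\<forall>X\<in>set S. admissible {} L X"
    "successively fragmenting_move S" "\<forall>D\<in>#last S. single_vertex D"
    using shellable_fragmenting_seq[OF assms] by auto
  then have "full_fragmenting_shelling D S" by (auto simp: full_fragmenting_shelling_def admissible_def)
  moreover have "fragmenting_shelling_length S \<le> L"
    using S(1,3) by (simp add: fragmenting_shelling_length_def admissible_def total_perim_def)
  ultimately show ?thesis unfolding FFFL_diag_def by (auto intro: cINF_lower2)
qed

text \<open>A full shelling is in particular a fragmenting one, so here too the infimum is over a
  nonempty set.\<close>

lemma FFFL_diag_shellable: assumes "diagram D"
  shows "\<exists>n. shellable True {} (FFFL_diag D) n {#D#}"
proof -
  have sub: "shellable fr b L n X \<Longrightarrow> shellable True b L n X" for fr b L n X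
    by (induction rule: shellable.induct) (auto intro: shellable.intros)
  obtain n where n: "shellable True {} (FFL_diag D) n {#D#}" using FFL_diag_shellable[OF assms] sub by blast
  then obtain S where "hd S = {#D#} \<and> S \<noteq> [] \<and> (\<forall>X\<in>set S. admissible {} (FFL_diag D) X)
    \<and> successively fragmenting_move S \<and> (\<forall>D\<in>#last S. single_vertex D)"
    using shellable_fragmenting_seq by blast
  then have "full_fragmenting_shelling D S" by (auto simp: full_fragmenting_shelling_def admissible_def)
  then have "FFFL_diag D \<in> fragmenting_shelling_length ` {S. full_fragmenting_shelling D S}"
    unfolding FFFL_diag_def by (intro Inf_nat_def1) auto
  then obtain S where S: "full_fragmenting_shelling D S" "fragmenting_shelling_length S = FFFL_diag D" by auto
  have "\<forall>X\<in>set S. admissible {} (FFFL_diag D) X"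
    using S(1) by (auto simp: full_fragmenting_shelling_def S(2)[symmetric] fragmenting_shelling_length_def
      admissible_def total_perim_def)
  then show ?thesis using fragmenting_seq_shellable[of S "FFFL_diag D"] S(1)
    by (auto simp: full_fragmenting_shelling_def)
qed

section \<open>Null sequences of words\<close>

text \<open>The words that may be read around a 2-cell from an arbitrary dart on it. The direction
  of reading is fixed by the embedding, so inverse relators have to be included.\<close>

definition cyclic_rels :: "'a presentation \<Rightarrow> 'a word set" where
  "cyclic_rels P = {v @ u | u v. u @ v \<in> rels P \<union> inv_word ` rels P}"

text \<open>The effects of the three shelling moves on the boundary word.\<close>

definition elem :: "'a presentation \<Rightarrow> ('a word \<times> 'a word) set" where
  "elem P = {([x, inv_letter x], []) | x. x \<in> gens P \<times> UNIV} \<union> {([], [x, inv_letter x]) | x. x \<in> gens P \<times> UNIV}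
     \<union> {([x], t) | x t. x \<in> gens P \<times> UNIV \<and> inv_letter x # t \<in> cyclic_rels P}"

definition estep :: "('a word \<times> 'a word) set \<Rightarrow> 'a word \<Rightarrow> 'a word \<Rightarrow> bool" where
  "estep R w w' \<longleftrightarrow> (\<exists>x y s s'. (s, s') \<in> R \<and> w = x @ s @ y \<and> w' = x @ s' @ y)"

definition tlen :: "'a list multiset \<Rightarrow> nat" where
  "tlen W = (\<Sum>w\<in>#W. length w)"

lemma tlen_simps [simp]: "tlen {#} = 0" "tlen (add_mset w W) = length w + tlen W" "tlen (W + V) = tlen W + tlen V"
  by (simp_all add: tlen_def)

text \<open>The parameter \<open>rt\<close> permits cyclic conjugation and \<open>fr\<close> permits fragmentation. The index
  counts the applications of \<open>R\<close>.\<close>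

inductive null_seq :: "bool \<Rightarrow> bool \<Rightarrow> ('a word \<times> 'a word) set \<Rightarrow> nat \<Rightarrow> nat \<Rightarrow> 'a word multiset \<Rightarrow> bool"
  for rt fr R L where
  empty: "null_seq rt fr R L 0 {#}"
| drop: "null_seq rt fr R L n W \<Longrightarrow> rt \<or> W = {#} \<Longrightarrow> null_seq rt fr R L n (add_mset [] W)"
| undrop: "null_seq rt fr R L n (add_mset [] W) \<Longrightarrow> rt \<Longrightarrow> null_seq rt fr R L n W"
| move: "estep R w w' \<Longrightarrow> length w + tlen W \<le> L \<Longrightarrow> null_seq rt fr R L n (add_mset w' W)
    \<Longrightarrow> null_seq rt fr R L (Suc n) (add_mset w W)"
| rot: "rt \<Longrightarrow> null_seq rt fr R L n (add_mset (v @ u) W) \<Longrightarrow> null_seq rt fr R L n (add_mset (u @ v) W)"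
| frag: "fr \<Longrightarrow> u \<noteq> [] \<Longrightarrow> v \<noteq> [] \<Longrightarrow> null_seq rt fr R L n (add_mset u (add_mset v W))
    \<Longrightarrow> null_seq rt fr R L n (add_mset (u @ v) W)"

section \<open>Labelled diagrams\<close>

text \<open>The condition on a cell is imposed at every starting dart, with cyclic conjugates
  allowed, so that no distinguished dart has to be carried through the moves.\<close>

definition labelling :: "'a presentation \<Rightarrow> diag \<Rightarrow> (nat \<Rightarrow> 'a \<times> bool) \<Rightarrow> bool" where
  "labelling P D lab \<longleftrightarrow> (\<forall>d\<in>darts D. lab d \<in> gens P \<times> UNIV \<and> lab (opp D d) = inv_letter (lab d))
    \<and> (\<forall>d t. d \<in> darts D \<longrightarrow> d \<notin> bnd D \<longrightarrow> cyc (nxt D) (d # t) \<longrightarrow> map lab (d # t) \<in> cyclic_rels P)"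

lemma labellingD: assumes "labelling P D lab"
  shows "d \<in> darts D \<Longrightarrow> lab d \<in> gens P \<times> UNIV" "d \<in> darts D \<Longrightarrow> lab (opp D d) = inv_letter (lab d)"
    "d \<in> darts D \<Longrightarrow> d \<notin> bnd D \<Longrightarrow> cyc (nxt D) (d # t) \<Longrightarrow> map lab (d # t) \<in> cyclic_rels P"
  using assms unfolding labelling_def by blast+

lemma labellingI:
  assumes "\<And>d. d \<in> darts D \<Longrightarrow> lab d \<in> gens P \<times> UNIV"
    "\<And>d. d \<in> darts D \<Longrightarrow> lab (opp D d) = inv_letter (lab d)"
    "\<And>d t. d \<in> darts D \<Longrightarrow> d \<notin> bnd D \<Longrightarrow> cyc (nxt D) (d # t) \<Longrightarrow> map lab (d # t) \<in> cyclic_rels P"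
  shows "labelling P D lab"
  using assms unfolding labelling_def by blast

definition based :: "nat set \<Rightarrow> diag \<Rightarrow> nat list \<Rightarrow> bool" where
  "based b D l \<longleftrightarrow> b = {} \<or> l = [] \<or> org D (hd l) \<in> b"

text \<open>For closed \<open>K\<close> this is the boundary word of the pieces in \<open>K\<close>,
  which remains when the other pieces are contracted and their stretches of the boundary are
  skipped.\<close>

definition kword :: "(nat \<Rightarrow> 'b) \<Rightarrow> nat list \<Rightarrow> nat set \<Rightarrow> 'b list" where
  "kword lab l K = map lab (filter (\<lambda>x. x \<in> K) l)"

lemma kword_append [simp]: "kword lab (l @ m) K = kword lab l K @ kword lab m K"
  by (simp add: kword_def)

lemma kword_Nil [simp]: "kword lab [] K = []"
  by (simp add: kword_def)

lemma kword_all: "set l \<subseteq> K \<Longrightarrow> kword lab l K = map lab l"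
  unfolding kword_def by (metis filter_True subsetD)

lemma kword_none: "set l \<inter> K = {} \<Longrightarrow> kword lab l K = []"
  unfolding kword_def by (metis disjoint_iff filter_False map_is_Nil_conv)

lemma kword_cong: "(\<And>x. x \<in> set l \<Longrightarrow> (x \<in> K \<longleftrightarrow> x \<in> K') \<and> lab x = lab' x) \<Longrightarrow> kword lab l K = kword lab' l K'"
  by (induction l) (auto simp: kword_def)

lemma inv_letter_inv [simp]: "inv_letter (inv_letter x) = x"
  by (simp add: inv_letter_def)

lemma inv_letter_in [simp]: "inv_letter x \<in> A \<times> UNIV \<longleftrightarrow> x \<in> A \<times> UNIV"
  by (cases x) (simp add: inv_letter_def)

lemma closed_cycle: assumes "closed_darts D K" "cyc (nxt D) (x # l)" "set (x # l) \<subseteq> darts D - bnd D" "y \<in> set (x # l)"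
  shows "y \<in> K \<longleftrightarrow> x \<in> K"
proof -
  have "y \<in> orbit (nxt D) x" using cyc_orbit[OF assms(2), of x] assms(4) by simp
  then have "y \<in> darts D - bnd D \<and> (y \<in> K \<longleftrightarrow> x \<in> K)"
  proof induction
    case base
    have "x \<in> darts D - bnd D" "nxt D x \<in> darts D - bnd D"
      using cyc_in[OF assms(2) list.set_intros(1)] assms(3) by (meson list.set_intros(1) subsetD)+
    then show ?case using closed_nxt[OF assms(1), of x] by simp
  next
    case (step z)
    have zl: "z \<in> set (x # l)" using step(1) cyc_orbit[OF assms(2), of x] by simp
    have "nxt D z \<in> darts D - bnd D" using cyc_in[OF assms(2) zl] assms(3) by blast
    then show ?case using closed_nxt[OF assms(1), of z] step(2) by simp
  qed
  then show ?thesis by simp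
qed

text \<open>The boundary word read along \<open>u2 @ u1\<close> and restricted to a closed set of darts changes by at
  most one elementary step, and it changes only for closed sets that contain \<open>d\<close>.\<close>

definition frame_step where
  "frame_step P b D D' lab l \<longleftrightarrow> (\<exists>u1 u2 lab' l' \<kappa> d. l = u1 @ u2
    \<and> (b \<noteq> {} \<longrightarrow> u1 = [] \<or> u2 = [] \<or> org D (hd u1) = org D (hd u2))
    \<and> labelling P D' lab' \<and> bcyc D' l' \<and> based b D' l'
    \<and> (\<forall>K. closed_darts D K \<longrightarrow> closed_darts D' (\<kappa> K)) \<and> (\<forall>K K'. K \<inter> K' = {} \<longrightarrow> \<kappa> K \<inter> \<kappa> K' = {})
    \<and> (\<forall>K. closed_darts D K \<longrightarrow>
        (if d \<in> K then estep (elem P) (kword lab (u2 @ u1) K) (kword lab' l' (\<kappa> K))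
         else kword lab' l' (\<kappa> K) = kword lab (u2 @ u1) K)))"

lemma frame_stepI:
  assumes "l = u1 @ u2" "b \<noteq> {} \<Longrightarrow> u1 = [] \<or> u2 = [] \<or> org D (hd u1) = org D (hd u2)"
    "labelling P D' lab'" "bcyc D' l'" "based b D' l'"
    "\<And>K. closed_darts D K \<Longrightarrow> closed_darts D' (\<kappa> K)" "\<And>K K'. K \<inter> K' = {} \<Longrightarrow> \<kappa> K \<inter> \<kappa> K' = {}"
    "\<And>K. closed_darts D K \<Longrightarrow>
        (if d \<in> K then estep (elem P) (kword lab (u2 @ u1) K) (kword lab' l' (\<kappa> K))
         else kword lab' l' (\<kappa> K) = kword lab (u2 @ u1) K)"
  shows "frame_step P b D D' lab l"
  unfolding frame_step_def
proof (rule exI[of _ u1], rule exI[of _ u2], rule exI[of _ lab'], rule exI[of _ l'], rule exI[of _ \<kappa>],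
      rule exI[of _ d], intro conjI)
  show "b \<noteq> {} \<longrightarrow> u1 = [] \<or> u2 = [] \<or> org D (hd u1) = org D (hd u2)" using assms(2) ..
  show "\<forall>K. closed_darts D K \<longrightarrow> closed_darts D' (\<kappa> K)" using assms(6) by (intro allI impI)
  show "\<forall>K K'. K \<inter> K' = {} \<longrightarrow> \<kappa> K \<inter> \<kappa> K' = {}" using assms(7) by (intro allI impI)
  show "\<forall>K. closed_darts D K \<longrightarrow>
        (if d \<in> K then estep (elem P) (kword lab (u2 @ u1) K) (kword lab' l' (\<kappa> K))
         else kword lab' l' (\<kappa> K) = kword lab (u2 @ u1) K)" using assms(8) by (intro allI impI)
qed (fact assms)+

context edge_removal
begin

lemma labelling_restrict: assumes c: "\<And>x. x \<in> darts E \<Longrightarrow> x \<notin> bnd E \<Longrightarrow> x \<notin> bnd D \<and> (\<exists>l. cyc (nxt D) (x # l) \<and> cyc (nxt E) (x # l))"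
    and lab: "labelling P D lab"
  shows "labelling P E lab"
proof (rule labellingI)
  fix x assume x: "x \<in> darts E"
  show "lab x \<in> gens P \<times> UNIV" using labellingD(1)[OF lab extD(10)[OF ex x]] .
  show "lab (opp E x) = inv_letter (lab x)"
    using labellingD(2)[OF lab extD(10)[OF ex x]] extD(7)[OF ex x] by simp
next
  fix x l assume x: "x \<in> darts E" "x \<notin> bnd E" and l: "cyc (nxt E) (x # l)"
  obtain l' where l': "x \<notin> bnd D" "cyc (nxt D) (x # l')" "cyc (nxt E) (x # l')" using c[OF x] by blast
  have "l' = l" using cyc_unique[OF l'(3) l] .
  then show "map lab (x # l) \<in> cyclic_rels P"
    using labellingD(3)[OF lab extD(10)[OF ex x(1)] l'(1)] l'(2) by blast
qed

lemma closed_restrict: assumes c: "\<And>x. x \<in> darts E \<Longrightarrow> x \<notin> bnd E \<Longrightarrow> x \<notin> bnd D \<and> nxt D x \<in> darts E"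
    and K: "closed_darts D K"
  shows "closed_darts E K"
  unfolding closed_darts_def
proof (intro ballI conjI impI)
  fix x assume x: "x \<in> darts E"
  show "opp E x \<in> K \<longleftrightarrow> x \<in> K"
    using closed_opp[OF K extD(10)[OF ex x]] extD(7)[OF ex x] by simp
  assume xb: "x \<notin> bnd E"
  then have "nxt E x = nxt D x" using c x ext_nxt(1)[OF pD ex x] by blast
  then show "nxt E x \<in> K \<longleftrightarrow> x \<in> K" using closed_nxt[OF K extD(10)[OF ex x]] c[OF x xb] by simp
qed

end

context removal2
begin

lemma nonbnd_E: assumes "x \<in> darts E" "x \<notin> bnd E"
  shows "x \<notin> bnd D" "\<exists>l. cyc (nxt D) (x # l) \<and> cyc (nxt E) (x # l)" "nxt D x \<in> darts E"
proof -
  show "x \<notin> bnd D" using assms nonbnd_D by blast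
  obtain l where l: "cyc (nxt D) (x # l)" "cyc (nxt E) (x # l)" "set (x # l) \<subseteq> darts E - bnd E" by (rule other[OF DiffI[OF assms]])
  then show "\<exists>l. cyc (nxt D) (x # l) \<and> cyc (nxt E) (x # l)" by blast
  have "nxt D x \<in> set (x # l)" using cyc_in[OF l(1)] by simp
  then show "nxt D x \<in> darts E" using l(3) by blast
qed

lemma labelling_small: "labelling P D lab \<Longrightarrow> labelling P E lab"
  by (rule labelling_restrict) (intro conjI nonbnd_E)

lemma closed_small: "closed_darts D K \<Longrightarrow> closed_darts E K"
  by (rule closed_restrict) (intro conjI nonbnd_E)

text \<open>A closed set contains all of the collapsed cell or none of it. In the former case the
  letter of \<open>d\<close> is replaced by the rest of the relator; in the latter neither
  \<open>d\<close> nor \<open>t\<close> is read. Closed sets of \<open>D\<close> are closed in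
  \<open>E\<close>, so they are kept as they are.\<close>

lemma frame: assumes D: "diagram D" and lab: "labelling P D lab" and l: "bcyc D l" "based b D l"
  shows "frame_step P b D E lab l"
proof -
  have "d \<in> set l" using l(1) bD by (simp add: bcyc_def)
  then obtain u1 u2 where u: "l = u1 @ d # u2" by (meson split_list)
  have "bcyc D (d # u2 @ u1)" using bcyc_rotate[of D u1 "d # u2"] l(1) u by simp
  then have v: "v = u2 @ u1" using bcyc_unique bcycs(1) by blast
  have c: "bcyc E (u1 @ t @ u2)" using bcyc_rotate[of E "t @ u2" u1] bcycs(2) v by simp
  have ba: "based b E (u1 @ t @ u2)"
  proof (cases "b = {} \<or> u1 @ t @ u2 = []")
    case False
    then have s: "org D (hd l) \<in> b" using l(2) u by (auto simp: based_def)
    have "org D (hd (u1 @ t @ u2)) = org D (hd l)"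
    proof (cases "u1 = []")
      case True
      then show ?thesis using hd_org[OF D v] False u by simp
    qed (use u in simp)
    moreover have "hd (u1 @ t @ u2) \<in> darts E"
      using hd_in_set[of "u1 @ t @ u2"] False in_E v by auto
    ultimately show ?thesis using s ext_opp(5)[OF pD ex] by (simp add: based_def)
  qed (auto simp: based_def)
  have w: "if d \<in> K then estep (elem P) (kword lab ([] @ l) K) (kword lab (u1 @ t @ u2) K)
         else kword lab (u1 @ t @ u2) K = kword lab ([] @ l) K" if K: "closed_darts D K" for K
  proof -
    have dD: "d \<in> darts D" "e \<in> darts D" using sD by auto
    have e: "e \<in> K \<longleftrightarrow> d \<in> K" using closed_opp[OF K dD(1)] extD(5)[OF ex] by simp
    have et: "set (e # t) \<subseteq> darts D - bnd D" using nonbnd_D by blast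
    have t: "y \<in> K \<longleftrightarrow> d \<in> K" if "y \<in> set t" for y
      using closed_cycle[OF K ce et, of y] that e by simp
    show ?thesis
    proof (cases "d \<in> K")
      case True
      have "lab e # map lab t \<in> cyclic_rels P"
        using labellingD(3)[OF lab, of e t] ce et by simp
      moreover have "lab e = inv_letter (lab d)" "lab d \<in> gens P \<times> UNIV"
        using labellingD(1,2)[OF lab dD(1)] extD(5)[OF ex] by simp_all
      ultimately have "([lab d], map lab t) \<in> elem P" unfolding elem_def by auto
      moreover have "kword lab t K = map lab t" using t True by (intro kword_all) blast
      moreover have "kword lab (d # u2) K = [lab d] @ kword lab u2 K" using True by (simp add: kword_def)
      ultimately show ?thesis using True unfolding estep_def u
        by (metis append_Nil kword_append)
    next
      case False
      then have "kword lab t K = []" using t by (intro kword_none) blast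
      then show ?thesis using False u by (simp add: kword_def)
    qed
  qed
  show ?thesis
  proof (rule frame_stepI[of l l "[]" b D P E lab "u1 @ t @ u2" "\<lambda>K. K" d lab])
    fix K assume "closed_darts D K"
    from w[OF this] show "if d \<in> K then estep (elem P) (kword lab ([] @ l) K) (kword lab (u1 @ t @ u2) K)
         else kword lab (u1 @ t @ u2) K = kword lab ([] @ l) K" .
  qed (use labelling_small[OF lab] closed_small c ba in simp_all)
qed

end

context removal1
begin

lemma nonbnd_cyc: assumes "x \<in> darts E" "x \<notin> bnd E"
  obtains l where "cyc (nxt D) (x # l)" "cyc (nxt E) (x # l)" "set (x # l) \<subseteq> darts E - bnd E"
proof -
  have x: "x \<in> darts D" "x \<notin> bnd D" using assms nonbnd_D by auto
  obtain l where l: "cyc (nxt D) (x # l)" "set (x # l) \<subseteq> darts D - bnd D"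
    using nonbnd_cycle[OF pD bcycs(1) x] by metis
  then show ?thesis using that cyc_transfer[OF l(1)] nonbnd_D by blast
qed

lemma nonbnd_E: assumes "x \<in> darts E" "x \<notin> bnd E"
  shows "x \<notin> bnd D" "\<exists>l. cyc (nxt D) (x # l) \<and> cyc (nxt E) (x # l)" "nxt D x \<in> darts E"
proof -
  show "x \<notin> bnd D" using assms nonbnd_D by blast
  obtain l where l: "cyc (nxt D) (x # l)" "cyc (nxt E) (x # l)" "set (x # l) \<subseteq> darts E - bnd E" by (rule nonbnd_cyc[OF assms])
  then show "\<exists>l. cyc (nxt D) (x # l) \<and> cyc (nxt E) (x # l)" by blast
  have "nxt D x \<in> set (x # l)" using cyc_in[OF l(1)] by simp
  then show "nxt D x \<in> darts E" using l(3) by blast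
qed

lemma labelling_small: "labelling P D lab \<Longrightarrow> labelling P E lab"
  by (rule labelling_restrict) (intro conjI nonbnd_E)

lemma closed_small: "closed_darts D K \<Longrightarrow> closed_darts E K"
  by (rule closed_restrict) (intro conjI nonbnd_E)

lemma frame: assumes D: "diagram D" and lab: "labelling P D lab" and l: "bcyc D l" "based b D l"
    and b: "b \<subseteq> verts E"
  shows "frame_step P b D E lab l"
proof -
  have dD: "d \<in> darts D" "e \<in> darts D" using sD by auto
  have "e \<in> set l" using l(1) bD by (simp add: bcyc_def)
  then obtain u1 u2 where u: "l = u1 @ e # u2" by (meson split_list)
  have v: "d # v = u2 @ u1"
    using bcyc_unique[of D e "d # v" "u2 @ u1"] bcyc_rotate[of D u1 "e # u2"] l(1) u bcycs(1) by simp
  have w: "if d \<in> K then estep (elem P) (kword lab (m1 @ e # d # m2) K) (kword lab (m1 @ m2) K)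
         else kword lab (m1 @ m2) K = kword lab (m1 @ e # d # m2) K" if K: "closed_darts D K" for K m1 m2
  proof -
    have e: "e \<in> K \<longleftrightarrow> d \<in> K" using closed_opp[OF K dD(1)] extD(5)[OF ex] by simp
    show ?thesis
    proof (cases "d \<in> K")
      case True
      have "lab d = inv_letter (lab e)" "lab e \<in> gens P \<times> UNIV"
        using labellingD(1,2)[OF lab dD(2)] extD(6)[OF ex] by simp_all
      then have "([lab e, lab d], []) \<in> elem P" unfolding elem_def by auto
      moreover have "kword lab (m1 @ e # d # m2) K = kword lab m1 K @ [lab e, lab d] @ kword lab m2 K"
        using True e by (simp add: kword_def)
      moreover have "kword lab (m1 @ m2) K = kword lab m1 K @ [] @ kword lab m2 K" by simp
      ultimately show ?thesis using True unfolding estep_def by metis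
    next
      case False
      then show ?thesis using e by (simp add: kword_def)
    qed
  qed
  show ?thesis
  proof (cases "u2 = []")
    case True
    \<comment> \<open>The circuit starts at the tip, so the two darts of the spike stand at opposite
      ends of \<open>l\<close>. The tip disappears and therefore is not the base; in the free case
      the reading is rotated to start with \<open>e\<close>.\<close>
    then have u1: "u1 = d # v" using v by simp
    have "b = {}"
    proof (rule ccontr)
      assume "b \<noteq> {}"
      then have "p \<in> b" using l(2) u u1 od by (auto simp: based_def)
      then show False using b pv by blast
    qed
    then show ?thesis
    proof (intro frame_stepI[of l u1 "[e]" b D P E lab v "\<lambda>K. K" d lab])
      fix K assume "closed_darts D K"
      from w[OF this, of "[]" v] show "if d \<in> K then estep (elem P) (kword lab ([e] @ u1) K) (kword lab v K)
         else kword lab v K = kword lab ([e] @ u1) K" by (simp only: u1 append_Nil append_Cons)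
    qed (use labelling_small[OF lab] closed_small bcycs(2) u u1 True in \<open>simp_all add: based_def\<close>)
  next
    case False
    then obtain m2 where m2: "u2 = d # m2" "v = m2 @ u1" using v by (cases u2) auto
    have c: "bcyc E (u1 @ m2)" using bcyc_rotate[of E m2 u1] bcycs(2) m2 by simp
    have "based b E (u1 @ m2)"
    proof (cases "b = {} \<or> u1 @ m2 = []")
      case False
      then have s: "org D (hd l) \<in> b" using l(2) u by (auto simp: based_def)
      have "org D (hd (u1 @ m2)) = org D (hd l)"
      proof (cases "u1 = []")
        case True
        have "nxt D d = hd (v @ [e])" using cyc_next[of "nxt D" "[e]" d v] cd by (cases v) auto
        then have "org D (hd (v @ [e])) = org D e"
          using org_nxt[OF D, of d] dD extD(5)[OF ex] by simp
        then show ?thesis using False True m2 u by auto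
      qed (use u in simp)
      moreover have "hd (u1 @ m2) \<in> darts E"
        using hd_in_set[of "u1 @ m2"] False in_E m2 by auto
      ultimately show ?thesis using s ext_opp(5)[OF pD ex] by (simp add: based_def)
    qed (auto simp: based_def)
    then show ?thesis
    proof (intro frame_stepI[of l l "[]" b D P E lab "u1 @ m2" "\<lambda>K. K" d lab])
      fix K assume "closed_darts D K"
      from w[OF this, of u1 m2] show "if d \<in> K then estep (elem P) (kword lab ([] @ l) K) (kword lab (u1 @ m2) K)
         else kword lab (u1 @ m2) K = kword lab ([] @ l) K" by (simp only: u m2 append_Nil append_Cons)
    qed (use labelling_small[OF lab] closed_small c u m2 in simp_all)
  qed
qed

end

lemma elemI: "x \<in> gens P \<times> UNIV \<Longrightarrow> ([x, inv_letter x], []) \<in> elem P"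
    "x \<in> gens P \<times> UNIV \<Longrightarrow> ([], [x, inv_letter x]) \<in> elem P"
    "x \<in> gens P \<times> UNIV \<Longrightarrow> inv_letter x # t \<in> cyclic_rels P \<Longrightarrow> ([x], t) \<in> elem P"
  unfolding elem_def by auto

lemma cyc_insert2: assumes c: "cyc f (p # q)" and n: "g \<notin> set (p # q)" "h \<notin> set (p # q)" "g \<noteq> h"
  shows "cyc (f(p := g, g := h, h := f p)) (p # g # h # q)" (is "cyc ?f _")
proof -
  have q: "?f x = f x" if "x \<in> set q" for x using that c n by (auto simp: cyc_def)
  have d: "distinct (p # g # h # q)" using c n by (auto simp: cyc_def)
  have fp: "f p = hd (q @ [p])" using cyc_next[of f "[]" p q] c by simp
  have v: "?f p = g" "?f g = h" "?f h = f p" using n by auto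
  show ?thesis
  proof (cases "q = []")
    case True
    then show ?thesis using d v fp by (simp add: cyc_def)
  next
    case False
    have "successively (\<lambda>a b. ?f a = b) q"
    proof (rule successively_mono)
      show "successively (\<lambda>a b. f a = b) q" using c False by (simp add: cyc_def successively_Cons)
      show "?f x = y" if "x \<in> set q" "y \<in> set q" "f x = y" for x y using q[OF that(1)] that(3) by simp
    qed
    moreover have "?f (last q) = p" using q[OF last_in_set[OF False]] c False by (simp add: cyc_def)
    ultimately show ?thesis using d v fp False
      by (simp add: cyc_def successively_Cons del: fun_upd_apply)
  qed
qed

section \<open>The effect of a 1-cell expansion\<close>

locale expansion =
  fixes D D' :: diag and d p w g h y
  assumes dD: "d \<in> darts D" and pb: "p \<in> bnd D" and y: "y \<in> {g, nxt D p}"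
    and og: "org D (nxt D p) = org D d" and w: "w \<notin> verts D"
    and gh: "g \<notin> darts D" "h \<notin> darts D" "g \<noteq> h"
    and D': "D' = \<lparr>verts = insert w (verts D), darts = darts D \<union> {g, h},
       opp = (opp D)(d := h, h := d, opp D d := g, g := opp D d),
       org = (\<lambda>x. if x \<in> orbit (\<lambda>z. ((nxt D)(p := g, g := h, h := nxt D p))
                (((opp D)(d := h, h := d, opp D d := g, g := opp D d)) z)) y then w
              else ((org D)(g := org D d, h := org D (opp D d))) x),
       nxt = (nxt D)(p := g, g := h, h := nxt D p), bnd = bnd D \<union> {g, h}\<rparr>"
    and diD: "diagram D" and diD': "diagram D'"
begin

text \<open>The initial vertices in \<open>D'\<close> before one copy of the cut vertex receives its
  new name.\<close>

definition gD where "gD = (org D)(g := org D d, h := org D (opp D d))"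

lemma pm: "pmap D" "pmap D'" using diD diD' by (auto simp: diagram_iff)

lemma basics: "opp D d \<in> darts D" "opp D d \<noteq> d" "opp D (opp D d) = d" "p \<in> darts D" "nxt D p \<in> darts D" "nxt D p \<in> bnd D"
  using pmapD[OF pm(1)] dD pb diagramD(7)[OF diD] nxt_bnd[OF diD, of p] by auto

lemma simps: "verts D' = insert w (verts D)" "darts D' = darts D \<union> {g, h}" "bnd D' = bnd D \<union> {g, h}"
  by (simp_all add: D')

lemma opp': "opp D' d = h" "opp D' h = d" "opp D' g = opp D d" "opp D' (opp D d) = g"
    "x \<in> darts D \<Longrightarrow> x \<noteq> d \<Longrightarrow> x \<noteq> opp D d \<Longrightarrow> opp D' x = opp D x"
  using gh basics dD by (auto simp: D')

lemma nxt': "nxt D' p = g" "nxt D' g = h" "nxt D' h = nxt D p"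
    "x \<in> darts D \<Longrightarrow> x \<noteq> p \<Longrightarrow> nxt D' x = nxt D x"
  using gh basics by (auto simp: D')

lemma org': "org D' x = (if x \<in> orbit (rot D') y then w else gD x)"
  by (simp add: D' gD_def rot_def[abs_def])

lemma gD: "gD g = org D d" "gD h = org D (opp D d)" "x \<in> darts D \<Longrightarrow> gD x = org D x"
  using gh by (auto simp: gD_def)

lemma rot': "rot D' d = nxt D p" "rot D' h = (if d = p then g else nxt D d)" "rot D' (opp D d) = h"
    "rot D' g = (if opp D d = p then g else rot D d)"
    "x \<in> darts D \<Longrightarrow> x \<noteq> d \<Longrightarrow> x \<noteq> opp D d \<Longrightarrow> rot D' x = (if opp D x = p then g else rot D x)"
  using opp' nxt' dD basics pmapD(3)[OF pm(1)] by (auto simp: rot_def)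

text \<open>Every rotation orbit of \<open>D'\<close> thus lies over a single vertex of
  \<open>D\<close>, which separates the effect of cutting from that of renaming.\<close>

lemma gD_rot: assumes "x \<in> darts D'" shows "gD (rot D' x) = gD x"
proof -
  have in': "nxt D d \<in> darts D" "rot D d \<in> darts D" using pmapD[OF pm(1)] dD by auto
  consider "x = d" | "x = h" | "x = opp D d" | "x = g" | "x \<in> darts D" "x \<noteq> d" "x \<noteq> opp D d"
    using assms by (auto simp: simps)
  then show ?thesis
  proof cases
    case 1 then show ?thesis using rot'(1) gD(3) basics(5) dD og by simp
  next
    case 2
    have "org D (nxt D d) = org D (opp D d)" using org_nxt[OF diD dD] .
    then show ?thesis using 2 rot'(2) gD in' og by (cases "d = p") auto
  next
    case 3 then show ?thesis using rot'(3) gD(2) gD(3)[OF basics(1)] by simp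
  next
    case 4
    have "org D (rot D d) = org D d" using org_rot[OF diD dD] .
    then show ?thesis using 4 rot'(4) gD(1) gD(3)[OF in'(2)] by (cases "opp D d = p") auto
  next
    case 5
    have r: "rot D x \<in> darts D" "org D (rot D x) = org D x" using pmapD(9)[OF pm(1) 5(1)] org_rot[OF diD 5(1)] .
    show ?thesis
    proof (cases "opp D x = p")
      case True
      then have "nxt D p = rot D x" by (simp add: rot_def)
      then show ?thesis using True rot'(5)[OF 5] gD(1) gD(3)[OF 5(1)] og r by simp
    next
      case False
      then show ?thesis using rot'(5)[OF 5] gD(3) r 5(1) by simp
    qed
  qed
qed

lemma yD': "y \<in> darts D'" using y basics by (auto simp: simps)

lemma gD_orbit: assumes "x \<in> darts D'" "z \<in> orbit (rot D') x" shows "gD z = gD x"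
  using assms(2)
proof induction
  case base then show ?case using gD_rot assms(1) by simp
next
  case (step z)
  then show ?case using gD_rot orbit_sym(1)[OF pm(2) assms(1)] by simp
qed

lemma gD_y: "gD y = org D d" using y gD basics og by auto

text \<open>If both copies had been renamed, connectedness of \<open>D'\<close> would still supply a
  dart named \<open>s\<close>, whose rotation orbit avoids \<open>g\<close> and the successor of
  \<open>p\<close>. Away from these two the rotations of \<open>D'\<close> and \<open>D\<close>
  agree up to the insertion of \<open>h\<close>, so the old darts of that orbit would be closed
  under rotation in \<open>D\<close>. They would include \<open>d\<close>, which rotates to the
  successor of \<open>p\<close> in \<open>D'\<close>.\<close>

lemma one_keeps_name: assumes s: "org D d = s" and sv: "s \<in> verts D'"
  shows "org D' g = s \<or> org D' (nxt D p) = s"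
proof (rule ccontr)
  assume "\<not> ?thesis"
  then have both: "g \<in> orbit (rot D') y" "nxt D p \<in> orbit (rot D') y"
    using org' gD(1) gD(3)[OF basics(5)] og s by (auto split: if_splits)
  have sD: "s \<in> verts D" "s \<noteq> w" using pmapD(8)[OF pm(1) dD] s w by auto
  have "org D' y = w" using org'[of y] orbit_sym(3)[OF pm(2) yD' both(1)] by simp
  then have "(s, w) \<in> (adjacent D')\<^sup>*"
    using diagramD(4)[OF diD'] sv pmapD(8)[OF pm(2) yD'] unfolding conn_def by metis
  then obtain u where "(s, u) \<in> adjacent D'" by (cases rule: converse_rtranclE) (use sD(2) in auto)
  then obtain x where x: "x \<in> darts D'" "org D' x = s" by (auto simp: adjacent_def)
  define Q where "Q = orbit (rot D') x"
  have xy: "x \<notin> orbit (rot D') y" using x(2) org'[of x] sD by auto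
  have gx: "gD x = s" using x(2) org'[of x] xy by simp
  have dis: "z \<notin> Q" if "z \<in> orbit (rot D') y" for z
  proof
    assume "z \<in> Q"
    then have z: "z \<in> orbit (rot D') x" by (simp add: Q_def)
    have "orbit (rot D') x = orbit (rot D') y" "x \<in> orbit (rot D') x"
      using orbit_sym(2,3)[OF pm(2) x(1) z] orbit_sym(2)[OF pm(2) yD' that] by simp_all
    then show False using xy by simp
  qed
  have nO: "nxt D p \<notin> Q" "g \<notin> Q" using dis both by auto
  have st: "rot D' z \<in> Q" if "z \<in> Q" for z using that unfolding Q_def by (rule orbit.step)
  have dO: "d \<notin> Q" using st[of d] rot'(1) nO by auto
  have h: "nxt D d \<in> Q" "nxt D d \<in> darts D" if "h \<in> Q"
    using st[OF that] rot'(2) nO pmapD(6)[OF pm(1) dD] by (auto split: if_splits)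
  have cl: "rot D z \<in> Q \<inter> darts D" if z: "z \<in> Q \<inter> darts D" for z
  proof (cases "z = opp D d")
    case True
    then have "h \<in> Q" using st[of z] z rot'(3) by simp
    then show ?thesis using h True basics(3) by (simp add: rot_def)
  next
    case False
    then have "rot D' z = rot D z" using rot'(5)[of z] z dO nO st[of z] by (metis IntE)
    then show ?thesis using st[of z] z pmapD(9)[OF pm(1)] by auto
  qed
  have "x \<in> Q" using rot_cycle[OF pm(2) x(1)] unfolding Q_def by (metis list.set_intros(1))
  then have "x = h \<or> x \<in> darts D" using x(1) nO simps by auto
  then obtain z where z: "z \<in> Q \<inter> darts D" using \<open>x \<in> Q\<close> h by blast
  have "gD z = s" using gD_orbit[OF x(1), of z] z gx unfolding Q_def by simp
  then have "d \<in> orbit (rot D) z"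
    using diagramD(3)[OF diD] z dD s gD(3)[of z] unfolding orgcond_def by (metis IntE)
  then have "d \<in> Q \<inter> darts D"
    by induction (use cl z in auto)
  then show False using dO by simp
qed

text \<open>The new circuit is read from the old start, from the successor of \<open>p\<close>, and
  from \<open>g\<close>. The right choice depends on which copy of the cut vertex keeps the name of
  the base.\<close>

lemma bcyc': assumes "bcyc D (a @ p # c)"
  shows "bcyc D' (a @ [p, g, h] @ c)" "bcyc D' (c @ a @ [p, g, h])" "bcyc D' ([g, h] @ c @ a @ [p])"
proof -
  have b: "bcyc D (p # c @ a)" using bcyc_rotate[of D a "p # c"] assms by simp
  have n: "g \<notin> set (p # c @ a)" "h \<notin> set (p # c @ a)"
    using b gh diagramD(7)[OF diD] by (auto simp: bcyc_def)
  have "cyc (nxt D') (p # g # h # c @ a)"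
    using cyc_insert2[OF _ n gh(3), of "nxt D"] b by (simp add: bcyc_def D')
  moreover have "set (p # g # h # c @ a) = bnd D'" using b by (auto simp: bcyc_def simps)
  ultimately have r: "bcyc D' (p # g # h # c @ a)" by (simp add: bcyc_def)
  show "bcyc D' (a @ [p, g, h] @ c)" using bcyc_rotate[of D' "p # g # h # c" a] r by simp
  show "bcyc D' (c @ a @ [p, g, h])" using bcyc_rotate[of D' "[p, g, h]" "c @ a"] r by simp
  show "bcyc D' ([g, h] @ c @ a @ [p])" using bcyc_rotate[of D' "[p]" "[g, h] @ c @ a"] r by simp
qed

lemma nonbnd_cyc: assumes "x \<in> darts D'" "x \<notin> bnd D'" 
  obtains l where "cyc (nxt D) (x # l)" "cyc (nxt D') (x # l)" "set (x # l) \<subseteq> darts D - bnd D"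
    "x \<in> darts D" "x \<notin> bnd D"
proof -
  have x: "x \<in> darts D" "x \<notin> bnd D" using assms simps by auto
  obtain m where "bcyc D m" using diagramD(6)[OF diD] by blast
  then obtain l where l: "cyc (nxt D) (x # l)" "set (x # l) \<subseteq> darts D - bnd D"
    using nonbnd_cycle[OF pm(1) _ x] by metis
  have "cyc (nxt D') (x # l)"
    by (rule cyc_cong[OF l(1)]) (use l(2) pb nxt'(4) in fastforce)
  then show ?thesis using that l x by blast
qed

definition lab' where "lab' lab = lab(g := lab d, h := inv_letter (lab d))"

lemma lab': "lab' lab g = lab d" "lab' lab h = inv_letter (lab d)" "x \<in> darts D \<Longrightarrow> lab' lab x = lab x"
  using gh by (auto simp: lab'_def)

lemma labelling': assumes lab: "labelling P D lab" shows "labelling P D' (lab' lab)"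
proof (rule labellingI)
  fix x assume x: "x \<in> darts D'"
  note d = labellingD(1,2)[OF lab dD]
  consider "x = d" | "x = h" | "x = opp D d" | "x = g" | "x \<in> darts D" "x \<noteq> d" "x \<noteq> opp D d"
    using x by (auto simp: simps)
  then show "lab' lab (opp D' x) = inv_letter (lab' lab x)"
  proof cases
    case 5
    then show ?thesis using labellingD(2)[OF lab 5(1)] opp'(5)[OF 5] lab'(3)[where lab=lab] pmapD(3)[OF pm(1) 5(1)] by simp
  qed (use d opp' lab'[where lab=lab] dD basics in simp_all)
  show "lab' lab x \<in> gens P \<times> UNIV"
    using x d(1) labellingD(1)[OF lab] lab'[where lab=lab] by (auto simp only: simps Un_iff insert_iff inv_letter_in empty_iff)
next
  fix x l assume x: "x \<in> darts D'" "x \<notin> bnd D'" and l: "cyc (nxt D') (x # l)"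
  obtain m where m: "cyc (nxt D) (x # m)" "cyc (nxt D') (x # m)" "set (x # m) \<subseteq> darts D - bnd D"
    "x \<in> darts D" "x \<notin> bnd D" by (rule nonbnd_cyc[OF x])
  have "m = l" using cyc_unique[OF m(2) l] .
  moreover have "map (lab' lab) (x # m) = map lab (x # m)"
    by (rule map_cong[OF HOL.refl]) (use m(3) lab'(3)[where lab=lab] in blast)
  ultimately show "map (lab' lab) (x # l) \<in> cyclic_rels P"
    using labellingD(3)[OF lab m(4,5,1)] by metis
qed

text \<open>Both copies of the cut edge belong to a closed set if and only if the edge did; hence
  the new darts follow \<open>d\<close>.\<close>

definition \<kappa> where "\<kappa> K = (if d \<in> K then K \<union> {g, h} else K - {g, h})"

lemma \<kappa>_old: "x \<in> darts D \<Longrightarrow> x \<in> \<kappa> K \<longleftrightarrow> x \<in> K"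
  using gh by (auto simp: \<kappa>_def)

lemma \<kappa>_new: "g \<in> \<kappa> K \<longleftrightarrow> d \<in> K" "h \<in> \<kappa> K \<longleftrightarrow> d \<in> K"
  by (auto simp: \<kappa>_def)

lemma closed': assumes K: "closed_darts D K" shows "closed_darts D' (\<kappa> K)"
  unfolding closed_darts_def
proof (intro ballI conjI impI)
  fix x assume x: "x \<in> darts D'"
  have e: "opp D d \<in> K \<longleftrightarrow> d \<in> K" using closed_opp[OF K dD] .
  consider "x = d" | "x = h" | "x = opp D d" | "x = g" | "x \<in> darts D" "x \<noteq> d" "x \<noteq> opp D d"
    using x by (auto simp: simps)
  then show "opp D' x \<in> \<kappa> K \<longleftrightarrow> x \<in> \<kappa> K"
  proof cases
    case 5
    then show ?thesis using closed_opp[OF K 5(1)] opp'(5)[OF 5] \<kappa>_old pmapD(3)[OF pm(1) 5(1)] by simp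
  qed (use e opp' \<kappa>_old \<kappa>_new dD basics in simp_all)
  assume xb: "x \<notin> bnd D'"
  obtain m where m: "x \<in> darts D" "x \<notin> bnd D" by (rule nonbnd_cyc[OF x xb])
  then have "nxt D' x = nxt D x" using nxt'(4)[of x] pb by metis
  then show "nxt D' x \<in> \<kappa> K \<longleftrightarrow> x \<in> \<kappa> K"
    using closed_nxt[OF K m] \<kappa>_old m(1) pmapD(6)[OF pm(1) m(1)] by simp
qed

lemma \<kappa>_disjoint: "K \<inter> K' = {} \<Longrightarrow> \<kappa> K \<inter> \<kappa> K' = {}"
  by (auto simp: \<kappa>_def)

lemma words': assumes lab: "labelling P D lab" and s: "set (a @ c) \<subseteq> darts D"
  shows "if d \<in> K then estep (elem P) (kword lab (a @ c) K) (kword (lab' lab) (a @ [g, h] @ c) (\<kappa> K))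
         else kword (lab' lab) (a @ [g, h] @ c) (\<kappa> K) = kword lab (a @ c) K"
proof -
  have e: "kword (lab' lab) a (\<kappa> K) = kword lab a K" "kword (lab' lab) c (\<kappa> K) = kword lab c K"
    using s \<kappa>_old lab'(3)[where lab=lab] by (auto intro!: kword_cong)
  show ?thesis
  proof (cases "d \<in> K")
    case True
    have "([], [lab d, inv_letter (lab d)]) \<in> elem P"
      using labellingD(1)[OF lab dD] by (rule elemI(2))
    moreover have "kword (lab' lab) [g, h] (\<kappa> K) = [lab d, inv_letter (lab d)]"
      using True \<kappa>_new lab'[where lab=lab] by (simp add: kword_def)
    ultimately show ?thesis using True e unfolding estep_def kword_append by (metis append_Nil)
  next
    case False
    then have "kword (lab' lab) [g, h] (\<kappa> K) = []" using \<kappa>_new by (simp add: kword_def)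
    then show ?thesis using False e by (simp only: kword_append append_Nil if_False)
  qed
qed

lemma frame: assumes lab: "labelling P D lab" and l: "bcyc D l" "based b D l"
  and b: "b = {} \<or> b = {s}" "b \<subseteq> verts D'"
  shows "frame_step P b D D' lab l"
proof -
  have "p \<in> set l" using l(1) pb by (simp add: bcyc_def)
  then obtain m1 m2 where m: "l = m1 @ p # m2" by (meson split_list)
  note bc = bcyc'[OF l(1)[unfolded m]]
  have sub: "set (m1 @ p # m2) \<subseteq> darts D" using l(1) m diagramD(7)[OF diD] by (auto simp: bcyc_def)
  have np: "nxt D p = hd (m2 @ m1 @ [p])" using cyc_next[of "nxt D" m1 p m2] l(1) m by (simp add: bcyc_def)
  have inner: "set ((m2 @ m1 @ [p]) @ []) \<subseteq> darts D" "set ([] @ (m2 @ m1 @ [p])) \<subseteq> darts D"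
    "set ((m1 @ [p]) @ m2) \<subseteq> darts D" using sub by auto
  \<comment> \<open>If the base is the vertex being cut, reading restarts at \<open>g\<close> or at
    the successor of \<open>p\<close>, whichever still has the name of the base. Both positions
    arise from cutting \<open>l\<close> at a second occurrence of the base. In all other cases the
    starting dart keeps its initial vertex.\<close>
  consider (rotate) "based b D' (m2 @ m1 @ [p, g, h])" "b = {} \<or> org D (nxt D p) = s"
    | (rotate') "based b D' ([g, h] @ m2 @ m1 @ [p])" "b = {} \<or> org D (nxt D p) = s"
    | (stay) "based b D' (m1 @ [p, g, h] @ m2)"
  proof (cases "b = {}")
    case True
    then show ?thesis using rotate by (simp add: based_def)
  next
    case False
    then have bs: "b = {s}" using b by blast
    have hl: "org D (hd l) = s" using l(2) bs m by (simp add: based_def)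
    show ?thesis
    proof (cases "org D (nxt D p) = s")
      case True
      then consider "org D' g = s" | "org D' (nxt D p) = s"
        using one_keeps_name[of s] og b(2) bs by auto
      then show ?thesis
      proof cases
        case 1
        then show ?thesis using rotate' True bs by (simp add: based_def)
      next
        case 2
        have "hd (m2 @ m1 @ [p, g, h]) = nxt D p" using np by (cases m2; cases m1) auto
        then show ?thesis using rotate True bs 2 by (simp add: based_def)
      qed
    next
      case False
      have hD: "hd l \<in> darts D" using sub m by (cases m1) auto
      have "hd l \<notin> orbit (rot D') y"
      proof
        assume "hd l \<in> orbit (rot D') y"
        then have "gD (hd l) = org D d" using gD_orbit[OF yD'] gD_y by simp
        then show False using gD(3)[OF hD] hl False og by simp
      qed
      then have "org D' (hd l) = s" using org' gD(3)[OF hD] hl by simp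
      moreover have "hd (m1 @ [p, g, h] @ m2) = hd l" using m by (cases m1) auto
      ultimately show ?thesis using stay bs by (simp add: based_def)
    qed
  qed
  then show ?thesis
  proof cases
    case rotate
    have c: "b \<noteq> {} \<Longrightarrow> m1 @ [p] = [] \<or> m2 = [] \<or> org D (hd (m1 @ [p])) = org D (hd m2)"
      using rotate(2) l(2) b np m by (cases m2; cases m1) (auto simp: based_def)
    show ?thesis
    proof (rule frame_stepI[of l "m1 @ [p]" m2 b D P D' "lab' lab" "(m2 @ m1 @ [p]) @ [g, h] @ []" \<kappa> d lab])
      fix K assume "closed_darts D K"
      show "if d \<in> K then estep (elem P) (kword lab (m2 @ (m1 @ [p])) K) (kword (lab' lab) ((m2 @ m1 @ [p]) @ [g, h] @ []) (\<kappa> K))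
         else kword (lab' lab) ((m2 @ m1 @ [p]) @ [g, h] @ []) (\<kappa> K) = kword lab (m2 @ (m1 @ [p])) K"
        using words'[OF lab inner(1), of K] by (simp only: append_Nil2)
    qed (use labelling'[OF lab] closed' \<kappa>_disjoint c bc rotate(1) m in simp_all)
  next
    case rotate'
    have c: "b \<noteq> {} \<Longrightarrow> m1 @ [p] = [] \<or> m2 = [] \<or> org D (hd (m1 @ [p])) = org D (hd m2)"
      using rotate'(2) l(2) b np m by (cases m2; cases m1) (auto simp: based_def)
    show ?thesis
    proof (rule frame_stepI[of l "m1 @ [p]" m2 b D P D' "lab' lab" "[] @ [g, h] @ (m2 @ m1 @ [p])" \<kappa> d lab])
      fix K assume "closed_darts D K"
      show "if d \<in> K then estep (elem P) (kword lab (m2 @ (m1 @ [p])) K) (kword (lab' lab) ([] @ [g, h] @ (m2 @ m1 @ [p])) (\<kappa> K))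
         else kword (lab' lab) ([] @ [g, h] @ (m2 @ m1 @ [p])) (\<kappa> K) = kword lab (m2 @ (m1 @ [p])) K"
        using words'[OF lab inner(2), of K] by (simp only: append_Nil)
    qed (use labelling'[OF lab] closed' \<kappa>_disjoint c bc rotate'(1) m in simp_all)
  next
    case stay
    show ?thesis
    proof (rule frame_stepI[of l l "[]" b D P D' "lab' lab" "(m1 @ [p]) @ [g, h] @ m2" \<kappa> d lab])
      fix K assume "closed_darts D K"
      show "if d \<in> K then estep (elem P) (kword lab ([] @ l) K) (kword (lab' lab) ((m1 @ [p]) @ [g, h] @ m2) (\<kappa> K))
         else kword (lab' lab) ((m1 @ [p]) @ [g, h] @ m2) (\<kappa> K) = kword lab ([] @ l) K"
        using words'[OF lab inner(3), of K] by (simp only: append_Nil m append_assoc append_Cons)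
    qed (use labelling'[OF lab] closed' \<kappa>_disjoint bc stay m in simp_all)
  qed
qed

end

lemma shelling_move_frame:
  assumes D: "diagram D" and D': "diagram D'" and m: "shelling_move D D'"
    and lab: "labelling P D lab" and l: "bcyc D l" "based b D l"
    and b: "b = {} \<or> b = {s}" "b \<subseteq> verts D'"
  shows "frame_step P b D D' lab l"
proof -
  from m consider "collapse1 D D'" | "collapse2 D D'" | "expand1 D D'" by (auto simp: shelling_move_def)
  then show ?thesis
  proof cases
    case 1
    obtain d e v p where "removal1 D D' d e v p" using collapse1E[OF D 1] by metis
    then show ?thesis using removal1.frame[OF _ D lab l b(2)] by blast
  next
    case 2
    obtain d e t v where "removal2 D D' d e t v" using collapse2E[OF D 2] by metis
    then show ?thesis using removal2.frame[OF _ D lab l] by blast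
  next
    case 3
    obtain d p w g h y where "expansion D D' d p w g h y"
      using 3 D D' unfolding expand1_def expansion_def Let_def by blast
    then show ?thesis using expansion.frame[OF _ lab l b] by blast
  qed
qed

section \<open>Shellings yield null sequences\<close>

lemma split_list_at: assumes "l = [] \<or> Q (hd l)"
  shows "\<exists>ss. concat ss = l \<and> (\<forall>s\<in>set ss. s \<noteq> [] \<and> Q (hd s) \<and> (\<forall>x\<in>set (tl s). \<not> Q x))"
  using assms
proof (induction "length l" arbitrary: l rule: less_induct)
  case less
  show ?case
  proof (cases l)
    case Nil
    then show ?thesis by (intro exI[of _ "[]"]) simp
  next
    case (Cons x xs)
    let ?r = "dropWhile (\<lambda>y. \<not> Q y) xs" and ?s = "x # takeWhile (\<lambda>y. \<not> Q y) xs"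
    have "?r = [] \<or> Q (hd ?r)" using hd_dropWhile[of "\<lambda>y. \<not> Q y" xs] by auto
    moreover have "length ?r < length l" using Cons length_dropWhile_le[of "\<lambda>y. \<not> Q y" xs] by simp
    ultimately obtain ss where ss: "concat ss = ?r"
      "\<forall>s\<in>set ss. s \<noteq> [] \<and> Q (hd s) \<and> (\<forall>x\<in>set (tl s). \<not> Q x)" using less.hyps by metis
    show ?thesis
      by (intro exI[of _ "?s # ss"]) (use ss Cons less.prems in \<open>auto dest: set_takeWhileD\<close>)
  qed
qed

text \<open>Sets chosen separately might overlap away from the boundary. Subtracting those already
  chosen makes them disjoint and keeps their traces on the boundary, since these are
  disjoint.\<close>

lemma disjoint_enclosures:
  assumes "\<forall>s\<in>set ss. encloses D s" "distinct (concat ss)"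
  shows "\<exists>Bs. list_all2 (\<lambda>s B. closed_darts D B \<and> B \<inter> bnd D = set s) ss Bs \<and> sorted_wrt (\<lambda>K K'. K \<inter> K' = {}) Bs"
  using assms
proof (induction ss)
  case (Cons s ss)
  then obtain Bs where Bs: "list_all2 (\<lambda>s B. closed_darts D B \<and> B \<inter> bnd D = set s) ss Bs"
    "sorted_wrt (\<lambda>K K'. K \<inter> K' = {}) Bs" by auto
  obtain K where K: "closed_darts D K" "K \<inter> bnd D = set s" using Cons.prems by (auto simp: encloses_def)
  have B: "closed_darts D B \<and> (\<exists>s'\<in>set ss. B \<inter> bnd D = set s')" if "B \<in> set Bs" for B
    using Bs(1) that by (induction ss Bs rule: list_all2_induct) auto
  let ?C = "K - \<Union>(set Bs)"
  have "closed_darts D (K - \<Union>(set Bs))"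
    using K(1) B unfolding closed_darts_def by (simp add: Ball_def)
  moreover have "?C \<inter> bnd D = set s"
  proof
    show "?C \<inter> bnd D \<subseteq> set s" using K(2) by blast
    show "set s \<subseteq> ?C \<inter> bnd D"
    proof
      fix x assume x: "x \<in> set s"
      have "x \<notin> B" if BB: "B \<in> set Bs" for B
      proof
        assume "x \<in> B"
        moreover obtain s' where "s' \<in> set ss" "B \<inter> bnd D = set s'" using B[OF BB] by blast
        ultimately have "x \<in> set (concat ss)" using x K(2) by auto
        then show False using Cons.prems(2) x by auto
      qed
      then show "x \<in> ?C \<inter> bnd D" using x K(2) by blast
    qed
  qed
  ultimately show ?case using Bs by (intro exI[of _ "?C # Bs"]) auto
qed simp

lemma first_return_past:
  assumes "successively (\<lambda>a b. f a = b) (z # ys)" "\<forall>y\<in>set ys. y \<notin> A" "m > 0" "(f ^^ m) (last (z # ys)) \<in> A"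
  shows "first_return A f z = first_return A f (last (z # ys)) \<and> (\<exists>m>0. (f ^^ m) z \<in> A)"
  using assms
proof (induction ys arbitrary: z)
  case (Cons y ys)
  then have fz: "f z = y" and ih: "first_return A f y = first_return A f (last (y # ys))" "\<exists>m>0. (f ^^ m) y \<in> A"
    by auto
  then obtain k where k: "k > 0" "(f ^^ k) (f z) \<in> A" by blast
  have "first_return A f z = first_return A f (f z)"
    by (rule first_return_skip[OF _ k]) (use Cons.prems fz in auto)
  moreover have "(f ^^ Suc k) z \<in> A" using k by (simp add: funpow_swap1)
  ultimately show ?case using ih fz by auto
qed auto

section \<open>One side of a fragmentation\<close>

locale fragment_side =
  fixes D E :: diag and v V V' A A'
  assumes diD: "diagram D" and diE: "diagram E" and VV: "V \<inter> V' = {v}"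
    and AA: "A \<union> A' = darts D" "A \<inter> A' = {}" and cl: "\<forall>c\<in>cells D. c \<subseteq> A \<or> c \<subseteq> A'"
    and E: "E = subdiag D V A (bnd D \<inter> A)" and oA': "org D ` A' \<subseteq> V'"
begin

lemma pm: "pmap D" "pmap E" using diD diE by (auto simp: diagram_iff)

lemma E_simps: "verts E = V" "darts E = A" "opp E = opp D" "org E = org D" "bnd E = bnd D \<inter> A"
    "nxt E x = first_return A (rot D) (opp D x)"
  by (simp_all add: E subdiag_def)

lemma oppA: "x \<in> A \<Longrightarrow> opp D x \<in> A" using pmapD(3)[OF pm(2)] by (simp add: E_simps)

lemma closedA: "closed_darts D A"
  unfolding closed_darts_def
proof (intro ballI conjI impI)
  fix x assume x: "x \<in> darts D"
  show "opp D x \<in> A \<longleftrightarrow> x \<in> A" using oppA pmapD(5)[OF pm(1) x] by metis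
  assume xb: "x \<notin> bnd D"
  obtain l where l: "bcyc D l" using diagramD(6)[OF diD] by blast
  obtain t where t: "cyc (nxt D) (x # t)" "set (x # t) \<subseteq> darts D - bnd D" "orbit (nxt D) x = set (x # t)"
    by (rule nonbnd_cycle[OF pm(1) l x xb])
  have "set (x # t) \<in> cells D" using cells_eq[OF pm(1) l diagramD(7)[OF diD]] x xb t(3) by (metis DiffI imageI)
  then have "set (x # t) \<subseteq> A \<or> set (x # t) \<subseteq> A'" using cl by blast
  moreover have "nxt D x \<in> set (x # t)" using cyc_in[OF t(1)] by simp
  ultimately show "nxt D x \<in> A \<longleftrightarrow> x \<in> A" using AA(2) by auto
qed

lemma AD: "x \<in> A \<Longrightarrow> x \<in> darts D" using AA by blast

lemma nxtE: "x \<in> A \<Longrightarrow> nxt D x \<in> A \<Longrightarrow> nxt E x = nxt D x"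
  using first_return_step[of "rot D" "opp D x" A] rot_opp[OF pm(1), of x] AD by (simp add: E_simps)

lemma nonbnd_cyc: assumes "x \<in> A" "x \<notin> bnd D"
  obtains t where "cyc (nxt D) (x # t)" "cyc (nxt E) (x # t)" "nxt D x = nxt E x"
proof -
  obtain l where l: "bcyc D l" using diagramD(6)[OF diD] by blast
  obtain t where t: "cyc (nxt D) (x # t)" "set (x # t) \<subseteq> darts D - bnd D"
    using nonbnd_cycle[OF pm(1) l AD[OF assms(1)] assms(2)] by metis
  have tA: "set (x # t) \<subseteq> A" using closed_cycle[OF closedA t] assms(1) by blast
  have e: "nxt D y = nxt E y" if "y \<in> set (x # t)" for y
    using nxtE[of y] that tA cyc_in[OF t(1) that] by (metis subsetD)
  have "cyc (nxt E) (x # t)" by (rule cyc_cong[OF t(1) e])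
  then show ?thesis using that t(1) e[of x] by simp
qed

lemma labelling_side: assumes "labelling P D lab" shows "labelling P E lab"
proof (rule labellingI)
  fix x assume x: "x \<in> darts E"
  then have xD: "x \<in> darts D" using AD by (simp add: E_simps)
  show "lab x \<in> gens P \<times> UNIV" using labellingD(1)[OF assms xD] .
  show "lab (opp E x) = inv_letter (lab x)" using labellingD(2)[OF assms xD] by (simp add: E_simps)
next
  fix x l assume x: "x \<in> darts E" "x \<notin> bnd E" and l: "cyc (nxt E) (x # l)"
  then have xA: "x \<in> A" "x \<notin> bnd D" by (auto simp: E_simps)
  obtain t where t: "cyc (nxt D) (x # t)" "cyc (nxt E) (x # t)" by (rule nonbnd_cyc[OF xA])
  have "t = l" using cyc_unique[OF t(2) l] .
  then show "map lab (x # l) \<in> cyclic_rels P" using labellingD(3)[OF assms AD[OF xA(1)] xA(2)] t(1) by blast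
qed

lemma closed_side: assumes "closed_darts D K" shows "closed_darts E K"
  unfolding closed_darts_def
proof (intro ballI conjI impI)
  fix x assume x: "x \<in> darts E"
  then have xD: "x \<in> darts D" "x \<in> A" using AD by (simp_all add: E_simps)
  show "opp E x \<in> K \<longleftrightarrow> x \<in> K" using closed_opp[OF assms xD(1)] by (simp add: E_simps)
  assume "x \<notin> bnd E"
  then have xb: "x \<notin> bnd D" using xD by (simp add: E_simps)
  obtain t where "nxt D x = nxt E x" by (rule nonbnd_cyc[OF xD(2) xb])
  then show "nxt E x \<in> K \<longleftrightarrow> x \<in> K" using closed_nxt[OF assms xD(1) xb] by simp
qed

lemma orgA: "x \<in> A \<Longrightarrow> org D x \<in> V" using pmapD(8)[OF pm(2)] by (simp add: E_simps)

text \<open>A dart and its successor on different sides share a vertex of both sides, and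
  \<open>v\<close> is the only one.\<close>

lemma switch: assumes "x \<in> darts D" "(x \<in> A) \<noteq> (nxt D x \<in> A)" shows "org D (nxt D x) = v"
proof -
  have o: "opp D x \<in> A \<longleftrightarrow> x \<in> A" using closed_opp[OF closedA assms(1)] .
  have D: "opp D x \<in> darts D" "nxt D x \<in> darts D" using pmapD[OF pm(1)] assms(1) by auto
  have n: "org D (nxt D x) = org D (opp D x)" using org_nxt[OF diD assms(1)] .
  have "org D y \<in> V'" if "y \<in> darts D" "y \<notin> A" for y using that AA oA' by blast
  then have "org D (nxt D x) \<in> V \<inter> V'" using o D n assms(2) orgA by (metis IntI)
  then show ?thesis using VV by simp
qed

definition seg :: "nat list \<Rightarrow> bool" where
  "seg s \<longleftrightarrow> s \<noteq> [] \<and> set s \<subseteq> bnd D \<and> successively (\<lambda>a b. nxt D a = b) s \<and> org D (hd s) = v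
     \<and> org D (nxt D (last s)) = v \<and> (set s \<subseteq> A \<or> set s \<inter> A = {}) \<and> encloses D s"

text \<open>The rotation enters the sector of the loop \<open>s\<close> at its first dart and leaves
  it at the reverse of its last dart. All darts in between belong to the set enclosed by
  \<open>s\<close> and lie outside \<open>A\<close>, so no return to \<open>A\<close> happens before
  the sector has been passed.\<close>

lemma hop: assumes s: "seg s" "set s \<inter> A = {}" and x: "x \<in> bnd D" "nxt D x = hd s"
    and m: "a \<in> A" "org D a = v"
  shows "first_return A (rot D) (opp D x) = first_return A (rot D) (opp D (last s))"
proof -
  note s' = s(1)[unfolded seg_def]
  obtain B where B: "closed_darts D B" "B \<inter> bnd D = set s" using s' by (auto simp: encloses_def)
  have bD: "bnd D \<subseteq> darts D" by (rule diagramD[OF diD])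
  have sD: "set s \<subseteq> darts D" using s' bD by blast
  have hs: "hd s \<in> set s" "last s \<in> set s" using s' by auto
  have lo: "opp D (last s) \<in> darts D" using pmapD(3)[OF pm(1)] hs sD by blast
  have "last s \<in> darts D" using hs sD by blast
  then have oo: "org D (opp D (last s)) = v" using org_nxt[OF diD, of "last s"] s' by simp
  obtain t where t: "cyc (rot D) (hd s # t)" "set (hd s # t) \<subseteq> darts D" "orbit (rot D) (hd s) = set (hd s # t)"
    using rot_cycle[OF pm(1), of "hd s"] hs sD by blast
  have "opp D (last s) \<in> set (hd s # t)"
    using diagramD(3)[OF diD] lo oo hs sD s' t(3) unfolding orgcond_def by blast
  then obtain p1 p2 where p: "hd s # t = p1 @ opp D (last s) # p2" by (meson split_list)
  have aD: "a \<in> darts D" using AD m(1) .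
  have ad: "a \<in> orbit (rot D) (opp D (last s))"
    using diagramD(3)[OF diD] lo oo aD m(2) unfolding orgcond_def by metis
  then obtain k where k: "k > 0" "(rot D ^^ k) (opp D (last s)) \<in> A" using m(1) unfolding orbit_altdef by blast
  have ro: "rot D (opp D x) = hd s" using rot_opp[OF pm(1), of x] x bD by auto
  \<comment> \<open>If the reverse of \<open>y\<close> lies inside the diagram, closedness of
    \<open>B\<close> and of \<open>A\<close> applies. If it is a boundary dart, it belongs to
    \<open>s\<close>, and as it is not the last one its successor belongs to \<open>s\<close> as
    well.\<close>
  have step: "rot D y \<in> B - A" if y: "y \<in> B - A" "y \<in> darts D" "y \<noteq> opp D (last s)" for y
  proof -
    let ?o = "opp D y"
    have o: "?o \<in> B" "?o \<notin> A" "?o \<in> darts D" "?o \<noteq> last s"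
      using closed_opp[OF B(1) y(2)] closed_opp[OF closedA y(2)] y pmapD(3,5)[OF pm(1) y(2)] by auto
    show ?thesis
    proof (cases "?o \<in> bnd D")
      case False
      then show ?thesis using closed_nxt[OF B(1) o(3)] closed_nxt[OF closedA o(3)] o by (simp add: rot_def)
    next
      case True
      then have "?o \<in> set s" using o B(2) by blast
      then obtain q1 q2 where q: "s = q1 @ ?o # q2" by (meson split_list)
      then have "q2 \<noteq> []" using o(4) by auto
      then have "nxt D ?o = hd q2" "hd q2 \<in> set s" using s' q by (auto simp: successively_append_iff successively_Cons)
      then show ?thesis using s(2) B(2) unfolding rot_def by auto
    qed
  qed
  have all: "set (p1 @ [opp D (last s)]) \<subseteq> B - A"
  proof -
    have "set (p1' @ [z]) \<subseteq> B - A" if "p1 @ [opp D (last s)] = p1' @ [z] @ r" for p1' z r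
      using that
    proof (induction p1' arbitrary: z r rule: rev_induct)
      case Nil
      then have "z = hd s" using p by (cases p1) auto
      then show ?case using hs B(2) s(2) by auto
    next
      case (snoc u us)
      then have ih: "set (us @ [u]) \<subseteq> B - A" by (metis append.assoc append_Cons append_Nil)
      have e: "hd s # t = us @ u # z # r @ p2" using p snoc.prems by simp
      then have "rot D u = z" using t(1) by (auto simp: cyc_def successively_append_iff)
      moreover have "u \<in> darts D" using t(2) e by auto
      moreover have "u \<noteq> opp D (last s)"
      proof -
        have dl: "distinct (us @ u # z # r @ p2)" using t(1) e by (metis cyc_def)
        have "last (p1 @ [opp D (last s)]) = last ((us @ [u]) @ z # r)" using snoc.prems by simp
        then have "opp D (last s) = last (z # r)" by simp
        then have "opp D (last s) \<in> set (z # r)" using last_in_set[of "z # r"] by simp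
        then show ?thesis using dl by auto
      qed
      ultimately have "z \<in> B - A" using step[of u] ih by auto
      then show ?case using ih by simp
    qed
    from this[of p1 "opp D (last s)" "[]"] show ?thesis by simp
  qed
  have "successively (\<lambda>a b. rot D a = b) (opp D x # p1 @ [opp D (last s)])"
  proof -
    have "successively (\<lambda>a b. rot D a = b) (p1 @ opp D (last s) # p2)" using t(1) p by (metis cyc_def)
    moreover have "hd (p1 @ [opp D (last s)]) = hd s" using p by (cases p1) auto
    ultimately show ?thesis using ro by (auto simp: successively_append_iff successively_Cons)
  qed
  from first_return_past[OF this, of A k] all k show ?thesis by auto
qed

lemma chain: assumes "successively (\<lambda>a b. nxt D a = b) (z # concat ss)" "\<forall>s\<in>set ss. seg s" "z \<in> bnd D"
    "filter (\<lambda>x. x \<in> A) (concat ss) \<noteq> []"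
  shows "first_return A (rot D) (opp D z) = hd (filter (\<lambda>x. x \<in> A) (concat ss))"
  using assms
proof (induction ss arbitrary: z)
  case (Cons s ss)
  have s: "seg s" "s \<noteq> []" using Cons.prems(2) by (auto simp: seg_def)
  have nz: "nxt D z = hd s" using Cons.prems(1) s(2) by (simp add: successively_Cons)
  have zD: "z \<in> darts D" using Cons.prems(3) diagramD(7)[OF diD] by blast
  show ?case
  proof (cases "set s \<subseteq> A")
    case True
    then have "hd s \<in> A" using s(2) by auto
    moreover have "rot D (opp D z) = hd s" using rot_opp[OF pm(1) zD] nz by simp
    ultimately show ?thesis using first_return_step[of "rot D" "opp D z" A] s(2) by (cases s) auto
  next
    case False
    then have sA: "set s \<inter> A = {}" using s(1) by (auto simp: seg_def)
    then have f: "filter (\<lambda>x. x \<in> A) s = []" by (auto simp: filter_empty_conv)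
    then have f2: "filter (\<lambda>x. x \<in> A) (concat ss) \<noteq> []" using Cons.prems(4) by simp
    have "\<exists>a\<in>A. org D a = v"
    proof -
      obtain x where "x \<in> set (concat ss)" "x \<in> A" using f2 by (metis filter_False)
      then obtain s' where s': "s' \<in> set ss" "x \<in> set s'" by auto
      then have "set s' \<subseteq> A" "seg s'" using Cons.prems(2) \<open>x \<in> A\<close> unfolding seg_def by auto
      then show ?thesis unfolding seg_def by (metis hd_in_set subsetD)
    qed
    then have h: "first_return A (rot D) (opp D z) = first_return A (rot D) (opp D (last s))"
      using hop[OF s(1) sA Cons.prems(3) nz] by blast
    have "successively (\<lambda>a b. nxt D a = b) (last s # concat ss)"
    proof -
      have "successively (\<lambda>a b. nxt D a = b) ((z # s) @ concat ss)" using Cons.prems(1) by simp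
      then show ?thesis using s(2) unfolding successively_append_iff by (auto simp: successively_Cons)
    qed
    moreover have "last s \<in> bnd D" using s by (auto simp: seg_def)
    ultimately have "first_return A (rot D) (opp D (last s)) = hd (filter (\<lambda>x. x \<in> A) (concat ss))"
      using Cons.IH Cons.prems(2) f2 by auto
    then show ?thesis using h f by simp
  qed
qed simp

text \<open>At the cut vertex the rotation skips the loops of the other side one after the other. So
  the successor in \<open>E\<close> of a boundary dart is the next dart in \<open>A\<close> on the
  circuit of \<open>D\<close>, and deleting the other side from the circuit is correct.\<close>

lemma bcyc_side: assumes l: "bcyc D (concat ss)" and ss: "\<forall>s\<in>set ss. seg s"
  shows "bcyc E (filter (\<lambda>x. x \<in> A) (concat ss))"
proof -
  let ?l = "filter (\<lambda>x. x \<in> A) (concat ss)"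
  have c: "cyc (nxt D) (concat ss)" using l by (simp add: bcyc_def)
  have "cyc (first_return A (nxt D)) ?l" using cyc_first_return[OF c] .
  moreover have "first_return A (nxt D) z = nxt E z" if z: "z \<in> set ?l" for z
  proof (cases "nxt D z \<in> A")
    case True
    then show ?thesis using first_return_step[of "nxt D" z A] nxtE[of z] z by simp
  next
    case False
    obtain s where s: "s \<in> set ss" "z \<in> set s" using z by auto
    then have sA: "set s \<subseteq> A" "seg s" using ss z unfolding seg_def by auto
    have "z = last s"
    proof (rule ccontr)
      assume nl: "z \<noteq> last s"
      obtain q1 q2 where q: "s = q1 @ z # q2" using s(2) by (meson split_list)
      then have "q2 \<noteq> []" using nl by auto
      then have "nxt D z = hd q2" "hd q2 \<in> set s"
        using sA(2) q by (auto simp: seg_def successively_append_iff successively_Cons)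
      then show False using False sA(1) by auto
    qed
    obtain s1 s2 where st: "ss = s1 @ s # s2" using s(1) by (meson split_list)
    obtain s0 where s0: "s = s0 @ [z]" using \<open>z = last s\<close> s(2) by (metis append_butlast_last_id empty_iff empty_set)
    let ?r = "s2 @ s1 @ [s]"
    have "cyc (nxt D) (concat s1 @ s0 @ z # concat s2)" using c st s0 by simp
    then have "cyc (nxt D) (z # concat s2 @ concat s1 @ s0)"
      using cyc_rotate[of "nxt D" "concat s1 @ s0" "z # concat s2"] by simp
    then have "successively (\<lambda>a b. nxt D a = b) ((z # concat s2 @ concat s1 @ s0) @ [z])"
      unfolding successively_append_iff[of _ "z # concat s2 @ concat s1 @ s0"] by (simp add: cyc_def)
    then have suc: "successively (\<lambda>a b. nxt D a = b) (z # concat ?r)" using s0 by simp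
    have ne: "filter (\<lambda>x. x \<in> A) (concat ?r) \<noteq> []" using s(2) z by (auto simp: filter_empty_conv)
    have zb: "z \<in> bnd D" using z l by (auto simp: bcyc_def)
    have "first_return A (rot D) (opp D z) = hd (filter (\<lambda>x. x \<in> A) (concat ?r))"
      using chain[OF suc _ zb ne] ss st by auto
    moreover have "first_return A (nxt D) z = hd (filter (\<lambda>x. x \<in> A) (concat ?r))"
      using first_return_chain[OF suc, of A] ne by (metis list.collapse)
    ultimately show ?thesis by (simp add: E_simps)
  qed
  ultimately have "cyc (nxt E) ?l" by (rule cyc_cong)
  then show ?thesis using l by (auto simp: bcyc_def E_simps)
qed

lemma bcyc_whole: assumes "bnd D \<subseteq> A" "bcyc D l" shows "bcyc E l"
proof -
  have s: "set l \<subseteq> A" using assms by (auto simp: bcyc_def)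
  have "cyc (nxt E) l"
  proof (rule cyc_cong)
    show "cyc (nxt D) l" using assms by (simp add: bcyc_def)
    fix x assume "x \<in> set l"
    then show "nxt D x = nxt E x" using nxtE[of x] s cyc_in[of "nxt D" l x] assms(2) unfolding bcyc_def by (metis subsetD)
  qed
  then show ?thesis using assms by (auto simp: bcyc_def E_simps)
qed

lemma bcyc_none: "bnd D \<inter> A = {} \<Longrightarrow> bcyc E []"
  by (simp add: bcyc_def E_simps)

text \<open>The circuit is cut at all its visits to \<open>v\<close>. As both sides occur on it, the
  side changes somewhere; such a change happens at \<open>v\<close>, which provides a place to
  start. Between two visits the side cannot change.\<close>

lemma segments: assumes b: "bcyc D l" and ne: "bnd D \<inter> A \<noteq> {}" "\<not> bnd D \<subseteq> A"
  obtains u1 u2 ss where "l = u1 @ u2" "concat ss = u2 @ u1" "\<forall>s\<in>set ss. seg s"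
proof -
  have bD: "bnd D \<subseteq> darts D" by (rule diagramD[OF diD])
  have cl: "cyc (nxt D) l" "set l = bnd D" using b by (auto simp: bcyc_def)
  have "\<exists>x\<in>bnd D. x \<in> A \<and> nxt D x \<notin> A"
  proof (rule ccontr)
    assume n: "\<not> ?thesis"
    obtain a where a: "a \<in> bnd D" "a \<in> A" using ne by blast
    have "y \<in> bnd D \<and> y \<in> A" if "y \<in> orbit (nxt D) a" for y
      using that by induction (use n a cyc_in[OF cl(1)] cl(2) in auto)
    then have "bnd D \<subseteq> A" using cyc_orbit[OF cl(1), of a] a cl(2) by blast
    then show False using ne by simp
  qed
  then obtain x where x: "x \<in> bnd D" "x \<in> A" "nxt D x \<notin> A" by blast
  then have xv: "org D (nxt D x) = v" "nxt D x \<in> set l" using switch[of x] bD cyc_in[OF cl(1), of x] cl(2) by auto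
  then obtain u1 u2' where u: "l = u1 @ nxt D x # u2'" by (meson split_list)
  let ?u2 = "nxt D x # u2'"
  have br: "bcyc D (?u2 @ u1)" using bcyc_rotate b u by blast
  obtain ss where ss: "concat ss = ?u2 @ u1"
    "\<forall>s\<in>set ss. s \<noteq> [] \<and> org D (hd s) = v \<and> (\<forall>x\<in>set (tl s). org D x \<noteq> v)"
    using split_list_at[of "?u2 @ u1" "\<lambda>z. org D z = v"] xv(1) by auto
  have br': "bcyc D (concat ss)" using br ss(1) by simp
  have "seg s" if s: "s \<in> set ss" for s
  proof -
    obtain s1 s2 where st: "ss = s1 @ s # s2" using s by (meson split_list)
    have r: "bcyc D (s @ concat s2 @ concat s1)"
      using bcyc_rotate[of D "concat s1" "s @ concat s2"] br' st by simp
    let ?o = "concat s2 @ concat s1"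
    have sp: "s \<noteq> []" "org D (hd s) = v" "\<forall>x\<in>set (tl s). org D x \<noteq> v" using ss(2) s by auto
    have sb: "set s \<subseteq> bnd D" using r by (auto simp: bcyc_def)
    have su: "successively (\<lambda>a b. nxt D a = b) s" using r by (auto simp: bcyc_def cyc_def successively_append_iff)
    have ho: "org D (hd ?o) = v" if "?o \<noteq> []"
    proof -
      have "\<exists>s'\<in>set ss. hd ?o = hd s'"
      proof (cases s2)
        case Nil
        then show ?thesis using that st ss(2) by (cases s1) auto
      next
        case (Cons a as)
        then show ?thesis using st ss(2) by auto
      qed
      then show ?thesis using ss(2) by auto
    qed
    obtain s0 z where s0: "s = s0 @ [z]" using sp(1) by (cases s rule: rev_cases) auto
    then have "cyc (nxt D) (s0 @ z # ?o)" using r by (simp add: bcyc_def)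
    then have nl: "nxt D (last s) = hd (?o @ s)" using cyc_next[of "nxt D" s0 z ?o] s0 by simp
    then have ol: "org D (nxt D (last s)) = v" using ho sp by (cases "?o = []") (simp_all only: append_Nil hd_append2 not_False_eq_True)
    have en: "encloses D s"
    proof (cases "?o = []")
      case True
      then have "bcyc D s" using r by (metis append_Nil2)
      then show ?thesis unfolding encloses_def
        by (intro exI[of _ UNIV]) (simp add: closed_darts_def bcyc_def)
    next
      case False
      have "enclosing D" using diagram_enclosing[OF diD] .
      then show ?thesis unfolding enclosing_def using r sp(1,2) False ho[OF False] by metis
    qed
    have "set q \<subseteq> A \<or> set q \<inter> A = {}"
      if "successively (\<lambda>a b. nxt D a = b) q" "\<forall>x\<in>set (tl q). org D x \<noteq> v" "set q \<subseteq> darts D" for q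
      using that
    proof (induction q)
      case (Cons x q)
      show ?case
      proof (cases q)
        case (Cons y q')
        have "(x \<in> A) = (y \<in> A)" using switch[of x] Cons.prems Cons by auto
        moreover have "set q \<subseteq> A \<or> set q \<inter> A = {}" using Cons.IH Cons.prems Cons by auto
        ultimately show ?thesis using Cons by auto
      qed auto
    qed simp
    from this[of s] have "set s \<subseteq> A \<or> set s \<inter> A = {}" using su sp sb bD by blast
    then show ?thesis unfolding seg_def using sp su sb ol en by blast
  qed
  then show ?thesis using that[of u1 ?u2 ss] u ss(1) by blast
qed

end

text \<open>The invariant carried along a shelling. All words are read along one circuit from one
  starting dart. A list is needed because a change of the base occurrence and a fragmentation both
  subdivide the closed sets.\<close>

definition words_of :: "'a presentation \<Rightarrow> nat set \<Rightarrow> diag \<Rightarrow> 'a word list \<Rightarrow> bool" where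
  "words_of P b D ws \<longleftrightarrow> (\<exists>lab l Ks. labelling P D lab \<and> bcyc D l \<and> based b D l
    \<and> (\<forall>K\<in>set Ks. closed_darts D K) \<and> sorted_wrt (\<lambda>K K'. K \<inter> K' = {}) Ks \<and> ws = map (kword lab l) Ks)"

text \<open>By disjointness every dart of the circuit contributes a letter to at most one of the
  words.\<close>

lemma kword_total_length: assumes "sorted_wrt (\<lambda>K K'. K \<inter> K' = {}) Ks"
  shows "(\<Sum>w\<leftarrow>map (kword lab l) Ks. length w) \<le> length l"
proof (induction l)
  case (Cons x l)
  have one: "(\<Sum>K\<leftarrow>Ks. of_bool (x \<in> K)) \<le> (1::nat)"
    using assms
  proof (induction Ks)
    case (Cons K Ks)
    have "(\<Sum>K\<leftarrow>Ks. of_bool (x \<in> K)) = (0::nat)" if "x \<in> K"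
      using Cons.prems that by (auto simp: sum_list_eq_0_iff)
    then show ?case using Cons by (cases "x \<in> K") auto
  qed simp
  have "length (kword lab (x # l) K) = of_bool (x \<in> K) + length (kword lab l K)" for K
    by (simp add: kword_def)
  then have "(\<Sum>w\<leftarrow>map (kword lab (x # l)) Ks. length w) =
    (\<Sum>K\<leftarrow>Ks. of_bool (x \<in> K)) + (\<Sum>w\<leftarrow>map (kword lab l) Ks. length w)"
    by (simp only: map_map o_def sum_list_addf)
  then show ?case using one Cons by simp
qed (simp add: kword_def o_def)

lemma perim_bcyc: "bcyc D l \<Longrightarrow> perim D = length l"
  unfolding perim_def bcyc_def cyc_def by (metis distinct_card)

lemma words_of_perim: "words_of P b D ws \<Longrightarrow> (\<Sum>w\<leftarrow>ws. length w) \<le> perim D"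
  using kword_total_length perim_bcyc unfolding words_of_def by fastforce

lemma words_of_single_vertex: assumes "diagram D" "single_vertex D" "words_of P b D ws"
  shows "\<forall>w\<in>set ws. w = []"
proof -
  have "bnd D = {}" using assms(1,2) diagramD(7)[OF assms(1)] by (auto simp: single_vertex_def)
  then show ?thesis using assms(3) by (auto simp: words_of_def bcyc_def)
qed

text \<open>The dart \<open>d\<close> of the frame lies in at most one of the disjoint sets, so at
  most one word changes. The preliminary change of the starting dart rotates the words in the free
  case; with a base it is absorbed by a finer family of sets with the same concatenation.\<close>

lemma words_step:
  assumes D: "diagram D" "diagram D'" "shelling_move D D'" and b: "b = {} \<or> b = {s}" "b \<subseteq> verts D'"
    and w: "words_of P b D ws"
  shows "\<exists>ws0 ws'. words_of P b D' ws'
    \<and> (b = {} \<longrightarrow> list_all2 (\<lambda>w w0. \<exists>x y. w = x @ y \<and> w0 = y @ x) ws ws0)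
    \<and> (b \<noteq> {} \<longrightarrow> concat ws0 = concat ws)
    \<and> (ws' = ws0 \<or> (\<exists>pre w post w'. ws0 = pre @ [w] @ post \<and> ws' = pre @ [w'] @ post \<and> estep (elem P) w w'))"
proof -
  obtain lab l Ks where f: "labelling P D lab" "bcyc D l" "based b D l" "\<forall>K\<in>set Ks. closed_darts D K"
    "sorted_wrt (\<lambda>K K'. K \<inter> K' = {}) Ks" "ws = map (kword lab l) Ks"
    using w unfolding words_of_def by blast
  have "frame_step P b D D' lab l" using shelling_move_frame[OF D(1,2,3) f(1-3) b] .
  then obtain u1 u2 lab' l' \<kappa> d where u: "l = u1 @ u2"
    and hd: "b \<noteq> {} \<longrightarrow> u1 = [] \<or> u2 = [] \<or> org D (hd u1) = org D (hd u2)"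
    and l': "labelling P D' lab'" "bcyc D' l'" "based b D' l'"
    and \<kappa>: "\<forall>K. closed_darts D K \<longrightarrow> closed_darts D' (\<kappa> K)" "\<forall>K K'. K \<inter> K' = {} \<longrightarrow> \<kappa> K \<inter> \<kappa> K' = {}"
    and st: "\<forall>K. closed_darts D K \<longrightarrow>
        (if d \<in> K then estep (elem P) (kword lab (u2 @ u1) K) (kword lab' l' (\<kappa> K))
         else kword lab' l' (\<kappa> K) = kword lab (u2 @ u1) K)"
    unfolding frame_step_def by (elim exE conjE) (rule that; assumption)
  have "\<exists>Ks0. (\<forall>K\<in>set Ks0. closed_darts D K) \<and> sorted_wrt (\<lambda>K K'. K \<inter> K' = {}) Ks0
    \<and> (b = {} \<longrightarrow> Ks0 = Ks) \<and> (b \<noteq> {} \<longrightarrow> concat (map (kword lab (u2 @ u1)) Ks0) = concat ws)"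
  proof (cases "b = {} \<or> u1 = [] \<or> u2 = []")
    case True
    then show ?thesis using f(4-6) u by (intro exI[of _ Ks]) auto
  next
    case False
    \<comment> \<open>Each closed set is cut along the loop \<open>u1\<close>. Read along
      \<open>u2 @ u1\<close>, its two parts yield the letters from \<open>u1\<close> and the letters
      from \<open>u2\<close> in this order, so their concatenation is what was read along
      \<open>u1 @ u2\<close>.\<close>
    have e: "enclosing D" using diagram_enclosing[OF D(1)] .
    have "bcyc D (u1 @ u2)" "org D (hd u1) = org D (hd u2)" "u1 \<noteq> []" "u2 \<noteq> []" using f(2) u hd False by auto
    then have "encloses D u1" using e unfolding enclosing_def by blast
    then obtain B where B: "closed_darts D B" "B \<inter> bnd D = set u1" unfolding encloses_def by blast
    have su: "set u1 \<subseteq> B" "set u2 \<inter> B = {}"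
      using f(2) u B(2) by (auto simp: bcyc_def cyc_def)
    have k: "kword lab u1 (K \<inter> B) = kword lab u1 K" "kword lab u2 (K \<inter> B) = []"
      "kword lab u1 (K - B) = []" "kword lab u2 (K - B) = kword lab u2 K" for K
      using su by (auto intro!: kword_cong kword_none)
    let ?Ks = "concat (map (\<lambda>K. [K \<inter> B, K - B]) Ks)"
    have "concat (map (kword lab (u2 @ u1)) (concat (map (\<lambda>K. [K \<inter> B, K - B]) Ks))) = concat (map (kword lab l) Ks)" for Ks
      by (induction Ks) (simp_all add: u k)
    moreover have "\<forall>K\<in>set ?Ks. closed_darts D K"
      using f(4) B(1) by (auto simp: closed_darts_def)
    moreover have "sorted_wrt (\<lambda>K K'. K \<inter> K' = {}) ?Ks"
      using f(5) by (induction Ks) auto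
    ultimately show ?thesis using f(6) False by (intro exI[of _ ?Ks]) auto
  qed
  then obtain Ks0 where K0: "\<forall>K\<in>set Ks0. closed_darts D K" "sorted_wrt (\<lambda>K K'. K \<inter> K' = {}) Ks0"
    "b = {} \<longrightarrow> Ks0 = Ks" "b \<noteq> {} \<longrightarrow> concat (map (kword lab (u2 @ u1)) Ks0) = concat ws" by blast
  let ?ws0 = "map (kword lab (u2 @ u1)) Ks0" and ?ws' = "map (kword lab' l') (map \<kappa> Ks0)"
  have "sorted_wrt (\<lambda>K K'. K \<inter> K' = {}) (map \<kappa> Ks0)"
    unfolding sorted_wrt_map using K0(2) by (rule sorted_wrt_mono_rel[rotated]) (use \<kappa>(2) in blast)
  then have "words_of P b D' ?ws'"
    unfolding words_of_def using l' K0(1) \<kappa>(1) by (intro exI[of _ lab'] exI[of _ l'] exI[of _ "map \<kappa> Ks0"]) auto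
  moreover have "b = {} \<longrightarrow> list_all2 (\<lambda>w w0. \<exists>x y. w = x @ y \<and> w0 = y @ x) ws ?ws0"
    using K0(3) f(6) u by (auto simp: list_all2_conv_all_nth)
  moreover have "?ws' = ?ws0 \<or> (\<exists>pre w post w'. ?ws0 = pre @ [w] @ post \<and> ?ws' = pre @ [w'] @ post \<and> estep (elem P) w w')"
  proof (cases "\<exists>K\<in>set Ks0. d \<in> K")
    case False
    then have "?ws' = ?ws0" using st K0(1) by auto
    then show ?thesis ..
  next
    case True
    then obtain K where K: "K \<in> set Ks0" "d \<in> K" by blast
    then obtain pre post where p: "Ks0 = pre @ K # post" by (meson split_list)
    have "d \<notin> K'" if "K' \<in> set pre \<union> set post" for K'
      using K0(2) p that K(2) by (auto simp: sorted_wrt_append)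
    then have "map (kword lab' l') (map \<kappa> pre) = map (kword lab (u2 @ u1)) pre"
      "map (kword lab' l') (map \<kappa> post) = map (kword lab (u2 @ u1)) post"
      using st K0(1) p by auto
    moreover have "estep (elem P) (kword lab (u2 @ u1) K) (kword lab' l' (\<kappa> K))"
      using st K0(1) K by auto
    ultimately show ?thesis using p
      by (intro disjI2 exI[of _ "map (kword lab (u2 @ u1)) pre"] exI[of _ "kword lab (u2 @ u1) K"]
          exI[of _ "map (kword lab (u2 @ u1)) post"] exI[of _ "kword lab' l' (\<kappa> K)"]) simp
  qed
  ultimately show ?thesis using K0(4) by blast
qed

lemma estep_context: "estep R w w' \<Longrightarrow> estep R (a @ w @ c) (a @ w' @ c)"
  unfolding estep_def by (metis append.assoc)

text \<open>An empty factor is handled by \<open>undrop\<close>. The rule \<open>frag\<close> itself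
  is restricted to nonempty factors, because a component with empty boundary has no dart at which it
  could be wedged.\<close>

lemma null_seq_frag: assumes "fr" "rt" "null_seq rt fr R L n (add_mset u (add_mset v W))"
  shows "null_seq rt fr R L n (add_mset (u @ v) W)"
proof (cases "u = [] \<or> v = []")
  case True
  then have "null_seq rt fr R L n (add_mset [] (add_mset (u @ v) W))"
    using assms(3) by (auto simp: add_mset_commute)
  then show ?thesis using assms(2) by (rule null_seq.undrop)
next
  case False
  then show ?thesis using assms by (auto intro: null_seq.frag)
qed

lemma null_seq_concat: assumes "fr" "rt" "null_seq rt fr R L n (mset ps + W)"
  shows "null_seq rt fr R L n (add_mset (concat ps) W)"
  using assms(3)
proof (induction ps arbitrary: W)
  case Nil
  then show ?case using assms(2) by (auto intro: null_seq.drop)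
next
  case (Cons p ps)
  then have "null_seq rt fr R L n (mset ps + add_mset p W)" by simp
  then have "null_seq rt fr R L n (add_mset (concat ps) (add_mset p W))" by (rule Cons.IH)
  then show ?case using null_seq_frag[OF assms(1,2), of R L n p "concat ps" W] by (simp add: add_mset_commute)
qed

lemma null_seq_rotate_all:
  assumes "rt" "list_all2 (\<lambda>w w0. \<exists>x y. w = x @ y \<and> w0 = y @ x) ws ws0" "null_seq rt fr R L n (mset ws0 + W)"
  shows "null_seq rt fr R L n (mset ws + W)"
  using assms(2,3)
proof (induction arbitrary: W rule: list_all2_induct)
  case (Cons w ws w0 ws0)
  have "null_seq rt fr R L n (mset ws + add_mset w0 W)" using Cons.IH[of "add_mset w0 W"] Cons.prems by simp
  then have "null_seq rt fr R L n (add_mset w (mset ws + W))"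
    using Cons.hyps(1) null_seq.rot[OF assms(1)] by (auto simp: ac_simps)
  then show ?case by simp
qed simp

text \<open>Only the concatenation survives a change of the base occurrence, so the null sequence is
  for it. Moves that touch none of the closed sets leave it unchanged, whence \<open>m\<close> may
  be smaller than \<open>n\<close>.\<close>

lemma shellable_null_seq_based:
  assumes "shellable fr b L n X" "\<not> fr" "b = {s}" "X = {#D#}" "words_of P b D ws"
  shows "\<exists>m\<le>n. null_seq False False (elem P) L m {#concat ws#}"
  using assms
proof (induction arbitrary: D ws rule: shellable.induct)
  case (vertices X)
  then have "diagram D" "single_vertex D" by (auto simp: admissible_def)
  then have "concat ws = []" using words_of_single_vertex[of D P b ws] vertices by auto
  moreover have "null_seq False False (elem P) L 0 {#[]#}" by (rule null_seq.drop[OF null_seq.empty]) simp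
  ultimately show ?case by (metis le_refl)
next
  case (shell D0 X D' n)
  have [simp]: "D0 = D" "X = {#}" using shell.prems by auto
  have D: "diagram D" "perim D \<le> L" using shell(1) by (auto simp: admissible_def)
  have D': "diagram D'" "b \<subseteq> verts D'" using shellable_admissible[OF shell(3)] by (auto simp: admissible_def)
  have "shelling_move D D'" "b \<noteq> {}" using shell(2) shell.prems(2) by auto
  then obtain ws0 ws' where w: "words_of P b D' ws'" "concat ws0 = concat ws"
    "ws' = ws0 \<or> (\<exists>pre w post w'. ws0 = pre @ [w] @ post \<and> ws' = pre @ [w'] @ post \<and> estep (elem P) w w')"
    using words_step[OF D(1) D'(1) _ disjI2[OF shell.prems(2)] D'(2) shell.prems(4)] by blast
  obtain m where m: "m \<le> n" "null_seq False False (elem P) L m {#concat ws'#}"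
    using shell.IH[OF shell.prems(1,2) _ w(1)] by auto
  have "length (concat ws) \<le> L" using words_of_perim[OF shell.prems(4)] D(2) by (simp add: length_concat)
  then have "null_seq False False (elem P) L (Suc m) {#concat ws#}" if "estep (elem P) (concat ws) (concat ws')"
    using null_seq.move[OF that, of "{#}" L False False m] m(2) by simp
  moreover have "concat ws' = concat ws \<or> estep (elem P) (concat ws) (concat ws')"
    using w(2,3) estep_context by (metis concat.simps(2) concat_append append_Nil append_Cons)
  ultimately show ?case using m by (metis Suc_le_mono le_Suc_eq)
qed simp

text \<open>Every word is cut where the boundary visits the vertex of fragmentation. Each piece
  stems from a loop on one side and is the word of a closed set there; fragmentation steps split the
  old words into these pieces, up to rotation and empty words.\<close>

lemma words_frag:
  assumes D: "diagram D" and f: "fragment D D1 D2" and w: "words_of P {} D ws"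
  shows "\<exists>ws1 ws2. words_of P {} D1 ws1 \<and> words_of P {} D2 ws2
    \<and> (\<forall>R L n W. null_seq True True R L n (mset ws1 + mset ws2 + W) \<longrightarrow> null_seq True True R L n (mset ws + W))"
proof -
  obtain v V1 V2 A1 A2 where f: "V1 \<union> V2 = verts D" "V1 \<inter> V2 = {v}" "A1 \<union> A2 = darts D" "A1 \<inter> A2 = {}"
     "\<forall>c\<in>cells D. c \<subseteq> A1 \<or> c \<subseteq> A2"
     "D1 = subdiag D V1 A1 (bnd D \<inter> A1)" "D2 = subdiag D V2 A2 (bnd D \<inter> A2)" "diagram D1" "diagram D2"
    using f unfolding fragment_def by blast
  obtain lab l Ks where g: "labelling P D lab" "bcyc D l" "\<forall>K\<in>set Ks. closed_darts D K"
    "sorted_wrt (\<lambda>K K'. K \<inter> K' = {}) Ks" "ws = map (kword lab l) Ks"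
    using w unfolding words_of_def by blast
  have o: "org D ` A1 \<subseteq> V1" "org D ` A2 \<subseteq> V2"
    using pmapD(8)[OF diagramD(1)[OF f(8)]] pmapD(8)[OF diagramD(1)[OF f(9)]] by (auto simp: f(6,7) subdiag_def)
  have s1: "fragment_side D D1 v V1 V2 A1 A2"
    by unfold_locales (use D f o in auto)
  have s2: "fragment_side D D2 v V2 V1 A2 A1"
    by unfold_locales (use D f o in auto)
  have bD: "bnd D \<subseteq> A1 \<union> A2" using f(3) diagramD(7)[OF D] by blast
  have "\<exists>u1 u2 ss Bs. l = u1 @ u2 \<and> concat ss = u2 @ u1 \<and> (\<forall>s\<in>set ss. set s \<subseteq> A1 \<or> set s \<subseteq> A2)
    \<and> bcyc D1 (filter (\<lambda>x. x \<in> A1) (concat ss)) \<and> bcyc D2 (filter (\<lambda>x. x \<in> A2) (concat ss))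
    \<and> list_all2 (\<lambda>s B. closed_darts D B \<and> B \<inter> bnd D = set s) ss Bs \<and> sorted_wrt (\<lambda>K K'. K \<inter> K' = {}) Bs"
  proof -
    \<comment> \<open>If one side contributes nothing to the boundary circuit, the circuit is not
      cut, and the whole set of darts encloses it.\<close>
    have whole: ?thesis if "bnd D \<subseteq> A1 \<and> bnd D \<inter> A2 = {} \<or> bnd D \<subseteq> A2 \<and> bnd D \<inter> A1 = {}"
    proof -
      have sl: "set l = bnd D" using g(2) by (simp add: bcyc_def)
      have b: "bcyc D1 (filter (\<lambda>x. x \<in> A1) l) \<and> bcyc D2 (filter (\<lambda>x. x \<in> A2) l)"
      proof (cases "bnd D \<subseteq> A1 \<and> bnd D \<inter> A2 = {}")
        case True
        then have "filter (\<lambda>x. x \<in> A1) l = l" "filter (\<lambda>x. x \<in> A2) l = []"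
          using sl by (auto simp: filter_id_conv filter_empty_conv)
        then show ?thesis using fragment_side.bcyc_whole[OF s1 _ g(2)] fragment_side.bcyc_none[OF s2] True by simp
      next
        case False
        then have c: "bnd D \<subseteq> A2" "bnd D \<inter> A1 = {}" using that by auto
        then have "filter (\<lambda>x. x \<in> A2) l = l" "filter (\<lambda>x. x \<in> A1) l = []"
          using sl by (auto simp: filter_id_conv filter_empty_conv)
        then show ?thesis using fragment_side.bcyc_whole[OF s2 _ g(2)] fragment_side.bcyc_none[OF s1] c by simp
      qed
      show ?thesis
        by (rule exI[of _ l], rule exI[of _ "[]"], rule exI[of _ "[l]"], rule exI[of _ "[UNIV]"])
          (use that b sl in \<open>auto simp: closed_darts_def\<close>)
    qed
    show ?thesis
    proof (cases "bnd D \<inter> A1 = {} \<or> bnd D \<subseteq> A1")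
      case True
      then show ?thesis using whole bD f(4) by blast
    next
      case False
      then obtain u1 u2 ss where ss: "l = u1 @ u2" "concat ss = u2 @ u1" "\<forall>s\<in>set ss. fragment_side.seg D v A1 s"
        using fragment_side.segments[OF s1 g(2)] by metis
      have b: "bcyc D (concat ss)" using bcyc_rotate[of D u1 u2] g(2) ss by simp
      have sub: "set s \<subseteq> A1 \<or> set s \<inter> A1 = {}" "set s \<subseteq> bnd D" "encloses D s" if "s \<in> set ss" for s
        using ss(3) that unfolding fragment_side.seg_def[OF s1] by auto
      have A2: "set s \<subseteq> A1 \<or> set s \<subseteq> A2" if "s \<in> set ss" for s using sub[OF that] bD by blast
      have "fragment_side.seg D v A2 s" if "s \<in> set ss" for s
      proof -
        have "set s \<subseteq> A2 \<or> set s \<inter> A2 = {}" using A2[OF that] sub(1)[OF that] f(4) by blast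
        then show ?thesis using ss(3) that unfolding fragment_side.seg_def[OF s1] fragment_side.seg_def[OF s2] by blast
      qed
      then have "bcyc D1 (filter (\<lambda>x. x \<in> A1) (concat ss))" "bcyc D2 (filter (\<lambda>x. x \<in> A2) (concat ss))"
        using fragment_side.bcyc_side[OF s1 b ss(3)] fragment_side.bcyc_side[OF s2 b] by auto
      moreover obtain Bs where "list_all2 (\<lambda>s B. closed_darts D B \<and> B \<inter> bnd D = set s) ss Bs"
        "sorted_wrt (\<lambda>K K'. K \<inter> K' = {}) Bs"
        using disjoint_enclosures[of ss D] sub(3) b by (auto simp: bcyc_def cyc_def)
      ultimately show ?thesis using ss(1,2) A2 by blast
    qed
  qed
  then obtain u1 u2 ss Bs where h: "l = u1 @ u2" "concat ss = u2 @ u1" "\<forall>s\<in>set ss. set s \<subseteq> A1 \<or> set s \<subseteq> A2"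
    "bcyc D1 (filter (\<lambda>x. x \<in> A1) (concat ss))" "bcyc D2 (filter (\<lambda>x. x \<in> A2) (concat ss))"
    "list_all2 (\<lambda>s B. closed_darts D B \<and> B \<inter> bnd D = set s) ss Bs" "sorted_wrt (\<lambda>K K'. K \<inter> K' = {}) Bs" by blast
  let ?l1 = "filter (\<lambda>x. x \<in> A1) (concat ss)" and ?l2 = "filter (\<lambda>x. x \<in> A2) (concat ss)"
  \<comment> \<open>There is one set for each closed set and each boundary loop. The same list
    serves both fragments, as a loop on the other side contributes the empty word.\<close>
  define Ks' where "Ks' = concat (map (\<lambda>K. map (\<lambda>B. K \<inter> B) Bs) Ks)"
  have Bc: "closed_darts D B" if "B \<in> set Bs" for B
    using h(6) that by (induction rule: list_all2_induct) auto
  have K'c: "closed_darts D K" if "K \<in> set Ks'" for K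
    using that g(3) Bc by (auto simp: Ks'_def intro: closed_darts_Int)
  have K's: "sorted_wrt (\<lambda>K K'. K \<inter> K' = {}) Ks'"
  proof -
    have one: "sorted_wrt (\<lambda>K K'. K \<inter> K' = {}) (map (\<lambda>B. K \<inter> B) Bs)" for K
      unfolding sorted_wrt_map using h(7) by (rule sorted_wrt_mono_rel[rotated]) blast
    show ?thesis unfolding Ks'_def using g(4) by (induction Ks) (auto simp: sorted_wrt_append one)
  qed
  let ?ws1 = "map (kword lab ?l1) Ks'" and ?ws2 = "map (kword lab ?l2) Ks'"
  have "words_of P {} D1 ?ws1" unfolding words_of_def
    using fragment_side.labelling_side[OF s1 g(1)] h(4) fragment_side.closed_side[OF s1 K'c] K's
    by (intro exI[of _ lab] exI[of _ ?l1] exI[of _ Ks']) (simp add: based_def)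
  moreover have "words_of P {} D2 ?ws2" unfolding words_of_def
    using fragment_side.labelling_side[OF s2 g(1)] h(5) fragment_side.closed_side[OF s2 K'c] K's
    by (intro exI[of _ lab] exI[of _ ?l2] exI[of _ Ks']) (simp add: based_def)
  moreover have "null_seq True True R L n (mset ws + W)" if n: "null_seq True True R L n (mset ?ws1 + mset ?ws2 + W)"
    for R L n W
  proof -
    have sb: "set (concat ss) = bnd D" using g(2) h(1,2) by (auto simp: bcyc_def)
    have pc: "kword lab ?l1 (K \<inter> B) @ kword lab ?l2 (K \<inter> B) = kword lab s K"
      if ssm: "s \<in> set ss" and Bs': "B \<inter> bnd D = set s" and dss: "distinct (concat ss)" for K B s
    proof -
      obtain s1' s2' where st: "ss = s1' @ s # s2'" using ssm by (meson split_list)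
      have k: "kword lab (filter (\<lambda>x. x \<in> A) (concat ss)) (K \<inter> B) = kword lab (filter (\<lambda>x. x \<in> A) s) K" for A
      proof -
        have sub: "set (filter (\<lambda>x. x \<in> A) m) \<subseteq> set m" for m by simp
        have "set s \<subseteq> B" using Bs' by blast
        then have e: "kword lab (filter (\<lambda>x. x \<in> A) s) (K \<inter> B) = kword lab (filter (\<lambda>x. x \<in> A) s) K"
          by (intro kword_cong) (use sub[of s] in blast)
        have n: "kword lab (filter (\<lambda>x. x \<in> A) m) (K \<inter> B) = []" if "set m \<subseteq> bnd D" "set m \<inter> set s = {}" for m
        proof (rule kword_none)
          show "set (filter (\<lambda>x. x \<in> A) m) \<inter> (K \<inter> B) = {}"
            using that sub[of m] Bs' by blast
        qed
        have "set (concat s1') \<subseteq> bnd D" "set (concat s1') \<inter> set s = {}"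
          "set (concat s2') \<subseteq> bnd D" "set (concat s2') \<inter> set s = {}"
          using sb dss unfolding st by auto
        then have "kword lab (filter (\<lambda>x. x \<in> A) (concat s1')) (K \<inter> B) = []"
          "kword lab (filter (\<lambda>x. x \<in> A) (concat s2')) (K \<inter> B) = []" using n by blast+
        then have "kword lab (filter (\<lambda>x. x \<in> A) (concat s1' @ s @ concat s2')) (K \<inter> B) = kword lab (filter (\<lambda>x. x \<in> A) s) K"
          using e by (simp only: filter_append kword_append append_Nil append_Nil2)
        then show ?thesis unfolding st by simp
      qed
      consider "set s \<subseteq> A1" "set s \<inter> A2 = {}" | "set s \<subseteq> A2" "set s \<inter> A1 = {}"
        using h(3) ssm f(4) by blast
      then show ?thesis
      proof cases
        case 1
        then have "filter (\<lambda>x. x \<in> A1) s = s" "filter (\<lambda>x. x \<in> A2) s = []"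
          by (auto simp: filter_id_conv filter_empty_conv)
        then show ?thesis using k by simp
      next
        case 2
        then have "filter (\<lambda>x. x \<in> A2) s = s" "filter (\<lambda>x. x \<in> A1) s = []"
          by (auto simp: filter_id_conv filter_empty_conv)
        then show ?thesis using k by simp
      qed
    qed
    have dis: "distinct (concat ss)" using g(2) bcyc_rotate[of D u1 u2] h(1,2) by (auto simp: bcyc_def cyc_def)
    have cc: "concat (map (\<lambda>B. kword lab ?l1 (K \<inter> B) @ kword lab ?l2 (K \<inter> B)) Bs) = kword lab (concat ss) K" for K
    proof -
      have "concat (map (\<lambda>B. kword lab ?l1 (K \<inter> B) @ kword lab ?l2 (K \<inter> B)) Bs') = kword lab (concat ss') K"
        if "list_all2 (\<lambda>s B. closed_darts D B \<and> B \<inter> bnd D = set s) ss' Bs'" "set ss' \<subseteq> set ss" for ss' Bs'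
        using that by (induction rule: list_all2_induct) (auto simp: pc[OF _ _ dis])
      then show ?thesis using h(6) by blast
    qed
    define pcs where "pcs K = concat (map (\<lambda>B. [kword lab ?l1 (K \<inter> B), kword lab ?l2 (K \<inter> B)]) Bs)" for K
    have cp: "concat (pcs K) = kword lab (concat ss) K" for K
    proof -
      have "concat (pcs K) = concat (map (\<lambda>B. kword lab ?l1 (K \<inter> B) @ kword lab ?l2 (K \<inter> B)) Bs)"
        unfolding pcs_def by (induction Bs) simp_all
      then show ?thesis using cc by simp
    qed
    have mp: "mset (pcs K) = mset (map (\<lambda>B. kword lab ?l1 (K \<inter> B)) Bs) + mset (map (\<lambda>B. kword lab ?l2 (K \<inter> B)) Bs)" for K
      unfolding pcs_def by (induction Bs) simp_all
    have mm: "mset (map (kword lab ?l1) Ks') + mset (map (kword lab ?l2) Ks') = mset (concat (map pcs Ks))"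
      unfolding Ks'_def by (induction Ks) (simp_all add: mp o_def)
    have comb: "null_seq True True R L n (mset (map (\<lambda>K. concat (pcs K)) Qs) + W')"
      if "null_seq True True R L n (mset (concat (map pcs Qs)) + W')" for Qs W'
      using that
    proof (induction Qs arbitrary: W')
      case (Cons K Qs)
      then have "null_seq True True R L n (mset (concat (map pcs Qs)) + (mset (pcs K) + W'))" by (simp add: ac_simps)
      then have "null_seq True True R L n (mset (pcs K) + (mset (map (\<lambda>K. concat (pcs K)) Qs) + W'))"
        using Cons.IH[of "mset (pcs K) + W'"] by (simp add: ac_simps)
      then show ?case using null_seq_concat[of True True] by simp
    qed simp
    have "null_seq True True R L n (mset (map (\<lambda>K. concat (pcs K)) Ks) + W)"
      by (rule comb) (use n mm in simp)
    then have "null_seq True True R L n (mset (map (kword lab (concat ss)) Ks) + W)" by (simp add: cp)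
    moreover have "list_all2 (\<lambda>w w0. \<exists>x y. w = x @ y \<and> w0 = y @ x) ws (map (kword lab (concat ss)) Ks)"
      unfolding g(5) h(1,2) by (auto simp: list_all2_conv_all_nth)
    ultimately show ?thesis using null_seq_rotate_all[OF TrueI] by blast
  qed
  ultimately show ?thesis by blast
qed

text \<open>Each component is paired with its own list of words. The total length of the words is
  bounded by the total perimeter, so the bound \<open>L\<close> is inherited at every move.\<close>

lemma shellable_null_seq_free:
  assumes "shellable fr {} L n X" "X = image_mset fst Y" "\<forall>(D, ws)\<in>#Y. words_of P {} D ws"
  shows "\<exists>m\<le>n. null_seq True fr (elem P) L m (\<Sum>(D, ws)\<in>#Y. mset ws)"
  using assms
proof (induction arbitrary: Y rule: shellable.induct)
  case (vertices X)
  have e: "\<forall>w\<in>set ws. w = []" if "(D, ws) \<in># Y" for D ws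
  proof -
    have "D \<in># X" using that vertices(3) by force
    then show ?thesis using words_of_single_vertex[of D P "{}" ws] vertices that by (auto simp: admissible_def)
  qed
  then have "\<forall>w\<in>#(\<Sum>(D, ws)\<in>#Y. mset ws). w = []" by (auto simp: sum_mset.neutral in_Union_mset_iff split: prod.splits)
  moreover have "null_seq True fr (elem P) L 0 W" if "\<forall>w\<in>#W. w = []" for W
    using that by (induction W) (auto intro: null_seq.empty null_seq.drop)
  ultimately show ?case by blast
next
  case (shell D X D' n)
  obtain z Y0 where Y: "Y = add_mset z Y0" "fst z = D" "X = image_mset fst Y0"
    using shell.prems(1) by (metis msed_map_invR)
  obtain ws where z: "z = (D, ws)" using Y(2) by (cases z) auto
  have w: "words_of P {} D ws" using shell.prems(2) Y z by auto
  have D: "diagram D" using shell(1) by (auto simp: admissible_def)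
  have D': "diagram D'" using shellable_admissible[OF shell(3)] by (auto simp: admissible_def)
  obtain ws0 ws' where w': "words_of P {} D' ws'" "list_all2 (\<lambda>w w0. \<exists>x y. w = x @ y \<and> w0 = y @ x) ws ws0"
    "ws' = ws0 \<or> (\<exists>pre w post w'. ws0 = pre @ [w] @ post \<and> ws' = pre @ [w'] @ post \<and> estep (elem P) w w')"
    using words_step[OF D D' shell(2) disjI1[OF HOL.refl] empty_subsetI w] by blast
  let ?W = "\<Sum>(D, ws)\<in>#Y0. mset ws"
  obtain m where m: "m \<le> n" "null_seq True fr (elem P) L m (mset ws' + ?W)"
    using shell.IH[of "add_mset (D', ws') Y0"] Y w'(1) shell.prems(2) by auto
  have "\<exists>m\<le>Suc n. null_seq True fr (elem P) L m (mset ws0 + ?W)"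
  proof (cases "ws' = ws0")
    case True
    then show ?thesis using m by (intro exI[of _ m]) auto
  next
    case False
    then obtain pre w post w1 where s: "ws0 = pre @ [w] @ post" "ws' = pre @ [w1] @ post" "estep (elem P) w w1"
      using w'(3) by blast
    have t0: "tlen (mset ws0) = tlen (mset ws)"
      using w'(2) by (induction rule: list_all2_induct) auto
    have tm: "tlen (mset us) = (\<Sum>w\<leftarrow>us. length w)" for us :: "'a word list" by (induction us) auto
    have "tlen (\<Sum>(D, ws)\<in>#Y0. mset ws) \<le> total_perim (image_mset fst Y0)"
      if "\<forall>(D, ws)\<in>#Y0. words_of P {} D ws" for Y0
      using that
    proof (induction Y0)
      case (add z Y0)
      then show ?case using words_of_perim[of P "{}" "fst z" "snd z"] by (cases z) (auto simp: tm)
    qed simp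
    then have "tlen ?W \<le> total_perim X" using Y shell.prems(2) by simp
    moreover have "tlen (mset ws) \<le> perim D" using words_of_perim[OF w] tm by simp
    moreover have "perim D + total_perim X \<le> L" using shell(1) by (simp add: admissible_def)
    ultimately have "tlen (mset ws0 + ?W) \<le> L" using t0 by simp
    then have "length w + tlen (mset pre + mset post + ?W) \<le> L" using s(1) by simp
    then have "null_seq True fr (elem P) L (Suc m) (add_mset w (mset pre + mset post + ?W))"
      using null_seq.move[OF s(3)] m(2) s(2) by simp
    then show ?thesis using m(1) s(1) by (intro exI[of _ "Suc m"]) simp
  qed
  then obtain m' where "m' \<le> Suc n" "null_seq True fr (elem P) L m' (mset ws + ?W)"
    using null_seq_rotate_all[OF TrueI w'(2)] by blast
  then show ?case using Y z by auto
next
  case (frag D X D1 D2 n)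
  obtain z Y0 where Y: "Y = add_mset z Y0" "fst z = D" "X = image_mset fst Y0"
    using frag.prems(1) by (metis msed_map_invR)
  obtain ws where z: "z = (D, ws)" using Y(2) by (cases z) auto
  have w: "words_of P {} D ws" using frag.prems(2) Y z by auto
  have D: "diagram D" using frag(2) by (auto simp: admissible_def)
  obtain ws1 ws2 where w': "words_of P {} D1 ws1" "words_of P {} D2 ws2"
    "\<And>R L n W. null_seq True True R L n (mset ws1 + mset ws2 + W) \<Longrightarrow> null_seq True True R L n (mset ws + W)"
    using words_frag[OF D frag(3) w] by blast
  let ?W = "\<Sum>(D, ws)\<in>#Y0. mset ws"
  have "\<exists>m\<le>n. null_seq True fr (elem P) L m (mset ws1 + mset ws2 + ?W)"
    using frag.IH[of "add_mset (D1, ws1) (add_mset (D2, ws2) Y0)"] Y w'(1,2) frag.prems(2)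
    by (simp add: add.assoc)
  then show ?case using w'(3) frag(1) Y z by auto
qed

section \<open>Null sequences yield shellings\<close>

definition realizes :: "'a presentation \<Rightarrow> nat set \<Rightarrow> diag \<Rightarrow> 'a word \<Rightarrow> bool" where
  "realizes P b D w \<longleftrightarrow> diagram D \<and> b \<subseteq> verts D
    \<and> (\<exists>lab l. labelling P D lab \<and> bcyc D l \<and> based b D l \<and> w = map lab l)"

lemma realizesI: assumes "diagram D" "b \<subseteq> verts D" "labelling P D lab" "bcyc D l" "based b D l" "map lab l = w"
  shows "realizes P b D w"
  using assms unfolding realizes_def by blast

lemma ext_veq: assumes p: "pmap D" and e: "ext D E d e"
  shows "veq b E (subdiag D (verts E) (darts E) (bnd E))"
proof -
  have "first_return (darts E) (rot D) (opp D x) = nxt E x" if "x \<in> darts E" for x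
    using extD(9)[OF e that] by simp
  then show ?thesis unfolding veq_def veq_via_def subdiag_def
    by (intro exI[of _ id]) (simp add: extD(7,8)[OF e])
qed

lemma fresh: assumes "finite (F :: nat set)" obtains x y where "x \<notin> F" "y \<notin> F" "x \<noteq> y"
proof -
  obtain x where "x \<notin> F" using ex_new_if_finite[OF _ assms] by auto
  moreover obtain y where "y \<notin> insert x F" using ex_new_if_finite[of "insert x F"] assms by auto
  ultimately show ?thesis using that by blast
qed

lemma cyclic_rels_rotate: assumes "u @ v \<in> cyclic_rels P" shows "v @ u \<in> cyclic_rels P"
proof -
  have r: "w \<in> cyclic_rels P \<longleftrightarrow> (\<exists>n r. r \<in> rels P \<union> inv_word ` rels P \<and> w = rotate n r)" for w
  proof
    assume "w \<in> cyclic_rels P"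
    then obtain u v where "w = v @ u" "u @ v \<in> rels P \<union> inv_word ` rels P" by (auto simp: cyclic_rels_def)
    then show "\<exists>n r. r \<in> rels P \<union> inv_word ` rels P \<and> w = rotate n r"
      using rotate_append[of u v] by metis
  next
    assume "\<exists>n r. r \<in> rels P \<union> inv_word ` rels P \<and> w = rotate n r"
    then obtain n r where nr: "r \<in> rels P \<union> inv_word ` rels P" "w = rotate n r" by blast
    let ?k = "n mod length r"
    have "w = drop ?k r @ take ?k r" using nr(2) by (simp add: rotate_drop_take)
    moreover have "take ?k r @ drop ?k r \<in> rels P \<union> inv_word ` rels P" using nr(1) by simp
    ultimately show "w \<in> cyclic_rels P" unfolding cyclic_rels_def by blast
  qed
  obtain n s where "s \<in> rels P \<union> inv_word ` rels P" "u @ v = rotate n s" using assms r by blast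
  moreover from this have "v @ u = rotate (length u + n) s"
    using rotate_append[of u v] by (simp add: rotate_rotate[symmetric] del: rotate_rotate)
  ultimately show ?thesis using r by blast
qed

lemma no_darts: assumes "diagram D" "bcyc D []" shows "darts D = {}"
  using assms diagramD(8)[OF assms(1)] by (simp add: bcyc_def)

lemma nth_neq_last: assumes "distinct m" "Suc i < length m" shows "m ! i \<noteq> last m"
  using assms by (cases m rule: rev_cases) (auto simp: nth_append)

section \<open>Attaching a spike\<close>

locale spike =
  fixes D :: diag and r :: "nat list" and s0 g h w :: nat
  assumes diD: "diagram D" and r: "bcyc D r" and s0: "s0 \<in> verts D" "r \<noteq> [] \<Longrightarrow> s0 = org D (hd r)"
    and new: "g \<notin> darts D" "h \<notin> darts D" "g \<noteq> h" "w \<notin> verts D"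
begin

text \<open>\<open>r\<close> is the boundary circuit read from the attaching vertex,
  \<open>g\<close> leads to the tip and \<open>h\<close> leads back. For empty \<open>r\<close> the
  default \<open>g\<close> closes the circuit of a single edge.\<close>

definition nx where "nx x = (if x = g then h else if x = h then hd (r @ [g]) else if r \<noteq> [] \<and> x = last r then g else nxt D x)"

definition S :: diag where
  "S = \<lparr>verts = insert w (verts D), darts = insert h (insert g (darts D)), opp = (opp D)(h := g, g := h),
     org = (org D)(h := w, g := s0), nxt = nx, bnd = set (g # h # r)\<rparr>"

lemma pm: "pmap D" using diD by (simp add: diagram_iff)

lemma rD: "set r \<subseteq> darts D" using r diagramD(7)[OF diD] by (simp add: bcyc_def)

lemma gr: "g \<notin> set r" "h \<notin> set r" using rD new by auto

lemma cyc_r: "cyc nx (g # h # r)"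
proof (cases "r = []")
  case True
  then show ?thesis unfolding cyc_def nx_def using new by simp
next
  case False
  have cr: "distinct r" "successively (\<lambda>a b. nxt D a = b) r" using r by (auto simp: bcyc_def cyc_def)
  have "successively (\<lambda>a b. nx a = b) r"
    unfolding successively_conv_nth
  proof (intro allI impI)
    fix i assume i: "Suc i < length r"
    then have "r ! i \<noteq> last r" using nth_neq_last[OF cr(1) i] by simp
    moreover have "r ! i \<in> set r" using i by simp
    ultimately show "nx (r ! i) = r ! Suc i" using successively_nth[OF cr(2) i] gr by (auto simp: nx_def)
  qed
  moreover have "last r \<noteq> g" "last r \<noteq> h" using gr last_in_set[OF False] by auto
  then have "nx (last r) = g" using False by (simp add: nx_def)
  moreover have "nx g = h" "nx h = hd r" using new False by (auto simp: nx_def)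
  ultimately show ?thesis using cr(1) gr new False by (simp add: cyc_def successively_Cons)
qed

lemma nx_other: assumes "x \<in> darts D" "x \<notin> bnd D" shows "nx x = nxt D x"
proof -
  have "x \<noteq> last r" if "r \<noteq> []" using assms(2) r last_in_set[OF that] by (auto simp: bcyc_def)
  then show ?thesis using assms new by (auto simp: nx_def)
qed

lemma pmS: "pmap S"
  unfolding pmap_def
proof (intro conjI)
  show "finite (verts S)" "finite (darts S)" using pmapD(1,2)[OF pm] by (simp_all add: S_def)
  show "\<forall>d\<in>darts S. opp S d \<in> darts S \<and> opp S d \<noteq> d \<and> opp S (opp S d) = d"
    using pmapD(3-5)[OF pm] new by (auto simp: S_def)
  show "org S ` darts S \<subseteq> verts S" using pmapD(8)[OF pm] new s0 by (auto simp: S_def)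
  have "bij_betw nx (darts S) (darts S)"
  proof (rule cyc_cover_bij)
    fix x assume x: "x \<in> darts S"
    show "\<exists>l. cyc nx l \<and> x \<in> set l \<and> set l \<subseteq> darts S"
    proof (cases "x \<in> set (g # h # r)")
      case True
      then show ?thesis using cyc_r rD by (intro exI[of _ "g # h # r"]) (auto simp: S_def)
    next
      case False
      then have x': "x \<in> darts D" "x \<notin> bnd D" using x r by (auto simp: S_def bcyc_def)
      obtain t where t: "cyc (nxt D) (x # t)" "set (x # t) \<subseteq> darts D - bnd D"
        using nonbnd_cycle[OF pm r x'] by metis
      have "cyc nx (x # t)" by (rule cyc_cong[OF t(1)]) (use t(2) nx_other in \<open>metis DiffD1 DiffD2 subsetD\<close>)
      then show ?thesis using t(2) by (intro exI[of _ "x # t"]) (auto simp: S_def)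
    qed
  qed
  then show "bij_betw (nxt S) (darts S) (darts S)" by (simp add: S_def)
qed

lemma rotS: "rot S g = hd (r @ [g])" "rot S h = h" "x \<in> darts D \<Longrightarrow> rot S x = nx (opp D x)"
  using new by (auto simp: rot_def S_def nx_def)

lemma extS: "ext S D h g"
  unfolding ext_def
proof (intro conjI ballI)
  fix x assume x: "x \<in> darts D"
  have ox: "opp D x \<in> darts D" "opp D (opp D x) = x" using pmapD(3,5)[OF pm x] .
  have oS: "opp S x = opp D x" using x new by (auto simp: S_def)
  show "opp S x = opp D x" by (rule oS)
  show "org S x = org D x" using x new by (auto simp: S_def)
  have r1: "rot S (opp D x) = nx x" using rotS(3)[OF ox(1)] ox(2) by simp
  show "nxt D x = first_return (darts D) (rot S) (opp S x)"
  proof (cases "r \<noteq> [] \<and> x = last r")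
    case True
    then have "nx x = g" using x new by (auto simp: nx_def)
    moreover have "nxt D x = hd r" using True r by (auto simp: bcyc_def cyc_def)
    moreover have "hd r \<in> darts D" using True rD by auto
    ultimately show ?thesis using first_return_2[of "rot S" "opp D x" "darts D"] r1 rotS(1) True new(1) oS by simp
  next
    case False
    then have "nx x = nxt D x" using x new by (auto simp: nx_def)
    then show ?thesis using first_return_step[of "rot S" "opp D x" "darts D"] r1 pmapD(6)[OF pm x] oS by simp
  qed
qed (use new in \<open>auto simp: S_def\<close>)

lemma removal: "removal1 S D h g r w"
proof
  show "pmap S" "pmap D" "ext S D h g" by (rule pmS pm extS)+
  show "cyc (nxt S) (g # h # r)" using cyc_r by (simp add: S_def)
  show "bnd D = set r" using r by (simp add: bcyc_def)
  show "set (g # h # r) \<subseteq> darts S" using rD by (auto simp: S_def)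
qed (use new s0 in \<open>simp_all add: S_def\<close>)

lemma diS: "diagram S"
proof (rule removal1.diagram_big[OF removal diD])
  fix z assume z: "z \<in> darts S"
  show "org S (rot S z) = org S z"
  proof (cases "z \<in> darts D")
    case True
    have oz: "opp D z \<in> darts D" using pmapD(3)[OF pm True] .
    have nz: "nxt D (opp D z) = rot D z" by (simp add: rot_def)
    have rz: "rot D z \<in> darts D" "org D (rot D z) = org D z" using pmapD(9)[OF pm True] org_rot[OF diD True] .
    have oS: "org S y = org D y" if "y \<in> darts D" for y using that new by (auto simp: S_def)
    show ?thesis
    proof (cases "r \<noteq> [] \<and> opp D z = last r")
      case t: True
      then have "rot S z = g" using rotS(3)[OF True] oz new by (auto simp: nx_def)
      moreover have "rot D z = hd r" using t r nz by (auto simp: bcyc_def cyc_def)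
      moreover have "org S g = s0" by (simp add: S_def)
      ultimately show ?thesis using rz s0(2) t oS[OF True] by simp
    next
      case False
      then have "rot S z = rot D z" using rotS(3)[OF True] oz new nz by (auto simp: nx_def)
      then show ?thesis using rz oS True by simp
    qed
  next
    case False
    then consider "z = h" | "z = g" using z by (auto simp: S_def)
    then show ?thesis
    proof cases
      case 1
      then show ?thesis using rotS(2) by simp
    next
      case 2
      show ?thesis
      proof (cases "r = []")
        case True
        then show ?thesis using 2 rotS(1) by simp
      next
        case False
        then have "hd r \<in> darts D" using rD by auto
        then have "org S (hd r) = org D (hd r)" using new by (auto simp: S_def)
        moreover have "org S g = s0" by (simp add: S_def)
        ultimately show ?thesis using 2 rotS(1) s0(2) False by simp
      qed
    qed
  qed
qed

lemma labS: assumes "labelling P D lab" "x \<in> gens P \<times> UNIV"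
  shows "labelling P S (lab(g := x, h := inv_letter x))"
proof (rule labellingI)
  fix d assume d: "d \<in> darts S"
  consider "d = g" | "d = h" | "d \<in> darts D" "d \<noteq> g" "d \<noteq> h" "opp D d \<noteq> g" "opp D d \<noteq> h"
  proof -
    have "d = g \<or> d = h \<or> d \<in> darts D" using d by (auto simp: S_def)
    then show ?thesis using that new pmapD(3)[OF pm, of d] by metis
  qed
  note c = this
  show "(lab(g := x, h := inv_letter x)) d \<in> gens P \<times> UNIV"
    using c by cases (use assms(2) new labellingD(1)[OF assms(1)] in \<open>simp_all del: mem_Times_iff\<close>)
  show "(lab(g := x, h := inv_letter x)) (opp S d) = inv_letter ((lab(g := x, h := inv_letter x)) d)"
    using c by cases (use new labellingD(2)[OF assms(1)] in \<open>simp_all add: S_def\<close>)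
next
  fix d t assume d: "d \<in> darts S" "d \<notin> bnd S" and c: "cyc (nxt S) (d # t)"
  then have d': "d \<in> darts D" "d \<notin> bnd D" using r by (auto simp: S_def bcyc_def)
  obtain l where l: "cyc (nxt S) (d # l)" "cyc (nxt D) (d # l)" "set (d # l) \<subseteq> darts D - bnd D"
    by (rule removal1.nonbnd_cyc[OF removal d'])
  have "l = t" using cyc_unique[OF l(1) c] .
  moreover have "map (lab(g := x, h := inv_letter x)) (d # l) = map lab (d # l)"
    by (rule map_cong[OF HOL.refl]) (use l(3) new in auto)
  ultimately show "map (lab(g := x, h := inv_letter x)) (d # t) \<in> cyclic_rels P"
    using labellingD(3)[OF assms(1) d' l(2)] by metis
qed

lemma collapse: "\<exists>E. shelling_move S E \<and> veq b D E"
proof -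
  have e: "darts S - {h, opp S h} = darts D" "verts S - {org S h} = verts D" "bnd S - {h, opp S h} = bnd D"
    using new gr r by (auto simp: S_def bcyc_def)
  have "{x \<in> darts S. org S x = org S h} = {h}"
  proof -
    have "org D x \<noteq> w" if "x \<in> darts D" for x using pmapD(8)[OF pm that] new by blast
    then show ?thesis using new s0(1) by (auto simp: S_def)
  qed
  then have "collapse1 S (subdiag S (verts D) (darts D) (bnd D))"
    unfolding collapse1_def e[symmetric] by (intro bexI[of _ h]) (auto simp: S_def)
  then show ?thesis using ext_veq[OF pmS extS] unfolding shelling_move_def by blast
qed

end

text \<open>Inverse to a 1-cell collapse. The set \<open>F\<close> stands for the names used by the
  other components; new names avoid it, so that the components stay apart.\<close>

lemma realize_spike: assumes R: "realizes P b D (u @ v)" and x: "x \<in> gens P \<times> UNIV" and F: "finite F"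
    and b: "b = {} \<or> b = {s}"
  shows "\<exists>D' E. realizes P b D' (u @ [x, inv_letter x] @ v) \<and> shelling_move D' E \<and> veq b D E
    \<and> verts D' \<inter> F \<subseteq> verts D \<and> darts D' \<inter> F \<subseteq> darts D"
proof -
  obtain lab l where l: "diagram D" "b \<subseteq> verts D" "labelling P D lab" "bcyc D l" "based b D l" "u @ v = map lab l"
    using R by (auto simp: realizes_def)
  obtain lu lv where lw: "l = lu @ lv" "u = map lab lu" "v = map lab lv"
    using l(6) by (auto simp: append_eq_map_conv)
  have br: "bcyc D (lv @ lu)" using bcyc_rotate l(4) lw(1) by blast
  \<comment> \<open>The attaching vertex is read off from the circuit. If there is no dart, the
    circuit does not determine it, and the base is taken when there is one.\<close>
  have "\<exists>s0. s0 \<in> verts D \<and> (lv @ lu \<noteq> [] \<longrightarrow> s0 = org D (hd (lv @ lu))) \<and> (lv @ lu = [] \<and> b \<noteq> {} \<longrightarrow> s0 \<in> b)"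
  proof (cases "lv @ lu = []")
    case True
    then show ?thesis using diagramD(2)[OF l(1)] l(2) b by blast
  next
    case False
    then have "hd (lv @ lu) \<in> darts D" using br diagramD(7)[OF l(1)] hd_in_set unfolding bcyc_def by blast
    then show ?thesis using pmapD(8)[OF diagramD(1)[OF l(1)]] False by blast
  qed
  then obtain s0 where v0: "s0 \<in> verts D" "lv @ lu \<noteq> [] \<Longrightarrow> s0 = org D (hd (lv @ lu))"
    "lv @ lu = [] \<Longrightarrow> b \<noteq> {} \<Longrightarrow> s0 \<in> b" by blast
  have fin: "finite (darts D \<union> F)" "finite (verts D \<union> F)" using F pmapD(1,2)[OF diagramD(1)[OF l(1)]] by auto
  obtain g h where gh: "g \<notin> darts D \<union> F" "h \<notin> darts D \<union> F" "g \<noteq> h" by (rule fresh[OF fin(1)])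
  obtain w where w: "w \<notin> verts D \<union> F" using ex_new_if_finite[OF _ fin(2)] by auto
  interpret spike D "lv @ lu" s0 g h w
    by unfold_locales (use l br v0 gh w in auto)
  let ?lab = "lab(g := x, h := inv_letter x)"
  have "bcyc S (g # h # lv @ lu)" using cyc_r by (simp add: bcyc_def S_def)
  then have bS: "bcyc S (lu @ [g, h] @ lv)" using bcyc_rotate[of S "[g, h] @ lv" lu] by simp
  have "based b S (lu @ [g, h] @ lv)"
  proof (cases "lu = []")
    case True
    have "s0 \<in> b" if "b \<noteq> {}"
    proof (cases "lv = []")
      case t: True
      then show ?thesis using v0(3)[OF _ that] True by simp
    next
      case False
      then have "l \<noteq> []" "s0 = org D (hd l)" using v0(2) True lw(1) by simp_all
      then show ?thesis using l(5) that unfolding based_def by simp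
    qed
    moreover have "org S g = s0" by (simp add: S_def)
    moreover have "hd (lu @ [g, h] @ lv) = g" using True by simp
    ultimately show ?thesis unfolding based_def by metis
  next
    case False
    then have "hd lu \<in> darts D" using rD by auto
    then have "org S (hd lu) = org D (hd lu)" using new by (auto simp: S_def)
    then show ?thesis using False l(5) lw(1) by (simp add: based_def)
  qed
  moreover have "map ?lab (lu @ [g, h] @ lv) = u @ [x, inv_letter x] @ v"
  proof -
    have ml: "map ?lab m = map lab m" if "set m \<subseteq> darts D" for m
      by (rule map_cong[OF HOL.refl]) (use that new in auto)
    have "map ?lab lu = u" unfolding lw(2) by (rule ml) (use rD in simp)
    moreover have "map ?lab lv = v" unfolding lw(3) by (rule ml) (use rD in simp)
    moreover have "map ?lab [g, h] = [x, inv_letter x]" using new by simp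
    ultimately show ?thesis by (simp only: map_append)
  qed
  moreover have "b \<subseteq> verts S" using l(2) by (auto simp: S_def)
  ultimately have "realizes P b S (u @ [x, inv_letter x] @ v)"
    using realizesI[OF diS _ labS[OF l(3) x] bS] by blast
  moreover have "verts S \<inter> F \<subseteq> verts D" "darts S \<inter> F \<subseteq> darts D" using gh w by (auto simp: S_def)
  ultimately show ?thesis using collapse by blast
qed

section \<open>Attaching a 2-cell\<close>

locale attached_cell =
  fixes D :: diag and t v :: "nat list" and s0 g h :: nat
  assumes diD: "diagram D" and tv: "bcyc D (t @ v)" and s0: "s0 \<in> verts D"
    and new: "g \<notin> darts D" "h \<notin> darts D" "g \<noteq> h"
begin

text \<open>\<open>g\<close> takes the place of \<open>t\<close> on the boundary, and
  \<open>h\<close> closes \<open>t\<close> to the circuit of the new cell. Both \<open>t\<close> and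
  \<open>v\<close> may be empty, whence the defaults \<open>h\<close> and \<open>g\<close>.\<close>

definition nx where "nx x = (if x = g then hd (v @ [g]) else if x = h then hd (t @ [h])
   else if v \<noteq> [] \<and> x = last v then g else if t \<noteq> [] \<and> x = last t then h else nxt D x)"

text \<open>The value \<open>s0\<close> is for a diagram without darts, where the new edge is a loop
  at its only vertex.\<close>

definition vx where "vx m = (if m = [] then s0 else org D (hd m))"

definition S :: diag where
  "S = \<lparr>verts = verts D, darts = insert g (insert h (darts D)), opp = (opp D)(g := h, h := g),
     org = (org D)(g := vx (t @ v), h := vx (v @ t)), nxt = nx, bnd = set (g # v)\<rparr>"

lemma pm: "pmap D" using diD by (simp add: diagram_iff)

lemma sub: "set t \<subseteq> darts D" "set v \<subseteq> darts D" using tv diagramD(7)[OF diD] by (auto simp: bcyc_def)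

lemma dis: "distinct (t @ v)" using tv by (simp add: bcyc_def cyc_def)

lemma fresh': "g \<notin> set t" "g \<notin> set v" "h \<notin> set t" "h \<notin> set v" using sub new by auto

lemma last_v: "v \<noteq> [] \<Longrightarrow> nxt D (last v) = hd (t @ v)"
  using tv by (auto simp: bcyc_def cyc_def)

lemma last_t: "t \<noteq> [] \<Longrightarrow> nxt D (last t) = hd (v @ t)"
  using bcyc_rotate[OF tv] by (auto simp: bcyc_def cyc_def)

lemma disj_last: "t \<noteq> [] \<Longrightarrow> last t \<notin> set v" "v \<noteq> [] \<Longrightarrow> last v \<notin> set t"
  using dis by (metis disjoint_iff distinct_append last_in_set)+

lemma nx_vals: "nx g = hd (v @ [g])" "nx h = hd (t @ [h])" "v \<noteq> [] \<Longrightarrow> nx (last v) = g" "t \<noteq> [] \<Longrightarrow> nx (last t) = h"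
proof -
  show "nx g = hd (v @ [g])" "nx h = hd (t @ [h])" using new by (auto simp: nx_def)
  show "nx (last v) = g" if "v \<noteq> []" using that fresh' last_in_set[OF that] by (auto simp: nx_def)
  show "nx (last t) = h" if "t \<noteq> []"
  proof -
    have lt: "last t \<in> set t" using that by simp
    have "last t \<noteq> g" "last t \<noteq> h" using fresh'(1,3) lt by blast+
    moreover have "\<not> (v \<noteq> [] \<and> last t = last v)" using disj_last(2) lt by auto
    ultimately show ?thesis using that by (auto simp: nx_def)
  qed
qed

lemma nx_same: "x \<in> darts D \<Longrightarrow> (v \<noteq> [] \<Longrightarrow> x \<noteq> last v) \<Longrightarrow> (t \<noteq> [] \<Longrightarrow> x \<noteq> last t) \<Longrightarrow> nx x = nxt D x"
  using new by (auto simp: nx_def)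

lemma nx_other: assumes "x \<in> darts D" "x \<notin> bnd D" shows "nx x = nxt D x"
proof (rule nx_same[OF assms(1)])
  have "bnd D = set t \<union> set v" using tv unfolding bcyc_def by simp
  then have n: "x \<notin> set t" "x \<notin> set v" using assms(2) by blast+
  show "x \<noteq> last v" if "v \<noteq> []" using n(2) last_in_set[OF that] by blast
  show "x \<noteq> last t" if "t \<noteq> []" using n(1) last_in_set[OF that] by blast
qed

lemma cyc_part: assumes "successively (\<lambda>a b. nxt D a = b) m" "distinct m" "k \<notin> set m" "set m \<subseteq> darts D"
    "nx k = hd (m @ [k])" "m \<noteq> [] \<Longrightarrow> nx (last m) = k" "\<And>x. x \<in> set m \<Longrightarrow> x \<noteq> last m \<Longrightarrow> nx x = nxt D x"
  shows "cyc nx (k # m)"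
proof -
  have "successively (\<lambda>a b. nx a = b) m"
    unfolding successively_conv_nth
  proof (intro allI impI)
    fix i assume i: "Suc i < length m"
    then have "m ! i \<noteq> last m" using nth_neq_last[OF assms(2) i] by simp
    then show "nx (m ! i) = m ! Suc i" using successively_nth[OF assms(1) i] assms(7)[of "m ! i"] i by simp
  qed
  then show ?thesis using assms(2,3,5,6) by (cases "m = []") (auto simp: cyc_def successively_Cons)
qed

lemma cycs: "cyc nx (g # v)" "cyc nx (h # t)"
proof -
  have su: "successively (\<lambda>a b. nxt D a = b) t" "successively (\<lambda>a b. nxt D a = b) v"
    using tv by (auto simp: bcyc_def cyc_def successively_append_iff)
  show "cyc nx (g # v)"
    by (rule cyc_part[OF su(2)])
      (use dis fresh' sub nx_vals disj_last in \<open>auto intro!: nx_same\<close>)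
  show "cyc nx (h # t)"
    by (rule cyc_part[OF su(1)])
      (use dis fresh' sub nx_vals disj_last in \<open>auto intro!: nx_same\<close>)
qed

lemma pmS: "pmap S"
  unfolding pmap_def
proof (intro conjI)
  show "finite (verts S)" "finite (darts S)" using pmapD(1,2)[OF pm] by (simp_all add: S_def)
  show "\<forall>d\<in>darts S. opp S d \<in> darts S \<and> opp S d \<noteq> d \<and> opp S (opp S d) = d"
    using pmapD(3-5)[OF pm] new by (auto simp: S_def)
  have "vx m \<in> verts D" if "set m \<subseteq> darts D" for m
    using that pmapD(8)[OF pm] s0 by (cases m) (auto simp: vx_def)
  then have "vx (t @ v) \<in> verts D" "vx (v @ t) \<in> verts D" using sub by simp_all
  then show "org S ` darts S \<subseteq> verts S" using pmapD(8)[OF pm] new by (auto simp: S_def)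
  have "bij_betw nx (darts S) (darts S)"
  proof (rule cyc_cover_bij)
    fix x assume x: "x \<in> darts S"
    consider "x \<in> set (g # v)" | "x \<in> set (h # t)" | "x \<in> darts D" "x \<notin> bnd D"
      using x tv by (auto simp: S_def bcyc_def)
    then show "\<exists>l. cyc nx l \<and> x \<in> set l \<and> set l \<subseteq> darts S"
    proof cases
      case 1
      then show ?thesis using cycs sub by (intro exI[of _ "g # v"]) (auto simp: S_def)
    next
      case 2
      then show ?thesis using cycs sub by (intro exI[of _ "h # t"]) (auto simp: S_def)
    next
      case 3
      obtain l where l: "cyc (nxt D) (x # l)" "set (x # l) \<subseteq> darts D - bnd D"
        using nonbnd_cycle[OF pm tv 3] by metis
      have "cyc nx (x # l)" by (rule cyc_cong[OF l(1)]) (use l(2) nx_other in \<open>metis DiffD1 DiffD2 subsetD\<close>)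
      then show ?thesis using l(2) by (intro exI[of _ "x # l"]) (auto simp: S_def)
    qed
  qed
  then show "bij_betw (nxt S) (darts S) (darts S)" by (simp add: S_def)
qed

lemma rotS: "rot S g = hd (t @ [h])" "rot S h = hd (v @ [g])" "x \<in> darts D \<Longrightarrow> rot S x = nx (opp D x)"
  using new nx_vals by (auto simp: rot_def S_def)

lemma extS: "ext S D g h"
  unfolding ext_def
proof (intro conjI ballI)
  fix x assume x: "x \<in> darts D"
  have ox: "opp D x \<in> darts D" "opp D (opp D x) = x" using pmapD(3,5)[OF pm x] .
  have oS: "opp S x = opp D x" using x new by (auto simp: S_def)
  show "opp S x = opp D x" by (rule oS)
  show "org S x = org D x" using x new by (auto simp: S_def)
  have r1: "rot S (opp D x) = nx x" using rotS(3)[OF ox(1)] ox(2) by simp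
  have ht: "hd t \<in> darts D" if "t \<noteq> []" using sub that by auto
  have hv: "hd v \<in> darts D" if "v \<noteq> []" using sub that by auto
  consider "v \<noteq> []" "x = last v" "t \<noteq> []" | "v \<noteq> []" "x = last v" "t = []"
    | "t \<noteq> []" "x = last t" "v \<noteq> []" | "t \<noteq> []" "x = last t" "v = []"
    | "v \<noteq> [] \<longrightarrow> x \<noteq> last v" "t \<noteq> [] \<longrightarrow> x \<noteq> last t" by blast
  then show "nxt D x = first_return (darts D) (rot S) (opp S x)"
  proof cases
    case 1
    then show ?thesis using first_return_2[of "rot S" "opp D x" "darts D"] r1 rotS nx_vals last_v ht new oS by simp
  next
    case 2
    then show ?thesis using first_return_3[of "rot S" "opp D x" "darts D"] r1 rotS nx_vals last_v hv new oS by simp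
  next
    case 3
    then show ?thesis using first_return_2[of "rot S" "opp D x" "darts D"] r1 rotS nx_vals last_t hv new oS by simp
  next
    case 4
    then show ?thesis using first_return_3[of "rot S" "opp D x" "darts D"] r1 rotS nx_vals last_t ht new oS by simp
  next
    case 5
    then have "nx x = nxt D x" using nx_same[OF x] by blast
    then show ?thesis using first_return_step[of "rot S" "opp D x" "darts D"] r1 pmapD(6)[OF pm x] oS by simp
  qed
qed (use new in \<open>auto simp: S_def\<close>)

lemma removal: "removal2 S D g h t v"
proof
  show "pmap S" "pmap D" "ext S D g h" by (rule pmS pm extS)+
  show "cyc (nxt S) (g # v)" "cyc (nxt S) (h # t)" using cycs by (simp_all add: S_def)
  show "bnd D = set (t @ v)" using tv by (simp add: bcyc_def)
  show "set (g # v) \<subseteq> darts S" "set (h # t) \<subseteq> darts S" using sub by (auto simp: S_def)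
qed (use new fresh' in \<open>simp_all add: S_def\<close>)

lemma diS: "diagram S"
proof (rule removal2.diagram_big[OF removal diD])
  fix z assume z: "z \<in> darts S"
  have oS: "org S y = org D y" if "y \<in> darts D" for y using that new by (auto simp: S_def)
  have og: "org S g = vx (t @ v)" "org S h = vx (v @ t)" using new by (auto simp: S_def)
  have ht: "org S (hd t) = org D (hd t)" if "t \<noteq> []" using sub that by (intro oS) auto
  have hv: "org S (hd v) = org D (hd v)" if "v \<noteq> []" using sub that by (intro oS) auto
  consider "z = g" | "z = h" | "z \<in> darts D" using z by (auto simp: S_def)
  then show "org S (rot S z) = org S z"
  proof cases
    case 1
    then show ?thesis using rotS(1) og ht by (cases "t = []") (auto simp: vx_def)
  next
    case 2
    then show ?thesis using rotS(2) og hv by (cases "v = []") (auto simp: vx_def)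
  next
    case 3
    note zD = 3
    have oz: "opp D z \<in> darts D" using pmapD(3)[OF pm zD] .
    have nz: "nxt D (opp D z) = rot D z" by (simp add: rot_def)
    have rz: "rot D z \<in> darts D" "org D (rot D z) = org D z" using pmapD(9)[OF pm zD] org_rot[OF diD zD] .
    consider "v \<noteq> []" "opp D z = last v" | "t \<noteq> []" "opp D z = last t"
      | "v \<noteq> [] \<longrightarrow> opp D z \<noteq> last v" "t \<noteq> [] \<longrightarrow> opp D z \<noteq> last t" by blast
    then show ?thesis
    proof cases
      case 1
      then have "rot S z = g" using rotS(3)[OF zD] nx_vals by simp
      moreover have "rot D z = hd (t @ v)" using last_v 1 nz by simp
      ultimately show ?thesis using og rz oS[OF zD] 1 by (simp add: vx_def)
    next
      case 2
      then have "rot S z = h" using rotS(3)[OF zD] nx_vals by simp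
      moreover have "rot D z = hd (v @ t)" using last_t 2 nz by simp
      ultimately show ?thesis using og rz oS[OF zD] 2 by (simp add: vx_def)
    next
      case 3
      then have "rot S z = rot D z" using rotS(3)[OF zD] nx_same[OF oz] nz 3 by simp
      then show ?thesis using rz oS zD by simp
    qed
  qed
qed

lemma labS: assumes "labelling P D lab" "x \<in> gens P \<times> UNIV" "inv_letter x # map lab t \<in> cyclic_rels P"
  shows "labelling P S (lab(g := x, h := inv_letter x))" (is "labelling P S ?lab")
proof (rule labellingI)
  fix d assume d: "d \<in> darts S"
  consider "d = g" | "d = h" | "d \<in> darts D" "d \<noteq> g" "d \<noteq> h" "opp D d \<noteq> g" "opp D d \<noteq> h"
  proof -
    have "d = g \<or> d = h \<or> d \<in> darts D" using d by (auto simp: S_def)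
    then show ?thesis using that new pmapD(3)[OF pm, of d] by metis
  qed
  note c = this
  show "?lab d \<in> gens P \<times> UNIV"
    using c by cases (use assms(2) new labellingD(1)[OF assms(1)] in \<open>simp_all del: mem_Times_iff\<close>)
  show "?lab (opp S d) = inv_letter (?lab d)"
    using c by cases (use new labellingD(2)[OF assms(1)] in \<open>simp_all add: S_def\<close>)
next
  fix d l assume d: "d \<in> darts S" "d \<notin> bnd S" and c: "cyc (nxt S) (d # l)"
  have ml: "map ?lab m = map lab m" if "set m \<subseteq> darts D" for m
    by (rule map_cong[OF HOL.refl]) (use that new in auto)
  show "map ?lab (d # l) \<in> cyclic_rels P"
  proof (cases "d \<in> set (h # t)")
    case True
    then obtain m1 m2 where m: "h # t = m1 @ d # m2" by (meson split_list)
    have "cyc (nxt S) (h # t)" using cycs by (simp add: S_def)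
    then have "cyc (nxt S) (m1 @ d # m2)" unfolding m .
    then have "cyc (nxt S) ((d # m2) @ m1)" by (rule cyc_rotate)
    then have lm: "l = m2 @ m1" using cyc_unique[OF c, of "m2 @ m1"] by (simp only: append_Cons)
    have "map ?lab t = map lab t" by (rule ml[OF sub(1)])
    moreover have "?lab h = inv_letter x" using new by simp
    ultimately have "map ?lab (h # t) \<in> cyclic_rels P" using assms(3) by (simp only: list.map)
    then have "map ?lab m1 @ map ?lab (d # m2) \<in> cyclic_rels P" unfolding m map_append .
    then have "map ?lab (d # m2) @ map ?lab m1 \<in> cyclic_rels P" by (rule cyclic_rels_rotate)
    then show ?thesis using lm by simp
  next
    case False
    then have d': "d \<in> darts D - bnd D" using d tv by (auto simp: S_def bcyc_def)
    obtain k where k: "cyc (nxt S) (d # k)" "cyc (nxt D) (d # k)" "set (d # k) \<subseteq> darts D - bnd D"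
      by (rule removal2.other[OF removal d'])
    have "k = l" using cyc_unique[OF k(1) c] .
    moreover have "map ?lab (d # k) = map lab (d # k)" by (rule ml) (use k(3) in blast)
    ultimately show ?thesis using labellingD(3)[OF assms(1) _ _ k(2)] d' by (metis DiffD1 DiffD2)
  qed
qed

lemma collapse: "\<exists>E. shelling_move S E \<and> veq b D E"
proof -
  have "cyc (nxt S) (h # t)" using cycs by (simp add: S_def)
  then have orb: "orbit (nxt S) (opp S g) = set (h # t)"
    using cyc_orbit[of "nxt S" "h # t" h] new by (simp add: S_def)
  have e: "darts S - {g, opp S g} = darts D" "verts S = verts D"
    "bnd S \<union> orbit (nxt S) (opp S g) - {g, opp S g} = bnd D"
    unfolding orb using new fresh' tv by (auto simp: S_def bcyc_def)
  have "collapse2 S (subdiag S (verts D) (darts D) (bnd D))"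
    unfolding collapse2_def e(1,3)[symmetric] e(2)[symmetric]
    by (intro bexI[of _ g]) (use new fresh' in \<open>auto simp: S_def\<close>)
  then show ?thesis using ext_veq[OF pmS extS] unfolding shelling_move_def by blast
qed

end

text \<open>Inverse to a 2-cell collapse: the stretch \<open>t\<close> of the boundary is covered by
  a cell whose free edge is labelled \<open>x\<close>. For empty \<open>t\<close> the cell is
  bounded by a loop.\<close>

lemma realize_cell: assumes R: "realizes P b D (u @ t @ v)" and x: "x \<in> gens P \<times> UNIV"
    and r: "inv_letter x # t \<in> cyclic_rels P" and F: "finite F" and b: "b = {} \<or> b = {s}"
  shows "\<exists>D' E. realizes P b D' (u @ [x] @ v) \<and> shelling_move D' E \<and> veq b D E
    \<and> verts D' \<inter> F \<subseteq> verts D \<and> darts D' \<inter> F \<subseteq> darts D"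
proof -
  obtain lab l where l: "diagram D" "b \<subseteq> verts D" "labelling P D lab" "bcyc D l" "based b D l" "u @ t @ v = map lab l"
    using R by (auto simp: realizes_def)
  obtain lu lt lv where lw: "l = lu @ lt @ lv" "u = map lab lu" "t = map lab lt" "v = map lab lv"
  proof -
    obtain lu m where "l = lu @ m" "u = map lab lu" "t @ v = map lab m"
      using l(6) by (auto simp: append_eq_map_conv)
    moreover obtain lt lv where "m = lt @ lv" "t = map lab lt" "v = map lab lv"
      using calculation(3) by (auto simp: append_eq_map_conv)
    ultimately show ?thesis using that by blast
  qed
  have br: "bcyc D (lt @ (lv @ lu))" using bcyc_rotate[of D lu "lt @ lv"] l(4) lw(1) by simp
  obtain s0 where v0: "s0 \<in> verts D" "b \<noteq> {} \<Longrightarrow> s0 \<in> b"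
    using diagramD(2)[OF l(1)] l(2) b by blast
  have fin: "finite (darts D \<union> F)" using F pmapD(2)[OF diagramD(1)[OF l(1)]] by auto
  obtain g h where gh: "g \<notin> darts D \<union> F" "h \<notin> darts D \<union> F" "g \<noteq> h" by (rule fresh[OF fin(1)])
  interpret attached_cell D lt "lv @ lu" s0 g h
    by unfold_locales (use l br v0 gh in auto)
  let ?lab = "lab(g := x, h := inv_letter x)"
  have "bcyc S (g # lv @ lu)" using cycs by (simp add: bcyc_def S_def)
  then have bS: "bcyc S (lu @ [g] @ lv)" using bcyc_rotate[of S "[g] @ lv" lu] by simp
  have "based b S (lu @ [g] @ lv)"
  proof (cases "lu = []")
    case True
    have "vx (lt @ lv) \<in> b" if "b \<noteq> {}"
    proof (cases "lt @ lv = []")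
      case t: True
      then show ?thesis using v0(2)[OF that] unfolding vx_def by simp
    next
      case False
      then have "vx (lt @ lv) = org D (hd (lt @ lv))" unfolding vx_def by (rule if_not_P)
      moreover have "l = lt @ lv" using True lw(1) by simp
      ultimately show ?thesis using l(5) that False unfolding based_def by metis
    qed
    moreover have "org S g = vx (lt @ lv @ lu)" using new by (simp add: S_def)
    moreover have "lt @ lv @ lu = lt @ lv" using True by simp
    moreover have "hd (lu @ [g] @ lv) = g" using True by simp
    ultimately show ?thesis unfolding based_def by metis
  next
    case False
    then have "hd lu \<in> darts D" using sub by auto
    then have "org S (hd lu) = org D (hd lu)" using new by (auto simp: S_def)
    then show ?thesis using False l(5) lw(1) by (simp add: based_def)
  qed
  moreover have "map ?lab (lu @ [g] @ lv) = u @ [x] @ v"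
  proof -
    have ml: "map ?lab m = map lab m" if "set m \<subseteq> darts D" for m
      by (rule map_cong[OF HOL.refl]) (use that new in auto)
    have "map ?lab lu = u" unfolding lw(2) by (rule ml) (use sub in simp)
    moreover have "map ?lab lv = v" unfolding lw(4) by (rule ml) (use sub in simp)
    moreover have "map ?lab [g] = [x]" using new by simp
    ultimately show ?thesis by (simp only: map_append)
  qed
  moreover have "b \<subseteq> verts S" using l(2) by (auto simp: S_def)
  moreover have "labelling P S ?lab" using labS[OF l(3) x] r lw(3) by simp
  ultimately have "realizes P b S (u @ [x] @ v)"
    using realizesI[OF diS _ _ bS] by blast
  moreover have "verts S \<inter> F \<subseteq> verts D" "darts S \<inter> F \<subseteq> darts D" using gh by (auto simp: S_def)
  ultimately show ?thesis using collapse by blast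
qed

section \<open>Folding two boundary edges together\<close>

lemma orbit_org: assumes "diagram D" "z \<in> darts D"
  shows "orbit (rot D) z = {u \<in> darts D. org D u = org D z}"
  using diagramD(1,3)[OF assms(1)] assms(2) orbit_sym(1)[OF diagramD(1)[OF assms(1)] assms(2)]
  unfolding orgcond_def by fastforce

text \<open>Injectivity of the rotation determines the last entry. With both ends prescribed, the
  cycles at two vertices can be concatenated when these are merged.\<close>

lemma vertex_cycle: assumes "diagram D" "z \<in> darts D" "w \<in> darts D" "rot D w = z"
  obtains t where "cyc (rot D) (z # t)" "set (z # t) = {u \<in> darts D. org D u = org D z}" "last (z # t) = w"
proof -
  note pm = diagramD(1)[OF assms(1)]
  obtain t where t: "cyc (rot D) (z # t)" "set (z # t) \<subseteq> darts D" "orbit (rot D) z = set (z # t)"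
    by (rule rot_cycle[OF pm assms(2)])
  have "rot D (last (z # t)) = z" using t(1) by (simp add: cyc_def)
  moreover have "last (z # t) \<in> darts D" using t(2) last_in_set[of "z # t"] by blast
  ultimately have "last (z # t) = w" using inj_onD[OF rot_inj[OF pm]] assms(3,4) by metis
  then show ?thesis using that t orbit_org[OF assms(1,2)] by blast
qed

text \<open>Inverse to a 1-cell expansion: two consecutive boundary edges whose labels cancel are
  folded together, which merges their outer end vertices into \<open>m\<close>.\<close>

locale fold =
  fixes D :: diag and x x' :: nat and r :: "nat list" and m m' :: nat
  assumes diD: "diagram D" and rb: "bcyc D (x # x' # r)" and ne: "r \<noteq> []"
    and mm: "{m, m'} = {org D x, org D (hd r)}" "m \<noteq> m'"
begin

definition y where "y = opp D x"
definition y' where "y' = opp D x'"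
definition \<rho> where "\<rho> u = (if u = m' then m else u)"

text \<open>The outer darts \<open>x\<close> and \<open>x'\<close> disappear, and their reverses
  \<open>y\<close> and \<open>y'\<close> become the two darts of the folded edge.\<close>

definition S :: diag where
  "S = \<lparr>verts = verts D - {m'}, darts = darts D - {x, x'}, opp = (opp D)(y := y', y' := y),
     org = (\<lambda>z. \<rho> (org D z)), nxt = (nxt D)(last r := hd r), bnd = set r\<rparr>"

lemma pm: "pmap D" using diD by (simp add: diagram_iff)

lemma cr: "cyc (nxt D) (x # x' # r)" using rb by (simp add: bcyc_def)

lemma bD: "bnd D = insert x (insert x' (set r))" using rb by (auto simp: bcyc_def)

lemma in_darts: "x \<in> darts D" "x' \<in> darts D" "set r \<subseteq> darts D"
  using bD diagramD(7)[OF diD] by auto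

lemma dist: "x \<noteq> x'" "x \<notin> set r" "x' \<notin> set r" "distinct r" using cr by (auto simp: cyc_def)

lemma hl: "hd r \<in> set r" "last r \<in> set r" using ne by auto

lemma hl_darts: "hd r \<in> darts D" "last r \<in> darts D" using hl in_darts by blast+

lemma hl_neq: "hd r \<noteq> x" "hd r \<noteq> x'" "last r \<noteq> x" "last r \<noteq> x'" using hl dist by metis+

lemma nx: "nxt D x = x'" "nxt D x' = hd r" "nxt D (last r) = x"
  using cr ne by (auto simp: cyc_def successively_Cons)

lemma p02: "org D x \<noteq> org D (hd r)" using mm by (auto simp: doubleton_eq_iff)

lemma yD: "y \<in> darts D" "y' \<in> darts D" "opp D y = x" "opp D y' = x'"
  using pmapD(3,5)[OF pm in_darts(1)] pmapD(3,5)[OF pm in_darts(2)] by (simp_all add: y_def y'_def)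

lemma oy: "org D y = org D x'" "org D y' = org D (hd r)"
  using org_nxt[OF diD in_darts(1)] org_nxt[OF diD in_darts(2)] nx by (simp_all add: y_def y'_def)

lemma yneq: "y \<noteq> x" "y' \<noteq> x'" "y' \<noteq> x" "y \<noteq> x'" "y \<noteq> y'"
proof -
  show "y \<noteq> x" "y' \<noteq> x'" using pmapD(4)[OF pm] in_darts by (simp_all add: y_def y'_def)
  show a: "y' \<noteq> x" using oy(2) p02 by auto
  show "y \<noteq> x'" using a yD by (auto simp: y'_def)
  show "y \<noteq> y'" using yD dist(1) by metis
qed

lemma S_simps: "verts S = verts D - {m'}" "darts S = darts D - {x, x'}" "bnd S = set r" "org S z = \<rho> (org D z)"
    "nxt S (last r) = hd r" "z \<noteq> last r \<Longrightarrow> nxt S z = nxt D z"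
    "opp S y = y'" "opp S y' = y" "z \<noteq> y \<Longrightarrow> z \<noteq> y' \<Longrightarrow> opp S z = opp D z"
  using yneq by (auto simp: S_def)

lemma opp_in: assumes "z \<in> darts S" "z \<noteq> y" "z \<noteq> y'" shows "opp D z \<in> darts S"
proof -
  have z: "z \<in> darts D" using assms by (simp add: S_simps)
  have "opp D z \<noteq> x" "opp D z \<noteq> x'" using assms(2,3) pmapD(5)[OF pm z] by (auto simp: y_def y'_def)
  then show ?thesis using pmapD(3)[OF pm z] by (simp add: S_simps)
qed

lemma yS: "y \<in> darts S" "y' \<in> darts S" using yD yneq by (auto simp: S_simps)

lemma cyc_r: "cyc (nxt S) r"
proof -
  have "successively (\<lambda>a b. nxt S a = b) r"
    unfolding successively_conv_nth
  proof (intro allI impI)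
    fix i assume i: "Suc i < length r"
    have "successively (\<lambda>a b. nxt D a = b) r" using cr ne by (auto simp: cyc_def successively_Cons)
    from successively_nth[OF this i] show "nxt S (r ! i) = r ! Suc i"
      using S_simps(6)[OF nth_neq_last[OF dist(4) i]] by simp
  qed
  then show ?thesis using S_simps(5) dist(4) by (simp add: cyc_def)
qed

lemma nonbnd: "darts S - bnd S = darts D - bnd D" using bD by (auto simp: S_simps)

lemma other: assumes "z \<in> darts D - bnd D"
  obtains l where "cyc (nxt D) (z # l)" "cyc (nxt S) (z # l)" "set (z # l) \<subseteq> darts D - bnd D"
proof -
  have z: "z \<in> darts D" "z \<notin> bnd D" using assms by auto
  obtain l where l: "cyc (nxt D) (z # l)" "set (z # l) \<subseteq> darts D - bnd D"
    using nonbnd_cycle[OF pm rb z] by metis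
  have "cyc (nxt S) (z # l)"
  proof (rule cyc_cong[OF l(1)])
    fix u assume "u \<in> set (z # l)"
    then have "u \<noteq> last r" using l(2) hl(2) bD by blast
    then show "nxt D u = nxt S u" using S_simps(6) by simp
  qed
  then show ?thesis using that l by blast
qed

lemma m_in: "m \<in> verts D" "m' \<in> verts D"
proof -
  have "{m, m'} \<subseteq> verts D" unfolding mm(1) using pmapD(8)[OF pm] in_darts hl_darts by simp
  then show "m \<in> verts D" "m' \<in> verts D" by auto
qed

lemma pmS: "pmap S"
  unfolding pmap_def
proof (intro conjI ballI)
  show "finite (verts S)" "finite (darts S)" using pmapD(1,2)[OF pm] by (simp_all add: S_simps)
  show "org S ` darts S \<subseteq> verts S" using pmapD(8)[OF pm] m_in mm(2) by (auto simp: S_simps \<rho>_def)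
  show "bij_betw (nxt S) (darts S) (darts S)"
  proof (rule cyc_cover_bij)
    fix z assume z: "z \<in> darts S"
    show "\<exists>l. cyc (nxt S) l \<and> z \<in> set l \<and> set l \<subseteq> darts S"
    proof (cases "z \<in> set r")
      case True
      then show ?thesis using cyc_r in_darts dist by (intro exI[of _ r]) (auto simp: S_simps)
    next
      case False
      then have "z \<in> darts D - bnd D" using z nonbnd S_simps(3) by blast
      then obtain l where "cyc (nxt S) (z # l)" "set (z # l) \<subseteq> darts D - bnd D" by (rule other)
      then show ?thesis using nonbnd by (intro exI[of _ "z # l"]) auto
    qed
  qed
  fix z assume z: "z \<in> darts S"
  consider "z = y" | "z = y'" | "z \<noteq> y" "z \<noteq> y'" by blast
  note c = this
  show "opp S z \<in> darts S" using c by cases (use yS S_simps opp_in[OF z] in simp_all)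
  show "opp S z \<noteq> z" using c by cases (use yneq S_simps(7-9) pmapD(4)[OF pm] z in \<open>auto simp: S_simps(2)\<close>)
  show "opp S (opp S z) = z"
    using c
  proof cases
    case 3
    have zD: "z \<in> darts D" using z by (simp add: S_simps)
    have o: "opp D z \<noteq> y" "opp D z \<noteq> y'"
    proof -
      have "opp D (opp D z) = z" using pmapD(5)[OF pm zD] .
      then show "opp D z \<noteq> y" "opp D z \<noteq> y'" using z yD(3,4) by (auto simp: S_simps(2))
    qed
    then show ?thesis using 3 S_simps(9) pmapD(5)[OF pm zD] by simp
  qed (use S_simps in simp_all)
qed

text \<open>An intermediate rotation, in which the cycles at the two outer ends are already joined
  but \<open>x\<close> and \<open>x'\<close> are still present. The rotation of \<open>S\<close> is
  its first return to the remaining darts.\<close>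

definition rot1 where "rot1 = (rot D)(y' := x, opp D (last r) := hd r)"

lemma ol: "org D (opp D (last r)) = org D x" using org_nxt[OF diD hl_darts(2)] nx by simp

lemma rot1_vals: "rot1 y' = x" "rot1 (opp D (last r)) = hd r" "z \<noteq> y' \<Longrightarrow> z \<noteq> opp D (last r) \<Longrightarrow> rot1 z = rot D z"
proof -
  have "opp D (last r) \<noteq> y'" using ol oy(2) p02 by auto
  then show "rot1 y' = x" "rot1 (opp D (last r)) = hd r" by (auto simp: rot1_def)
  show "z \<noteq> y' \<Longrightarrow> z \<noteq> opp D (last r) \<Longrightarrow> rot1 z = rot D z" by (simp add: rot1_def)
qed

lemma nxtS_in: "u \<in> darts S \<Longrightarrow> nxt S u \<in> darts S"
  using pmapD(6)[OF pmS] .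

lemma rotS: assumes z: "z \<in> darts S" shows "rot S z = first_return (darts S) rot1 z"
proof -
  have zD: "z \<in> darts D" using z by (simp add: S_simps)
  consider "z = y" | "z = y'" | "z \<noteq> y" "z \<noteq> y'" by blast
  then show ?thesis
  proof cases
    case 1
    have "y \<noteq> opp D (last r)" using yD(3) pmapD(5)[OF pm hl_darts(2)] hl_neq by metis
    then have r1: "rot1 y = x'" using rot1_vals(3)[of y] yneq nx(1) yD(3) by (simp add: rot_def)
    have r2: "rot1 x' = nxt S y'"
    proof (cases "y' = last r")
      case True
      then show ?thesis using rot1_vals(2) S_simps(5) yD(4) by metis
    next
      case False
      then have "x' \<noteq> opp D (last r)" using pmapD(5)[OF pm hl_darts(2)] by (metis y'_def)
      then show ?thesis using rot1_vals(3)[of x'] yneq S_simps(6)[OF False] by (simp add: rot_def y'_def)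
    qed
    have "rot S y = nxt S y'" by (simp add: rot_def S_simps(7))
    moreover have "first_return (darts S) rot1 y = rot1 (rot1 y)"
      by (rule first_return_2) (use r1 r2 nxtS_in[OF yS(2)] in \<open>auto simp: S_simps(2)\<close>)
    ultimately show ?thesis using 1 r1 r2 by simp
  next
    case 2
    have r2: "rot1 x = nxt S y"
    proof (cases "y = last r")
      case True
      then show ?thesis using rot1_vals(2) S_simps(5) yD(3) by metis
    next
      case False
      then have "x \<noteq> opp D (last r)" using pmapD(5)[OF pm hl_darts(2)] by (metis y_def)
      then show ?thesis using rot1_vals(3)[of x] yneq S_simps(6)[OF False] by (simp add: rot_def y_def)
    qed
    have "rot S y' = nxt S y" by (simp add: rot_def S_simps(8))
    moreover have "first_return (darts S) rot1 y' = rot1 (rot1 y')"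
      by (rule first_return_2) (use rot1_vals(1) r2 nxtS_in[OF yS(1)] in \<open>auto simp: S_simps(2)\<close>)
    ultimately show ?thesis using 2 rot1_vals(1) r2 by simp
  next
    case 3
    have o: "opp D z \<in> darts S" using opp_in[OF z 3] .
    have "rot1 z = nxt S (opp D z)"
    proof (cases "opp D z = last r")
      case True
      then have "z = opp D (last r)" using pmapD(5)[OF pm zD] by metis
      then show ?thesis using rot1_vals(2) S_simps(5) True by simp
    next
      case False
      then have "z \<noteq> opp D (last r)" using pmapD(5)[OF pm hl_darts(2)] by metis
      then show ?thesis using rot1_vals(3) 3 S_simps(6)[OF False] by (simp add: rot_def)
    qed
    then show ?thesis using first_return_step[of rot1 z "darts S"] nxtS_in[OF o] 3
      by (simp add: rot_def S_simps(9))
  qed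
qed

lemma cyc_rot1: assumes z: "z \<in> darts D"
  obtains c where "cyc rot1 c" "z \<in> set c"
    "set c = {u \<in> darts D. \<rho> (org D u) = \<rho> (org D z)}"
proof (cases "org D z \<in> {m, m'}")
  case False
  obtain t where t: "cyc (rot D) (z # t)" "set (z # t) \<subseteq> darts D" "orbit (rot D) z = set (z # t)"
    by (rule rot_cycle[OF pm z])
  have s: "set (z # t) = {u \<in> darts D. org D u = org D z}" using t(3) orbit_org[OF diD z] by simp
  have n: "org D z \<noteq> org D x" "org D z \<noteq> org D (hd r)" using False mm(1) by auto
  have "cyc rot1 (z # t)"
  proof (rule cyc_cong[OF t(1)])
    fix u assume "u \<in> set (z # t)"
    then have "org D u = org D z" using s by blast
    then have "u \<noteq> y'" "u \<noteq> opp D (last r)" using n ol oy(2) by auto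
    then show "rot D u = rot1 u" using rot1_vals(3) by simp
  qed
  moreover have "set (z # t) = {u \<in> darts D. \<rho> (org D u) = \<rho> (org D z)}"
    unfolding s using False by (auto simp: \<rho>_def)
  ultimately show ?thesis using that[OF _ list.set_intros(1)] by blast
next
  case True
  have r0: "rot D (opp D (last r)) = x" using rot_opp[OF pm hl_darts(2)] nx by simp
  have r2: "rot D y' = hd r" using rot_opp[OF pm in_darts(2)] nx by (simp add: y'_def)
  obtain t0 where t0: "cyc (rot D) (x # t0)" "set (x # t0) = {u \<in> darts D. org D u = org D x}" "last (x # t0) = opp D (last r)"
    by (rule vertex_cycle[OF diD in_darts(1) pmapD(3)[OF pm hl_darts(2)] r0])
  obtain t2 where t2: "cyc (rot D) (hd r # t2)" "set (hd r # t2) = {u \<in> darts D. org D u = org D (hd r)}" "last (hd r # t2) = y'"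
    by (rule vertex_cycle[OF diD hl_darts(1) yD(2) r2])
  have d: "set (hd r # t2) \<inter> set (x # t0) = {}" unfolding t0(2) t2(2) using p02 by auto
  have suc: "successively (\<lambda>a b. rot1 a = b) l"
    if "cyc (rot D) l" "\<And>u. u \<in> set l \<Longrightarrow> u = y' \<or> u = opp D (last r) \<Longrightarrow> u = last l" for l
    unfolding successively_conv_nth
  proof (intro allI impI)
    fix i assume i: "Suc i < length l"
    have "l ! i \<noteq> last l" using nth_neq_last i that(1) by (auto simp: cyc_def)
    moreover have "l ! i \<in> set l" using i by simp
    ultimately have "rot1 (l ! i) = rot D (l ! i)" using that(2) rot1_vals(3) by metis
    moreover have "successively (\<lambda>a b. rot D a = b) l" using that(1) by (simp add: cyc_def)
    ultimately show "rot1 (l ! i) = l ! Suc i" using successively_nth[OF _ i] by simp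
  qed
  have s0: "successively (\<lambda>a b. rot1 a = b) (x # t0)"
  proof (rule suc[OF t0(1)])
    fix u assume "u \<in> set (x # t0)" "u = y' \<or> u = opp D (last r)"
    moreover have "y' \<notin> set (x # t0)" unfolding t0(2) using oy(2) p02 by auto
    ultimately show "u = last (x # t0)" using t0(3) by metis
  qed
  have s2: "successively (\<lambda>a b. rot1 a = b) (hd r # t2)"
  proof (rule suc[OF t2(1)])
    fix u assume "u \<in> set (hd r # t2)" "u = y' \<or> u = opp D (last r)"
    moreover have "opp D (last r) \<notin> set (hd r # t2)" unfolding t2(2) using ol p02 by auto
    ultimately show "u = last (hd r # t2)" using t2(3) by metis
  qed
  \<comment> \<open>Each of the two cycles ends at the dart from which \<open>rot1\<close> jumps to
    the beginning of the other one.\<close>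
  let ?c = "(hd r # t2) @ (x # t0)"
  have ds: "distinct (hd r # t2)" "distinct (x # t0)" using t0(1) t2(1) by (simp_all add: cyc_def)
  have "cyc rot1 ?c"
    unfolding cyc_def successively_append_iff distinct_append
    using s0 s2 t0(3) t2(3) rot1_vals(1,2) d ds by simp
  moreover have "set ?c = {u \<in> darts D. \<rho> (org D u) = \<rho> (org D z)}"
  proof -
    have "set ?c = {u \<in> darts D. org D u \<in> {m, m'}}" unfolding set_append t0(2) t2(2) mm(1) by auto
    then show ?thesis using True mm(2) by (auto simp: \<rho>_def)
  qed
  moreover have "z \<in> set ?c" unfolding calculation(2) using z by simp
  ultimately show ?thesis using that[of ?c] by blast
qed

lemma orgS: "orgcond S"
  unfolding orgcond_def
proof (intro ballI)
  fix z u assume zu: "z \<in> darts S" "u \<in> darts S"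
  then have zD: "z \<in> darts D" by (simp add: S_simps)
  obtain c where c: "cyc rot1 c" "z \<in> set c" "set c = {u \<in> darts D. \<rho> (org D u) = \<rho> (org D z)}"
    by (rule cyc_rot1[OF zD])
  let ?l = "filter (\<lambda>u. u \<in> darts S) c"
  have "cyc (first_return (darts S) rot1) ?l" by (rule cyc_first_return[OF c(1)])
  moreover have "first_return (darts S) rot1 v = rot S v" if "v \<in> set ?l" for v
    using rotS[of v] that unfolding set_filter by simp
  ultimately have "cyc (rot S) ?l" by (rule cyc_cong)
  then have "orbit (rot S) z = set ?l" by (rule cyc_orbit) (use c(2) zu(1) in simp)
  then have "u \<in> orbit (rot S) z \<longleftrightarrow> \<rho> (org D u) = \<rho> (org D z)"
    using c(3) zu(2) by (auto simp: S_simps(2))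
  then show "org S z = org S u \<longleftrightarrow> u \<in> orbit (rot S) z" by (auto simp: S_simps(4))
qed

lemma \<rho>_ends: "\<rho> (org D x) = \<rho> (org D (hd r))"
  using mm by (auto simp: \<rho>_def doubleton_eq_iff)

lemma connS: "conn S"
proof -
  have step: "(\<rho> (org D z), \<rho> (org D (opp D z))) \<in> adjacent S" if z: "z \<in> darts D" for z
  proof -
    have a: "(org S u, org S (opp S u)) \<in> adjacent S" if "u \<in> darts S" for u
      using that by (simp add: adjacent_def)
    consider "z = x" | "z = x'" | "z = y" | "z = y'" | "z \<in> darts S" "z \<noteq> y" "z \<noteq> y'"
      using z by (auto simp: S_simps(2))
    then show ?thesis
    proof cases
      case 1
      then show ?thesis using a[OF yS(2)] \<rho>_ends oy by (simp add: S_simps(4,8) y_def)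
    next
      case 2
      then show ?thesis using a[OF yS(1)] oy by (simp add: S_simps(4,7) y'_def)
    next
      case 3
      then show ?thesis using a[OF yS(1)] \<rho>_ends oy yD by (simp add: S_simps(4,7))
    next
      case 4
      then show ?thesis using a[OF yS(2)] oy yD by (simp add: S_simps(4,8))
    next
      case 5
      then show ?thesis using a[OF 5(1)] by (simp add: S_simps(4,9))
    qed
  qed
  have "(\<rho> u, \<rho> v) \<in> (adjacent S)\<^sup>*" if "(u, v) \<in> (adjacent D)\<^sup>*" for u v
    using that
  proof induction
    case (step b c)
    then obtain z where "z \<in> darts D" "b = org D z" "c = org D (opp D z)" by (auto simp: adjacent_def)
    then have "(\<rho> b, \<rho> c) \<in> adjacent S" using \<open>\<And>z. z \<in> darts D \<Longrightarrow> (\<rho> (org D z), \<rho> (org D (opp D z))) \<in> adjacent S\<close> by simp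
    then show ?case using step(3) by simp
  qed simp
  moreover have "\<rho> u = u" if "u \<in> verts S" for u using that by (auto simp: S_simps \<rho>_def)
  moreover have "verts S \<subseteq> verts D" by (auto simp: S_simps)
  ultimately show ?thesis using diagramD(4)[OF diD] unfolding conn_def by (metis subsetD)
qed

lemma edgesS: "card (edges D) = Suc (card (edges S))"
proof -
  let ?T = "darts D - {x, x', y, y'}"
  let ?R = "(\<lambda>z. {z, opp D z}) ` ?T"
  have fin: "finite ?R" using pmapD(2)[OF pm] by simp
  have o: "opp D z \<in> ?T" if "z \<in> ?T" for z
  proof -
    have "opp D (opp D z) = z" "opp D z \<in> darts D" using pmapD(3,5)[OF pm] that by auto
    then show ?thesis using that yD by (auto simp: y_def y'_def)
  qed
  have dD: "darts D = {x, x', y, y'} \<union> ?T" using in_darts yD by auto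
  have "edges D = insert {x, y} (insert {x', y'} ?R)"
  proof -
    have o': "opp D x = y" "opp D x' = y'" by (simp_all only: y_def y'_def)
    have "(\<lambda>z. {z, opp D z}) ` {x, x', y, y'} = {{x, y}, {x', y'}}"
      unfolding image_insert image_empty o' yD(3,4) by (simp only: insert_commute insert_absorb2)
    moreover have "edges D = (\<lambda>z. {z, opp D z}) ` {x, x', y, y'} \<union> ?R"
      unfolding edges_def image_Un[symmetric] dD[symmetric] by (rule HOL.refl)
    ultimately show ?thesis by simp
  qed
  moreover have "edges S = insert {y, y'} ?R"
  proof -
    have "darts S = {y, y'} \<union> ?T" using yD yneq by (auto simp: S_simps(2))
    moreover have "(\<lambda>z. {z, opp S z}) ` ?T = ?R" using S_simps(9) by (intro image_cong) auto
    ultimately show ?thesis unfolding edges_def by (auto simp: S_simps(7,8) image_Un)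
  qed
  moreover have "{x, y} \<notin> ?R" "{x', y'} \<notin> ?R" "{y, y'} \<notin> ?R"
  proof -
    have "k \<subseteq> ?T" if "k \<in> ?R" for k using that o by auto
    then show "{x, y} \<notin> ?R" "{x', y'} \<notin> ?R" "{y, y'} \<notin> ?R" by blast+
  qed
  moreover have "{x, y} \<noteq> {x', y'}" using dist yneq by (auto simp: doubleton_eq_iff)
  ultimately show ?thesis using fin by simp
qed

lemma bS: "bcyc S r" using cyc_r by (simp add: bcyc_def S_simps)

text \<open>The fold removes one vertex and one edge and keeps all cells.\<close>

lemma eulerS: "euler S"
proof -
  have e: "orbit (nxt D) z = orbit (nxt S) z" if z: "z \<in> darts D - bnd D" for z
  proof -
    obtain l where "cyc (nxt D) (z # l)" "cyc (nxt S) (z # l)" by (rule other[OF z])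
    then show ?thesis using cyc_orbit[of "nxt D" "z # l" z] cyc_orbit[of "nxt S" "z # l" z] by simp
  qed
  have "cells D = orbit (nxt D) ` (darts D - bnd D)" using cells_eq[OF pm rb diagramD(7)[OF diD]] .
  moreover have "cells S = orbit (nxt S) ` (darts S - bnd S)"
    by (rule cells_eq[OF pmS bS]) (use in_darts dist in \<open>auto simp: S_simps\<close>)
  ultimately have "cells S = cells D" using e nonbnd by simp
  moreover have "card (verts D) = Suc (card (verts S))"
    unfolding S_simps(1) by (rule card_Suc_Diff1[OF pmapD(1)[OF pm] m_in(2), symmetric])
  ultimately show ?thesis using diagramD(5)[OF diD] edgesS by (simp add: euler_def)
qed

lemma diS: "diagram S"
  unfolding diagram_iff
proof (intro conjI)
  show "verts S \<noteq> {}" using m_in mm by (auto simp: S_simps)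
  show "\<exists>l. bcyc S l" using bS by blast
  show "bnd S \<subseteq> darts S" using in_darts dist by (auto simp: S_simps)
  show "bnd S = {} \<longrightarrow> darts S = {}" using ne by (simp add: S_simps)
qed (rule pmS orgS connS eulerS)+

lemma labS: assumes "labelling P D lab" "lab x' = inv_letter (lab x)" shows "labelling P S lab"
proof (rule labellingI)
  fix d assume d: "d \<in> darts S"
  then have dD: "d \<in> darts D" by (simp add: S_simps)
  show "lab d \<in> gens P \<times> UNIV" using labellingD(1)[OF assms(1) dD] .
  have ly: "lab y = inv_letter (lab x)" "lab y' = lab x"
    using labellingD(2)[OF assms(1)] in_darts assms(2) by (simp_all add: y_def y'_def)
  consider "d = y" | "d = y'" | "d \<noteq> y" "d \<noteq> y'" by blast
  then show "lab (opp S d) = inv_letter (lab d)"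
  proof cases
    case 3
    then show ?thesis using labellingD(2)[OF assms(1) dD] S_simps(9) by simp
  qed (use ly S_simps(7,8) in simp_all)
next
  fix d t assume d: "d \<in> darts S" "d \<notin> bnd S" and c: "cyc (nxt S) (d # t)"
  then have d': "d \<in> darts D - bnd D" using nonbnd by blast
  obtain l where l: "cyc (nxt D) (d # l)" "cyc (nxt S) (d # l)" by (rule other[OF d'])
  have "l = t" using cyc_unique[OF l(2) c] .
  then show "map lab (d # t) \<in> cyclic_rels P" using labellingD(3)[OF assms(1) _ _ l(1)] d' by blast
qed

text \<open>Cutting along \<open>y'\<close> at the boundary position after \<open>last r\<close>,
  with \<open>x\<close> and \<open>x'\<close> as new darts and \<open>m'\<close> as new name,
  restores \<open>D\<close>. The dart \<open>c\<close> marks the copy of the merged vertex that was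
  called \<open>m'\<close>.\<close>

lemma expand: assumes b: "m' \<notin> b" shows "\<exists>E. shelling_move S E \<and> veq b D E"
proof -
  define oE where "oE = (opp S)(y' := x', x' := y', opp S y' := x, x := opp S y')"
  define nE where "nE = (nxt S)(last r := x, x := x', x' := nxt S (last r))"
  define gE where "gE = (org S)(x := org S y', x' := org S (opp S y'))"
  define c where "c = (if m' = org D x then x else hd r)"
  define E where "E = \<lparr>verts = insert m' (verts S), darts = darts S \<union> {x, x'}, opp = oE,
      org = (\<lambda>z. if z \<in> orbit (\<lambda>z. nE (oE z)) c then m' else gE z), nxt = nE, bnd = bnd S \<union> {x, x'}\<rparr>"
  have "expand1 S E" unfolding expand1_def
  proof (intro bexI exI conjI)
    show "org S (nxt S (last r)) = org S y'" using oy by (simp add: S_simps)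
    show "m' \<notin> verts S" "x \<notin> darts S" "x' \<notin> darts S" by (auto simp: S_simps)
    show "x \<noteq> x'" by (rule dist)
    show "c \<in> {x, nxt S (last r)}" by (simp add: c_def S_simps)
    show "last r \<in> bnd S" using hl by (simp add: S_simps)
    show "y' \<in> darts S" by (rule yS)
    show "let opp' = (opp S)(y' := x', x' := y', opp S y' := x, x := opp S y');
            nxt' = (nxt S)(last r := x, x := x', x' := nxt S (last r));
            org' = (org S)(x := org S y', x' := org S (opp S y'))
        in E = \<lparr>verts = insert m' (verts S), darts = darts S \<union> {x, x'}, opp = opp',
                 org = (\<lambda>z. if z \<in> orbit (\<lambda>z. nxt' (opp' z)) c then m' else org' z),
                 nxt = nxt', bnd = bnd S \<union> {x, x'}\<rparr>"
      unfolding Let_def E_def oE_def nE_def gE_def by (rule HOL.refl)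
  qed
  moreover have "veq_via b id D E"
  proof -
    have o: "oE z = opp D z" if "z \<in> darts D" for z
    proof -
      consider "z = x" | "z = x'" | "z = y" | "z = y'" | "z \<noteq> x" "z \<noteq> x'" "z \<noteq> y" "z \<noteq> y'" by blast
      then show ?thesis by cases (use yneq yD dist S_simps(8,9) in \<open>auto simp: oE_def y_def[symmetric] y'_def[symmetric]\<close>)
    qed
    have n: "nE z = nxt D z" for z
    proof -
      consider "z = x" | "z = x'" | "z = last r" | "z \<noteq> x" "z \<noteq> x'" "z \<noteq> last r" by blast
      then show ?thesis by cases (use nx hl_neq dist S_simps(5,6) in \<open>auto simp: nE_def\<close>)
    qed
    have cD: "c \<in> darts D" "org D c = m'"
      using in_darts hl_darts mm by (auto simp: c_def doubleton_eq_iff)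
    have "orbit (\<lambda>z. nE (oE z)) c = orbit (rot D) c"
      by (rule orbit_agree[of "darts D"])
        (use o n cD pmapD(3,6)[OF pm] in \<open>auto simp: rot_def\<close>)
    then have orb: "orbit (\<lambda>z. nE (oE z)) c = {u \<in> darts D. org D u = m'}" using orbit_org[OF diD cD(1)] cD(2) by simp
    have g: "gE z = org D z" if z: "z \<in> darts D" "org D z \<noteq> m'" for z
    proof -
      consider "z = x" | "z = x'" | "z \<noteq> x" "z \<noteq> x'" by blast
      then show ?thesis
      proof cases
        case 1
        then have "m = org D x" "m' = org D (hd r)" using z(2) mm by (auto simp: doubleton_eq_iff)
        moreover have "gE x = \<rho> (org D (hd r))" using dist oy by (simp add: gE_def S_simps(4))
        moreover have "\<rho> m' = m" by (simp add: \<rho>_def)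
        ultimately show ?thesis using 1 by metis
      next
        case 2
        then show ?thesis using z(2) oy by (simp add: gE_def S_simps(4,8) \<rho>_def)
      next
        case 3
        then show ?thesis using z(2) by (simp add: gE_def S_simps(4) \<rho>_def)
      qed
    qed
    have "verts E = verts D" "darts E = darts D" "bnd E = bnd D"
      using m_in in_darts bD by (auto simp: E_def S_simps)
    then show ?thesis unfolding veq_via_def using o n g orb by (auto simp: E_def)
  qed
  ultimately show ?thesis unfolding shelling_move_def veq_def by blast
qed

end

text \<open>Inverse to a 1-cell expansion where the ends to be identified are distinct. Otherwise
  the fold is impossible, and the first alternative reports that the reduced word is already read on
  an enclosed part of \<open>D\<close>.\<close>

lemma realize_fold: assumes R: "realizes P b D (u @ [a, inv_letter a] @ v)" and b: "b = {} \<or> b = {s}"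
  shows "words_of P b D [u @ v] \<or> (\<exists>D' E. realizes P b D' (u @ v) \<and> shelling_move D' E \<and> veq b D E
    \<and> verts D' \<subseteq> verts D \<and> darts D' \<subseteq> darts D)"
proof -
  obtain lab l where l: "diagram D" "b \<subseteq> verts D" "labelling P D lab" "bcyc D l" "based b D l"
    "u @ [a, inv_letter a] @ v = map lab l"
    using R by (auto simp: realizes_def)
  obtain lu x x' lv where lw: "l = lu @ [x, x'] @ lv" "u = map lab lu" "lab x = a" "lab x' = inv_letter a" "v = map lab lv"
    using l(6) by (auto simp: append_eq_map_conv Cons_eq_map_conv)
  let ?r = "lv @ lu"
  have br: "bcyc D ([x, x'] @ ?r)" using bcyc_rotate[of D lu "[x, x'] @ lv"] l(4) lw(1) by simp
  have dl: "distinct l" "set l = bnd D" using l(4) by (auto simp: bcyc_def cyc_def)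
  show ?thesis
  proof (cases "?r = [] \<or> org D x = org D (hd ?r)")
    case True
    \<comment> \<open>The two edges form a loop or exhaust the boundary. The rest of the circuit
      encloses a closed set, and reading on that set omits just the cancelling pair.\<close>
    have "\<exists>K. closed_darts D K \<and> K \<inter> bnd D = set ?r"
    proof (cases "?r = []")
      case True
      then show ?thesis by (intro exI[of _ "{}"]) (auto simp: closed_darts_def)
    next
      case False
      then have "encloses D [x, x']"
        using diagram_enclosing[OF l(1)] br \<open>?r = [] \<or> org D x = org D (hd ?r)\<close> unfolding enclosing_def
        by (metis list.sel(1) list.discI)
      then show ?thesis using encloses_compl[of D ?r "[x, x']"] bcyc_rotate[OF br] unfolding encloses_def by blast
    qed
    then obtain K where K: "closed_darts D K" "K \<inter> bnd D = set ?r" by blast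
    have lb: "set lu \<subseteq> bnd D" "set lv \<subseteq> bnd D" "x \<in> bnd D" "x' \<in> bnd D"
      unfolding dl(2)[symmetric] lw(1) by auto
    have xn: "x \<notin> set ?r" "x' \<notin> set ?r" using dl(1) unfolding lw(1) by auto
    have "kword lab lu K = map lab lu" "kword lab lv K = map lab lv"
      by (rule kword_all; use K(2) in auto)+
    moreover have "kword lab [x, x'] K = []" by (rule kword_none) (use K(2) xn lb in auto)
    ultimately have "kword lab l K = u @ v" unfolding lw(1) kword_append using lw(2,5) by simp
    then have "words_of P b D [u @ v]" unfolding words_of_def using l K(1)
      by (intro exI[of _ lab] exI[of _ l] exI[of _ "[K]"]) simp
    then show ?thesis ..
  next
    case False
    \<comment> \<open>The name that survives is chosen so that the base is never renamed. As
      \<open>b\<close> has at most one element and the two ends differ, \<open>m'\<close> is not in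
      \<open>b\<close>.\<close>
    define m where "m = (if org D x \<in> b then org D x else org D (hd ?r))"
    define m' where "m' = (if org D x \<in> b then org D (hd ?r) else org D x)"
    interpret fold D x x' ?r m m'
      by unfold_locales (use l(1) br False in \<open>auto simp: m_def m'_def\<close>)
    have mb: "m' \<notin> b" using b False by (auto simp: m'_def)
    have "bcyc S (lu @ lv)" using bcyc_rotate[OF bS] .
    moreover have "based b S (lu @ lv)"
    proof (cases "b = {} \<or> lu @ lv = []")
      case c: False
      then have hb: "org D (hd l) \<in> b" using l(5) lw(1) by (auto simp: based_def)
      have "\<rho> w = w" if "w \<in> b" for w using that mb by (auto simp: \<rho>_def)
      moreover have "\<rho> (org D (hd (lu @ lv))) = \<rho> (org D (hd l))"
      proof (cases "lu = []")
        case True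
        then have "hd l = x" "hd (lu @ lv) = hd ?r" using lw(1) by auto
        then show ?thesis using \<rho>_ends by simp
      next
        case False
        then show ?thesis using lw(1) by simp
      qed
      ultimately show ?thesis using hb by (simp add: based_def S_simps(4))
    qed (auto simp: based_def)
    moreover have "b \<subseteq> verts S" using l(2) mb by (auto simp: S_simps(1))
    moreover have "labelling P S lab" using labS[OF l(3)] lw(3,4) by simp
    moreover have "map lab (lu @ lv) = u @ v" using lw(2,5) by simp
    ultimately have "realizes P b S (u @ v)" by (intro realizesI[OF diS])
    moreover have "verts S \<subseteq> verts D" "darts S \<subseteq> darts D" by (auto simp: S_simps)
    ultimately show ?thesis using expand[OF mb] by blast
  qed
qed

section \<open>The wedge of two diagrams\<close>

lemma first_return_around: assumes "cyc f (p @ q)" "p \<noteq> []" "set q \<inter> A = {}" "hd p \<in> A"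
  shows "first_return A f (last p) = hd p"
proof -
  obtain p' z where p: "p = p' @ [z]" using assms(2) by (cases p rule: rev_cases) auto
  have "successively (\<lambda>a b. f a = b) ((p @ q) @ [hd p])"
    unfolding successively_append_iff[of _ "p @ q"] using assms(1,2) by (simp add: cyc_def)
  then have "successively (\<lambda>a b. f a = b) (p' @ (z # q @ [hd p]))" using p by simp
  then have "successively (\<lambda>a b. f a = b) (z # q @ [hd p])" unfolding successively_append_iff by blast
  moreover have "filter (\<lambda>a. a \<in> A) (q @ [hd p]) = [hd p]"
    using assms(3,4) by (auto simp: filter_empty_conv)
  ultimately show ?thesis using first_return_chain[of f z "q @ [hd p]" A "hd p" "[]"] p by simp
qed

lemma cyc_succ: "cyc f l \<Longrightarrow> Suc i < length l \<Longrightarrow> f (l ! i) = l ! Suc i"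
  using cyc_nth[of f l i] by simp

locale wedge =
  fixes D1 D2 :: diag and l1 l2 :: "nat list"
  assumes di: "diagram D1" "diagram D2" and bl: "bcyc D1 l1" "bcyc D2 l2" and ne: "l1 \<noteq> []" "l2 \<noteq> []"
    and dj: "verts D1 \<inter> verts D2 = {}" "darts D1 \<inter> darts D2 = {}"
begin

definition v1 where "v1 = org D1 (hd l1)"
definition v2 where "v2 = org D2 (hd l2)"
definition \<rho> where "\<rho> u = (if u = v2 then v1 else u)"

text \<open>Splicing the boundary circuits at their first darts also splices the rotation cycles at
  \<open>v1\<close> and \<open>v2\<close>. All other regions are kept.\<close>

definition S :: diag where
  "S = \<lparr>verts = verts D1 \<union> (verts D2 - {v2}), darts = darts D1 \<union> darts D2,
     opp = (\<lambda>z. if z \<in> darts D1 then opp D1 z else opp D2 z),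
     org = (\<lambda>z. if z \<in> darts D1 then org D1 z else \<rho> (org D2 z)),
     nxt = (\<lambda>z. if z = last l1 then hd l2 else if z = last l2 then hd l1
              else if z \<in> darts D1 then nxt D1 z else nxt D2 z), bnd = set (l1 @ l2)\<rparr>"

lemma pm: "pmap D1" "pmap D2" using di by (simp_all add: diagram_iff)

lemma sub: "set l1 \<subseteq> darts D1" "set l2 \<subseteq> darts D2" "set l1 = bnd D1" "set l2 = bnd D2"
  using bl diagramD(7)[OF di(1)] diagramD(7)[OF di(2)] by (auto simp: bcyc_def)

lemma ends: "hd l1 \<in> darts D1" "last l1 \<in> darts D1" "hd l2 \<in> darts D2" "last l2 \<in> darts D2"
    "last l1 \<in> set l1" "last l2 \<in> set l2"
  using ne sub by auto

lemma nD: "x \<in> darts D1 \<Longrightarrow> x \<notin> darts D2" "x \<in> darts D2 \<Longrightarrow> x \<notin> darts D1"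
  using dj(2) by auto

lemma vv: "v1 \<in> verts D1" "v2 \<in> verts D2" "v1 \<notin> verts D2" "v2 \<notin> verts D1"
  using pmapD(8)[OF pm(1) ends(1)] pmapD(8)[OF pm(2) ends(3)] dj(1) by (auto simp: v1_def v2_def)

lemma S_simps: "verts S = verts D1 \<union> (verts D2 - {v2})" "darts S = darts D1 \<union> darts D2" "bnd S = set l1 \<union> set l2"
  "x \<in> darts D1 \<Longrightarrow> opp S x = opp D1 x" "x \<in> darts D2 \<Longrightarrow> opp S x = opp D2 x"
  "x \<in> darts D1 \<Longrightarrow> org S x = org D1 x" "x \<in> darts D2 \<Longrightarrow> org S x = \<rho> (org D2 x)"
  "nxt S (last l1) = hd l2" "nxt S (last l2) = hd l1"
  "x \<in> darts D1 \<Longrightarrow> x \<noteq> last l1 \<Longrightarrow> nxt S x = nxt D1 x" "x \<in> darts D2 \<Longrightarrow> x \<noteq> last l2 \<Longrightarrow> nxt S x = nxt D2 x"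
  using nD ends by (auto simp: S_def)

lemma cyc_l: "cyc (nxt S) (l1 @ l2)"
proof -
  have c: "cyc (nxt D1) l1" "cyc (nxt D2) l2" using bl by (simp_all add: bcyc_def)
  have "successively (\<lambda>a b. nxt S a = b) l1"
    unfolding successively_conv_nth
  proof (intro allI impI)
    fix i assume i: "Suc i < length l1"
    have "l1 ! i \<noteq> last l1" "l1 ! i \<in> darts D1" using nth_neq_last[OF _ i] c(1) i sub(1) by (auto simp: cyc_def)
    then show "nxt S (l1 ! i) = l1 ! Suc i" using S_simps(10) cyc_succ[OF c(1) i] by simp
  qed
  moreover have "successively (\<lambda>a b. nxt S a = b) l2"
    unfolding successively_conv_nth
  proof (intro allI impI)
    fix i assume i: "Suc i < length l2"
    have "l2 ! i \<noteq> last l2" "l2 ! i \<in> darts D2" using nth_neq_last[OF _ i] c(2) i sub(2) by (auto simp: cyc_def)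
    then show "nxt S (l2 ! i) = l2 ! Suc i" using S_simps(11) cyc_succ[OF c(2) i] by simp
  qed
  moreover have "set l1 \<inter> set l2 = {}" using sub dj(2) by blast
  ultimately show ?thesis using c S_simps(8,9) ne by (auto simp: cyc_def successively_append_iff)
qed

lemma other1: assumes "z \<in> darts D1 - bnd D1"
  obtains l where "cyc (nxt D1) (z # l)" "cyc (nxt S) (z # l)" "set (z # l) \<subseteq> darts D1 - bnd D1"
proof -
  have z: "z \<in> darts D1" "z \<notin> bnd D1" using assms by auto
  obtain l where l: "cyc (nxt D1) (z # l)" "set (z # l) \<subseteq> darts D1 - bnd D1"
    using nonbnd_cycle[OF pm(1) bl(1) z] by metis
  have "cyc (nxt S) (z # l)"
  proof (rule cyc_cong[OF l(1)])
    fix u assume "u \<in> set (z # l)"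
    then have "u \<in> darts D1" "u \<noteq> last l1" using l(2) ends(5) sub(3) by blast+
    then show "nxt D1 u = nxt S u" using S_simps(10) by simp
  qed
  then show ?thesis using that l by blast
qed

lemma other2: assumes "z \<in> darts D2 - bnd D2"
  obtains l where "cyc (nxt D2) (z # l)" "cyc (nxt S) (z # l)" "set (z # l) \<subseteq> darts D2 - bnd D2"
proof -
  have z: "z \<in> darts D2" "z \<notin> bnd D2" using assms by auto
  obtain l where l: "cyc (nxt D2) (z # l)" "set (z # l) \<subseteq> darts D2 - bnd D2"
    using nonbnd_cycle[OF pm(2) bl(2) z] by metis
  have "cyc (nxt S) (z # l)"
  proof (rule cyc_cong[OF l(1)])
    fix u assume "u \<in> set (z # l)"
    then have "u \<in> darts D2" "u \<noteq> last l2" using l(2) ends(6) sub(4) by blast+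
    then show "nxt D2 u = nxt S u" using S_simps(11) by simp
  qed
  then show ?thesis using that l by blast
qed

lemma nonbnd: "darts S - bnd S = (darts D1 - bnd D1) \<union> (darts D2 - bnd D2)"
  using sub dj(2) by (auto simp: S_simps)

lemma pmS: "pmap S"
  unfolding pmap_def
proof (intro conjI ballI)
  show "finite (verts S)" "finite (darts S)" using pmapD(1,2)[OF pm(1)] pmapD(1,2)[OF pm(2)] by (simp_all add: S_simps)
  show "org S ` darts S \<subseteq> verts S"
  proof
    fix u assume "u \<in> org S ` darts S"
    then obtain z where z: "z \<in> darts S" "u = org S z" by blast
    then consider "z \<in> darts D1" | "z \<in> darts D2" by (auto simp: S_simps(2))
    then show "u \<in> verts S"
    proof cases
      case 1
      then show ?thesis using z(2) S_simps(6)[OF 1] pmapD(8)[OF pm(1) 1] by (simp add: S_simps(1))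
    next
      case 2
      then show ?thesis using z(2) S_simps(7)[OF 2] pmapD(8)[OF pm(2) 2] vv(1) by (simp add: S_simps(1) \<rho>_def)
    qed
  qed
  show "bij_betw (nxt S) (darts S) (darts S)"
  proof (rule cyc_cover_bij)
    fix z assume z: "z \<in> darts S"
    consider "z \<in> set (l1 @ l2)" | "z \<in> darts D1 - bnd D1" | "z \<in> darts D2 - bnd D2"
      using z nonbnd S_simps(3) by auto
    then show "\<exists>l. cyc (nxt S) l \<and> z \<in> set l \<and> set l \<subseteq> darts S"
    proof cases
      case 1
      then show ?thesis using cyc_l sub by (intro exI[of _ "l1 @ l2"]) (auto simp: S_simps(2))
    next
      case 2
      then obtain l where "cyc (nxt S) (z # l)" "set (z # l) \<subseteq> darts D1 - bnd D1" by (rule other1)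
      then show ?thesis by (intro exI[of _ "z # l"]) (auto simp: S_simps(2))
    next
      case 3
      then obtain l where "cyc (nxt S) (z # l)" "set (z # l) \<subseteq> darts D2 - bnd D2" by (rule other2)
      then show ?thesis by (intro exI[of _ "z # l"]) (auto simp: S_simps(2))
    qed
  qed
  fix z assume "z \<in> darts S"
  then consider "z \<in> darts D1" | "z \<in> darts D2" by (auto simp: S_simps(2))
  note c = this
  show "opp S z \<in> darts S" using c by cases (use S_simps(2,4,5) pmapD(3)[OF pm(1)] pmapD(3)[OF pm(2)] in auto)
  show "opp S z \<noteq> z" using c by cases (use S_simps(4,5) pmapD(4)[OF pm(1)] pmapD(4)[OF pm(2)] in auto)
  show "opp S (opp S z) = z"
    using c by cases (use S_simps(4,5) pmapD(3,5)[OF pm(1)] pmapD(3,5)[OF pm(2)] in auto)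
qed

lemma rotS1: "z \<in> darts D1 \<Longrightarrow> rot S z = (if opp D1 z = last l1 then hd l2 else rot D1 z)"
  using S_simps(4,8,10) pmapD(3)[OF pm(1)] by (auto simp: rot_def)

lemma rotS2: "z \<in> darts D2 \<Longrightarrow> rot S z = (if opp D2 z = last l2 then hd l1 else rot D2 z)"
  using S_simps(5,9,11) pmapD(3)[OF pm(2)] by (auto simp: rot_def)

text \<open>Each cycle is listed so that it ends at the reverse of the last boundary dart, where the
  rotation of the wedge crosses over to the other diagram.\<close>

lemma vertex_cycles:
  obtains m1 m2 where "m1 \<noteq> []" "m2 \<noteq> []" "hd m1 = hd l1" "hd m2 = hd l2" "last m1 = opp D1 (last l1)" "last m2 = opp D2 (last l2)"
    "set m1 = {u \<in> darts D1. org D1 u = v1}" "set m2 = {u \<in> darts D2. org D2 u = v2}" "cyc (rot S) (m1 @ m2)"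
proof -
  have n: "nxt D1 (last l1) = hd l1" "nxt D2 (last l2) = hd l2" using bl ne by (auto simp: bcyc_def cyc_def)
  have r: "rot D1 (opp D1 (last l1)) = hd l1" "rot D2 (opp D2 (last l2)) = hd l2"
    using rot_opp[OF pm(1) ends(2)] rot_opp[OF pm(2) ends(4)] n by simp_all
  obtain t1 where t1: "cyc (rot D1) (hd l1 # t1)" "set (hd l1 # t1) = {u \<in> darts D1. org D1 u = org D1 (hd l1)}"
    "last (hd l1 # t1) = opp D1 (last l1)"
    by (rule vertex_cycle[OF di(1) ends(1) pmapD(3)[OF pm(1) ends(2)] r(1)])
  obtain t2 where t2: "cyc (rot D2) (hd l2 # t2)" "set (hd l2 # t2) = {u \<in> darts D2. org D2 u = org D2 (hd l2)}"
    "last (hd l2 # t2) = opp D2 (last l2)"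
    by (rule vertex_cycle[OF di(2) ends(3) pmapD(3)[OF pm(2) ends(4)] r(2)])
  let ?m1 = "hd l1 # t1" and ?m2 = "hd l2 # t2"
  have s1: "successively (\<lambda>a b. rot S a = b) ?m1"
    unfolding successively_conv_nth
  proof (intro allI impI)
    fix i assume i: "Suc i < length ?m1"
    have "?m1 ! i \<noteq> opp D1 (last l1)" using nth_neq_last[OF _ i] t1(1,3) by (auto simp: cyc_def)
    moreover have d: "?m1 ! i \<in> darts D1" using nth_mem[of i ?m1] i t1(2) by auto
    ultimately have "opp D1 (?m1 ! i) \<noteq> last l1" using pmapD(5)[OF pm(1) d] by metis
    then have "rot S (?m1 ! i) = rot D1 (?m1 ! i)" using rotS1[OF d] by simp
    then show "rot S (?m1 ! i) = ?m1 ! Suc i" using cyc_succ[OF t1(1) i] by simp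
  qed
  have s2: "successively (\<lambda>a b. rot S a = b) ?m2"
    unfolding successively_conv_nth
  proof (intro allI impI)
    fix i assume i: "Suc i < length ?m2"
    have "?m2 ! i \<noteq> opp D2 (last l2)" using nth_neq_last[OF _ i] t2(1,3) by (auto simp: cyc_def)
    moreover have d: "?m2 ! i \<in> darts D2" using nth_mem[of i ?m2] i t2(2) by auto
    ultimately have "opp D2 (?m2 ! i) \<noteq> last l2" using pmapD(5)[OF pm(2) d] by metis
    then have "rot S (?m2 ! i) = rot D2 (?m2 ! i)" using rotS2[OF d] by simp
    then show "rot S (?m2 ! i) = ?m2 ! Suc i" using cyc_succ[OF t2(1) i] by simp
  qed
  have e: "rot S (opp D1 (last l1)) = hd l2" "rot S (opp D2 (last l2)) = hd l1"
    using rotS1[OF pmapD(3)[OF pm(1) ends(2)]] rotS2[OF pmapD(3)[OF pm(2) ends(4)]]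
      pmapD(5)[OF pm(1) ends(2)] pmapD(5)[OF pm(2) ends(4)] by simp_all
  have "set ?m1 \<inter> set ?m2 = {}" unfolding t1(2) t2(2) using dj(2) by blast
  moreover have "distinct ?m1" "distinct ?m2" using t1(1) t2(1) by (simp_all add: cyc_def)
  ultimately have "cyc (rot S) (?m1 @ ?m2)"
    unfolding cyc_def successively_append_iff distinct_append using s1 s2 e t1(3) t2(3) by simp
  then show ?thesis using that[of ?m1 ?m2] t1(2,3) t2(2,3) by (simp add: v1_def v2_def)
qed

lemma orgS: "orgcond S"
proof -
  obtain m1 m2 where m: "m1 \<noteq> []" "m2 \<noteq> []" "set m1 = {u \<in> darts D1. org D1 u = v1}" 
     "set m2 = {u \<in> darts D2. org D2 u = v2}" "cyc (rot S) (m1 @ m2)"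
    by (rule vertex_cycles)
  have o1: "org S u = org D1 u" if "u \<in> darts D1" for u using S_simps(6)[OF that] .
  have v1m: "set (m1 @ m2) = {u \<in> darts S. org S u = v1}"
  proof -
    have "org S u = v1 \<longleftrightarrow> org D2 u = v2" if "u \<in> darts D2" for u
      using S_simps(7)[OF that] pmapD(8)[OF pm(2) that] vv(3) by (auto simp: \<rho>_def)
    then show ?thesis using o1 nD unfolding set_append m(3,4) by (auto simp: S_simps(2))
  qed
  have "orbit (rot S) z = {u \<in> darts S. org S u = org S z}" if z: "z \<in> darts S" for z
  proof (cases "org S z = v1")
    case True
    then have "z \<in> set (m1 @ m2)" using v1m z by blast
    then show ?thesis using cyc_orbit[OF m(5)] v1m True by simp
  next
    case False
    from z consider "z \<in> darts D1" | "z \<in> darts D2" by (auto simp: S_simps(2))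
    then show ?thesis
    proof cases
      case 1
      obtain t where t: "cyc (rot D1) (z # t)" "set (z # t) \<subseteq> darts D1" "orbit (rot D1) z = set (z # t)"
        by (rule rot_cycle[OF pm(1) 1])
      have s: "set (z # t) = {u \<in> darts D1. org D1 u = org D1 z}" using t(3) orbit_org[OF di(1) 1] by simp
      have "cyc (rot S) (z # t)"
      proof (rule cyc_cong[OF t(1)])
        fix u assume u: "u \<in> set (z # t)"
        then have ud: "u \<in> darts D1" "org D1 u \<noteq> v1" using s False o1[OF 1] by auto
        have "opp D1 u \<noteq> last l1"
        proof
          assume "opp D1 u = last l1"
          then have "rot D1 u = hd l1" using bl(1) ne by (simp add: rot_def bcyc_def cyc_def)
          then show False using org_rot[OF di(1) ud(1)] ud(2) by (simp add: v1_def)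
        qed
        then show "rot D1 u = rot S u" using rotS1[OF ud(1)] by simp
      qed
      then have "orbit (rot S) z = set (z # t)" by (rule cyc_orbit) simp
      moreover have "org S u \<noteq> org S z" if "u \<in> darts D2" for u
        using S_simps(7)[OF that] pmapD(8)[OF pm(2) that] pmapD(8)[OF pm(1) 1] o1[OF 1] False dj(1)
        by (auto simp: \<rho>_def)
      ultimately show ?thesis using s o1 1 by (auto simp: S_simps(2))
    next
      case 2
      obtain t where t: "cyc (rot D2) (z # t)" "set (z # t) \<subseteq> darts D2" "orbit (rot D2) z = set (z # t)"
        by (rule rot_cycle[OF pm(2) 2])
      have s: "set (z # t) = {u \<in> darts D2. org D2 u = org D2 z}" using t(3) orbit_org[OF di(2) 2] by simp
      have z2: "org D2 z \<noteq> v2" "org S z = org D2 z" using False S_simps(7)[OF 2] by (auto simp: \<rho>_def)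
      have "cyc (rot S) (z # t)"
      proof (rule cyc_cong[OF t(1)])
        fix u assume u: "u \<in> set (z # t)"
        then have ud: "u \<in> darts D2" "org D2 u \<noteq> v2" using s z2 by auto
        have "opp D2 u \<noteq> last l2"
        proof
          assume "opp D2 u = last l2"
          then have "rot D2 u = hd l2" using bl(2) ne by (simp add: rot_def bcyc_def cyc_def)
          then show False using org_rot[OF di(2) ud(1)] ud(2) by (simp add: v2_def)
        qed
        then show "rot D2 u = rot S u" using rotS2[OF ud(1)] by simp
      qed
      then have "orbit (rot S) z = set (z # t)" by (rule cyc_orbit) simp
      moreover have "org S u \<noteq> org S z" if "u \<in> darts D1" for u
        using o1[OF that] pmapD(8)[OF pm(1) that] pmapD(8)[OF pm(2) 2] z2(2) dj(1) by auto
      moreover have "org S u = org S z \<longleftrightarrow> org D2 u = org D2 z" if "u \<in> darts D2" for u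
        using S_simps(7)[OF that] z2 False by (auto simp: \<rho>_def)
      ultimately show ?thesis using s by (auto simp: S_simps(2))
    qed
  qed
  then show ?thesis unfolding orgcond_def by auto
qed

lemma connS: "conn S"
proof -
  have a1: "adjacent D1 \<subseteq> adjacent S"
  proof
    fix k assume "k \<in> adjacent D1"
    then obtain z where z: "z \<in> darts D1" "k = (org D1 z, org D1 (opp D1 z))" by (auto simp: adjacent_def)
    then have "k = (org S z, org S (opp S z))" using S_simps(4,6) pmapD(3)[OF pm(1) z(1)] by simp
    then show "k \<in> adjacent S" using z(1) by (auto simp: adjacent_def S_simps(2))
  qed
  have a2: "(\<rho> u, \<rho> w) \<in> adjacent S" if "(u, w) \<in> adjacent D2" for u w
  proof -
    obtain z where z: "z \<in> darts D2" "u = org D2 z" "w = org D2 (opp D2 z)" using \<open>(u, w) \<in> adjacent D2\<close> by (auto simp: adjacent_def)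
    then have "(\<rho> u, \<rho> w) = (org S z, org S (opp S z))" using S_simps(5,7) pmapD(3)[OF pm(2) z(1)] by simp
    then show ?thesis using z(1) by (auto simp: adjacent_def S_simps(2))
  qed
  have a2': "(\<rho> u, \<rho> w) \<in> (adjacent S)\<^sup>*" if "(u, w) \<in> (adjacent D2)\<^sup>*" for u w
    using that by induction (auto intro: rtrancl_into_rtrancl a2)
  have "(v1, u) \<in> (adjacent S)\<^sup>* \<and> (u, v1) \<in> (adjacent S)\<^sup>*" if u: "u \<in> verts S" for u
  proof (cases "u \<in> verts D1")
    case True
    then have "(v1, u) \<in> (adjacent D1)\<^sup>*" "(u, v1) \<in> (adjacent D1)\<^sup>*"
      using diagramD(4)[OF di(1)] vv(1) by (auto simp: conn_def)
    then show ?thesis using rtrancl_mono[OF a1] by blast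
  next
    case False
    then have u2: "u \<in> verts D2" "u \<noteq> v2" using u by (auto simp: S_simps(1))
    then have "(v2, u) \<in> (adjacent D2)\<^sup>*" "(u, v2) \<in> (adjacent D2)\<^sup>*"
      using diagramD(4)[OF di(2)] vv(2) by (auto simp: conn_def)
    then have "(\<rho> v2, \<rho> u) \<in> (adjacent S)\<^sup>*" "(\<rho> u, \<rho> v2) \<in> (adjacent S)\<^sup>*" using a2' by blast+
    then show ?thesis using u2(2) by (simp add: \<rho>_def)
  qed
  then show ?thesis unfolding conn_def by (meson rtrancl_trans)
qed

lemma bS: "bcyc S (l1 @ l2)" using cyc_l by (simp add: bcyc_def S_simps(3))

lemma cellsS: "cells S = cells D1 \<union> cells D2"
proof -
  have e1: "orbit (nxt S) z = orbit (nxt D1) z" if z: "z \<in> darts D1 - bnd D1" for z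
  proof -
    obtain l where "cyc (nxt D1) (z # l)" "cyc (nxt S) (z # l)" by (rule other1[OF z])
    then show ?thesis using cyc_orbit[of "nxt D1" "z # l" z] cyc_orbit[of "nxt S" "z # l" z] by simp
  qed
  have e2: "orbit (nxt S) z = orbit (nxt D2) z" if z: "z \<in> darts D2 - bnd D2" for z
  proof -
    obtain l where "cyc (nxt D2) (z # l)" "cyc (nxt S) (z # l)" by (rule other2[OF z])
    then show ?thesis using cyc_orbit[of "nxt D2" "z # l" z] cyc_orbit[of "nxt S" "z # l" z] by simp
  qed
  have "cells S = orbit (nxt S) ` (darts S - bnd S)"
    by (rule cells_eq[OF pmS bS]) (use sub in \<open>auto simp: S_simps(2,3)\<close>)
  moreover have "cells D1 = orbit (nxt D1) ` (darts D1 - bnd D1)" "cells D2 = orbit (nxt D2) ` (darts D2 - bnd D2)"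
    using cells_eq[OF pm(1) bl(1) diagramD(7)[OF di(1)]] cells_eq[OF pm(2) bl(2) diagramD(7)[OF di(2)]] .
  moreover have "orbit (nxt S) ` (darts D1 - bnd D1) = orbit (nxt D1) ` (darts D1 - bnd D1)"
    by (rule image_cong[OF HOL.refl e1])
  moreover have "orbit (nxt S) ` (darts D2 - bnd D2) = orbit (nxt D2) ` (darts D2 - bnd D2)"
    by (rule image_cong[OF HOL.refl e2])
  ultimately show ?thesis using nonbnd by (simp add: image_Un)
qed

lemma cells_sub: "c \<in> cells D1 \<Longrightarrow> c \<subseteq> darts D1 \<and> c \<noteq> {}" "c \<in> cells D2 \<Longrightarrow> c \<subseteq> darts D2 \<and> c \<noteq> {}"
proof -
  have g: "c \<subseteq> darts D \<and> c \<noteq> {}" if pd: "pmap D" and c: "c \<in> cells D" for c D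
  proof -
    obtain d where d: "d \<in> darts D" "c = orbit (nxt D) d" using c by (auto simp: cells_def regions_def)
    obtain t where "set (d # t) \<subseteq> darts D" "orbit (nxt D) d = set (d # t)" by (rule nxt_cycle[OF pd d(1)])
    then show ?thesis using d(2) by auto
  qed
  show "c \<in> cells D1 \<Longrightarrow> c \<subseteq> darts D1 \<and> c \<noteq> {}" "c \<in> cells D2 \<Longrightarrow> c \<subseteq> darts D2 \<and> c \<noteq> {}" using g pm by blast+
qed

text \<open>The sum of the two Euler relations counts the common vertex twice and the complementary
  region twice; these two units are the surplus of the constant.\<close>

lemma eulerS: "euler S"
proof -
  have f: "finite (cells D1)" "finite (cells D2)" "finite (edges D1)" "finite (edges D2)"
    using pmapD(2)[OF pm(1)] pmapD(2)[OF pm(2)] by (auto simp: cells_def regions_def edges_def)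
  have "cells D1 \<inter> cells D2 = {}" using cells_sub dj(2) by blast
  then have c: "card (cells S) = card (cells D1) + card (cells D2)" using f by (simp add: cellsS card_Un_disjoint)
  have "edges S = edges D1 \<union> edges D2"
  proof -
    have "(\<lambda>d. {d, opp S d}) ` darts D1 = edges D1" "(\<lambda>d. {d, opp S d}) ` darts D2 = edges D2"
      unfolding edges_def by (rule image_cong; simp add: S_simps(4,5))+
    then show ?thesis by (simp add: edges_def[of S] S_simps(2) image_Un)
  qed
  moreover have "edges D1 \<inter> edges D2 = {}"
  proof -
    have "c \<inter> darts D1 \<noteq> {}" if "c \<in> edges D1" for c using that by (auto simp: edges_def)
    moreover have "c \<subseteq> darts D2" if "c \<in> edges D2" for c using that pmapD(3)[OF pm(2)] by (auto simp: edges_def)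
    ultimately show ?thesis using dj(2) by blast
  qed
  ultimately have e: "card (edges S) = card (edges D1) + card (edges D2)" using f by (simp add: card_Un_disjoint)
  have "verts D1 \<inter> (verts D2 - {v2}) = {}" using dj(1) by blast
  then have "card (verts S) = card (verts D1) + card (verts D2 - {v2})"
    using pmapD(1)[OF pm(1)] pmapD(1)[OF pm(2)] by (simp add: S_simps(1) card_Un_disjoint)
  moreover have "Suc (card (verts D2 - {v2})) = card (verts D2)"
    by (rule card_Suc_Diff1[OF pmapD(1)[OF pm(2)] vv(2)])
  ultimately show ?thesis using c e diagramD(5)[OF di(1)] diagramD(5)[OF di(2)] by (simp add: euler_def)
qed

lemma diS: "diagram S"
  unfolding diagram_iff
proof (intro conjI)
  show "verts S \<noteq> {}" using vv by (auto simp: S_simps(1))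
  show "\<exists>l. bcyc S l" using bS by blast
  show "bnd S \<subseteq> darts S" using sub by (auto simp: S_simps(2,3))
  show "bnd S = {} \<longrightarrow> darts S = {}" using ne by (simp add: S_simps(3))
qed (rule pmS orgS connS eulerS)+

lemma labS: assumes "labelling P D1 lab1" "labelling P D2 lab2"
  shows "labelling P S (\<lambda>z. if z \<in> darts D1 then lab1 z else lab2 z)" (is "labelling P S ?lab")
proof (rule labellingI)
  have l2: "?lab z = lab2 z" if "z \<in> darts D2" for z using nD(2)[OF that] by simp
  fix d assume "d \<in> darts S"
  then consider "d \<in> darts D1" | "d \<in> darts D2" by (auto simp: S_simps(2))
  note c = this
  show "?lab d \<in> gens P \<times> UNIV"
    using c by cases (use l2 labellingD(1)[OF assms(1)] labellingD(1)[OF assms(2)] in \<open>simp_all del: mem_Times_iff\<close>)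
  show "?lab (opp S d) = inv_letter (?lab d)"
    using c
  proof cases
    case 1
    then show ?thesis using S_simps(4)[OF 1] labellingD(2)[OF assms(1) 1] pmapD(3)[OF pm(1) 1] by simp
  next
    case 2
    then show ?thesis using S_simps(5)[OF 2] labellingD(2)[OF assms(2) 2] l2[OF 2] nD(2)[OF pmapD(3)[OF pm(2) 2]] by simp
  qed
next
  have l2: "?lab z = lab2 z" if "z \<in> darts D2" for z using nD(2)[OF that] by simp
  fix d t assume d: "d \<in> darts S" "d \<notin> bnd S" and c: "cyc (nxt S) (d # t)"
  from d consider "d \<in> darts D1 - bnd D1" | "d \<in> darts D2 - bnd D2" using nonbnd by blast
  then show "map ?lab (d # t) \<in> cyclic_rels P"
  proof cases
    case 1
    obtain l where l: "cyc (nxt D1) (d # l)" "cyc (nxt S) (d # l)" "set (d # l) \<subseteq> darts D1 - bnd D1" by (rule other1[OF 1])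
    have "l = t" using cyc_unique[OF l(2) c] .
    moreover have "map ?lab (d # l) = map lab1 (d # l)"
      by (rule map_cong[OF HOL.refl]) (use l(3) in auto)
    ultimately show ?thesis using labellingD(3)[OF assms(1) _ _ l(1)] 1 by (metis DiffD1 DiffD2)
  next
    case 2
    obtain l where l: "cyc (nxt D2) (d # l)" "cyc (nxt S) (d # l)" "set (d # l) \<subseteq> darts D2 - bnd D2" by (rule other2[OF 2])
    have "l = t" using cyc_unique[OF l(2) c] .
    moreover have "map ?lab (d # l) = map lab2 (d # l)"
      by (rule map_cong[OF HOL.refl l2]) (use l(3) in blast)
    ultimately show ?thesis using labellingD(3)[OF assms(2) _ _ l(1)] 2 by (metis DiffD1 DiffD2)
  qed
qed

text \<open>A first return to the darts of one part skips the darts of the other in the common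
  rotation cycle and so recovers the original cycle. The second part comes back with
  \<open>v2\<close> renamed, which is why diagrams are compared up to vertex names.\<close>

lemma split: "\<exists>E1 E2. fragment S E1 E2 \<and> veq {} D1 E1 \<and> veq {} D2 E2"
proof -
  obtain m1 m2 where m: "m1 \<noteq> []" "m2 \<noteq> []" "hd m1 = hd l1" "hd m2 = hd l2"
    "last m1 = opp D1 (last l1)" "last m2 = opp D2 (last l2)" "set m1 = {u \<in> darts D1. org D1 u = v1}" 
    "set m2 = {u \<in> darts D2. org D2 u = v2}" "cyc (rot S) (m1 @ m2)"
    by (rule vertex_cycles)
  have nx: "nxt D1 (last l1) = hd l1" "nxt D2 (last l2) = hd l2" using bl ne by (auto simp: bcyc_def cyc_def)
  let ?V2 = "insert v1 (verts D2 - {v2})"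
  define E1 where "E1 = subdiag S (verts D1) (darts D1) (bnd S \<inter> darts D1)"
  define E2 where "E2 = subdiag S ?V2 (darts D2) (bnd S \<inter> darts D2)"
  have n1: "first_return (darts D1) (rot S) (opp S x) = nxt D1 x" if x: "x \<in> darts D1" for x
  proof (cases "x = last l1")
    case True
    have "set m2 \<inter> darts D1 = {}" using m(8) dj(2) by blast
    then show ?thesis using first_return_around[OF m(9,1), of "darts D1"] m(3,5) ends(1) nx(1) True S_simps(4)[OF x] by simp
  next
    case False
    have "rot S (opp S x) = nxt D1 x" using rot_opp[OF pmS, of x] S_simps(10)[OF x False] x by (simp add: S_simps(2))
    then show ?thesis using first_return_step[of "rot S" "opp S x" "darts D1"] pmapD(6)[OF pm(1) x] by simp
  qed
  have n2: "first_return (darts D2) (rot S) (opp S x) = nxt D2 x" if x: "x \<in> darts D2" for x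
  proof (cases "x = last l2")
    case True
    have "set m1 \<inter> darts D2 = {}" using m(7) dj(2) by blast
    then show ?thesis using first_return_around[OF cyc_rotate[OF m(9)] m(2), of "darts D2"] m(4,6) ends(3) nx(2) True S_simps(5)[OF x] by simp
  next
    case False
    have "rot S (opp S x) = nxt D2 x" using rot_opp[OF pmS, of x] S_simps(11)[OF x False] x by (simp add: S_simps(2))
    then show ?thesis using first_return_step[of "rot S" "opp S x" "darts D2"] pmapD(6)[OF pm(2) x] by simp
  qed
  have b: "bnd S \<inter> darts D1 = bnd D1" "bnd S \<inter> darts D2 = bnd D2"
    using sub dj(2) by (auto simp: S_simps(3))
  have q1: "veq_via {} id D1 E1" unfolding veq_via_def E1_def subdiag_def b
    using n1 S_simps(4,6) by simp
  have "inj_on \<rho> (verts D2)" using vv(3) by (auto simp: inj_on_def \<rho>_def)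
  moreover have "?V2 = \<rho> ` verts D2" using vv(2) by (auto simp: \<rho>_def)
  ultimately have q2: "veq_via {} \<rho> D2 E2" unfolding veq_via_def E2_def subdiag_def b
    using n2 S_simps(5,7) by simp
  have "fragment S E1 E2" unfolding fragment_def
  proof (intro exI conjI)
    show "verts D1 \<union> ?V2 = verts S" using vv by (auto simp: S_simps(1))
    show "verts D1 \<inter> ?V2 = {v1}" using vv dj(1) by auto
    show "darts D1 \<union> darts D2 = darts S" by (simp add: S_simps(2))
    show "darts D1 \<inter> darts D2 = {}" by (rule dj)
    show "\<forall>c\<in>cells S. c \<subseteq> darts D1 \<or> c \<subseteq> darts D2" using cells_sub unfolding cellsS by blast
    show "diagram E1" "diagram E2" using veq_diagram[OF di(1) q1] veq_diagram[OF di(2) q2] .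
  qed (rule E1_def E2_def)+
  then show ?thesis using q1 q2 unfolding veq_def by blast
qed

end

lemma realize_wedge: assumes "realizes P {} D1 u" "realizes P {} D2 v" "u \<noteq> []" "v \<noteq> []"
    "verts D1 \<inter> verts D2 = {}" "darts D1 \<inter> darts D2 = {}"
  shows "\<exists>D E1 E2. realizes P {} D (u @ v) \<and> fragment D E1 E2 \<and> veq {} D1 E1 \<and> veq {} D2 E2
    \<and> verts D \<subseteq> verts D1 \<union> verts D2 \<and> darts D \<subseteq> darts D1 \<union> darts D2"
proof -
  obtain lab1 l1 where l1: "diagram D1" "labelling P D1 lab1" "bcyc D1 l1" "u = map lab1 l1"
    using assms(1) by (auto simp: realizes_def)
  obtain lab2 l2 where l2: "diagram D2" "labelling P D2 lab2" "bcyc D2 l2" "v = map lab2 l2"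
    using assms(2) by (auto simp: realizes_def)
  interpret wedge D1 D2 l1 l2 by unfold_locales (use l1 l2 assms in auto)
  let ?lab = "\<lambda>z. if z \<in> darts D1 then lab1 z else lab2 z"
  have "map ?lab l1 = u" unfolding l1(4) by (rule map_cong[OF HOL.refl]) (use sub in auto)
  moreover have "map ?lab l2 = v" unfolding l2(4) by (rule map_cong[OF HOL.refl]) (use sub nD in auto)
  ultimately have "map ?lab (l1 @ l2) = u @ v" by (simp only: map_append)
  then have "realizes P {} S (u @ v)"
    using realizesI[OF diS empty_subsetI labS[OF l1(2) l2(2)] bS] by (simp add: based_def)
  moreover have "verts S \<subseteq> verts D1 \<union> verts D2" "darts S \<subseteq> darts D1 \<union> darts D2" by (auto simp: S_simps(1,2))
  ultimately show ?thesis using split by blast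
qed

text \<open>Phrased by removing one occurrence, so that equal pairs in the multiset count as
  different components.\<close>

definition apart :: "(diag \<times> 'w) multiset \<Rightarrow> bool" where
  "apart Z \<longleftrightarrow> (\<forall>z Y. Z = add_mset z Y \<longrightarrow>
     (\<forall>y\<in>#Y. verts (fst z) \<inter> verts (fst y) = {} \<and> darts (fst z) \<inter> darts (fst y) = {}))"

lemma apart_add: "apart (add_mset z Z) \<longleftrightarrow> apart Z \<and>
   (\<forall>y\<in>#Z. verts (fst z) \<inter> verts (fst y) = {} \<and> darts (fst z) \<inter> darts (fst y) = {})" (is "?L \<longleftrightarrow> ?R")
proof
  assume l: ?L
  have "\<forall>y\<in>#Y. verts (fst z') \<inter> verts (fst y) = {} \<and> darts (fst z') \<inter> darts (fst y) = {}"
    if "Z = add_mset z' Y" for z' Y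
  proof -
    have "add_mset z Z = add_mset z' (add_mset z Y)" using that by (simp add: add_mset_commute)
    then have "\<forall>y\<in>#add_mset z Y. verts (fst z') \<inter> verts (fst y) = {} \<and> darts (fst z') \<inter> darts (fst y) = {}"
      using l unfolding apart_def by blast
    then show ?thesis by simp
  qed
  then have "apart Z" unfolding apart_def by blast
  moreover have "\<forall>y\<in>#Z. verts (fst z) \<inter> verts (fst y) = {} \<and> darts (fst z) \<inter> darts (fst y) = {}"
    using l unfolding apart_def by (elim allE[of _ z] allE[of _ Z] impE) (rule HOL.refl)
  ultimately show ?R ..
next
  assume r: ?R
  show ?L unfolding apart_def
  proof (intro allI impI)
    fix z' Y assume e: "add_mset z Z = add_mset z' Y"
    show "\<forall>y\<in>#Y. verts (fst z') \<inter> verts (fst y) = {} \<and> darts (fst z') \<inter> darts (fst y) = {}"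
    proof (cases "z = z'")
      case True
      then show ?thesis using e r by auto
    next
      case False
      then obtain K where K: "Z = add_mset z' K" "Y = add_mset z K" using e by (auto simp: add_eq_conv_ex)
      have "\<forall>y\<in>#K. verts (fst z') \<inter> verts (fst y) = {} \<and> darts (fst z') \<inter> darts (fst y) = {}"
        using r K(1) unfolding apart_def by blast
      moreover have "verts (fst z) \<inter> verts (fst z') = {} \<and> darts (fst z) \<inter> darts (fst z') = {}" using r K(1) by auto
      ultimately show ?thesis using K(2) by auto
    qed
  qed
qed

lemma apart_replace:
  assumes "apart (add_mset (D, w) Z)" "verts D' \<inter> (\<Union>z\<in>set_mset Z. verts (fst z)) \<subseteq> verts D"
    "darts D' \<inter> (\<Union>z\<in>set_mset Z. darts (fst z)) \<subseteq> darts D"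
  shows "apart (add_mset (D', w') Z)"
  unfolding apart_add
proof (intro conjI ballI)
  show "apart Z" using assms(1) by (simp add: apart_add)
  fix y assume y: "y \<in># Z"
  then have "verts D \<inter> verts (fst y) = {}" "darts D \<inter> darts (fst y) = {}" using assms(1) by (auto simp: apart_add)
  then show "verts (fst (D', w')) \<inter> verts (fst y) = {}" "darts (fst (D', w')) \<inter> darts (fst y) = {}"
    using assms(2,3) y by auto
qed

lemma realizes_perim: "realizes P b D w \<Longrightarrow> perim D = length w"
  using perim_bcyc unfolding realizes_def by fastforce

lemma no_darts_single_vertex: assumes "diagram D" "darts D = {}" shows "single_vertex D"
proof -
  have "adjacent D = {}" using assms(2) by (simp add: adjacent_def)
  then have "u = v" if "u \<in> verts D" "v \<in> verts D" for u v
    using diagramD(4)[OF assms(1)] that unfolding conn_def by auto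
  then have "\<exists>v. verts D = {v}" using diagramD(2)[OF assms(1)] by blast
  then show ?thesis using assms(2) by (simp add: single_vertex_def)
qed

lemma single_vertex_perim: "diagram D \<Longrightarrow> single_vertex D \<Longrightarrow> perim D = 0"
  using diagramD(7) by (fastforce simp: single_vertex_def perim_def)

text \<open>A single vertex has perimeter zero, so it can accompany a whole shelling at no cost. It
  realizes the empty word introduced by \<open>drop\<close>.\<close>

lemma shellable_add_vertex:
  assumes "shellable fr b L n X" "diagram D" "single_vertex D" "b \<subseteq> verts D"
  shows "shellable fr b L n (add_mset D X)"
  using assms
proof (induction rule: shellable.induct)
  case (vertices X)
  then show ?case using single_vertex_perim[of D] by (intro shellable.vertices) (auto simp: admissible_def)
next
  case (shell D0 X D' n)
  have "admissible b L (add_mset D0 (add_mset D X))"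
    using shell single_vertex_perim[of D] by (auto simp: admissible_def)
  moreover have "shellable fr b L n (add_mset D' (add_mset D X))"
    using shell.IH shell.prems by (simp add: add_mset_commute)
  ultimately have "shellable fr b L (Suc n) (add_mset D0 (add_mset D X))" using shell(2) by (auto intro: shellable.shell)
  then show ?case by (simp add: add_mset_commute)
next
  case (frag D0 X D1 D2 n)
  have "admissible b L (add_mset D0 (add_mset D X))"
    using frag single_vertex_perim[of D] by (auto simp: admissible_def)
  moreover have "shellable fr b L n (add_mset D1 (add_mset D2 (add_mset D X)))"
    using frag.IH frag.prems by (simp add: add_mset_commute)
  ultimately have "shellable fr b L n (add_mset D0 (add_mset D X))" using frag(1,3) by (auto intro: shellable.frag)
  then show ?case by (simp add: add_mset_commute)
qed

lemma single_vertex_immobile: assumes "diagram D" "single_vertex D" shows "\<not> shelling_move D D'"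
proof -
  have "darts D = {}" "bnd D = {}" using assms diagramD(7)[OF assms(1)] by (auto simp: single_vertex_def)
  then show ?thesis by (auto simp: shelling_move_def collapse1_def collapse2_def expand1_def)
qed

lemma single_vertex_fragment: assumes "single_vertex D" "fragment D D1 D2"
  shows "single_vertex D1" "single_vertex D2"
proof -
  obtain V1 V2 A1 A2 where f: "A1 \<union> A2 = darts D" "D1 = subdiag D V1 A1 (bnd D \<inter> A1)" "D2 = subdiag D V2 A2 (bnd D \<inter> A2)"
    "diagram D1" "diagram D2" using assms(2) unfolding fragment_def by blast
  then have "darts D1 = {}" "darts D2 = {}" using assms(1) by (auto simp: subdiag_def single_vertex_def)
  then show "single_vertex D1" "single_vertex D2" using f(4,5) no_darts_single_vertex by auto
qed

text \<open>No shelling move applies to a single vertex, and fragmenting it yields single vertices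
  again. So such components can be left out of a whole shelling, as \<open>undrop\<close>
  demands.\<close>

lemma shellable_remove_vertices:
  assumes "shellable fr b L n X" "X = X1 + X2" "\<forall>D\<in>#X1. single_vertex D"
  shows "shellable fr b L n X2"
  using assms
proof (induction arbitrary: X1 X2 rule: shellable.induct)
  case (vertices X)
  then show ?case by (intro shellable.vertices) (auto simp: admissible_def total_perim_def)
next
  case (shell D X D' n)
  have "diagram D" using shell(1) by (simp add: admissible_def)
  then have "D \<notin># X1" using shell(2) shell.prems(2) single_vertex_immobile by blast
  then have "D \<in># X2" using shell.prems(1) by (metis union_iff union_single_eq_member)
  then obtain Y where Y: "X2 = add_mset D Y" by (metis multi_member_split)
  then have X: "X = X1 + Y" using shell.prems(1) by simp
  have "shellable fr b L n (add_mset D' Y)" using shell.IH[of X1 "add_mset D' Y"] X shell.prems(2) by simp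
  moreover have "admissible b L (add_mset D Y)" using shell(1) X by (auto simp: admissible_def total_perim_def)
  ultimately show ?case using shell(2) Y by (auto intro: shellable.shell)
next
  case (frag D X D1 D2 n)
  show ?case
  proof (cases "D \<in># X1")
    case True
    then obtain Y where Y: "X1 = add_mset D Y" by (metis multi_member_split)
    then have "X = Y + X2" using frag.prems(1) by simp
    moreover have "single_vertex D1" "single_vertex D2"
      using single_vertex_fragment frag(3) frag.prems(2) True by blast+
    ultimately show ?thesis using frag.IH[of "add_mset D1 (add_mset D2 Y)" X2] frag.prems(2) Y by simp
  next
    case False
    then have "D \<in># X2" using frag.prems(1) by (metis union_iff union_single_eq_member)
    then obtain Y where Y: "X2 = add_mset D Y" by (metis multi_member_split)
    then have X: "X = X1 + Y" using frag.prems(1) by simp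
    have "shellable fr b L n (add_mset D1 (add_mset D2 Y))"
      using frag.IH[of X1 "add_mset D1 (add_mset D2 Y)"] X frag.prems(2) by simp
    moreover have "admissible b L (add_mset D Y)" using frag(2) X by (auto simp: admissible_def total_perim_def)
    ultimately show ?thesis using frag(1,3) Y by (auto intro: shellable.frag)
  qed
qed

lemma null_seq_size: assumes "null_seq rt fr R L n W" "\<not> rt" "\<not> fr" shows "size W \<le> 1"
  using assms by induction auto

lemma realizes_words_of: "realizes P b D w \<Longrightarrow> words_of P b D [w]"
proof -
  assume "realizes P b D w"
  then obtain lab l where l: "labelling P D lab" "bcyc D l" "based b D l" "w = map lab l" by (auto simp: realizes_def)
  have "[w] = map (kword lab l) [UNIV]" using l(4) kword_all[of l UNIV lab] by simp
  moreover have "closed_darts D UNIV" by (simp add: closed_darts_def)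
  ultimately show ?thesis unfolding words_of_def using l(1-3)
    by (intro exI[of _ lab] exI[of _ l] exI[of _ "[UNIV]"]) simp
qed

text \<open>Names are kept apart only in the free case, where components may have to be wedged. With
  a base the words come from null sequences that have at most one word.\<close>

definition modelled :: "'a presentation \<Rightarrow> bool \<Rightarrow> nat set \<Rightarrow> nat \<Rightarrow> nat \<Rightarrow> 'a word multiset \<Rightarrow> bool" where
  "modelled P fr b L n W \<longleftrightarrow> (\<exists>Z. image_mset snd Z = W \<and> (\<forall>z\<in>#Z. realizes P b (fst z) (snd z))
     \<and> (b = {} \<longrightarrow> apart Z) \<and> (\<exists>m\<le>n. shellable fr b L m (image_mset fst Z)))"

lemma modelledI: "image_mset snd Z = W \<Longrightarrow> (\<And>z. z \<in># Z \<Longrightarrow> realizes P b (fst z) (snd z)) \<Longrightarrow> (b = {} \<Longrightarrow> apart Z) \<Longrightarrow> m \<le> n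
    \<Longrightarrow> shellable fr b L m (image_mset fst Z) \<Longrightarrow> modelled P fr b L n W"
  unfolding modelled_def by blast

lemma modelled_mono: "modelled P fr b L n W \<Longrightarrow> n \<le> n' \<Longrightarrow> modelled P fr b L n' W"
proof -
  assume "modelled P fr b L n W" and n: "n \<le> n'"
  then obtain Z m where Z: "image_mset snd Z = W" "\<forall>z\<in>#Z. realizes P b (fst z) (snd z)" "b = {} \<longrightarrow> apart Z"
    "m \<le> n" "shellable fr b L m (image_mset fst Z)" unfolding modelled_def by blast
  have "m \<le> n'" using Z(4) n by simp
  then show "modelled P fr b L n' W" unfolding modelled_def
    by (rule_tac exI[of _ Z], intro conjI Z(1,2,3), rule_tac exI[of _ m], intro conjI Z(5))
qed

lemma modelled_split: assumes "modelled P fr b L n (add_mset w W)"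
  obtains D Z m where "image_mset snd Z = W" "realizes P b D w" "\<forall>z\<in>#Z. realizes P b (fst z) (snd z)"
    "b = {} \<Longrightarrow> apart (add_mset (D, w) Z)" "m \<le> n" "shellable fr b L m (add_mset D (image_mset fst Z))"
proof -
  obtain Z' m where Z': "image_mset snd Z' = add_mset w W" "\<forall>z\<in>#Z'. realizes P b (fst z) (snd z)"
    "b = {} \<longrightarrow> apart Z'" "m \<le> n" "shellable fr b L m (image_mset fst Z')"
    using assms unfolding modelled_def by blast
  obtain z Z where z: "Z' = add_mset z Z" "snd z = w" "W = image_mset snd Z"
    using Z'(1) by (metis msed_map_invR)
  then have "z = (fst z, w)" by (cases z) auto
  then show ?thesis using that[of Z "fst z" m] Z' z by auto
qed

lemma realizes_total_perim: "\<forall>z\<in>#Z. realizes P b (fst z) (snd z) \<Longrightarrow> total_perim (image_mset fst Z) = tlen (image_mset snd Z)"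
proof (induction Z)
  case (add z Z)
  then have "perim (fst z) = length (snd z)" using realizes_perim by (metis union_single_eq_member)
  then show ?case using add by (simp add: total_perim_def)
qed (simp add: total_perim_def)

lemma modelled_step:
  assumes Z: "image_mset snd Z = W" "\<forall>z\<in>#Z. realizes P b (fst z) (snd z)" "b = {} \<Longrightarrow> apart (add_mset (D, w) Z)"
    and sh: "m \<le> n" "shellable fr b L m (add_mset D (image_mset fst Z))"
    and D': "realizes P b D' w'" "shelling_move D' E" "veq b D E"
      "verts D' \<inter> (\<Union>z\<in>set_mset Z. verts (fst z)) \<subseteq> verts D" "darts D' \<inter> (\<Union>z\<in>set_mset Z. darts (fst z)) \<subseteq> darts D"
    and L: "length w' + tlen W \<le> L"
  shows "modelled P fr b L (Suc n) (add_mset w' W)"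
proof -
  have "apart (add_mset (D', w') Z)" if "b = {}"
    by (rule apart_replace[OF Z(3)[OF that] D'(4,5)])
  moreover have "shellable fr b L (Suc m) (add_mset D' (image_mset fst Z))"
  proof (rule shellable.shell[OF _ D'(2)])
    show "shellable fr b L m (add_mset E (image_mset fst Z))" by (rule shellable_veq[OF sh(2) D'(3)])
    show "admissible b L (add_mset D' (image_mset fst Z))"
      unfolding admissible_def
    proof
      have "realizes P b D w \<Longrightarrow> diagram D \<and> b \<subseteq> verts D" for D w by (simp add: realizes_def)
      then show "\<forall>D\<in>#add_mset D' (image_mset fst Z). diagram D \<and> b \<subseteq> verts D" using Z(2) D'(1) by auto
      show "total_perim (add_mset D' (image_mset fst Z)) \<le> L"
        using Z(1) realizes_total_perim[OF Z(2)] realizes_perim[OF D'(1)] L by (simp add: total_perim_def)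
    qed
  qed
  ultimately show ?thesis using Z(1,2) D'(1) sh(1)
    by (intro modelledI[of "add_mset (D', w') Z" _ _ _ "Suc m"]) auto
qed

text \<open>Strong induction on the number of moves around an induction on the derivation. The inner
  one builds the shelling from its end; the outer one is invoked only where a fold is
  impossible.\<close>

lemma null_seq_modelled:
  assumes "null_seq (b = {}) fr (elem P) L n W" and b: "b = {} \<or> b = {0}" and fr: "fr \<longrightarrow> b = {}"
  shows "modelled P fr b L n W"
  using assms(1)
proof (induction n arbitrary: W rule: less_induct)
  case (less n)
  have "null_seq rt fr (elem P) L m W \<Longrightarrow> rt = (b = {}) \<Longrightarrow> m \<le> n \<Longrightarrow> modelled P fr b L m W" for rt m W
  proof (induction rule: null_seq.induct)
    case empty
    have "shellable fr b L 0 {#}" by (rule shellable.vertices) (auto simp: admissible_def)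
    then show ?case unfolding modelled_def by (intro exI[of _ "{#}"]) (auto simp: apart_def)
  next
    case (drop m W)
    then obtain Z k where Z: "image_mset snd Z = W" "\<forall>z\<in>#Z. realizes P b (fst z) (snd z)"
      "b = {} \<longrightarrow> apart Z" "k \<le> m" "shellable fr b L k (image_mset fst Z)" unfolding modelled_def by blast
    have "finite (verts D)" if "realizes P b D w" for D w
      using that pmapD(1)[OF diagramD(1)] by (auto simp: realizes_def)
    then have "finite (\<Union>z\<in>set_mset Z. verts (fst z))" using Z(2) by auto
    then obtain v0 where v0: "v0 \<notin> (\<Union>z\<in>set_mset Z. verts (fst z))" using ex_new_if_finite[OF infinite_UNIV_nat] by blast
    define v where "v = (if b = {} then v0 else 0)"
    define D where "D = \<lparr>verts = {v}, darts = {}, opp = id, org = id, nxt = id, bnd = {}\<rparr>"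
    have dg: "diagram D" by (simp add: D_def diagram_def cells_def regions_def edges_def)
    have sv: "single_vertex D" by (simp add: D_def single_vertex_def)
    have bv: "b \<subseteq> verts D" using b by (auto simp: D_def v_def)
    have "labelling P D undefined" "bcyc D []" by (auto simp: D_def labelling_def bcyc_def)
    then have "realizes P b D []" using dg bv realizesI[of D b P undefined "[]" "[]"] by (simp add: based_def)
    moreover have "apart (add_mset (D, []) Z)" if "b = {}"
      using Z(3) that v0 by (auto simp: apart_add D_def v_def)
    moreover have "shellable fr b L k (add_mset D (image_mset fst Z))" by (rule shellable_add_vertex[OF Z(5) dg sv bv])
    ultimately show ?case using Z by (intro modelledI[of "add_mset (D, []) Z" _ _ _ k]) auto
  next
    case (undrop m W)
    then obtain D Z k where Z: "image_mset snd Z = W" "realizes P b D []" "\<forall>z\<in>#Z. realizes P b (fst z) (snd z)"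
      "b = {} \<Longrightarrow> apart (add_mset (D, []) Z)" "k \<le> m" "shellable fr b L k (add_mset D (image_mset fst Z))"
      using modelled_split[of P fr b L m "[]" W] by blast
    have "bcyc D []" "diagram D" using Z(2) by (auto simp: realizes_def)
    then have "single_vertex D" using no_darts no_darts_single_vertex by blast
    then have "shellable fr b L k (image_mset fst Z)" using shellable_remove_vertices[OF Z(6), of "{#D#}"] by simp
    then show ?case using Z by (intro modelledI[of Z _ _ _ k]) (auto simp: apart_add)
  next
    case (move w w' W m)
    then have mo: "modelled P fr b L m (add_mset w' W)" by simp
    obtain D Z k where Z: "image_mset snd Z = W" "realizes P b D w'" "\<forall>z\<in>#Z. realizes P b (fst z) (snd z)"
      "b = {} \<Longrightarrow> apart (add_mset (D, w') Z)" "k \<le> m" "shellable fr b L k (add_mset D (image_mset fst Z))"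
      using modelled_split[OF mo] by blast
    let ?VF = "\<Union>z\<in>set_mset Z. verts (fst z)" and ?DF = "\<Union>z\<in>set_mset Z. darts (fst z)"
    have "finite (verts D)" "finite (darts D)" if "realizes P b D w" for D w
      using that pmapD(1,2)[OF diagramD(1)] by (auto simp: realizes_def)
    then have F: "finite (?VF \<union> ?DF)" using Z(3) by auto
    note step = modelled_step[OF Z(1,3,4,5,6) _ _ _ _ _ move(2)]
    obtain x y s s' where e: "(s, s') \<in> elem P" "w = x @ s @ y" "w' = x @ s' @ y" using move(1) by (auto simp: estep_def)
    from e(1) consider (red) a where "a \<in> gens P \<times> UNIV" "s = [a, inv_letter a]" "s' = []"
      | (ins) a where "a \<in> gens P \<times> UNIV" "s = []" "s' = [a, inv_letter a]"
      | (cell) a where "a \<in> gens P \<times> UNIV" "s = [a]" "inv_letter a # s' \<in> cyclic_rels P"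
      unfolding elem_def by blast
    then show ?case
    proof cases
      case red
      have r: "realizes P b D (x @ y)" using Z(2) e(3) red(3) by simp
      obtain D' E where D': "realizes P b D' w" "shelling_move D' E" "veq b D E"
        "verts D' \<inter> (?VF \<union> ?DF) \<subseteq> verts D" "darts D' \<inter> (?VF \<union> ?DF) \<subseteq> darts D"
        using realize_spike[OF r red(1) F b] e(2) red(2) by blast
      show ?thesis by (rule step[OF _ D'(1-3)]) (use D'(4,5) in auto)
    next
      case cell
      have r: "realizes P b D (x @ s' @ y)" using Z(2) e(3) by simp
      obtain D' E where D': "realizes P b D' w" "shelling_move D' E" "veq b D E"
        "verts D' \<inter> (?VF \<union> ?DF) \<subseteq> verts D" "darts D' \<inter> (?VF \<union> ?DF) \<subseteq> darts D"
        using realize_cell[OF r cell(1) cell(3) F b] e(2) cell(2) by blast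
      show ?thesis by (rule step[OF _ D'(1-3)]) (use D'(4,5) in auto)
    next
      case ins
      have r: "realizes P b D (x @ [a, inv_letter a] @ y)" using Z(2) e(3) ins(3) by simp
      have wxy: "w = x @ y" using e(2) ins(2) by simp
      from realize_fold[OF r b] consider "words_of P b D [w]"
        | D' E where "realizes P b D' w" "shelling_move D' E" "veq b D E" "verts D' \<subseteq> verts D" "darts D' \<subseteq> darts D"
        unfolding wxy by blast
      then show ?thesis
      proof cases
        case 2
        show ?thesis by (rule step[OF _ 2(1-3)]) (use 2(4,5) in auto)
      next
        case 1
        \<comment> \<open>The shelling that exists for \<open>w'\<close>, read on the enclosed part,
          is a null sequence for \<open>w\<close> together with the other words. It has at most
          \<open>k\<close> moves, which is at least one fewer than the sequence being
          realized.\<close>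
        have "\<exists>j\<le>k. null_seq (b = {}) fr (elem P) L j (add_mset w W)"
        proof (cases "b = {}")
          case True
          let ?Y = "add_mset (D, [w]) (image_mset (\<lambda>z. (fst z, [snd z])) Z)"
          have wz: "words_of P {} (fst z) [snd z]" if "z \<in># Z" for z
            using Z(3) that True realizes_words_of[of P b "fst z" "snd z"] by simp
          have ye: "image_mset fst ?Y = add_mset D (image_mset fst Z)" by (simp add: image_mset.compositionality o_def)
          have yw: "\<forall>(D, ws)\<in>#?Y. words_of P {} D ws"
          proof
            fix y assume "y \<in># ?Y"
            then consider "y = (D, [w])" | z where "z \<in># Z" "y = (fst z, [snd z])" by fastforce
            then show "case y of (D, ws) \<Rightarrow> words_of P {} D ws" using 1 True wz by cases simp_all
          qed
          have "shellable fr {} L k (image_mset fst ?Y)" using Z(6) True ye by simp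
          from shellable_null_seq_free[OF this HOL.refl yw]
          obtain j where j: "j \<le> k" "null_seq True fr (elem P) L j (\<Sum>(D, ws)\<in>#?Y. mset ws)" by blast
          have "(\<Sum>(D, ws)\<in>#image_mset (\<lambda>z. (fst z, [snd z])) Z. mset ws) = image_mset snd Z"
            by (induction Z) auto
          then show ?thesis using j Z(1) True by (intro exI[of _ j]) simp
        next
          case False
          then have bf: "b = {0}" "\<not> fr" using b fr by auto
          have "size (add_mset w' W) \<le> 1"
            by (rule null_seq_size[OF move(3)]) (use bf move.prems(1) in auto)
          then have W0: "W = {#}" by simp
          then have "Z = {#}" using Z(1) by simp
          then have "add_mset D (image_mset fst Z) = {#D#}" by simp
          from shellable_null_seq_based[OF Z(6) bf(2,1) this 1]
          obtain j where "j \<le> k" "null_seq False False (elem P) L j {#concat [w]#}" by blast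
          then show ?thesis using W0 bf by (intro exI[of _ j]) simp
        qed
        then obtain j where j: "j \<le> k" "null_seq (b = {}) fr (elem P) L j (add_mset w W)" by blast
        then have "j < n" using Z(5) move.prems(2) by simp
        then have "modelled P fr b L j (add_mset w W)" using less.IH[OF _ j(2)] by blast
        then show ?thesis by (rule modelled_mono) (use j(1) Z(5) in simp)
      qed
    qed
  next
    case (rot m v u W)
    then have be: "b = {}" by simp
    obtain D Z k where Z: "image_mset snd Z = W" "realizes P b D (v @ u)" "\<forall>z\<in>#Z. realizes P b (fst z) (snd z)"
      "b = {} \<Longrightarrow> apart (add_mset (D, v @ u) Z)" "k \<le> m" "shellable fr b L k (add_mset D (image_mset fst Z))"
      using modelled_split[of P fr b L m "v @ u" W] rot by blast
    obtain lab l where l: "diagram D" "labelling P D lab" "bcyc D l" "v @ u = map lab l" using Z(2) by (auto simp: realizes_def)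
    obtain lv lu where lw: "l = lv @ lu" "v = map lab lv" "u = map lab lu" using l(4) by (auto simp: append_eq_map_conv)
    have bc: "bcyc D (lu @ lv)" using bcyc_rotate l(3) lw(1) by blast
    have "realizes P b D (u @ v)" by (rule realizesI[OF l(1) _ l(2) bc]) (simp_all add: be based_def lw)
    moreover have "apart (add_mset (D, u @ v) Z)" using Z(4)[OF be] unfolding apart_add by simp
    ultimately show ?case using Z by (intro modelledI[of "add_mset (D, u @ v) Z" _ _ _ k]) auto
  next
    case (frag u v m W)
    then have be: "b = {}" using fr by simp
    obtain V where V: "V = add_mset v W" by simp
    have mo: "modelled P fr b L m (add_mset u V)" using frag V by simp
    obtain D1 Z1 k where Z1: "image_mset snd Z1 = V" "realizes P b D1 u" "\<forall>z\<in>#Z1. realizes P b (fst z) (snd z)"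
      "b = {} \<Longrightarrow> apart (add_mset (D1, u) Z1)" "k \<le> m" "shellable fr b L k (add_mset D1 (image_mset fst Z1))"
      using modelled_split[OF mo] by blast
    obtain z Z where z: "Z1 = add_mset z Z" "snd z = v" "W = image_mset snd Z" using Z1(1) unfolding V by (metis msed_map_invR)
    define D2 where "D2 = fst z"
    have z': "z = (D2, v)" using z(2) by (auto simp: D2_def)
    have D2: "realizes P b D2 v" using Z1(3) z(1) z' by auto
    have ap: "apart (add_mset (D1, u) (add_mset (D2, v) Z))" using Z1(4)[OF be] z(1) z' by simp
    obtain D E1 E2 where D: "realizes P {} D (u @ v)" "fragment D E1 E2" "veq {} D1 E1" "veq {} D2 E2"
      "verts D \<subseteq> verts D1 \<union> verts D2" "darts D \<subseteq> darts D1 \<union> darts D2"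
      using realize_wedge[of P D1 u D2 v] Z1(2) D2 be frag(2,3) ap by (auto simp: apart_add)
    have "apart (add_mset (D, u @ v) Z)" unfolding apart_add
    proof (intro conjI ballI)
      show "apart Z" using ap by (simp add: apart_add)
      fix y assume "y \<in># Z"
      then have "verts D1 \<inter> verts (fst y) = {}" "darts D1 \<inter> darts (fst y) = {}"
        "verts D2 \<inter> verts (fst y) = {}" "darts D2 \<inter> darts (fst y) = {}" using ap by (auto simp: apart_add)
      then show "verts (fst (D, u @ v)) \<inter> verts (fst y) = {}" "darts (fst (D, u @ v)) \<inter> darts (fst y) = {}"
        using D(5,6) by auto
    qed
    moreover have "shellable fr b L k (add_mset D (image_mset fst Z))"
    proof (rule shellable.frag[OF frag(1) _ D(2)])
      have "shellable fr b L k (add_mset D1 (add_mset D2 (image_mset fst Z)))" using Z1(6) z(1) z' by simp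
      then have "shellable fr b L k (add_mset D2 (add_mset E1 (image_mset fst Z)))"
        using shellable_veq[of fr b L k D1 "add_mset D2 (image_mset fst Z)" E1] D(3) be by (simp add: add_mset_commute)
      then show s: "shellable fr b L k (add_mset E1 (add_mset E2 (image_mset fst Z)))"
        using shellable_veq[of fr b L k D2 "add_mset E1 (image_mset fst Z)" E2] D(4) be by (simp add: add_mset_commute)
      have "perim D = perim D1 + perim D2" using realizes_perim[OF D(1)] realizes_perim[OF Z1(2)] realizes_perim[OF D2] by simp
      then show "admissible b L (add_mset D (image_mset fst Z))"
        using shellable_admissible[OF Z1(6)] D(1) z(1) z' be by (auto simp: admissible_def realizes_def)
    qed
    ultimately show ?case using z Z1(3,5) D(1) be
      by (intro modelledI[of "add_mset (D, u @ v) Z" _ _ _ k]) auto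
  qed
  then show ?case using less.prems by blast
qed

section \<open>Filling lengths of words as lengths of null sequences\<close>

definition fills :: "bool \<Rightarrow> bool \<Rightarrow> 'a presentation \<Rightarrow> nat \<Rightarrow> 'a word \<Rightarrow> bool" where
  "fills rt fr P L w \<longleftrightarrow> (\<exists>n. null_seq rt fr (elem P) L n {#w#})"

lemma read_cyc: "cyc (nxt D) (d # t) \<Longrightarrow> read D lab d = map lab (d # t)"
proof -
  assume c: "cyc (nxt D) (d # t)"
  have "orbit (nxt D) d = set (d # t)" using cyc_orbit[OF c] by simp
  moreover have "card (set (d # t)) = length (d # t)" using c by (metis cyc_def distinct_card)
  ultimately have "read D lab d = map (\<lambda>i. lab ((nxt D ^^ i) d)) [0..<length (d # t)]" by (simp add: read_def)
  also have "\<dots> = map lab (d # t)"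
  proof (rule nth_equalityI)
    fix i assume "i < length (map (\<lambda>i. lab ((nxt D ^^ i) d)) [0..<length (d # t)])"
    then have i: "i < length (d # t)" by simp
    then have "(nxt D ^^ i) d = (d # t) ! i" using cyc_funpow[OF c, of i] by simp
    then show "map (\<lambda>i. lab ((nxt D ^^ i) d)) [0..<length (d # t)] ! i = map lab (d # t) ! i"
      using i by (simp only: nth_map nth_upt length_upt length_map add_0 diff_zero)
  qed simp
  finally show ?thesis .
qed

lemma van_kampen_labelling: assumes "van_kampen P w D s"
  obtains lab l where "diagram D" "s \<in> verts D" "labelling P D lab" "bcyc D l" "l = [] \<or> org D (hd l) = s" "w = map lab l"
proof -
  obtain lab where D: "diagram D" "s \<in> verts D"
    and lab: "\<forall>d\<in>darts D. lab d \<in> gens P \<times> UNIV \<and> lab (opp D d) = inv_letter (lab d)"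
    and ce: "\<forall>c\<in>cells D. \<exists>d\<in>c. read D lab d \<in> rels P \<union> inv_word ` rels P"
    and w: "if darts D = {} then w = [] else \<exists>d\<in>bnd D. org D d = s \<and> read D lab d = w"
    using assms unfolding van_kampen_def by blast
  note DD = diagramD[OF D(1)]
  obtain m where m: "bcyc D m" using DD(6) by blast
  have "labelling P D lab"
  proof (rule labellingI)
    fix d t assume d: "d \<in> darts D" "d \<notin> bnd D" and c: "cyc (nxt D) (d # t)"
    have o: "orbit (nxt D) d = set (d # t)" using cyc_orbit[OF c] by simp
    have "orbit (nxt D) d \<in> cells D" unfolding cells_eq[OF DD(1) m DD(7)] using d by blast
    then obtain d' where d': "d' \<in> set (d # t)" "read D lab d' \<in> rels P \<union> inv_word ` rels P" using ce o by metis
    obtain p q where pq: "d # t = p @ d' # q" using d'(1) by (meson split_list)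
    have "cyc (nxt D) ((d' # q) @ p)" by (rule cyc_rotate) (use c pq in metis)
    then have "read D lab d' = map lab (d' # q) @ map lab p" using read_cyc[of D d' "q @ p" lab] by simp
    then have "map lab (d' # q) @ map lab p \<in> rels P \<union> inv_word ` rels P" using d'(2) by simp
    then have "map lab p @ map lab (d' # q) \<in> cyclic_rels P" unfolding cyclic_rels_def by blast
    then show "map lab (d # t) \<in> cyclic_rels P" using pq by (metis map_append)
  qed (use lab in auto)
  moreover have "\<exists>l. bcyc D l \<and> (l = [] \<or> org D (hd l) = s) \<and> w = map lab l"
  proof (cases "darts D = {}")
    case True
    then have "bcyc D []" using DD(7) by (simp add: bcyc_def)
    then show ?thesis using w True by auto
  next
    case False
    then obtain d where d: "d \<in> bnd D" "org D d = s" "read D lab d = w" using w by auto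
    obtain v where "bcyc D (d # v)" using bnd_cycle[OF D(1) d(1)] .
    then show ?thesis using d read_cyc[of D d v lab] by (intro exI[of _ "d # v"]) (auto simp: bcyc_def)
  qed
  ultimately show ?thesis using that D by blast
qed

lemma van_kampen_words_of: assumes "van_kampen P w D s" shows "words_of P {s} D [w]" "words_of P {} D [w]"
proof -
  obtain lab l where l: "diagram D" "s \<in> verts D" "labelling P D lab" "bcyc D l" "l = [] \<or> org D (hd l) = s" "w = map lab l"
    using van_kampen_labelling[OF assms] .
  have "realizes P {s} D w" "realizes P {} D w" using l by (auto simp: realizes_def based_def)
  then show "words_of P {s} D [w]" "words_of P {} D [w]" using realizes_words_of by blast+
qed

lemma van_kampenI:
  assumes "diagram D" "s \<in> verts D" "\<And>d. d \<in> darts D \<Longrightarrow> lab d \<in> gens P \<times> UNIV"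
    "\<And>d. d \<in> darts D \<Longrightarrow> lab (opp D d) = inv_letter (lab d)"
    "\<And>c. c \<in> cells D \<Longrightarrow> \<exists>d\<in>c. read D lab d \<in> rels P \<union> inv_word ` rels P"
    "if darts D = {} then w = [] else \<exists>d\<in>bnd D. org D d = s \<and> read D lab d = w"
  shows "van_kampen P w D s"
  unfolding van_kampen_def by (intro conjI exI[of _ lab] ballI assms)

text \<open>A cell whose word is a cyclic conjugate of a relator or of its inverse reads that
  relator or inverse itself from a suitable other dart.\<close>

lemma realizes_van_kampen: assumes "realizes P b D w"
  obtains s where "van_kampen P w D s" "b = {s'} \<Longrightarrow> s = s'"
proof -
  obtain lab l where l: "diagram D" "b \<subseteq> verts D" "labelling P D lab" "bcyc D l" "based b D l" "w = map lab l"
    using assms by (auto simp: realizes_def)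
  note DD = diagramD[OF l(1)]
  have ce: "\<exists>d\<in>c. read D lab d \<in> rels P \<union> inv_word ` rels P" if c: "c \<in> cells D" for c
  proof -
    obtain d where d: "d \<in> darts D" "d \<notin> bnd D" "c = orbit (nxt D) d" using c cells_eq[OF DD(1) l(4) DD(7)] by auto
    obtain t where t: "cyc (nxt D) (d # t)" "orbit (nxt D) d = set (d # t)" using nonbnd_cycle[OF DD(1) l(4) d(1,2)] by metis
    have "map lab (d # t) \<in> cyclic_rels P" using labellingD(3)[OF l(3) d(1,2) t(1)] .
    then obtain u v where uv: "map lab (d # t) = v @ u" "u @ v \<in> rels P \<union> inv_word ` rels P" unfolding cyclic_rels_def by blast
    obtain lv lu where lw: "d # t = lv @ lu" "v = map lab lv" "u = map lab lu"
      using uv(1)[symmetric] unfolding append_eq_map_conv by blast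
    have cy: "cyc (nxt D) (lu @ lv)" using cyc_rotate[of "nxt D" lv lu] t(1) lw(1) by simp
    have "lu @ lv \<noteq> []" using lw(1) by auto
    then obtain d' t' where dt: "lu @ lv = d' # t'" by (cases "lu @ lv") auto
    have "read D lab d' = u @ v" using read_cyc[of D d' t' lab] cy dt lw(2,3) by (metis map_append)
    moreover have "d' \<in> c"
    proof -
      have "set (lu @ lv) = set (d # t)" unfolding lw(1) by auto
      moreover have "d' \<in> set (lu @ lv)" unfolding dt by simp
      ultimately show ?thesis unfolding d(3) t(2) by simp
    qed
    ultimately show ?thesis using uv(2) by (intro bexI[of _ d']) simp_all
  qed
  show ?thesis
  proof (cases "l = []")
    case True
    then have n: "darts D = {}" using no_darts l(1,4) by blast
    have "single_vertex D" using no_darts_single_vertex[OF l(1) n] .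
    then obtain s where s: "verts D = {s}" unfolding single_vertex_def by blast
    have "van_kampen P w D s"
      by (rule van_kampenI[OF l(1) _ labellingD(1,2)[OF l(3)] ce]) (simp_all add: n True l(6) s)
    then show ?thesis
    proof (rule that)
      assume "b = {s'}"
      then show "s = s'" using l(2) s by simp
    qed
  next
    case False
    then obtain d t where dt: "l = d # t" by (cases l) auto
    have db: "d \<in> bnd D" using l(4) dt by (auto simp: bcyc_def)
    have "read D lab d = w" using read_cyc[of D d t lab] l(4,6) dt by (simp add: bcyc_def)
    then have rw: "\<exists>d'\<in>bnd D. org D d' = org D d \<and> read D lab d' = w" using db by blast
    have dd: "d \<in> darts D" using db DD(7) by blast
    then have ne: "darts D \<noteq> {}" by blast
    have "van_kampen P w D (org D d)"
      by (rule van_kampenI[OF l(1) pmapD(8)[OF DD(1) dd] labellingD(1,2)[OF l(3)] ce]) (simp_all add: ne rw)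
    then show ?thesis
    proof (rule that)
      assume "b = {s'}"
      then show "org D d = s'" using l(5) dt by (simp add: based_def)
    qed
  qed
qed

lemma modelled_single: assumes "modelled P fr b L n {#w#}"
  obtains D m where "realizes P b D w" "shellable fr b L m {#D#}"
proof -
  obtain V :: "'a word multiset" where V: "V = {#}" by simp
  have mo: "modelled P fr b L n (add_mset w V)" using assms V by simp
  obtain D Z m where Z: "image_mset snd Z = V" "realizes P b D w" "\<forall>z\<in>#Z. realizes P b (fst z) (snd z)"
    "b = {} \<Longrightarrow> apart (add_mset (D, w) Z)" "m \<le> n" "shellable fr b L m (add_mset D (image_mset fst Z))"
    using modelled_split[OF mo] by blast
  then show ?thesis using that[of D m] V by simp
qed

text \<open>The base is given the name \<open>0\<close>. The second claim provides van Kampen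
  diagrams, so that the infima over all diagrams for a word are attained.\<close>

lemma FL_word_le: assumes "fills False False P L w" shows "FL_word P w \<le> L" "\<exists>D s. van_kampen P w D s"
proof -
  obtain n where "null_seq ({0::nat} = {}) False (elem P) L n {#w#}" using assms by (auto simp: fills_def)
  then obtain D m where D: "realizes P {0} D w" "shellable False {0} L m {#D#}"
    by (rule modelled_single[OF null_seq_modelled, of _ _ P L n w]) (simp_all)
  obtain s where s: "van_kampen P w D s" "s = 0" using realizes_van_kampen[OF D(1)] by blast
  then have "FL_word P w \<le> FL_diag D 0" unfolding FL_word_def by (intro wellorder_Inf_le1) blast
  then show "FL_word P w \<le> L" using FL_diag_le[OF D(2)] by simp
  show "\<exists>D s. van_kampen P w D s" using s by blast
qed

lemma FFL_word_le: assumes "fills True False P L w" shows "FFL_word P w \<le> L"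
proof -
  obtain n where "null_seq (({}::nat set) = {}) False (elem P) L n {#w#}" using assms by (auto simp: fills_def)
  then obtain D m where D: "realizes P {} D w" "shellable False {} L m {#D#}"
    by (rule modelled_single[OF null_seq_modelled, of _ _ P L n w]) (simp_all)
  obtain s where s: "van_kampen P w D s" using realizes_van_kampen[OF D(1)] by blast
  then have "FFL_word P w \<le> FFL_diag D" unfolding FFL_word_def by (intro wellorder_Inf_le1) blast
  then show ?thesis using FFL_diag_le[OF D(2)] by simp
qed

lemma FFFL_word_le: assumes "fills True True P L w" shows "FFFL_word P w \<le> L"
proof -
  obtain n where "null_seq (({}::nat set) = {}) True (elem P) L n {#w#}" using assms by (auto simp: fills_def)
  then obtain D m where D: "realizes P {} D w" "shellable True {} L m {#D#}"
    by (rule modelled_single[OF null_seq_modelled, of _ _ P L n w]) (simp_all)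
  obtain s where s: "van_kampen P w D s" using realizes_van_kampen[OF D(1)] by blast
  then have "FFFL_word P w \<le> FFFL_diag D" unfolding FFFL_word_def by (intro wellorder_Inf_le1) blast
  then show ?thesis using FFFL_diag_le[OF D(2)] by simp
qed

lemma fills_FL_word: assumes "van_kampen P w D s" shows "fills False False P (FL_word P w) w"
proof -
  have "FL_word P w \<in> {FL_diag \<Delta> s |\<Delta> s. van_kampen P w \<Delta> s}"
    unfolding FL_word_def by (rule Inf_nat_def1) (use assms in blast)
  then obtain D s where D: "van_kampen P w D s" "FL_diag D s = FL_word P w"
    by (elim CollectE exE conjE) (rule that[OF _ HOL.sym])
  then have "diagram D" "s \<in> verts D" by (auto simp: van_kampen_def)
  then obtain n where "shellable False {s} (FL_word P w) n {#D#}" using FL_diag_shellable D(2) by metis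
  then show ?thesis
    using shellable_null_seq_based[of False "{s}" "FL_word P w" n _ s D P "[w]"] van_kampen_words_of(1)[OF D(1)]
    by (auto simp: fills_def)
qed

lemma fills_FFL_word: assumes "van_kampen P w D s" shows "fills True False P (FFL_word P w) w"
proof -
  have "FFL_word P w \<in> {FFL_diag \<Delta> |\<Delta> s. van_kampen P w \<Delta> s}"
    unfolding FFL_word_def by (rule Inf_nat_def1) (use assms in blast)
  then obtain D s where D: "van_kampen P w D s" "FFL_diag D = FFL_word P w"
    by (elim CollectE exE conjE) (rule that[OF _ HOL.sym])
  then have "diagram D" by (auto simp: van_kampen_def)
  then obtain n where "shellable False {} (FFL_word P w) n {#D#}" using FFL_diag_shellable D(2) by metis
  then show ?thesis
    using shellable_null_seq_free[of False "FFL_word P w" n _ "{#(D, [w])#}" P] van_kampen_words_of(2)[OF D(1)]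
    by (auto simp: fills_def)
qed

lemma fills_FFFL_word: assumes "van_kampen P w D s" shows "fills True True P (FFFL_word P w) w"
proof -
  have "FFFL_word P w \<in> {FFFL_diag \<Delta> |\<Delta> s. van_kampen P w \<Delta> s}"
    unfolding FFFL_word_def by (rule Inf_nat_def1) (use assms in blast)
  then obtain D s where D: "van_kampen P w D s" "FFFL_diag D = FFFL_word P w"
    by (elim CollectE exE conjE) (rule that[OF _ HOL.sym])
  then have "diagram D" by (auto simp: van_kampen_def)
  then obtain n where "shellable True {} (FFFL_word P w) n {#D#}" using FFFL_diag_shellable D(2) by metis
  then show ?thesis
    using shellable_null_seq_free[of True "FFFL_word P w" n _ "{#(D, [w])#}" P] van_kampen_words_of(2)[OF D(1)]
    by (auto simp: fills_def)
qed

section \<open>Words modulo the relators\<close>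

lemma inv_word_simps [simp]:
  "inv_word [] = []" "inv_word (x # w) = inv_word w @ [inv_letter x]" "inv_word (u @ v) = inv_word v @ inv_word u"
  "length (inv_word w) = length w" "inv_word (inv_word w) = w"
  by (simp_all add: inv_word_def rev_map o_def)

lemma words_simps [simp]:
  "[] \<in> words P" "x # w \<in> words P \<longleftrightarrow> x \<in> gens P \<times> UNIV \<and> w \<in> words P"
  "u @ v \<in> words P \<longleftrightarrow> u \<in> words P \<and> v \<in> words P"
  by (auto simp: words_def)

lemma inv_word_words [simp]: "inv_word w \<in> words P \<longleftrightarrow> w \<in> words P"
  by (induction w) auto

locale fin_presented =
  fixes P :: "'a presentation"
  assumes finite_presentation: "finite_presentation P"
begin

abbreviation weq (infix "\<approx>" 50) where "u \<approx> v \<equiv> word_eq P u v"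

declare word_eq.trans [trans]

lemma rels_words: "r \<in> rels P \<Longrightarrow> r \<in> words P"
  using finite_presentation by (auto simp: finite_presentation_def)

lemma weq_words: "u \<approx> v \<Longrightarrow> u \<in> words P \<and> v \<in> words P"
  by (induction rule: word_eq.induct) (auto dest: rels_words)

lemma weq_context: "u \<approx> v \<Longrightarrow> a \<in> words P \<Longrightarrow> c \<in> words P \<Longrightarrow> a @ u @ c \<approx> a @ v @ c"
proof (induction rule: word_eq.induct)
  case (refl w)
  then show ?case by (intro word_eq.refl) simp
next
  case (sym u v)
  then show ?case by (simp add: word_eq.sym)
next
  case (trans u v w)
  then show ?case using word_eq.trans by blast
next
  case (cancel u v x)
  then show ?case using word_eq.cancel[of "a @ u" P "v @ c" x] by simp
next
  case (relator u v r)
  then show ?case using word_eq.relator[of "a @ u" P "v @ c" r] by simp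
qed

lemma weq_append: assumes "u \<approx> u'" "v \<approx> v'" shows "u @ v \<approx> u' @ v'"
proof -
  note w = weq_words[OF assms(1)] weq_words[OF assms(2)]
  have "u @ v \<approx> u' @ v" using weq_context[OF assms(1), of "[]" v] w by simp
  moreover have "u' @ v \<approx> u' @ v'" using weq_context[OF assms(2), of u' "[]"] w by simp
  ultimately show ?thesis by (rule word_eq.trans)
qed

lemma weq_inv: assumes "w \<in> words P" shows "w @ inv_word w \<approx> []" "inv_word w @ w \<approx> []"
proof -
  have *: "w \<in> words P \<Longrightarrow> w @ inv_word w \<approx> []" for w
  proof (induction w)
    case Nil
    show ?case by (simp add: word_eq.refl)
  next
    case (Cons x w)
    then have "[x] @ (w @ inv_word w) @ [inv_letter x] \<approx> [x] @ [] @ [inv_letter x]"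
      by (intro weq_context) auto
    then have "(x # w) @ inv_word (x # w) \<approx> [x, inv_letter x]" by simp
    also have "\<dots> \<approx> []" using word_eq.cancel[of "[]" P "[]" x] Cons.prems by simp
    finally show ?case .
  qed
  show "w @ inv_word w \<approx> []" by (rule *[OF assms])
  show "inv_word w @ w \<approx> []" using *[of "inv_word w"] assms by simp
qed

lemma weq_cancel_left: assumes "a @ u \<approx> a @ v" shows "u \<approx> v"
proof -
  have w: "a \<in> words P" "u \<in> words P" "v \<in> words P" using weq_words[OF assms] by simp_all
  have c: "inv_word a @ a @ z \<approx> z" if "z \<in> words P" for z
    using weq_context[OF weq_inv(2)[OF w(1)], of "[]" z] that by simp
  have "u \<approx> inv_word a @ a @ u" by (rule word_eq.sym[OF c[OF w(2)]])
  also have "inv_word a @ a @ u \<approx> inv_word a @ a @ v"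
    using weq_context[OF assms, of "inv_word a" "[]"] w by simp
  also have "\<dots> \<approx> v" by (rule c[OF w(3)])
  finally show ?thesis .
qed

lemma weq_cross: assumes "a @ z \<approx> b @ c" shows "inv_word a @ b \<approx> z @ inv_word c"
proof -
  have w: "a \<in> words P" "z \<in> words P" "b \<in> words P" "c \<in> words P" using weq_words[OF assms] by simp_all
  have "a @ inv_word a @ b \<approx> b" using weq_context[OF weq_inv(1)[OF w(1)], of "[]" b] w by simp
  also have "b \<approx> b @ c @ inv_word c" using weq_context[OF weq_inv(1)[OF w(4)], of b "[]", THEN word_eq.sym] w by simp
  also have "\<dots> \<approx> a @ z @ inv_word c" using weq_context[OF assms, of "[]" "inv_word c", THEN word_eq.sym] w by simp
  finally show ?thesis by (rule weq_cancel_left)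
qed

lemma weq_rotate: assumes "u @ v \<approx> []" shows "v @ u \<approx> []"
proof -
  have w: "u \<in> words P" "v \<in> words P" using weq_words[OF assms] by simp_all
  have "u @ v @ u \<approx> u" using weq_context[OF assms, of "[]" u] w by simp
  then have "u @ (v @ u) \<approx> u @ []" by simp
  then show ?thesis by (rule weq_cancel_left)
qed

lemma word_class_eq: assumes "u \<in> words P" shows "word_class P u = word_class P v \<longleftrightarrow> u \<approx> v"
proof
  assume "word_class P u = word_class P v"
  then have "v \<approx> u" using word_eq.refl[OF assms] by (auto simp: word_class_def)
  then show "u \<approx> v" by (rule word_eq.sym)
next
  assume "u \<approx> v"
  then show "word_class P u = word_class P v" unfolding word_class_def
    by (blast intro: word_eq.sym word_eq.trans)
qed

lemma null_homotopic_iff: "null_homotopic P w \<longleftrightarrow> w \<approx> []"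
  using word_class_eq weq_words by (auto simp: null_homotopic_def presented_group_def)

lemma cyclic_rels_weq: assumes "c \<in> cyclic_rels P" shows "c \<approx> []"
proof -
  have r: "r \<approx> []" if "r \<in> rels P" for r using word_eq.relator[of "[]" P "[]" r] that by simp
  have "inv_word r \<approx> []" if "r \<in> rels P" for r
  proof -
    have "inv_word r \<approx> r @ inv_word r"
      using weq_context[OF r[OF that], of "[]" "inv_word r", THEN word_eq.sym] rels_words[OF that] by simp
    also have "\<dots> \<approx> []" by (rule weq_inv(1)[OF rels_words[OF that]])
    finally show ?thesis .
  qed
  then have "u @ v \<approx> []" if "u @ v \<in> rels P \<union> inv_word ` rels P" for u v using that r by auto
  then show ?thesis using assms weq_rotate unfolding cyclic_rels_def by blast
qed

lemma elem_weq: assumes "(s, s') \<in> elem P" shows "s \<approx> s'"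
proof -
  have c: "[x, inv_letter x] \<approx> []" if "x \<in> gens P \<times> UNIV" for x using word_eq.cancel[of "[]" P "[]" x] that by simp
  have "[x] \<approx> t" if x: "x \<in> gens P \<times> UNIV" "inv_letter x # t \<in> cyclic_rels P" for x t
  proof -
    have e: "inv_letter x # t \<approx> []" by (rule cyclic_rels_weq[OF x(2)])
    then have t: "t \<in> words P" using weq_words by fastforce
    have "[x] @ (inv_letter x # t) @ [] \<approx> [x] @ [] @ []" by (rule weq_context[OF e]) (use x in auto)
    from word_eq.sym[OF this] have "[x] \<approx> [x, inv_letter x] @ t" by simp
    also have "[x, inv_letter x] @ t \<approx> t" using weq_context[OF c[OF x(1)], of "[]" t] t by simp
    finally show ?thesis .
  qed
  then show ?thesis using assms c word_eq.sym unfolding elem_def by blast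
qed

end

section \<open>Bounded moves\<close>

text \<open>The bound applies to all words on the way, so that replacing a move by a chain costs an
  additive constant.\<close>

definition chain :: "('a word \<times> 'a word) set \<Rightarrow> nat \<Rightarrow> 'a word \<Rightarrow> 'a word \<Rightarrow> bool" where
  "chain R c = (\<lambda>u v. estep R u v \<and> length u \<le> c \<and> length v \<le> c)\<^sup>*\<^sup>*"

lemma estepI: "(s, s') \<in> R \<Longrightarrow> estep R (x @ s @ y) (x @ s' @ y)"
  unfolding estep_def by blast

lemma chain_refl [simp]: "chain R c u u"
  by (simp add: chain_def)

lemma chain_trans: "chain R c u v \<Longrightarrow> chain R c v w \<Longrightarrow> chain R c u w"
  unfolding chain_def by (rule rtranclp_trans)

lemma chain_step: "estep R u v \<Longrightarrow> length u \<le> c \<Longrightarrow> length v \<le> c \<Longrightarrow> chain R c u v"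
  unfolding chain_def by (simp add: r_into_rtranclp)

lemma chain_mono: assumes "chain R c u v" "c \<le> c'" shows "chain R c' u v"
  using assms(1) unfolding chain_def by (rule rtranclp_mono[THEN predicate2D, rotated]) (use assms(2) in auto)

lemma chain_mono_rel: assumes "chain R c u v" "R \<subseteq> R'" shows "chain R' c u v"
  using assms(1) unfolding chain_def
  by (rule rtranclp_mono[THEN predicate2D, rotated]) (use assms(2) in \<open>auto simp: estep_def, blast\<close>)

lemma chain_context: assumes "chain R c u v" shows "chain R (length a + c + length b) (a @ u @ b) (a @ v @ b)"
  using assms unfolding chain_def
proof (induction rule: rtranclp_induct)
  case (step v w)
  then have "estep R (a @ v @ b) (a @ w @ b)" using estep_context by blast
  then show ?case using step by (intro rtranclp.rtrancl_into_rtrancl[OF step.IH]) auto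
qed simp

lemma null_seq_mono: "null_seq rt fr R L n W \<Longrightarrow> R \<subseteq> R' \<Longrightarrow> L \<le> L' \<Longrightarrow> null_seq rt fr R' L' n W"
proof (induction rule: null_seq.induct)
  case (move w w' W n)
  have "estep R' w w'" using move(1,5) unfolding estep_def by blast
  then show ?case using move by (intro null_seq.move) auto
qed (auto intro: null_seq.intros)

lemma null_seq_chain: assumes "chain R c u v" "null_seq rt fr R L n (add_mset v W)" "c + tlen W \<le> L"
  shows "\<exists>m. null_seq rt fr R L m (add_mset u W)"
  using assms(1) unfolding chain_def
proof (induction rule: converse_rtranclp_induct)
  case base
  show ?case using assms(2) by blast
next
  case (step u v)
  then obtain m where "null_seq rt fr R L m (add_mset v W)" by blast
  then have "null_seq rt fr R L (Suc m) (add_mset u W)" by (rule null_seq.move[rotated 2]) (use step assms(3) in auto)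
  then show ?case by blast
qed

text \<open>While the chain for one move is carried out, the context of the move and the other words
  stay within \<open>L\<close>, and the part being rewritten adds at most \<open>c\<close>.\<close>

lemma null_seq_refine: assumes "null_seq rt fr R L n W" "\<And>s s'. (s, s') \<in> R \<Longrightarrow> chain R' c s s'"
  shows "\<exists>m. null_seq rt fr R' (L + c) m W"
  using assms(1)
proof (induction rule: null_seq.induct)
  case (move w w' W n)
  obtain x y s s' where s: "(s, s') \<in> R" "w = x @ s @ y" "w' = x @ s' @ y" using move(1) by (auto simp: estep_def)
  obtain m where "null_seq rt fr R' (L + c) m (add_mset w' W)" using move(4) by blast
  moreover have "chain R' (length x + c + length y) w w'" unfolding s(2,3) by (rule chain_context[OF assms(2)[OF s(1)]])
  ultimately show ?case using null_seq_chain[of R' _ w w' rt fr "L + c" m W] move(2) s(2) by simp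
qed (blast intro: null_seq.intros)+

text \<open>With rotation, \<open>t\<close> is brought behind \<open>t'\<close> and the product
  \<open>t' @ t\<close> is deleted in one move. Without it there is no fragmentation either: the
  sequence consists of moves on one word, around which \<open>t\<close> and \<open>t'\<close> are
  kept until it is empty and \<open>t @ t'\<close> can be deleted.\<close>

lemma null_seq_conjugate:
  assumes "null_seq rt fr R L n {#z#}" "rt \<or> \<not> fr" "(t @ t', []) \<in> R" "(t' @ t, []) \<in> R"
    "L + length t + length t' \<le> L'" "rt \<Longrightarrow> length z + length t + length t' \<le> L'"
  shows "\<exists>m. null_seq rt fr R L' m {#t @ z @ t'#}"
proof (cases rt)
  case True
  have "null_seq rt fr R L' n {#z#}" by (rule null_seq_mono[OF assms(1)]) (use assms(5) in auto)
  moreover have "estep R (z @ t' @ t) z" unfolding estep_def using assms(4) by (metis append_Nil2)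
  ultimately have "null_seq rt fr R L' (Suc n) (add_mset (z @ t' @ t) {#})"
    by (intro null_seq.move) (use assms(6) True in auto)
  then have "null_seq rt fr R L' (Suc n) (add_mset ((z @ t') @ t) {#})" by simp
  then show ?thesis using null_seq.rot[OF True] by blast
next
  case False
  have "null_seq rt fr R L n W \<Longrightarrow> W = {#z#} \<Longrightarrow> ?thesis" for n W
  proof (induction arbitrary: z rule: null_seq.induct)
    case (drop n W)
    have "null_seq rt fr R L' 0 {#[]#}" by (rule null_seq.drop[OF null_seq.empty]) simp
    then have "null_seq rt fr R L' (Suc 0) (add_mset (t @ t') {#})"
      by (intro null_seq.move[of R "t @ t'" "[]"]) (use assms(3,5) in \<open>auto simp: estep_def intro!: exI[of _ "[]"]\<close>)
    then show ?case using drop by auto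
  next
    case (move w w' W n)
    then have e: "w = z" "W = {#}" by auto
    obtain m where "null_seq rt fr R L' m {#t @ w' @ t'#}" using move.IH[of w'] e by auto
    moreover have "estep R (t @ z @ t') (t @ w' @ t')" using estep_context move(1) e by blast
    ultimately have "null_seq rt fr R L' (Suc m) {#t @ z @ t'#}"
      by (intro null_seq.move[of R "t @ z @ t'" "t @ w' @ t'"]) (use assms(5) move(2) e in auto)
    then show ?case by blast
  qed (use False assms(2) in auto)
  then show ?thesis using assms(1) by blast
qed

context fin_presented
begin

lemma elem_cellI: "x \<in> gens P \<times> UNIV \<Longrightarrow> inv_letter x # t \<in> cyclic_rels P \<Longrightarrow> ([x], t) \<in> elem P"
  unfolding elem_def by blast

lemma cancel_chain: "t \<in> words P \<Longrightarrow> \<exists>c. chain (elem P) c (inv_word t @ t) []"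
proof (induction t)
  case (Cons x t)
  then obtain c where c: "chain (elem P) c (inv_word t @ t) []" by auto
  have "([inv_letter x, inv_letter (inv_letter x)], []) \<in> elem P" using Cons.prems by (intro elemI) simp
  then have "estep (elem P) (inv_word (x # t) @ x # t) (inv_word t @ t)" unfolding estep_def
    by (intro exI[of _ "inv_word t"] exI[of _ t] exI[of _ "[inv_letter x, x]"] exI[of _ "[]"]) simp
  then have "chain (elem P) (c + 2 * length t + 2) (inv_word (x # t) @ x # t) (inv_word t @ t)" by (rule chain_step) simp_all
  moreover have "chain (elem P) (c + 2 * length t + 2) (inv_word t @ t) []" by (rule chain_mono[OF c]) simp
  ultimately show ?case using chain_trans by blast
qed (auto intro: exI[of _ 0])

text \<open>If the relator is \<open>x # t\<close>, the empty word grows to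
  \<open>[x, inv_letter x]\<close>, and a cell replaces the second letter by \<open>t\<close>. In
  the other direction a cell replaces \<open>x\<close> by \<open>inv_word t\<close>, and the rest
  cancels letter by letter.\<close>

lemma relator_chain: assumes r: "r \<in> rels P"
  shows "\<exists>c. chain (elem P) c r [] \<and> chain (elem P) c [] r"
proof (cases r)
  case (Cons x t)
  have w: "x \<in> gens P \<times> UNIV" "t \<in> words P" using rels_words[OF r] Cons by auto
  have "[] @ r \<in> cyclic_rels P" using r unfolding cyclic_rels_def by (intro CollectI, rule_tac exI[of _ r], rule_tac exI[of _ "[]"]) simp
  then have e1: "([inv_letter x], t) \<in> elem P" using w(1) Cons by (intro elem_cellI) simp_all
  have "inv_word t @ [inv_letter x] \<in> rels P \<union> inv_word ` rels P" using imageI[OF r, of inv_word] Cons by simp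
  then have "[inv_letter x] @ inv_word t \<in> cyclic_rels P" unfolding cyclic_rels_def by blast
  then have e2: "([x], inv_word t) \<in> elem P" using w(1) by (intro elem_cellI) simp_all
  have e3: "([], [x, inv_letter x]) \<in> elem P" using w(1) by (auto simp: elem_def)
  let ?c = "2 * length t + 2"
  have "estep (elem P) [] [x, inv_letter x]" unfolding estep_def using e3 by fastforce
  then have "chain (elem P) ?c [] [x, inv_letter x]" by (rule chain_step) simp_all
  moreover have "estep (elem P) [x, inv_letter x] r" unfolding estep_def Cons
    by (rule exI[of _ "[x]"], rule exI[of _ "[]"], rule exI[of _ "[inv_letter x]"], rule exI[of _ t]) (use e1 in simp)
  then have "chain (elem P) ?c [x, inv_letter x] r" by (rule chain_step) (simp_all add: Cons)
  ultimately have 1: "chain (elem P) ?c [] r" by (rule chain_trans)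
  have "estep (elem P) r (inv_word t @ t)" unfolding estep_def Cons
    by (rule exI[of _ "[]"], rule exI[of _ t], rule exI[of _ "[x]"], rule exI[of _ "inv_word t"]) (use e2 in simp)
  then have 2: "chain (elem P) ?c r (inv_word t @ t)" by (rule chain_step) (simp_all add: Cons)
  obtain d where d: "chain (elem P) d (inv_word t @ t) []" using cancel_chain w(2) by blast
  show ?thesis
  proof (intro exI[of _ "?c + d"] conjI)
    show "chain (elem P) (?c + d) r []"
      by (rule chain_trans[OF chain_mono[OF 2] chain_mono[OF d]]) simp_all
    show "chain (elem P) (?c + d) [] r" by (rule chain_mono[OF 1]) simp
  qed
qed auto

lemma weq_chain: "u \<approx> v \<Longrightarrow> \<exists>c. chain (elem P) c u v \<and> chain (elem P) c v u"
proof (induction rule: word_eq.induct)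
  case (trans u v w)
  then obtain c d where "chain (elem P) c u v" "chain (elem P) c v u" "chain (elem P) d v w" "chain (elem P) d w v" by blast
  then have "chain (elem P) (c + d) u v" "chain (elem P) (c + d) v w" "chain (elem P) (c + d) w v" "chain (elem P) (c + d) v u"
    using chain_mono[of "elem P" c _ _ "c + d"] chain_mono[of "elem P" d _ _ "c + d"] by simp_all
  then show ?case using chain_trans[of "elem P" "c + d" u v w] chain_trans[of "elem P" "c + d" w v u] by blast
next
  case (cancel u v x)
  then have "([x, inv_letter x], []) \<in> elem P" "([], [x, inv_letter x]) \<in> elem P" by (auto simp: elem_def)
  note this[THEN estepI, of u v]
  then have "chain (elem P) (length u + length v + 2) (u @ [x, inv_letter x] @ v) (u @ [] @ v)"
    "chain (elem P) (length u + length v + 2) (u @ [] @ v) (u @ [x, inv_letter x] @ v)" by (simp_all add: chain_step)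
  then show ?case by auto
next
  case (relator u v r)
  then obtain c where "chain (elem P) c r []" "chain (elem P) c [] r" using relator_chain by blast
  then have "chain (elem P) (length u + c + length v) (u @ r @ v) (u @ [] @ v)"
    "chain (elem P) (length u + c + length v) (u @ [] @ v) (u @ r @ v)" by (simp_all only: chain_context)
  then show ?case by auto
qed auto

definition bmoves :: "nat \<Rightarrow> ('a word \<times> 'a word) set" where
  "bmoves B = {(s, s'). s \<approx> s' \<and> length s \<le> B \<and> length s' \<le> B}"

lemma finite_words: "finite {w \<in> words P. length w \<le> n}"
proof -
  have "finite (gens P \<times> (UNIV :: bool set))" using finite_presentation by (simp add: finite_presentation_def)
  then have "finite {w. set w \<subseteq> gens P \<times> (UNIV :: bool set) \<and> length w \<le> n}" by (rule finite_lists_length_le)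
  then show ?thesis by (rule finite_subset[rotated]) (auto simp: words_def)
qed

text \<open>Each bounded move is a chain with some bound of its own. There are only finitely many
  bounded moves over a finite set of generators, so the maximum serves all of them.\<close>

lemma bmoves_chain: "\<exists>c. \<forall>(s, s')\<in>bmoves B. chain (elem P) c s s'"
proof -
  have "finite (bmoves B)"
    by (rule finite_subset[OF _ finite_cartesian_product[OF finite_words[of B] finite_words[of B]]])
      (auto simp: bmoves_def dest: weq_words)
  moreover have "\<forall>p\<in>bmoves B. \<exists>c. chain (elem P) c (fst p) (snd p)" using weq_chain by (auto simp: bmoves_def)
  then obtain c where c: "\<forall>p\<in>bmoves B. chain (elem P) (c p) (fst p) (snd p)" by metis
  ultimately have "c p \<le> Max (c ` bmoves B)" if "p \<in> bmoves B" for p using that by simp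
  then have "chain (elem P) (Max (c ` bmoves B)) (fst p) (snd p)" if "p \<in> bmoves B" for p
    using that c chain_mono by blast
  then show ?thesis by (intro exI[of _ "Max (c ` bmoves B)"]) auto
qed

text \<open>The bound is the length \<open>m\<close> of a longest relator, plus two for cancelling
  pairs.\<close>

lemma elem_bmoves: "\<exists>B. elem P \<subseteq> bmoves B"
proof -
  have "finite (length ` rels P)" using finite_presentation by (simp add: finite_presentation_def)
  then obtain m where m: "\<forall>r\<in>rels P. length r \<le> m" unfolding finite_nat_set_iff_bounded_le by blast
  have "length (v @ u) \<le> m" if "u @ v \<in> rels P \<union> inv_word ` rels P" for u v
  proof -
    have "length (u @ v) \<le> m" using that m by (metis UnE imageE inv_word_simps(4))
    then show ?thesis by simp
  qed
  then have "length c \<le> m" if "c \<in> cyclic_rels P" for c using that unfolding cyclic_rels_def by blast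
  then have "length s \<le> m + 2 \<and> length s' \<le> m + 2" if "(s, s') \<in> elem P" for s s'
    using that by (fastforce simp: elem_def)
  then show ?thesis using elem_weq by (intro exI[of _ "m + 2"]) (auto simp: bmoves_def)
qed

lemma bmoves_refine: "\<exists>c. \<forall>rt fr L n W. null_seq rt fr (bmoves B) L n W \<longrightarrow> (\<exists>m. null_seq rt fr (elem P) (L + c) m W)"
  using bmoves_chain[of B] null_seq_refine[of _ _ "bmoves B"] by blast

text \<open>Triviality propagates back from the end: moves keep the element, and both rotation and
  concatenation preserve triviality. This is needed where a rotation shifts the starting point of a
  path in a Cayley graph.\<close>

lemma null_seq_null_homotopic:
  "null_seq rt fr R L n W \<Longrightarrow> R \<subseteq> {(s, s'). s \<approx> s'} \<Longrightarrow> \<forall>w\<in>#W. w \<in> words P \<Longrightarrow> \<forall>w\<in>#W. w \<approx> []"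
proof (induction rule: null_seq.induct)
  case (drop n W)
  then show ?case by (simp add: word_eq.refl)
next
  case (undrop n W)
  then show ?case by simp
next
  case (move w w' W n)
  obtain x y s s' where s: "(s, s') \<in> R" "w = x @ s @ y" "w' = x @ s' @ y" using move(1) by (auto simp: estep_def)
  then have "s \<approx> s'" using move.prems by blast
  then have "w \<approx> w'" unfolding s(2,3) by (rule weq_context) (use move.prems s(2) in auto)
  moreover from this have "\<forall>w\<in>#add_mset w' W. w \<approx> []" using move.IH move.prems weq_words by simp
  ultimately show ?case by (auto intro: word_eq.trans)
next
  case (rot n v u W)
  then show ?case using weq_rotate by simp
next
  case (frag u v n W)
  then show ?case using weq_append[of u "[]" v "[]"] by simp
qed simp

text \<open>A derivation in the presentation is a chain of elementary moves; only the length of its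
  longest word is unknown. Realizing the resulting sequence is how diagrams for null-homotopic words
  are obtained.\<close>

lemma fills_exists: assumes "w \<approx> []" shows "\<exists>L. fills False False P L w"
proof -
  obtain c where c: "chain (elem P) c w []" using weq_chain[OF assms] by blast
  have "null_seq False False (elem P) c 0 {#[]#}" by (rule null_seq.drop[OF null_seq.empty]) simp
  then have "\<exists>m. null_seq False False (elem P) c m {#w#}" by (rule null_seq_chain[OF c]) simp
  then show ?thesis by (auto simp: fills_def)
qed

end

section \<open>Quasi-isometries on words\<close>

lemma (in group) foldr_mult: "set xs \<subseteq> carrier G \<Longrightarrow> z \<in> carrier G \<Longrightarrow>
    foldr (\<lambda>x y. x \<otimes> y) xs \<one> \<in> carrier G \<and> foldr (\<lambda>x y. x \<otimes> y) xs z = foldr (\<lambda>x y. x \<otimes> y) xs \<one> \<otimes> z"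
  by (induction xs) (auto simp: m_assoc)

lemma (in group) word_norm_attained:
  assumes S: "finite_generating_set G S" and g: "g \<in> carrier G"
  shows "\<exists>xs. length xs = word_norm G S g \<and> set xs \<subseteq> S \<union> m_inv G ` S \<and> foldr (\<lambda>x y. x \<otimes> y) xs \<one> = g"
proof -
  have c: "S \<union> m_inv G ` S \<subseteq> carrier G" using S by (auto simp: finite_generating_set_def)
  have "g \<in> generate G S \<Longrightarrow> \<exists>xs. set xs \<subseteq> S \<union> m_inv G ` S \<and> foldr (\<lambda>x y. x \<otimes> y) xs \<one> = g" for g
  proof (induction rule: generate.induct)
    case one
    show ?case by (intro exI[of _ "[]"]) simp
  next
    case (incl h)
    then show ?case using c by (intro exI[of _ "[h]"]) auto
  next
    case (inv h)
    then show ?case using c by (intro exI[of _ "[m_inv G h]"]) auto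
  next
    case (eng h1 h2)
    then obtain xs ys where x: "set xs \<subseteq> S \<union> m_inv G ` S" "foldr (\<lambda>x y. x \<otimes> y) xs \<one> = h1"
      and y: "set ys \<subseteq> S \<union> m_inv G ` S" "foldr (\<lambda>x y. x \<otimes> y) ys \<one> = h2" by blast
    have "set xs \<subseteq> carrier G" "set ys \<subseteq> carrier G" using x(1) y(1) c by blast+
    then have "h2 \<in> carrier G" using foldr_mult[of ys \<one>] y(2) by simp
    then have "foldr (\<lambda>x y. x \<otimes> y) (xs @ ys) \<one> = h1 \<otimes> h2" using foldr_mult[of xs h2] \<open>set xs \<subseteq> carrier G\<close> x(2) y(2) by simp
    then show ?case using x(1) y(1) by (intro exI[of _ "xs @ ys"]) simp
  qed
  then have "\<exists>n xs. length xs = n \<and> set xs \<subseteq> S \<union> m_inv G ` S \<and> foldr (\<lambda>x y. x \<otimes> y) xs \<one> = g"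
    using S g by (auto simp: finite_generating_set_def)
  then show ?thesis unfolding word_norm_def by (rule LeastI_ex)
qed

section \<open>Word metrics on a presented group\<close>

context fin_presented
begin

abbreviation G where "G \<equiv> presented_group P"
abbreviation cl where "cl \<equiv> word_class P"

lemma carrier_G: "carrier G = cl ` words P"
  by (simp add: presented_group_def)

lemma one_G: "\<one>\<^bsub>G\<^esub> = cl []"
  by (simp add: presented_group_def)

lemma class_mult: assumes "u \<in> words P" "v \<in> words P" shows "cl u \<otimes>\<^bsub>G\<^esub> cl v = cl (u @ v)"
proof -
  have "cl (u' @ v') = cl (u @ v)" if "u' \<in> cl u" "v' \<in> cl v" for u' v'
  proof -
    have "u @ v \<approx> u' @ v'" using that weq_append by (simp add: word_class_def)
    then show ?thesis using word_class_eq[of "u @ v" "u' @ v'"] assms by simp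
  qed
  moreover have "u \<in> cl u" "v \<in> cl v" using assms word_eq.refl by (auto simp: word_class_def)
  ultimately have "(\<Union>u'\<in>cl u. \<Union>v'\<in>cl v. cl (u' @ v')) = cl (u @ v)" by blast
  then show ?thesis by (simp add: presented_group_def)
qed

lemma inv_class: assumes "u \<in> words P" shows "cl (inv_word u) \<otimes>\<^bsub>G\<^esub> cl u = \<one>\<^bsub>G\<^esub>"
  using class_mult[of "inv_word u" u] assms word_class_eq[of "inv_word u @ u" "[]"] weq_inv(2)[OF assms] by (simp add: one_G)

lemma group_G: "group G"
proof (rule groupI)
  fix x y assume "x \<in> carrier G" "y \<in> carrier G"
  then show "x \<otimes>\<^bsub>G\<^esub> y \<in> carrier G" unfolding carrier_G using class_mult by auto
next
  fix x y z assume "x \<in> carrier G" "y \<in> carrier G" "z \<in> carrier G"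
  then show "x \<otimes>\<^bsub>G\<^esub> y \<otimes>\<^bsub>G\<^esub> z = x \<otimes>\<^bsub>G\<^esub> (y \<otimes>\<^bsub>G\<^esub> z)" unfolding carrier_G using class_mult by auto
next
  fix x assume "x \<in> carrier G"
  then show "\<one>\<^bsub>G\<^esub> \<otimes>\<^bsub>G\<^esub> x = x" unfolding carrier_G one_G using class_mult[of "[]"] by auto
next
  fix x assume "x \<in> carrier G"
  then obtain u where "u \<in> words P" "x = cl u" unfolding carrier_G by blast
  then show "\<exists>y\<in>carrier G. y \<otimes>\<^bsub>G\<^esub> x = \<one>\<^bsub>G\<^esub>" unfolding carrier_G using inv_class by (intro bexI[of _ "cl (inv_word u)"]) auto
qed (auto simp: carrier_G one_G)

lemma dist_class: assumes "u \<in> words P" "v \<in> words P"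
  shows "word_dist G S (cl u) (cl v) = real (word_norm G S (cl (inv_word u @ v)))"
proof -
  have "inv\<^bsub>G\<^esub> (cl u) = cl (inv_word u)"
    by (rule group.inv_equality[OF group_G inv_class]) (use assms carrier_G in auto)
  then show ?thesis unfolding word_dist_def using class_mult[of "inv_word u" v] assms by simp
qed

text \<open>The generating set \<open>S\<close> of the metric is unrelated to the generators of the
  presentation. The factor \<open>m\<close> bounds the lengths of chosen words for its elements and
  their inverses.\<close>

lemma norm_word: assumes S: "finite_generating_set G S"
  shows "\<exists>m. \<forall>w\<in>words P. \<exists>c\<in>words P. length c \<le> m * word_norm G S (cl w) \<and> c \<approx> w"
proof -
  let ?T = "S \<union> m_inv G ` S"
  have c: "?T \<subseteq> carrier G" using S group.inv_closed[OF group_G] by (auto simp: finite_generating_set_def)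
  then have "\<forall>s\<in>?T. \<exists>u. u \<in> words P \<and> s = cl u" unfolding carrier_G by blast
  then obtain rep where rep: "\<forall>s\<in>?T. rep s \<in> words P \<and> s = cl (rep s)" by metis
  have "finite (length ` rep ` ?T)" using S by (simp add: finite_generating_set_def)
  then have "length (rep s) \<le> Max (length ` rep ` ?T)" if "s \<in> ?T" for s using that by simp
  then obtain m where m: "\<And>s. s \<in> ?T \<Longrightarrow> length (rep s) \<le> m" by blast
  have *: "set xs \<subseteq> ?T \<Longrightarrow> concat (map rep xs) \<in> words P \<and> length (concat (map rep xs)) \<le> m * length xs
    \<and> foldr (\<lambda>x y. x \<otimes>\<^bsub>G\<^esub> y) xs \<one>\<^bsub>G\<^esub> = cl (concat (map rep xs))" for xs
  proof (induction xs)
    case (Cons s xs)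
    then have "s \<in> ?T" by simp
    then have s: "rep s \<in> words P" "s = cl (rep s)" "length (rep s) \<le> m" using rep m by blast+
    have i: "concat (map rep xs) \<in> words P" "length (concat (map rep xs)) \<le> m * length xs"
      "foldr (\<lambda>x y. x \<otimes>\<^bsub>G\<^esub> y) xs \<one>\<^bsub>G\<^esub> = cl (concat (map rep xs))" using Cons by simp_all
    have "s \<otimes>\<^bsub>G\<^esub> cl (concat (map rep xs)) = cl (rep s @ concat (map rep xs))"
      using class_mult[OF s(1) i(1)] s(2) by simp
    then show ?case using s(1,3) i by simp
  qed (simp add: one_G)
  show ?thesis
  proof (intro exI[of _ m] ballI)
    fix w assume w: "w \<in> words P"
    obtain xs where xs: "length xs = word_norm G S (cl w)" "set xs \<subseteq> ?T" "foldr (\<lambda>x y. x \<otimes>\<^bsub>G\<^esub> y) xs \<one>\<^bsub>G\<^esub> = cl w"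
      using group.word_norm_attained[OF group_G S, of "cl w"] w carrier_G by blast
    have "concat (map rep xs) \<approx> w" using *[OF xs(2)] xs(3) word_class_eq[of "concat (map rep xs)" w] by simp
    then show "\<exists>c\<in>words P. length c \<le> m * word_norm G S (cl w) \<and> c \<approx> w"
      using *[OF xs(2)] xs(1) by (intro bexI[of _ "concat (map rep xs)"]) simp_all
  qed
qed

lemma weq_flip: assumes "u @ c \<approx> v" shows "v @ inv_word c \<approx> u"
proof -
  have w: "u \<in> words P" "c \<in> words P" using weq_words[OF assms] by simp_all
  have "v @ inv_word c \<approx> (u @ c) @ inv_word c"
    by (rule weq_append[OF word_eq.sym[OF assms] word_eq.refl]) (use w in simp)
  also have "(u @ c) @ inv_word c \<approx> u" using weq_context[OF weq_inv(1)[OF w(2)], of u "[]"] w by simp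
  finally show ?thesis .
qed

lemma dist_near: assumes S: "finite_generating_set G S"
  shows "\<exists>m. \<forall>u\<in>words P. \<forall>v\<in>words P. word_dist G S (cl u) (cl v) \<le> r \<longrightarrow> (\<exists>c\<in>words P. length c \<le> m \<and> u @ c \<approx> v)"
proof -
  obtain m where m: "\<And>w. w \<in> words P \<Longrightarrow> \<exists>c\<in>words P. length c \<le> m * word_norm G S (cl w) \<and> c \<approx> w"
    using norm_word[OF S] by blast
  show ?thesis
  proof (intro exI[of _ "m * nat \<lfloor>r\<rfloor>"] ballI impI)
    fix u v assume w: "u \<in> words P" "v \<in> words P" and d: "word_dist G S (cl u) (cl v) \<le> r"
    have "real (word_norm G S (cl (inv_word u @ v))) \<le> r" using d dist_class[OF w] by simp
    then have n: "word_norm G S (cl (inv_word u @ v)) \<le> nat \<lfloor>r\<rfloor>" by (simp add: le_nat_floor)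
    obtain c where c: "c \<in> words P" "length c \<le> m * word_norm G S (cl (inv_word u @ v))" "c \<approx> inv_word u @ v"
      using m[of "inv_word u @ v"] w by auto
    have "u @ c \<approx> u @ inv_word u @ v" using weq_context[OF c(3), of u "[]"] w by simp
    also have "\<dots> \<approx> v" using weq_context[OF weq_inv(1)[OF w(1)], of "[]" v] w by simp
    finally have "u @ c \<approx> v" .
    moreover have "length c \<le> m * nat \<lfloor>r\<rfloor>" using c(2) n by (meson le_trans mult_le_mono2)
    ultimately show "\<exists>c\<in>words P. length c \<le> m * nat \<lfloor>r\<rfloor> \<and> u @ c \<approx> v" using c(1) by blast
  qed
qed

text \<open>There are finitely many words of length at most \<open>m\<close>, so their norms are
  bounded; the two generating sets need not be compared any further.\<close>

lemma near_dist: "\<exists>r. \<forall>u v c. length c \<le> m \<longrightarrow> u @ c \<approx> v \<longrightarrow> word_dist G S (cl u) (cl v) \<le> r"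
proof -
  have "finite ((\<lambda>c. word_norm G S (cl c)) ` {c \<in> words P. length c \<le> m})" using finite_words by simp
  then obtain k where "\<forall>n\<in>(\<lambda>c. word_norm G S (cl c)) ` {c \<in> words P. length c \<le> m}. n \<le> k"
    unfolding finite_nat_set_iff_bounded_le by (rule exE)
  then have k: "\<And>c. c \<in> words P \<Longrightarrow> length c \<le> m \<Longrightarrow> word_norm G S (cl c) \<le> k" by simp
  show ?thesis
  proof (intro exI[of _ "real k"] allI impI)
    fix u v c assume c: "length c \<le> m" "u @ c \<approx> v"
    have w: "u \<in> words P" "c \<in> words P" "v \<in> words P" using weq_words[OF c(2)] by simp_all
    have "inv_word u @ v \<approx> c @ inv_word []" by (rule weq_cross) (use c(2) in simp)
    then have "cl (inv_word u @ v) = cl c" using word_class_eq w by simp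
    then show "word_dist G S (cl u) (cl v) \<le> real k" using dist_class w k[OF w(2) c(1)] by simp
  qed
qed

end

text \<open>A coarsely Lipschitz map between Cayley graphs with vertices given by words. The literal
  equation \<open>F u = F v\<close> says that a value is chosen once per group element.\<close>

definition coarse_map :: "'a presentation \<Rightarrow> 'b presentation \<Rightarrow> nat \<Rightarrow> ('a word \<Rightarrow> 'b word) \<Rightarrow> bool" where
  "coarse_map P P' M F \<longleftrightarrow> (\<forall>u\<in>words P. F u \<in> words P') \<and> (\<forall>u v. word_eq P u v \<longrightarrow> F u = F v)
     \<and> (\<forall>u\<in>words P. \<forall>x\<in>gens P \<times> UNIV. \<exists>c\<in>words P'. length c \<le> M \<and> word_eq P' (F u @ c) (F (u @ [x])))"

definition coarse_inverse :: "'a presentation \<Rightarrow> nat \<Rightarrow> ('a word \<Rightarrow> 'b word) \<Rightarrow> ('b word \<Rightarrow> 'a word) \<Rightarrow> bool" where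
  "coarse_inverse P M F F' \<longleftrightarrow> (\<forall>u\<in>words P. \<exists>t\<in>words P. length t \<le> M \<and> word_eq P (u @ t) (F' (F u)))"

lemma coarse_map_mono: "coarse_map P P' M F \<Longrightarrow> M \<le> N \<Longrightarrow> coarse_map P P' N F"
  unfolding coarse_map_def by (meson order_trans)

lemma coarse_inverse_mono: "coarse_inverse P M F F' \<Longrightarrow> M \<le> N \<Longrightarrow> coarse_inverse P N F F'"
  unfolding coarse_inverse_def by (meson order_trans)

text \<open>\<open>F\<close> represents the values of the quasi-isometry, and \<open>F'\<close>
  picks approximate preimages by coarse surjectivity. The lower bound of the quasi-isometry makes
  \<open>F'\<close> coarsely Lipschitz, and \<open>dist_near\<close> turns bounds on distances into
  bounds on connecting words.\<close>

lemma quasi_isometric_coarse_maps: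
  fixes P :: "'a presentation" and P' :: "'b presentation"
  assumes fin: "finite_presentation P" "finite_presentation P'"
    and qi: "quasi_isometric_groups (presented_group P) (presented_group P')"
  obtains F F' M where "coarse_map P P' M F" "coarse_map P' P M F'" "coarse_inverse P M F F'" "coarse_inverse P' M F' F"
proof -
  interpret A: fin_presented P by unfold_locales (rule fin(1))
  interpret B: fin_presented P' by unfold_locales (rule fin(2))
  obtain S T where S: "finite_generating_set A.G S" and T: "finite_generating_set B.G T"
    and q: "quasi_isometric (carrier A.G) (word_dist A.G S) (carrier B.G) (word_dist B.G T)"
    using qi unfolding quasi_isometric_groups_def by blast
  let ?d = "\<lambda>u v. word_dist A.G S (A.cl u) (A.cl v)" and ?e = "word_dist B.G T"
  obtain f K C where f: "f \<in> carrier A.G \<rightarrow> carrier B.G" and K: "K \<ge> 1" "C \<ge> 0"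
    and lo: "\<And>x x'. x \<in> carrier A.G \<Longrightarrow> x' \<in> carrier A.G \<Longrightarrow> word_dist A.G S x x' / K - C \<le> ?e (f x) (f x')"
    and up: "\<And>x x'. x \<in> carrier A.G \<Longrightarrow> x' \<in> carrier A.G \<Longrightarrow> ?e (f x) (f x') \<le> K * word_dist A.G S x x' + C"
    and sur: "\<And>y. y \<in> carrier B.G \<Longrightarrow> \<exists>x\<in>carrier A.G. ?e (f x) y \<le> C"
    using q unfolding quasi_isometric_def by blast
  define F where "F u = (SOME v. v \<in> words P' \<and> B.cl v = f (A.cl u))" for u
  define F' where "F' v = (SOME u. u \<in> words P \<and> ?e (f (A.cl u)) (B.cl v) \<le> C)" for v
  have F: "F u \<in> words P' \<and> B.cl (F u) = f (A.cl u)" if "u \<in> words P" for u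
  proof -
    have "f (A.cl u) \<in> B.cl ` words P'" using f that A.carrier_G B.carrier_G by blast
    then have "\<exists>v. v \<in> words P' \<and> B.cl v = f (A.cl u)" by auto
    then show ?thesis unfolding F_def by (rule someI_ex)
  qed
  have F': "F' v \<in> words P \<and> ?e (f (A.cl (F' v))) (B.cl v) \<le> C" if "v \<in> words P'" for v
  proof -
    have "\<exists>u. u \<in> words P \<and> ?e (f (A.cl u)) (B.cl v) \<le> C" using sur[of "B.cl v"] that A.carrier_G B.carrier_G by auto
    then show ?thesis unfolding F'_def by (rule someI_ex)
  qed
  have FF: "?e (B.cl (F (F' v))) (B.cl v) \<le> C" if "v \<in> words P'" for v using F F'[OF that] by simp
  have lo': "?d u v \<le> K * (?e (B.cl (F u)) (B.cl (F v)) + C)" if "u \<in> words P" "v \<in> words P" for u v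
  proof -
    have "?d u v / K \<le> ?e (B.cl (F u)) (B.cl (F v)) + C"
      using lo[of "A.cl u" "A.cl v"] that F A.carrier_G by fastforce
    then show ?thesis using K(1) by (simp add: divide_le_eq mult.commute)
  qed
  have up': "?e (B.cl (F u)) (B.cl (F v)) \<le> K * ?d u v + C" if "u \<in> words P" "v \<in> words P" for u v
    using up[of "A.cl u" "A.cl v"] that F A.carrier_G by fastforce
  obtain r1 where r1: "\<And>u v c. length c \<le> 1 \<Longrightarrow> A.weq (u @ c) v \<Longrightarrow> ?d u v \<le> r1" using A.near_dist[of 1 S] by blast
  obtain m1 where m1: "\<And>u v. u \<in> words P' \<Longrightarrow> v \<in> words P' \<Longrightarrow> ?e (B.cl u) (B.cl v) \<le> K * r1 + C
      \<Longrightarrow> \<exists>c\<in>words P'. length c \<le> m1 \<and> B.weq (u @ c) v" using B.dist_near[OF T, of "K * r1 + C"] by blast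
  obtain m2 where m2: "\<And>u v. u \<in> words P' \<Longrightarrow> v \<in> words P' \<Longrightarrow> ?e (B.cl u) (B.cl v) \<le> C
      \<Longrightarrow> \<exists>c\<in>words P'. length c \<le> m2 \<and> B.weq (u @ c) v" using B.dist_near[OF T, of C] by blast
  \<comment> \<open>The images under \<open>F\<close> of \<open>F' u\<close> and
    \<open>F' (u @ [x])\<close> are joined through \<open>u\<close> and \<open>u @ [x]\<close>: two
    jumps of length at most \<open>m2\<close> and one edge.\<close>
  obtain r2 where r2: "\<And>u v c. length c \<le> 2 * m2 + 1 \<Longrightarrow> B.weq (u @ c) v \<Longrightarrow> ?e (B.cl u) (B.cl v) \<le> r2"
    using B.near_dist[of "2 * m2 + 1" T] by blast
  obtain m3 where m3: "\<And>u v. u \<in> words P \<Longrightarrow> v \<in> words P \<Longrightarrow> ?d u v \<le> K * (r2 + C)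
      \<Longrightarrow> \<exists>c\<in>words P. length c \<le> m3 \<and> A.weq (u @ c) v" using A.dist_near[OF S, of "K * (r2 + C)"] by blast
  obtain m4 where m4: "\<And>u v. u \<in> words P \<Longrightarrow> v \<in> words P \<Longrightarrow> ?d u v \<le> K * (C + C)
      \<Longrightarrow> \<exists>c\<in>words P. length c \<le> m4 \<and> A.weq (u @ c) v" using A.dist_near[OF S, of "K * (C + C)"] by blast
  have c1: "coarse_map P P' m1 F" unfolding coarse_map_def
  proof (intro conjI ballI allI impI)
    show "F u \<in> words P'" if "u \<in> words P" for u using F that by blast
    show "F u = F v" if "A.weq u v" for u v
      using A.word_class_eq[of u v] A.weq_words[OF that] that by (simp add: F_def)
    fix u x assume u: "u \<in> words P" and x: "x \<in> gens P \<times> (UNIV :: bool set)"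
    have ux: "u @ [x] \<in> words P" using u x by simp
    have "?d u (u @ [x]) \<le> r1" by (rule r1[of "[x]"]) (use word_eq.refl[OF ux] in auto)
    then have "K * ?d u (u @ [x]) \<le> K * r1" using K(1) by (intro mult_left_mono) auto
    then have "?e (B.cl (F u)) (B.cl (F (u @ [x]))) \<le> K * r1 + C" using up'[OF u ux] by linarith
    then show "\<exists>c\<in>words P'. length c \<le> m1 \<and> B.weq (F u @ c) (F (u @ [x]))" using m1 F u ux by blast
  qed
  have c2: "coarse_map P' P m3 F'" unfolding coarse_map_def
  proof (intro conjI ballI allI impI)
    show "F' v \<in> words P" if "v \<in> words P'" for v using F' that by blast
    show "F' u = F' v" if "B.weq u v" for u v
      using B.word_class_eq[of u v] B.weq_words[OF that] that by (simp add: F'_def)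
    fix u x assume u: "u \<in> words P'" and x: "x \<in> gens P' \<times> (UNIV :: bool set)"
    have ux: "u @ [x] \<in> words P'" using u x by simp
    have w: "F' u \<in> words P" "F' (u @ [x]) \<in> words P" using F' u ux by blast+
    obtain a where a: "a \<in> words P'" "length a \<le> m2" "B.weq (F (F' u) @ a) u" using m2[OF _ u FF[OF u]] F w by blast
    obtain b where b: "b \<in> words P'" "length b \<le> m2" "B.weq (F (F' (u @ [x])) @ b) (u @ [x])"
      using m2[OF _ ux FF[OF ux]] F w by blast
    have "B.weq ((F (F' u) @ a) @ [x]) (u @ [x])" by (rule B.weq_append[OF a(3)]) (use x word_eq.refl[of "[x]" P'] in auto)
    also have "B.weq (u @ [x]) (F (F' (u @ [x])) @ b)" by (rule word_eq.sym[OF b(3)])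
    finally have "B.weq (F (F' (u @ [x])) @ b) ((F (F' u) @ a) @ [x])" by (rule word_eq.sym)
    then have "B.weq (F (F' u) @ (a @ [x] @ inv_word b)) (F (F' (u @ [x])))" using B.weq_flip by fastforce
    then have "?e (B.cl (F (F' u))) (B.cl (F (F' (u @ [x])))) \<le> r2" by (rule r2[rotated]) (use a(2) b(2) in simp)
    then have "K * (?e (B.cl (F (F' u))) (B.cl (F (F' (u @ [x])))) + C) \<le> K * (r2 + C)" using K(1) by (intro mult_left_mono) auto
    then have "?d (F' u) (F' (u @ [x])) \<le> K * (r2 + C)" using lo'[OF w] by linarith
    then show "\<exists>c\<in>words P. length c \<le> m3 \<and> A.weq (F' u @ c) (F' (u @ [x]))" using m3[OF w] by blast
  qed
  have c3: "coarse_inverse P m4 F F'" unfolding coarse_inverse_def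
  proof
    fix u assume u: "u \<in> words P"
    then have w: "F u \<in> words P'" "F' (F u) \<in> words P" using F F' by blast+
    have "K * (?e (B.cl (F (F' (F u)))) (B.cl (F u)) + C) \<le> K * (C + C)" using K(1) FF[OF w(1)] by (intro mult_left_mono) auto
    then have "?d (F' (F u)) u \<le> K * (C + C)" using lo'[OF w(2) u] by linarith
    then obtain c where "c \<in> words P" "length c \<le> m4" "A.weq (F' (F u) @ c) u" using m4[OF w(2) u] by blast
    then show "\<exists>t\<in>words P. length t \<le> m4 \<and> A.weq (u @ t) (F' (F u))"
      using A.weq_flip by (intro bexI[of _ "inv_word c"]) auto
  qed
  have c4: "coarse_inverse P' m2 F' F" unfolding coarse_inverse_def
  proof
    fix v assume v: "v \<in> words P'"
    then have w: "F (F' v) \<in> words P'" using F F' by blast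
    then obtain c where "c \<in> words P'" "length c \<le> m2" "B.weq (F (F' v) @ c) v" using m2[OF w v FF[OF v]] by blast
    then show "\<exists>t\<in>words P'. length t \<le> m2 \<and> B.weq (v @ t) (F (F' v))"
      using B.weq_flip by (intro bexI[of _ "inv_word c"]) auto
  qed
  show ?thesis
    by (rule that[OF coarse_map_mono[OF c1] coarse_map_mono[OF c2] coarse_inverse_mono[OF c3] coarse_inverse_mono[OF c4],
      of "m1 + m2 + m3 + m4"]) simp_all
qed

section \<open>Transport of null sequences\<close>

locale coarse = A: fin_presented P + B: fin_presented P'
  for P :: "'a presentation" and P' :: "'b presentation" +
  fixes F :: "'a word \<Rightarrow> 'b word" and M :: nat
  assumes coarse: "coarse_map P P' M F"
begin

lemma F_words: "y \<in> words P \<Longrightarrow> F y \<in> words P'"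
  using coarse by (auto simp: coarse_map_def)

lemma F_cong: "word_eq P y y' \<Longrightarrow> F y = F y'"
  using coarse by (auto simp: coarse_map_def)

text \<open>The choice refers to \<open>y\<close> only through \<open>F y\<close> and
  \<open>F (y @ [x])\<close>, hence only to an edge of the Cayley graph. The two directions of an
  edge are chosen independently; the image of a cancelling pair is still trivial and of bounded
  length, so a bounded move deletes it.\<close>

definition edge_word :: "'a word \<Rightarrow> 'a \<times> bool \<Rightarrow> 'b word" where
  "edge_word y x = (SOME c. c \<in> words P' \<and> length c \<le> M \<and> word_eq P' (F y @ c) (F (y @ [x])))"

fun path_word :: "'a word \<Rightarrow> 'a word \<Rightarrow> 'b word" where
  "path_word y [] = []"
| "path_word y (x # w) = edge_word y x @ path_word (y @ [x]) w"

lemma edge_word: assumes "y \<in> words P" "x \<in> gens P \<times> UNIV"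
  shows "edge_word y x \<in> words P'" "length (edge_word y x) \<le> M" "word_eq P' (F y @ edge_word y x) (F (y @ [x]))"
proof -
  have "\<exists>c. c \<in> words P' \<and> length c \<le> M \<and> word_eq P' (F y @ c) (F (y @ [x]))"
    using coarse assms unfolding coarse_map_def by blast
  from someI_ex[OF this] show "edge_word y x \<in> words P'" "length (edge_word y x) \<le> M"
    "word_eq P' (F y @ edge_word y x) (F (y @ [x]))" unfolding edge_word_def by blast+
qed

lemma snoc_cong: assumes "word_eq P y y'" "x \<in> gens P \<times> UNIV" shows "word_eq P (y @ [x]) (y' @ [x])"
  by (rule A.weq_append[OF assms(1) word_eq.refl]) (use assms(2) in simp)

lemma edge_word_cong: assumes "word_eq P y y'" "x \<in> gens P \<times> UNIV" shows "edge_word y x = edge_word y' x"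
  unfolding edge_word_def F_cong[OF assms(1)] F_cong[OF snoc_cong[OF assms]] ..

lemma path_word_append: "path_word y (u @ v) = path_word y u @ path_word (y @ u) v"
  by (induction u arbitrary: y) auto

lemma path_word_cong: "word_eq P y y' \<Longrightarrow> w \<in> words P \<Longrightarrow> path_word y w = path_word y' w"
proof (induction w arbitrary: y y')
  case (Cons x w)
  then have x: "x \<in> gens P \<times> UNIV" "w \<in> words P" by auto
  show ?case using Cons.IH[OF snoc_cong[OF Cons.prems(1) x(1)] x(2)] edge_word_cong[OF Cons.prems(1) x(1)] by simp
qed simp

lemma path_word: "y \<in> words P \<Longrightarrow> w \<in> words P \<Longrightarrow>
    path_word y w \<in> words P' \<and> length (path_word y w) \<le> M * length w \<and> word_eq P' (F y @ path_word y w) (F (y @ w))"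
proof (induction w arbitrary: y)
  case Nil
  then show ?case using word_eq.refl[OF F_words] by simp
next
  case (Cons x w)
  then have x: "x \<in> gens P \<times> UNIV" "w \<in> words P" "y @ [x] \<in> words P" by auto
  note e = edge_word[OF Cons.prems(1) x(1)]
  have i: "path_word (y @ [x]) w \<in> words P'" "length (path_word (y @ [x]) w) \<le> M * length w"
    "word_eq P' (F (y @ [x]) @ path_word (y @ [x]) w) (F ((y @ [x]) @ w))" using Cons.IH[OF x(3,2)] by blast+
  have "word_eq P' ((F y @ edge_word y x) @ path_word (y @ [x]) w) (F (y @ [x]) @ path_word (y @ [x]) w)"
    by (rule B.weq_append[OF e(3) word_eq.refl[OF i(1)]])
  also note i(3)
  finally show ?case using e i by simp
qed

text \<open>Both paths join \<open>F y\<close> to the same point because \<open>s\<close> and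
  \<open>s'\<close> represent the same element; left cancellation makes the two path words equal in
  the group.\<close>

lemma path_word_bmoves: assumes "(s, s') \<in> A.bmoves K" "y \<in> words P"
  shows "(path_word y s, path_word y s') \<in> B.bmoves (M * K)"
proof -
  have e: "word_eq P s s'" "length s \<le> K" "length s' \<le> K" using assms(1) by (auto simp: A.bmoves_def)
  then have w: "s \<in> words P" "s' \<in> words P" using A.weq_words by blast+
  note p = path_word[OF assms(2) w(1)] path_word[OF assms(2) w(2)]
  have "word_eq P' (F y @ path_word y s) (F (y @ s))" using p by blast
  also have "F (y @ s) = F (y @ s')" by (rule F_cong[OF A.weq_append[OF word_eq.refl[OF assms(2)] e(1)]])
  also have "word_eq P' (F (y @ s')) (F y @ path_word y s')" using p word_eq.sym by blast
  finally have "word_eq P' (path_word y s) (path_word y s')" by (rule B.weq_cancel_left)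
  moreover have "length (path_word y s) \<le> M * K" "length (path_word y s') \<le> M * K"
    using p e by (meson le_trans mult_le_mono2)+
  ultimately show ?thesis by (simp add: B.bmoves_def)
qed

abbreviation paths :: "('a word \<times> 'a word) multiset \<Rightarrow> 'b word multiset" where
  "paths Z \<equiv> image_mset (\<lambda>z. path_word (fst z) (snd z)) Z"

lemma tlen_paths: "\<forall>z\<in>#Z. fst z \<in> words P \<and> snd z \<in> words P \<Longrightarrow> tlen (paths Z) \<le> M * tlen (image_mset snd Z)"
proof (induction Z)
  case (add z Z)
  then have "length (path_word (fst z) (snd z)) \<le> M * length (snd z)" using path_word by simp
  then show ?case using add by (simp add: algebra_simps)
qed simp

text \<open>Every word carries the starting point of its path. Moves keep it; a rotation advances it
  along \<open>u\<close>, and a fragmentation does so for the second factor.\<close>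

lemma null_seq_paths:
  assumes "null_seq rt fr (A.bmoves K) L n W" "fr \<longrightarrow> rt"
    "image_mset snd Z = W" "\<forall>z\<in>#Z. fst z \<in> words P \<and> snd z \<in> words P"
  shows "\<exists>m. null_seq rt fr (B.bmoves (M * K)) (M * L) m (paths Z)"
proof -
  let ?R = "B.bmoves (M * K)"
  let ?N = "null_seq rt fr ?R (M * L)"
  have split: "\<exists>y Z'. Z = add_mset (y, w) Z' \<and> image_mset snd Z' = W" if e: "image_mset snd Z = add_mset w W"
    for Z :: "('a word \<times> 'a word) multiset" and w W
  proof -
    obtain Z' z where "Z = add_mset z Z'" "snd z = w" "image_mset snd Z' = W" using msed_map_invR[OF e] by blast
    then show ?thesis by (intro exI[of _ "fst z"] exI[of _ Z']) auto
  qed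
  show ?thesis using assms(1,3,4)
  proof (induction arbitrary: Z rule: null_seq.induct)
    case empty
    then show ?case by (auto intro!: exI[of _ 0] null_seq.empty)
  next
    case (drop n W)
    obtain y Z' where Z: "Z = add_mset (y, []) Z'" "image_mset snd Z' = W" using split[OF drop.prems(1)] by blast
    then obtain m where "?N m (paths Z')" using drop.IH drop.prems(2) by auto
    moreover have "rt \<or> paths Z' = {#}" using drop(2) Z(2) by auto
    ultimately have "?N m (add_mset [] (paths Z'))" by (rule null_seq.drop)
    then show ?case unfolding Z(1) by auto
  next
    case (undrop n W)
    then obtain m where "?N m (paths (add_mset ([], []) Z))"
      using undrop.IH[of "add_mset ([], []) Z"] by auto
    then have "?N m (add_mset [] (paths Z))" by simp
    from null_seq.undrop[OF this undrop(2)] show ?case by blast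
  next
    case (move w w' W n)
    obtain y Z' where Z: "Z = add_mset (y, w) Z'" "image_mset snd Z' = W" using split[OF move.prems(1)] by blast
    obtain a b s s' where s: "(s, s') \<in> A.bmoves K" "w = a @ s @ b" "w' = a @ s' @ b" using move(1) by (auto simp: estep_def)
    have e: "word_eq P s s'" using s(1) by (simp add: A.bmoves_def)
    have w: "y \<in> words P" "a \<in> words P" "b \<in> words P" "s \<in> words P" "s' \<in> words P" "w \<in> words P" "w' \<in> words P"
      using move.prems(2) Z(1) s(2,3) A.weq_words[OF e] by auto
    have "word_eq P ((y @ a) @ s) ((y @ a) @ s')" by (rule A.weq_append[OF word_eq.refl e]) (use w in simp)
    then have pb: "path_word ((y @ a) @ s) b = path_word ((y @ a) @ s') b" by (rule path_word_cong) (rule w(3))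
    have "estep (?R) (path_word y a @ path_word (y @ a) s @ path_word ((y @ a) @ s) b)
        (path_word y a @ path_word (y @ a) s' @ path_word ((y @ a) @ s) b)"
      by (rule estepI[OF path_word_bmoves[OF s(1)]]) (use w in simp)
    then have est: "estep (?R) (path_word y w) (path_word y w')"
      unfolding pb using pb unfolding s(2,3) by (simp add: path_word_append)
    obtain m where "?N m (paths (add_mset (y, w') Z'))"
      using move.IH[of "add_mset (y, w') Z'"] Z move.prems(2) w by auto
    then have nm: "?N m (add_mset (path_word y w') (paths Z'))" by simp
    have "length (path_word y w) \<le> M * length w" using path_word w by blast
    moreover have "tlen (paths Z') \<le> M * tlen W" using tlen_paths[of Z'] Z move.prems(2) by auto
    ultimately have "length (path_word y w) + tlen (paths Z') \<le> M * (length w + tlen W)" by (simp add: algebra_simps)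
    also have "\<dots> \<le> M * L" using move(2) by (rule mult_le_mono2)
    finally have "length (path_word y w) + tlen (paths Z') \<le> M * L" .
    from null_seq.move[OF est this nm] show ?case unfolding Z(1) by auto
  next
    case (rot n v u W)
    obtain y Z' where Z: "Z = add_mset (y, u @ v) Z'" "image_mset snd Z' = W" using split[OF rot.prems(1)] by blast
    have w: "y \<in> words P" "u \<in> words P" "v \<in> words P" using rot.prems(2) Z(1) by auto
    have "\<forall>x\<in>#add_mset (v @ u) W. x \<in> words P" using rot.prems(2) Z w by auto
    then have "word_eq P (v @ u) []" using A.null_seq_null_homotopic[OF rot(2)] by (auto simp: A.bmoves_def)
    then have "word_eq P (u @ v) []" by (rule A.weq_rotate)
    then have "word_eq P (y @ u @ v) y" using A.weq_append[OF word_eq.refl[OF w(1)]] by fastforce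
    \<comment> \<open>A rotated word is null-homotopic, so its path closes up and the stretch
      \<open>u\<close> has the same image from either of its two starting points.\<close>
    then have pu: "path_word (y @ u @ v) u = path_word y u" using path_word_cong w(2) by blast
    obtain m where "?N m (paths (add_mset (y @ u, v @ u) Z'))"
      using rot.IH[of "add_mset (y @ u, v @ u) Z'"] Z rot.prems(2) w by auto
    then have "?N m (add_mset (path_word (y @ u) v @ path_word y u) (paths Z'))"
      by (simp add: path_word_append pu)
    from null_seq.rot[OF rot(1) this] show ?case unfolding Z(1) by (auto simp: path_word_append)
  next
    case (frag u v n W)
    obtain y Z' where Z: "Z = add_mset (y, u @ v) Z'" "image_mset snd Z' = W" using split[OF frag.prems(1)] by blast
    have w: "y \<in> words P" "u \<in> words P" "v \<in> words P" using frag.prems(2) Z(1) by auto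
    obtain m where "?N m (paths (add_mset (y, u) (add_mset (y @ u, v) Z')))"
      using frag.IH[of "add_mset (y, u) (add_mset (y @ u, v) Z')"] Z frag.prems(2) w by auto
    then have "?N m (add_mset (path_word y u) (add_mset (path_word (y @ u) v) (paths Z')))"
      by simp
    \<comment> \<open>The image of a nonempty factor may be empty, so the form of fragmentation that
      admits empty factors is required; it relies on \<open>fr\<close> implying
      \<open>rt\<close>.\<close>
    from null_seq_frag[OF frag(1) _ this] show ?case unfolding Z(1) using assms(2) frag(1) by (auto simp: path_word_append)
  qed
qed

end

locale coarse_pair = X: coarse P P' F M + Y: coarse P' P F' M
  for P :: "'a presentation" and P' :: "'b presentation" and F F' M +
  assumes inverse: "coarse_inverse P M F F'"
begin

text \<open>The rung at \<open>p\<close>: a short word from \<open>p\<close> to its image under the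
  round trip.\<close>

definition t :: "'a word \<Rightarrow> 'a word" where
  "t p = (SOME c. c \<in> words P \<and> length c \<le> M \<and> word_eq P (p @ c) (F' (F p)))"

lemma t: assumes "p \<in> words P" shows "t p \<in> words P" "length (t p) \<le> M" "word_eq P (p @ t p) (F' (F p))"
proof -
  have "\<exists>c. c \<in> words P \<and> length c \<le> M \<and> word_eq P (p @ c) (F' (F p))"
    using inverse assms unfolding coarse_inverse_def by blast
  from someI_ex[OF this] show "t p \<in> words P" "length (t p) \<le> M" "word_eq P (p @ t p) (F' (F p))"
    unfolding t_def by blast+
qed

text \<open>For a null-homotopic word the rungs at the beginning and at the end of the ladder agree,
  so the ladder leads to a conjugate of the round trip.\<close>

lemma t_cong: assumes "word_eq P p q" shows "t p = t q"
proof -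
  have "word_eq P (p @ c) z \<longleftrightarrow> word_eq P (q @ c) z" if c: "c \<in> words P" for c z
  proof -
    have "word_eq P (p @ c) (q @ c)" by (rule X.A.weq_append[OF assms word_eq.refl[OF c]])
    then show ?thesis using word_eq.sym word_eq.trans by blast
  qed
  then have "(\<lambda>c. c \<in> words P \<and> length c \<le> M \<and> word_eq P (p @ c) (F' (F p)))
      = (\<lambda>c. c \<in> words P \<and> length c \<le> M \<and> word_eq P (q @ c) (F' (F q)))"
    using X.F_cong[OF assms] by auto
  then show ?thesis by (simp add: t_def)
qed

abbreviation round_trip :: "'a word \<Rightarrow> 'a word \<Rightarrow> 'a word" where
  "round_trip p w \<equiv> Y.path_word (F p) (X.path_word p w)"

text \<open>Sweeps out the annulus between a word and its round trip, one rung \<open>t p\<close> at a time.\<close>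

lemma ladder: "p \<in> words P \<Longrightarrow> w \<in> words P \<Longrightarrow>
    chain (X.A.bmoves (M * M + M + 1)) ((M * M + M + 1) * length w + (M * M + M + 1))
      (inv_word (t p) @ w) (round_trip p w @ inv_word (t (p @ w)))"
proof (induction w arbitrary: p)
  case Nil
  then show ?case by simp
next
  case (Cons x v)
  let ?K = "M * M + M + 1"
  let ?R = "X.A.bmoves ?K"
  have x: "x \<in> gens P \<times> UNIV" "v \<in> words P" "p @ [x] \<in> words P" using Cons.prems by auto
  note e = X.edge_word[OF Cons.prems(1) x(1)]
  note t1 = t[OF Cons.prems(1)] and t2 = t[OF x(3)]
  have Fp: "F p \<in> words P'" by (rule X.F_words[OF Cons.prems(1)])
  have pv: "X.path_word (p @ [x]) v \<in> words P'" using X.path_word[OF x(3,2)] by blast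
  define z where "z = Y.path_word (F p) (X.edge_word p x)"
  have z: "z \<in> words P" "length z \<le> M * length (X.edge_word p x)" "word_eq P (F' (F p) @ z) (F' (F p @ X.edge_word p x))"
    using Y.path_word[OF Fp e(1)] unfolding z_def by blast+
  have lz: "length z \<le> M * M" using z(2) e(2) by (meson le_trans mult_le_mono2)
  have rt: "round_trip p (x # v) = z @ round_trip (p @ [x]) v"
    using Y.path_word_cong[OF e(3) pv] by (simp add: Y.path_word_append z_def)
  \<comment> \<open>The edge \<open>x\<close>, its round trip \<open>z\<close> and the two rungs
    form a square in the Cayley graph. Comparing the two ways around it yields one move across the
    square.\<close>
  have "word_eq P ((p @ t p) @ z) (F' (F p) @ z)" by (rule X.A.weq_append[OF t1(3) word_eq.refl[OF z(1)]])
  also note z(3)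
  also have "F' (F p @ X.edge_word p x) = F' (F (p @ [x]))" by (rule Y.F_cong[OF e(3)])
  also have "word_eq P (F' (F (p @ [x]))) ((p @ [x]) @ t (p @ [x]))" by (rule word_eq.sym[OF t2(3)])
  finally have "word_eq P (p @ (t p @ z)) (p @ ([x] @ t (p @ [x])))" by simp
  then have "word_eq P (t p @ z) ([x] @ t (p @ [x]))" by (rule X.A.weq_cancel_left)
  then have "word_eq P (inv_word (t p) @ [x]) (z @ inv_word (t (p @ [x])))" by (rule X.A.weq_cross)
  \<comment> \<open>The sides of this move have lengths at most \<open>M + 1\<close> and
    \<open>M * M + M\<close>, whence the bound \<open>M * M + M + 1\<close>.\<close>
  then have "(inv_word (t p) @ [x], z @ inv_word (t (p @ [x]))) \<in> ?R"
    using t1(2) t2(2) lz by (simp add: X.A.bmoves_def)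
  from estepI[OF this, of "[]" v]
  have es: "estep (?R) (inv_word (t p) @ x # v) (z @ inv_word (t (p @ [x])) @ v)" by simp
  have 1: "chain (?R) (?K * length (x # v) + ?K) (inv_word (t p) @ x # v) (z @ inv_word (t (p @ [x])) @ v)"
    by (rule chain_step[OF es]) (use t1(2) t2(2) lz in \<open>simp_all add: algebra_simps\<close>)
  have "chain (?R) (length z + (?K * length v + ?K) + length ([] :: 'a word)) (z @ (inv_word (t (p @ [x])) @ v) @ [])
      (z @ (round_trip (p @ [x]) v @ inv_word (t ((p @ [x]) @ v))) @ [])"
    by (rule chain_context[OF Cons.IH[OF x(3,2)]])
  then have "chain (?R) (length z + (?K * length v + ?K)) (z @ inv_word (t (p @ [x])) @ v)
      (round_trip p (x # v) @ inv_word (t (p @ x # v)))" unfolding rt by simp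
  then have 2: "chain (?R) (?K * length (x # v) + ?K) (z @ inv_word (t (p @ [x])) @ v)
      (round_trip p (x # v) @ inv_word (t (p @ x # v)))"
    by (rule chain_mono) (use lz in \<open>simp add: algebra_simps\<close>)
  show ?case using chain_trans[OF 1 2] by simp
qed

text \<open>\<open>w'\<close> is the path of \<open>w\<close>. Its null sequence is mapped back to
  one for the round trip of \<open>w\<close>, which is conjugated by the rung \<open>r\<close> at
  the identity; the ladder leads from \<open>w\<close> to this conjugate. The constant depends on
  neither the word nor the kind of filling.\<close>

lemma fills_transfer:
  obtains A where "\<And>w n. null_homotopic P w \<Longrightarrow> length w \<le> n \<Longrightarrow> \<exists>w'. null_homotopic P' w' \<and> length w' \<le> A * n
    \<and> (\<forall>rt fr L. (fr \<longrightarrow> rt) \<longrightarrow> fills rt fr P' L w' \<longrightarrow> fills rt fr P (A * L + A * n + A) w)"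
proof -
  let ?K = "M * M + M + 1"
  obtain B where B: "elem P' \<subseteq> X.B.bmoves B" using X.B.elem_bmoves by blast
  \<comment> \<open>The summands accommodate images of elementary moves, the cancellation of
    \<open>r\<close> with its inverse, and the moves across the squares of the ladder.\<close>
  define N where "N = M * B + 2 * M + ?K"
  obtain c where c: "\<And>rt fr L n W. null_seq rt fr (X.A.bmoves N) L n W \<Longrightarrow> \<exists>m. null_seq rt fr (elem P) (L + c) m W"
    using X.A.bmoves_refine[of N] by blast
  have mono: "X.A.bmoves i \<subseteq> X.A.bmoves j" if "i \<le> j" for i j using that by (auto simp: X.A.bmoves_def)
  let ?R = "X.A.bmoves N"
  \<comment> \<open>Chosen to dominate the coefficients of \<open>L\<close> and of \<open>n\<close>
    and the constant term in \<open>L2 + c\<close>, as well as the factor \<open>M\<close> in the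
    length of \<open>w'\<close>.\<close>
  define A where "A = M + M * M + ?K + 4 * M + c + 1"
  have "\<exists>w'. null_homotopic P' w' \<and> length w' \<le> A * n
    \<and> (\<forall>rt fr L. (fr \<longrightarrow> rt) \<longrightarrow> fills rt fr P' L w' \<longrightarrow> fills rt fr P (A * L + A * n + A) w)"
    if nh: "null_homotopic P w" and n: "length w \<le> n" for w n
  proof -
    have w0: "word_eq P w []" using nh X.A.null_homotopic_iff by simp
    then have w: "w \<in> words P" using X.A.weq_words by blast
    define w' where "w' = X.path_word [] w"
    have F0: "F [] \<in> words P'" by (rule X.F_words) simp
    have w': "w' \<in> words P'" "length w' \<le> M * length w" "word_eq P' (F [] @ w') (F w)"
      using X.path_word[of "[]" w] w unfolding w'_def by auto
    have "word_eq P' (F [] @ w') (F [] @ [])" using w'(3) X.F_cong[OF w0] by simp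
    then have w'0: "null_homotopic P' w'" using X.B.weq_cancel_left X.B.null_homotopic_iff by blast
    have lw': "length w' \<le> M * n" using w'(2) n by (meson le_trans mult_le_mono2)
    have "fills rt fr P (A * L + A * n + A) w" if fr: "fr \<longrightarrow> rt" and f: "fills rt fr P' L w'" for rt fr L
    proof -
      define r where "r = t []"
      have r: "r \<in> words P" "length r \<le> M" using t[of "[]"] by (simp_all add: r_def)
      obtain k where "null_seq rt fr (elem P') L k {#w'#}" using f by (auto simp: fills_def)
      then have "null_seq rt fr (X.B.bmoves B) L k {#w'#}" by (rule null_seq_mono[OF _ B]) simp
      from Y.null_seq_paths[OF this fr, of "{#(F [], w')#}"]
      obtain m where "null_seq rt fr (X.A.bmoves (M * B)) (M * L) m {#round_trip [] w#}" using F0 w'(1) by (auto simp: w'_def)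
      then have m: "null_seq rt fr (?R) (M * L) m {#round_trip [] w#}"
        by (rule null_seq_mono[OF _ mono]) (simp_all add: N_def)
      have "length (round_trip [] w) \<le> M * length w'" using Y.path_word[OF F0 w'(1)] by (simp add: w'_def)
      also have "\<dots> \<le> M * (M * n)" using lw' by (rule mult_le_mono2)
      finally have lr: "length (round_trip [] w) \<le> M * M * n" by simp
      have rr: "(r @ inv_word r, []) \<in> ?R" "(inv_word r @ r, []) \<in> ?R" "([], r @ inv_word r) \<in> ?R"
        using X.A.weq_inv[OF r(1)] r(2) word_eq.sym by (auto simp: X.A.bmoves_def N_def)
      \<comment> \<open>One bound for the transported sequence, for the round trip together with its
        two rungs, and for all words of the ladder.\<close>
      define L2 where "L2 = M * L + M * M * n + 4 * M + ?K * n + ?K"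
      have "\<exists>m. null_seq rt fr (?R) L2 m {#r @ round_trip [] w @ inv_word r#}"
        by (rule null_seq_conjugate[OF m _ rr(1,2)]) (use fr r(2) lr in \<open>auto simp: L2_def\<close>)
      then obtain m2 where m2: "null_seq rt fr (?R) L2 m2 {#r @ round_trip [] w @ inv_word r#}" by blast
      have nK: "?K * length w \<le> ?K * n" using n by (rule mult_le_mono2)
      have nn: "n \<le> ?K * n" by simp
      have es: "estep (?R) w (r @ inv_word r @ w)" using estepI[OF rr(3), of "[]" w] by simp
      have 1: "chain (?R) L2 w (r @ inv_word r @ w)"
        by (rule chain_step[OF es]) (use n nn r(2) in \<open>simp_all add: L2_def\<close>)
      have "chain (X.A.bmoves ?K) (?K * length w + ?K) (inv_word r @ w) (round_trip [] w @ inv_word r)"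
        using ladder[of "[]" w] w t_cong[OF w0] by (simp add: r_def)
      from chain_context[OF this, of r "[]"]
      have "chain (X.A.bmoves ?K) (length r + (?K * length w + ?K)) (r @ inv_word r @ w) (r @ round_trip [] w @ inv_word r)" by simp
      then have "chain (X.A.bmoves ?K) L2 (r @ inv_word r @ w) (r @ round_trip [] w @ inv_word r)"
        by (rule chain_mono) (use nK r(2) in \<open>simp add: L2_def\<close>)
      then have 2: "chain (?R) L2 (r @ inv_word r @ w) (r @ round_trip [] w @ inv_word r)"
        by (rule chain_mono_rel[OF _ mono]) (simp add: N_def)
      obtain m3 where "null_seq rt fr (?R) L2 m3 {#w#}"
        using null_seq_chain[OF chain_trans[OF 1 2] m2] by auto
      from c[OF this] obtain m4 where "null_seq rt fr (elem P) (L2 + c) m4 {#w#}" by blast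
      then have "null_seq rt fr (elem P) (A * L + A * n + A) m4 {#w#}"
        by (rule null_seq_mono) (simp_all add: L2_def A_def algebra_simps)
      then show ?thesis by (auto simp: fills_def)
    qed
    moreover have "M * n \<le> A * n" by (rule mult_le_mono1) (simp add: A_def)
    then have "length w' \<le> A * n" using lw' by (rule order_trans[rotated])
    ultimately show ?thesis using w'0 by blast
  qed
  then show ?thesis using that by blast
qed

end

section \<open>The filling functions\<close>

lemma (in fin_presented) finite_values: "finite {\<phi> w |w. null_homotopic P w \<and> length w \<le> n}"
proof -
  have "{\<phi> w |w. null_homotopic P w \<and> length w \<le> n} \<subseteq> \<phi> ` {w \<in> words P. length w \<le> n}"
    by (auto simp: null_homotopic_def)
  then show ?thesis using finite_words finite_subset by blast
qed

text \<open>The constant is \<open>A + 1\<close> because it has to be positive. Rounding is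
  harmless: for the integer part \<open>n\<close> of \<open>l\<close>, the integer
  \<open>A * n\<close> is at most the argument at which the other function is evaluated before
  rounding down.\<close>

lemma preceqI:
  fixes A :: nat
  assumes fin: "finite_presentation P" "finite_presentation P'"
    and A: "\<And>w n. null_homotopic P w \<Longrightarrow> length w \<le> n \<Longrightarrow>
      \<exists>w'. null_homotopic P' w' \<and> length w' \<le> A * n \<and> \<phi> w \<le> A * \<psi> w' + A * n + A"
  shows "(\<lambda>n. Max {\<phi> w |w. null_homotopic P w \<and> length w \<le> n}) \<preceq> (\<lambda>n. Max {\<psi> w |w. null_homotopic P' w \<and> length w \<le> n})"
proof -
  interpret p: fin_presented P by unfold_locales (rule fin(1))
  interpret p': fin_presented P' by unfold_locales (rule fin(2))
  let ?f = "\<lambda>n. Max {\<phi> w |w. null_homotopic P w \<and> length w \<le> n}"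
  let ?g = "\<lambda>n. Max {\<psi> w |w. null_homotopic P' w \<and> length w \<le> n}"
  have le: "?f n \<le> A * ?g k + A * n + A" if k: "A * n \<le> k" for n k
  proof -
    have "null_homotopic P []" by (simp add: p.null_homotopic_iff word_eq.refl)
    then have "{\<phi> w |w. null_homotopic P w \<and> length w \<le> n} \<noteq> {}" by fastforce
    then have "?f n \<in> {\<phi> w |w. null_homotopic P w \<and> length w \<le> n}" by (rule Max_in[OF p.finite_values])
    then obtain w where w: "null_homotopic P w" "length w \<le> n" "?f n = \<phi> w" by blast
    obtain w' where w': "null_homotopic P' w'" "length w' \<le> A * n" "\<phi> w \<le> A * \<psi> w' + A * n + A" using A[OF w(1,2)] by blast
    have "\<psi> w' \<le> ?g k" by (rule Max_ge[OF p'.finite_values]) (use w' k in auto)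
    then have "A * \<psi> w' \<le> A * ?g k" by (rule mult_le_mono2)
    then show ?thesis using w(3) w'(3) by linarith
  qed
  show ?thesis unfolding fun_preceq_def step_ext_def
  proof (intro exI[of _ "real A + 1"] conjI allI impI)
    fix l :: real assume l: "l \<ge> 0"
    let ?C = "real A + 1"
    let ?n = "nat \<lfloor>l\<rfloor>" and ?k = "nat \<lfloor>?C * l + ?C\<rfloor>"
    have nl: "real ?n \<le> l" using l by simp
    have "real A * real ?n \<le> ?C * l + ?C" using nl l by (intro order_trans[OF mult_mono[of "real A" ?C "real ?n" l]]) auto
    then have "A * ?n \<le> ?k" by (intro le_nat_floor) simp
    then have "?f ?n \<le> A * ?g ?k + A * ?n + A" by (rule le)
    then have "real (?f ?n) \<le> real (A * ?g ?k + A * ?n + A)" by (simp only: of_nat_le_iff)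
    also have "\<dots> = real A * real (?g ?k) + real A * real ?n + real A" by simp
    also have "\<dots> \<le> ?C * real (?g ?k) + ?C * l + ?C" by (intro add_mono mult_mono nl) auto
    finally show "real (?f ?n) \<le> ?C * real (?g ?k) + ?C * l + ?C" .
  qed simp
qed

lemma coarse_preceq:
  assumes fin: "finite_presentation P" "finite_presentation P'"
    and c: "coarse_map P P' M F" "coarse_map P' P M F'" "coarse_inverse P M F F'"
  shows "FL P \<preceq> FL P'" "FFL P \<preceq> FFL P'" "FFFL P \<preceq> FFFL P'"
proof -
  interpret coarse_pair P P' F F' M
    by (intro coarse_pair.intro coarse.intro coarse_axioms.intro coarse_pair_axioms.intro fin_presented.intro fin c)
  obtain A where A: "\<And>w n. null_homotopic P w \<Longrightarrow> length w \<le> n \<Longrightarrow> \<exists>w'. null_homotopic P' w' \<and> length w' \<le> A * n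
    \<and> (\<forall>rt fr L. (fr \<longrightarrow> rt) \<longrightarrow> fills rt fr P' L w' \<longrightarrow> fills rt fr P (A * L + A * n + A) w)"
    using fills_transfer by blast
  \<comment> \<open>A null sequence exists for every null-homotopic word of \<open>P'\<close>, and
    realizing it gives a diagram; so the infimum over the diagrams for \<open>w'\<close> is attained
    and yields a filling.\<close>
  have vk: "\<exists>D s. van_kampen P' w' D s" if "null_homotopic P' w'" for w'
  proof -
    obtain L where "fills False False P' L w'" using X.B.fills_exists X.B.null_homotopic_iff \<open>null_homotopic P' w'\<close> by blast
    then show ?thesis by (rule FL_word_le(2))
  qed
  have *: "(\<lambda>n. Max {\<phi> w |w. null_homotopic P w \<and> length w \<le> n}) \<preceq> (\<lambda>n. Max {\<psi> w |w. null_homotopic P' w \<and> length w \<le> n})"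
    if fr: "fr \<longrightarrow> rt" and le: "\<And>w L. fills rt fr P L w \<Longrightarrow> \<phi> w \<le> L" and fi: "\<And>w D s. van_kampen P' w D s \<Longrightarrow> fills rt fr P' (\<psi> w) w" for \<phi> \<psi> rt fr
  proof (rule preceqI[OF fin, of A])
    fix w n assume "null_homotopic P w" "length w \<le> n"
    from A[OF this] obtain w' where w': "null_homotopic P' w'" "length w' \<le> A * n"
      and f: "\<forall>rt fr L. (fr \<longrightarrow> rt) \<longrightarrow> fills rt fr P' L w' \<longrightarrow> fills rt fr P (A * L + A * n + A) w"
      by (elim exE conjE)
    obtain D s where "van_kampen P' w' D s" using vk[OF w'(1)] by (elim exE)
    then have "fills rt fr P (A * \<psi> w' + A * n + A) w" using f[rule_format, OF fr[rule_format] fi] by simp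
    then have "\<phi> w \<le> A * \<psi> w' + A * n + A" by (rule le)
    then show "\<exists>w'. null_homotopic P' w' \<and> length w' \<le> A * n \<and> \<phi> w \<le> A * \<psi> w' + A * n + A" using w' by blast
  qed
  show "FL P \<preceq> FL P'" using *[of False False "FL_word P" "FL_word P'", OF _ FL_word_le(1) fills_FL_word]
    by (simp add: FL_def[abs_def])
  show "FFL P \<preceq> FFL P'" using *[of False True "FFL_word P" "FFL_word P'", OF _ FFL_word_le fills_FFL_word]
    by (simp add: FFL_def[abs_def])
  show "FFFL P \<preceq> FFFL P'" using *[of True True "FFFL_word P" "FFFL_word P'", OF _ FFFL_word_le fills_FFFL_word]
    by (simp add: FFFL_def[abs_def])
qed

theorem theorem4:
  fixes P :: "'a presentation" and P' :: "'b presentation"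
  assumes "finite_presentation P" and "finite_presentation P'"
    and "quasi_isometric_groups (presented_group P) (presented_group P')"
  shows "FL P \<simeq> FL P' \<and> FFL P \<simeq> FFL P' \<and> FFFL P \<simeq> FFFL P'"
proof -
  obtain F F' M where "coarse_map P P' M F" "coarse_map P' P M F'" "coarse_inverse P M F F'" "coarse_inverse P' M F' F"
    by (rule quasi_isometric_coarse_maps[OF assms])
  then show ?thesis unfolding fun_simeq_def
    using coarse_preceq[OF assms(1,2)] coarse_preceq[OF assms(2,1)] by blast
qed

end
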